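(* Let $M_1, M_2$ be the two focal submanifolds of an isoparametric hypersurface in a unit sphere with $g=4$ distinct principal curvatures and multiplicities $(m_1,m_2)$, where $(m_1,m_2)$ is, up to interchanging $m_1$ and $m_2$, different from $(7,8)$. Then each of $M_1$ and $M_2$, equipped with the Riemannian metric induced from the sphere, is an $\mathcal{A}$-manifold.
   Context: An isoparametric hypersurface $M^n\subset S^{n+1}(1)$ in the unit sphere is a closed connected hypersurface with constant principal curvatures; $g$ denotes the number of distinct principal curvatures and $m_1,\dots,m_g$ their multiplicities, which satisfy $m_i=m_{i+2}$ (subscripts mod $g$). Such a hypersurface belongs to a family of parallel hypersurfaces that are the regular level sets of an isoparametric function $f$ on $S^{n+1}(1)$ (a function with $|\nabla f|^2=b(f)$, $\Delta f=a(f)$, with $b$ smooth and $a$ continuous). The two singular level sets of $f$ are the focal submanifolds $M_1$ and $M_2$; they are minimal submanifolds of $S^{n+1}(1)$ of codimension $m_1+1$ and $m_2+1$, respectively. For $g=4$: $n=2(m_1+m_2)$, $\dim M_1=m_1+2m_2$, $\dim M_2=2m_1+m_2$. A Riemannian manifold with Levi-Civita connection $\nabla$ and Ricci tensor $\rho$ is an $\mathcal{A}$-manifold if $\rho$ is cyclic parallel: $\nabla_i\rho_{jk}+\nabla_j\rho_{ki}+\nabla_k\rho_{ij}=0$; equivalently $(\nabla_X\rho)(X,X)=0$ for every tangent vector $X$. Known classification background: every isoparametric hypersurface in a sphere with $g=4$ and multiplicities different from $(7,8)$ (up to order) is either of OT-FKM type, or is the homogeneous one with $(m_1,m_2)=(2,2)$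 or $(4,5)$. Here OT-FKM type means the following: for symmetric real $2l\times 2l$ matrices $P_0,\dots,P_m$ with $P_\alpha P_\beta+P_\beta P_\alpha=2\delta_{\alpha\beta}I_{2l}$ (with $m>0$, $l-m-1>0$), put $F(x)=|x|^4-2\sum_{\alpha=0}^m\langle P_\alpha x,x\rangle^2$; the hypersurfaces are the regular level sets of $f=F|_{S^{2l-1}}$, with $M_1=f^{-1}(1)$, $M_2=f^{-1}(-1)$ and $(m_1,m_2)=(m,l-m-1)$. The homogeneous one with $(2,2)$ consists of principal orbits of $SO(5)$ acting on the unit sphere of $\mathfrak{so}(5)$ by $Z\mapsto AZA^{-1}$; the one with $(4,5)$ consists of principal orbits of $U(5)$ acting on the unit sphere of $\mathfrak{so}(5,\mathbb{C})$ by $Z\mapsto \overline{g}Zg^{-1}$. *)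

theory Defs
  imports "HOL-Analysis.Analysis"
begin

section \<open>Smooth maps and embedded submanifolds of a Euclidean space\<close>

fun Ck_on :: "nat \<Rightarrow> 'a::real_normed_vector set \<Rightarrow> ('a \<Rightarrow> 'b::real_normed_vector) \<Rightarrow> bool" where
  "Ck_on 0 U F \<longleftrightarrow> continuous_on U F"
| "Ck_on (Suc k) U F \<longleftrightarrow>
     (\<forall>x\<in>U. F differentiable (at x)) \<and> (\<forall>v. Ck_on k U (\<lambda>x. frechet_derivative F (at x) v))"

text \<open>Intended for open \<open>U\<close> only.\<close>

definition smooth_on :: "'a::real_normed_vector set \<Rightarrow> ('a \<Rightarrow> 'b::real_normed_vector) \<Rightarrow> bool" where
  "smooth_on U F \<longleftrightarrow> (\<forall>k. Ck_on k U F)"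

text \<open>
  A slice chart of \<open>M\<close>: a diffeomorphism \<open>\<phi>\<close> between open sets \<open>U\<close> and \<open>\<phi> ` U\<close> of the ambient
  space which carries the coordinate slice \<open>U \<inter> span B\<close> onto the part of \<open>M\<close> in \<open>\<phi> ` U\<close>.
  The coordinates on \<open>M\<close> are thus indexed by the elements of \<open>B\<close>, a set of standard basis
  vectors; this allows submanifolds of all dimensions without dimension-indexed types.
\<close>

definition slice_chart ::
    "'a::euclidean_space set \<Rightarrow> 'a set \<Rightarrow> 'a set \<Rightarrow> ('a \<Rightarrow> 'a) \<Rightarrow> bool" where
  "slice_chart M B U \<phi> \<longleftrightarrow>
     B \<subseteq> Basis \<and> open U \<and> open (\<phi> ` U) \<and> inj_on \<phi> U \<and>
     smooth_on U \<phi> \<and> smooth_on (\<phi> ` U) (inv_into U \<phi>) \<and>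
     \<phi> ` (U \<inter> span B) = M \<inter> \<phi> ` U"

definition embedded_submanifold :: "nat \<Rightarrow> 'a::euclidean_space set \<Rightarrow> bool" where
  "embedded_submanifold k M \<longleftrightarrow>
     (\<forall>p\<in>M. \<exists>B U \<phi>. slice_chart M B U \<phi> \<and> card B = k \<and> p \<in> \<phi> ` U)"

text \<open>Partial derivative in the direction of the coordinate \<open>b\<close>. At a point of a slice and for
  \<open>b \<in> B\<close> it depends only on the values of \<open>F\<close> on the slice.\<close>

definition pd :: "'a::real_normed_vector \<Rightarrow> ('a \<Rightarrow> 'b::real_normed_vector) \<Rightarrow> 'a \<Rightarrow> 'b" where
  "pd b F u = vector_derivative (\<lambda>t. F (u + t *\<^sub>R b)) (at 0)"

definition tangent_space :: "'a::euclidean_space set \<Rightarrow> 'a \<Rightarrow> 'a set" where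
  "tangent_space M p =
     {v. \<exists>B U \<phi> u. slice_chart M B U \<phi> \<and> u \<in> U \<inter> span B \<and> \<phi> u = p \<and>
                   v \<in> span ((\<lambda>b. pd b \<phi> u) ` B)}"

definition smooth_map_on :: "'a::euclidean_space set \<Rightarrow> ('a \<Rightarrow> 'b::real_normed_vector) \<Rightarrow> bool" where
  "smooth_map_on M F \<longleftrightarrow>
     (\<forall>p\<in>M. \<exists>W H. open W \<and> p \<in> W \<and> smooth_on W H \<and> (\<forall>x\<in>W \<inter> M. H x = F x))"

text \<open>The differential of a smooth map on \<open>M\<close>, computed with any local smooth extension.
  It is well defined for \<open>v \<in> tangent_space M p\<close> and meaningless for other \<open>v\<close>.\<close>

definition differential ::
    "'a::euclidean_space set \<Rightarrow> ('a \<Rightarrow> 'b::real_normed_vector) \<Rightarrow> 'a \<Rightarrow> 'a \<Rightarrow> 'b" where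
  "differential M F p v =
     (THE w. \<exists>W H. open W \<and> p \<in> W \<and> smooth_on W H \<and> (\<forall>x\<in>W \<inter> M. H x = F x) \<and>
                   w = frechet_derivative H (at p) v)"

section \<open>Riemannian geometry in coordinates\<close>

text \<open>
  Here \<open>G b c u\<close> are the components \<open>g\<^sub>b\<^sub>c(u)\<close> of a metric in coordinates indexed by
  the finite set \<open>B\<close>, and \<open>christoffel B G d b c\<close> is the symbol with upper index \<open>d\<close>.
\<close>

definition metric_inverse ::
    "'a::euclidean_space set \<Rightarrow> ('a \<Rightarrow> 'a \<Rightarrow> 'a \<Rightarrow> real) \<Rightarrow> 'a \<Rightarrow> 'a \<Rightarrow> 'a \<Rightarrow> real" where
  "metric_inverse B G b c u =
     (THE h. (\<forall>x y. x \<notin> B \<or> y \<notin> B \<longrightarrow> h x y = 0) \<and>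
             (\<forall>x\<in>B. \<forall>y\<in>B. (\<Sum>z\<in>B. G x z u * h z y) = (if x = y then 1 else 0))) b c"

definition christoffel ::
    "'a::euclidean_space set \<Rightarrow> ('a \<Rightarrow> 'a \<Rightarrow> 'a \<Rightarrow> real) \<Rightarrow> 'a \<Rightarrow> 'a \<Rightarrow> 'a \<Rightarrow> 'a \<Rightarrow> real" where
  "christoffel B G d b c u =
     (\<Sum>e\<in>B. metric_inverse B G d e u * (pd b (G e c) u + pd c (G e b) u - pd e (G b c) u)) / 2"

text \<open>The component of \<open>R(\<partial>\<^sub>a, \<partial>\<^sub>b) \<partial>\<^sub>c\<close> along \<open>\<partial>\<^sub>d\<close>, where
  \<open>R(X, Y) = [\<nabla>\<^sub>X, \<nabla>\<^sub>Y] - \<nabla>\<^bsub>[X, Y]\<^esub>\<close>.\<close>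

definition riemann ::
    "'a::euclidean_space set \<Rightarrow> ('a \<Rightarrow> 'a \<Rightarrow> 'a \<Rightarrow> real) \<Rightarrow>
      'a \<Rightarrow> 'a \<Rightarrow> 'a \<Rightarrow> 'a \<Rightarrow> 'a \<Rightarrow> real" where
  "riemann B G d c a b u =
     pd a (christoffel B G d b c) u - pd b (christoffel B G d a c) u +
     (\<Sum>e\<in>B. christoffel B G d a e u * christoffel B G e b c u
            - christoffel B G d b e u * christoffel B G e a c u)"

definition ricci ::
    "'a::euclidean_space set \<Rightarrow> ('a \<Rightarrow> 'a \<Rightarrow> 'a \<Rightarrow> real) \<Rightarrow> 'a \<Rightarrow> 'a \<Rightarrow> 'a \<Rightarrow> real" where
  "ricci B G b c u = (\<Sum>a\<in>B. riemann B G a c a b u)"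

definition nabla_ricci ::
    "'a::euclidean_space set \<Rightarrow> ('a \<Rightarrow> 'a \<Rightarrow> 'a \<Rightarrow> real) \<Rightarrow> 'a \<Rightarrow> 'a \<Rightarrow> 'a \<Rightarrow> 'a \<Rightarrow> real" where
  "nabla_ricci B G a b c u =
     pd a (ricci B G b c) u -
     (\<Sum>e\<in>B. christoffel B G e a b u * ricci B G e c u + christoffel B G e a c u * ricci B G b e u)"

definition grad_norm_sq ::
    "'a::euclidean_space set \<Rightarrow> ('a \<Rightarrow> 'a \<Rightarrow> 'a \<Rightarrow> real) \<Rightarrow> ('a \<Rightarrow> real) \<Rightarrow> 'a \<Rightarrow> real" where
  "grad_norm_sq B G F u = (\<Sum>b\<in>B. \<Sum>c\<in>B. metric_inverse B G b c u * pd b F u * pd c F u)"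

definition laplace_beltrami ::
    "'a::euclidean_space set \<Rightarrow> ('a \<Rightarrow> 'a \<Rightarrow> 'a \<Rightarrow> real) \<Rightarrow> ('a \<Rightarrow> real) \<Rightarrow> 'a \<Rightarrow> real" where
  "laplace_beltrami B G F u =
     (\<Sum>b\<in>B. \<Sum>c\<in>B. metric_inverse B G b c u *
        (pd b (pd c F) u - (\<Sum>d\<in>B. christoffel B G d b c u * pd d F u)))"

text \<open>The metric induced from the ambient inner product, pulled back along a chart. For a
  submanifold of the unit sphere it is also the metric induced from the sphere.\<close>

definition induced_metric ::
    "('a::euclidean_space \<Rightarrow> 'a) \<Rightarrow> 'a \<Rightarrow> 'a \<Rightarrow> 'a \<Rightarrow> real" where
  "induced_metric \<phi> b c u = pd b \<phi> u \<bullet> pd c \<phi> u"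

text \<open>An embedded submanifold whose induced metric has cyclic parallel Ricci tensor.\<close>

definition A_manifold :: "'a::euclidean_space set \<Rightarrow> bool" where
  "A_manifold N \<longleftrightarrow>
     (\<exists>k. embedded_submanifold k N) \<and>
     (\<forall>B U \<phi>. slice_chart N B U \<phi> \<longrightarrow>
        (\<forall>u\<in>U \<inter> span B. \<forall>a\<in>B. \<forall>b\<in>B. \<forall>c\<in>B.
           nabla_ricci B (induced_metric \<phi>) a b c u
           + nabla_ricci B (induced_metric \<phi>) b c a u
           + nabla_ricci B (induced_metric \<phi>) c a b u = 0))"

section \<open>Isoparametric hypersurfaces and functions on the unit sphere\<close>

definition unit_normal_field :: "'a::euclidean_space set \<Rightarrow> ('a \<Rightarrow> 'a) \<Rightarrow> bool" where
  "unit_normal_field M \<xi> \<longleftrightarrow>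
     smooth_map_on M \<xi> \<and>
     (\<forall>p\<in>M. norm (\<xi> p) = 1 \<and> \<xi> p \<bullet> p = 0 \<and> (\<forall>v\<in>tangent_space M p. \<xi> p \<bullet> v = 0))"

text \<open>
  The shape operator of a hypersurface of the sphere is \<open>X \<mapsto> - d\<xi>(X)\<close>: the derivative of \<open>\<xi>\<close> in
  the ambient space is already tangent to \<open>M\<close>, so no projection is needed.
\<close>

definition curvature_space ::
    "'a::euclidean_space set \<Rightarrow> ('a \<Rightarrow> 'a) \<Rightarrow> 'a \<Rightarrow> real \<Rightarrow> 'a set" where
  "curvature_space M \<xi> p \<mu> = {X \<in> tangent_space M p. - differential M \<xi> p X = \<mu> *\<^sub>R X}"

text \<open>
  A closed connected hypersurface of the unit sphere with exactly \<open>g\<close> distinct principal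
  curvatures \<open>\<kappa> 1 > \<dots> > \<kappa> g\<close>, all constant, of multiplicities \<open>m 1, \<dots>, m g\<close>.
\<close>

definition isoparametric_hypersurface ::
    "'a::euclidean_space set \<Rightarrow> nat \<Rightarrow> (nat \<Rightarrow> nat) \<Rightarrow> bool" where
  "isoparametric_hypersurface M g m \<longleftrightarrow>
     M \<subseteq> sphere 0 1 \<and> M \<noteq> {} \<and> compact M \<and> connected M \<and>
     (\<exists>n. DIM('a) = n + 2 \<and> embedded_submanifold n M) \<and>
     (\<exists>\<xi> \<kappa>. unit_normal_field M \<xi> \<and>
        (\<forall>i\<in>{1..g}. \<forall>j\<in>{1..g}. i < j \<longrightarrow> \<kappa> j < \<kappa> i) \<and>
        (\<forall>p\<in>M. {\<mu>. curvature_space M \<xi> p \<mu> \<noteq> {0}} = \<kappa> ` {1..g} \<and>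
               (\<forall>i\<in>{1..g}. dim (curvature_space M \<xi> p (\<kappa> i)) = m i)))"

text \<open>
  The functions \<open>b\<close> and \<open>a\<close> matter only on the compact interval of values of \<open>f\<close>, from which a
  smooth (resp. continuous) function always extends to the real line.
\<close>

definition isoparametric_function :: "('a::euclidean_space \<Rightarrow> real) \<Rightarrow> bool" where
  "isoparametric_function f \<longleftrightarrow>
     smooth_map_on (sphere 0 1) f \<and>
     (\<exists>(b :: real \<Rightarrow> real) (a :: real \<Rightarrow> real). smooth_on UNIV b \<and> continuous_on UNIV a \<and>
        (\<forall>B U \<phi>. slice_chart (sphere 0 1) B U \<phi> \<longrightarrow>
           (\<forall>u\<in>U \<inter> span B.
              grad_norm_sq B (induced_metric \<phi>) (f \<circ> \<phi>) u = b (f (\<phi> u)) \<and>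
              laplace_beltrami B (induced_metric \<phi>) (f \<circ> \<phi>) u = a (f (\<phi> u)))))"

definition critical_points :: "('a::euclidean_space \<Rightarrow> real) \<Rightarrow> 'a set" where
  "critical_points f =
     {p \<in> sphere 0 1. \<forall>v\<in>tangent_space (sphere 0 1) p. differential (sphere 0 1) f p v = 0}"

definition level_set :: "('a::euclidean_space \<Rightarrow> real) \<Rightarrow> real \<Rightarrow> 'a set" where
  "level_set f t = {p \<in> sphere 0 1. f p = t}"

definition regular_level_sets :: "('a::euclidean_space \<Rightarrow> real) \<Rightarrow> 'a set set" where
  "regular_level_sets f =
     {N. \<exists>t. N = level_set f t \<and> N \<noteq> {} \<and> N \<inter> critical_points f = {}}"

definition singular_level_sets :: "('a::euclidean_space \<Rightarrow> real) \<Rightarrow> 'a set set" where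
  "singular_level_sets f = {N. \<exists>t. N = level_set f t \<and> N \<inter> critical_points f \<noteq> {}}"

text \<open>
  \<open>M\<close> lies in the family of regular level sets of \<open>f\<close>, and \<open>M1\<close>, \<open>M2\<close> are the two singular
  level sets of \<open>f\<close>.
\<close>

definition focal_submanifolds ::
    "'a::euclidean_space set \<Rightarrow> ('a \<Rightarrow> real) \<Rightarrow> 'a set \<Rightarrow> 'a set \<Rightarrow> bool" where
  "focal_submanifolds M f M1 M2 \<longleftrightarrow>
     isoparametric_function f \<and> M \<in> regular_level_sets f \<and>
     M1 \<in> singular_level_sets f \<and> M2 \<in> singular_level_sets f \<and> M1 \<noteq> M2"

end

theory Submission
  imports Defs
begin

text \<open>
  Extend \<open>f\<close> to \<open>F x = f (x / |x|)\<close>. The equation \<open>|grad F|\<^sup>2 = b(F)\<close> makes the great circles normal to \<open>M\<close>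
  integral curves of the unit normal \<open>w = grad F / |grad F|\<close>, so all of them reach a singular level
  \<open>\<Sigma>\<close> at the same distance \<open>d\<close>, and every unit normal vector of \<open>\<Sigma>\<close> is the velocity of one of them.
  On \<open>\<Sigma>\<close> the Hessian of \<open>F\<close> is a multiple of the projection onto the normal space, and its
  derivative gives the shape operators: the eigenspace for the principal curvature \<open>cot \<theta>\<close> of \<open>M\<close>
  becomes an eigenspace for \<open>cot (\<theta> - d)\<close>, except when \<open>\<theta> = d\<close>. Replacing a normal by its opposite shows that
  these eigenvalues are symmetric about \<open>0\<close>. An end of \<open>F\<close> without such an exceptional \<open>\<theta>\<close> would be a one-sided
  hypersurface, which the sphere does not contain. Using the symmetry at both ends, the four angles are
  spaced by \<open>\<pi> / 4\<close>, so the shape operators \<open>A\<close> have eigenvalues among \<open>1, 0, -1\<close> and satisfy \<open>A\<^sup>3 = A\<close>,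
  and their traces, being integers depending continuously on a normal in a connected set and odd, vanish.

  By the Gauss equation the Ricci tensor of a minimal submanifold of the sphere is a multiple of the
  metric minus the sum of the squares of the shape operators, which is half the Frobenius product of
  the derivatives of the tangential projection. Its cyclic covariant derivative is a trace which
  vanishes by the derivative of \<open>A\<^sup>3 = |\<eta>|\<^sup>2 A\<close> along normal fields \<open>\<eta>\<close>.
\<close>

section \<open>Smooth functions\<close>

text \<open>The field \<open>w\<close> is undefined on a singular level, since the gradient vanishes
  there, whereas the Hessian \<open>H\<close> and its derivative \<open>HH\<close> are smooth across
  it. So identities for \<open>w\<close> along the normal great circles are rewritten for
  \<open>H\<close> and passed to the limit. The constant behind this is
  \<open>c = - b' tp / 2\<close>. It is positive because a zero of \<open>b\<close> of higher order
  at \<open>tp\<close> would put this level at infinite distance, while great circles are closed.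
  Positivity makes \<open>tp\<close> the maximum of \<open>F\<close>, makes \<open>H\<close>
  nondegenerate in the normal directions, hence the singular level a submanifold, and lets each unit
  normal be recovered as a limit of \<open>w\<close>. A focal angle at an end leaves three angles
  which, measured from it, are symmetric about \<open>pi / 2\<close>; the middle one is then
  \<open>pi / 2\<close>, but the spacing is still free. Only the other end, treated as the upper end
  of \<open>- F\<close>, fixes it, which is why both ends have to be shown focal.\<close>

lemma Ck_on_subset: "Ck_on k U F \<Longrightarrow> V \<subseteq> U \<Longrightarrow> Ck_on k V F"
  by (induction k arbitrary: F) (auto intro: continuous_on_subset)

lemma frechet_derivative_cong_open:
  assumes "open U" "x \<in> U" "\<And>x. x \<in> U \<Longrightarrow> F x = G x"
  shows "F differentiable (at x) \<longleftrightarrow> G differentiable (at x)"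
    and "frechet_derivative F (at x) = frechet_derivative G (at x)"
proof -
  have "(F has_derivative D) (at x) \<longleftrightarrow> (G has_derivative D) (at x)" for D
    using has_derivative_transform_within_open[OF _ assms(1,2)] assms(3) by metis
  then show "F differentiable (at x) \<longleftrightarrow> G differentiable (at x)"
    "frechet_derivative F (at x) = frechet_derivative G (at x)"
    unfolding differentiable_def frechet_derivative_def by auto
qed

lemma Ck_on_cong:
  assumes "open U" "\<And>x. x \<in> U \<Longrightarrow> F x = G x"
  shows "Ck_on k U F \<longleftrightarrow> Ck_on k U G"
  using assms(2)
proof (induction k arbitrary: F G)
  case 0
  then show ?case using continuous_on_cong by force
next
  case (Suc k)
  have "Ck_on k U (\<lambda>x. frechet_derivative F (at x) v) \<longleftrightarrow>
      Ck_on k U (\<lambda>x. frechet_derivative G (at x) v)" for v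
    by (rule Suc.IH) (use frechet_derivative_cong_open[OF assms(1)] Suc.prems in metis)
  moreover have "(\<forall>x\<in>U. F differentiable (at x)) \<longleftrightarrow> (\<forall>x\<in>U. G differentiable (at x))"
    using frechet_derivative_cong_open(1)[OF assms(1)] Suc.prems by metis
  ultimately show ?case by simp
qed

lemma Ck_on_continuous: "Ck_on k U F \<Longrightarrow> continuous_on U F"
  by (cases k) (auto intro!: continuous_at_imp_continuous_on differentiable_imp_continuous_within)

lemma Ck_on_SucD: "Ck_on (Suc k) U F \<Longrightarrow> Ck_on k U F"
proof (induction k arbitrary: F)
  case 0
  then show ?case using Ck_on_continuous by fastforce
next
  case (Suc k)
  have "Ck_on k U (\<lambda>x. frechet_derivative F (at x) v)" for v
    by (rule Suc.IH) (use Suc.prems in auto)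
  then show ?case using Suc.prems by simp
qed

lemma Ck_on_local:
  assumes "\<And>x. x \<in> U \<Longrightarrow> \<exists>W. open W \<and> x \<in> W \<and> Ck_on k W F"
  shows "Ck_on k U F"
  using assms
proof (induction k arbitrary: F)
  case 0
  have "isCont F x" if "x \<in> U" for x
    using 0[OF that] continuous_on_eq_continuous_at by auto
  then show ?case by (simp add: continuous_at_imp_continuous_on)
next
  case (Suc k)
  have "Ck_on k U (\<lambda>x. frechet_derivative F (at x) v)" for v
    by (rule Suc.IH) (use Suc.prems in \<open>force simp only: Ck_on.simps(2)\<close>)
  moreover have "F differentiable (at x)" if "x \<in> U" for x
    using Suc.prems[OF that] by auto
  ultimately show ?case by simp
qed

lemma smooth_on_local:
  assumes "\<And>x. x \<in> U \<Longrightarrow> \<exists>W. open W \<and> x \<in> W \<and> smooth_on W F"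
  shows "smooth_on U F"
  unfolding smooth_on_def
proof
  show "Ck_on k U F" for k
  proof (rule Ck_on_local)
    fix x assume "x \<in> U"
    from assms[OF this] show "\<exists>W. open W \<and> x \<in> W \<and> Ck_on k W F"
      unfolding smooth_on_def by blast
  qed
qed

lemma Ck_on_SucI:
  assumes "open U" "\<And>x. x \<in> U \<Longrightarrow> (F has_derivative D x) (at x)" "\<And>v. Ck_on k U (\<lambda>x. D x v)"
  shows "Ck_on (Suc k) U F"
proof -
  have "frechet_derivative F (at x) = D x" if "x \<in> U" for x
    using frechet_derivative_at[OF assms(2)[OF that]] by simp
  then have "Ck_on k U (\<lambda>x. frechet_derivative F (at x) v)" for v
    using Ck_on_cong[OF assms(1), of "\<lambda>x. frechet_derivative F (at x) v" "\<lambda>x. D x v" k] assms(3)[of v]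
    by simp
  then show ?thesis using assms(2) by (auto simp: differentiable_def)
qed

lemma Ck_on_SucE:
  assumes "Ck_on (Suc k) U F"
  shows "x \<in> U \<Longrightarrow> (F has_derivative frechet_derivative F (at x)) (at x)"
    and "Ck_on k U (\<lambda>x. frechet_derivative F (at x) v)"
  using assms by (auto simp: frechet_derivative_works[symmetric])

lemma Ck_on_const: "Ck_on k U (\<lambda>x. c)"
  by (induction k arbitrary: c) auto

lemma Ck_on_add:
  assumes "open U" "Ck_on k U F" "Ck_on k U G"
  shows "Ck_on k U (\<lambda>x. F x + G x)"
  using assms(2,3)
proof (induction k arbitrary: F G)
  case 0
  then show ?case by (simp add: continuous_on_add)
next
  case (Suc k)
  show ?case
    by (rule Ck_on_SucI[OF assms(1), where D = "\<lambda>x v. frechet_derivative F (at x) v + frechet_derivative G (at x) v"])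
      (intro has_derivative_add Suc.IH Ck_on_SucE[OF Suc.prems(1)] Ck_on_SucE[OF Suc.prems(2)]; assumption)+
qed

lemma Ck_on_bilinear:
  assumes "bounded_bilinear B" "open U" "Ck_on k U F" "Ck_on k U G"
  shows "Ck_on k U (\<lambda>x. B (F x) (G x))"
  using assms(3,4)
proof (induction k arbitrary: F G)
  case 0
  then show ?case using bounded_bilinear.continuous_on[OF assms(1)] by auto
next
  case (Suc k)
  show ?case
  proof (rule Ck_on_SucI[OF assms(2), where
        D = "\<lambda>x v. B (F x) (frechet_derivative G (at x) v) + B (frechet_derivative F (at x) v) (G x)"])
    show "Ck_on k U (\<lambda>x. B (F x) (frechet_derivative G (at x) v) + B (frechet_derivative F (at x) v) (G x))" for v
      by (intro Ck_on_add[OF assms(2)] Suc.IH Ck_on_SucE(2)[OF Suc.prems(1)] Ck_on_SucE(2)[OF Suc.prems(2)]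
          Ck_on_SucD[OF Suc.prems(1)] Ck_on_SucD[OF Suc.prems(2)])
  qed (intro bounded_bilinear.FDERIV[OF assms(1)] Ck_on_SucE(1)[OF Suc.prems(1)] Ck_on_SucE(1)[OF Suc.prems(2)])
qed

lemma Ck_on_linear:
  assumes "bounded_linear L" "open U" "Ck_on k U F"
  shows "Ck_on k U (\<lambda>x. L (F x))"
  using assms(3)
proof (induction k arbitrary: F)
  case 0
  then show ?case using bounded_linear.continuous_on[OF assms(1)] by auto
next
  case (Suc k)
  show ?case
    by (rule Ck_on_SucI[OF assms(2), where D = "\<lambda>x v. L (frechet_derivative F (at x) v)"])
      (intro bounded_linear.has_derivative[OF assms(1)] Suc.IH Ck_on_SucE[OF Suc.prems(1)]; assumption)+
qed

lemma Ck_on_id: "Ck_on k U (\<lambda>x. x)"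
proof (cases k)
  case (Suc j)
  have "frechet_derivative (\<lambda>x. x) (at x) = (\<lambda>v. v)" for x :: 'a
    using frechet_derivative_at[OF has_derivative_ident[of "at x"]] by simp
  then show ?thesis using Suc Ck_on_const by auto
qed auto

lemma Ck_on_sum:
  assumes "open U" "\<And>i. i \<in> I \<Longrightarrow> Ck_on k U (F i)"
  shows "Ck_on k U (\<lambda>x. \<Sum>i\<in>I. F i x)"
  using assms(2)
  by (induction I rule: infinite_finite_induct) (auto intro: Ck_on_const Ck_on_add[OF assms(1)])

lemma bounded_linear_euclidean_sum:
  fixes L :: "'a::euclidean_space \<Rightarrow> 'b::real_vector"
  assumes "linear L"
  shows "L v = (\<Sum>i\<in>Basis. (v \<bullet> i) *\<^sub>R L i)"
proof -
  have "L v = L (\<Sum>i\<in>Basis. (v \<bullet> i) *\<^sub>R i)" by (simp add: euclidean_representation)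
  then show ?thesis using assms by (simp add: linear_sum linear_cmul)
qed

text \<open>The chain rule applies the derivative of \<open>F\<close> at \<open>g x\<close> to a
  direction that varies with \<open>x\<close>. Expanding this direction in \<open>Basis\<close>
  leaves derivatives of \<open>F\<close> in fixed directions, to which the induction hypothesis
  applies.\<close>

lemma Ck_on_compose:
  fixes F :: "'b::euclidean_space \<Rightarrow> 'c::real_normed_vector"
  assumes "open U" "open V" "Ck_on k V F" "Ck_on k U g" "g ` U \<subseteq> V"
  shows "Ck_on k U (\<lambda>x. F (g x))"
  using assms(3-5)
proof (induction k arbitrary: F)
  case 0
  then show ?case using continuous_on_compose2 by auto
next
  case (Suc k)
  have hF: "(F has_derivative frechet_derivative F (at (g x))) (at (g x))" if "x \<in> U" for x
    using Ck_on_SucE(1)[OF Suc.prems(1)] Suc.prems(3) that by blast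
  have hd: "((\<lambda>x. F (g x)) has_derivative
      (\<lambda>v. \<Sum>i\<in>Basis. (frechet_derivative g (at x) v \<bullet> i) *\<^sub>R frechet_derivative F (at (g x)) i)) (at x)"
    if "x \<in> U" for x
    unfolding bounded_linear_euclidean_sum[OF has_derivative_linear[OF hF[OF that]], symmetric]
    by (rule has_derivative_compose[OF Ck_on_SucE(1)[OF Suc.prems(2) that] hF[OF that]])
  have gk: "Ck_on k U g" using Ck_on_SucD Suc.prems(2) by blast
  have "Ck_on k U (\<lambda>x. \<Sum>i\<in>Basis. (frechet_derivative g (at x) v \<bullet> i) *\<^sub>R
      frechet_derivative F (at (g x)) i)" for v
  proof (intro Ck_on_sum assms(1) Ck_on_bilinear[OF bounded_bilinear_scaleR])
    fix i :: 'b assume "i \<in> Basis"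
    show "Ck_on k U (\<lambda>x. frechet_derivative g (at x) v \<bullet> i)"
      by (rule Ck_on_linear[OF bounded_linear_inner_left assms(1) Ck_on_SucE(2)[OF Suc.prems(2)]])
    show "Ck_on k U (\<lambda>x. frechet_derivative F (at (g x)) i)"
      by (rule Suc.IH[OF Ck_on_SucE(2)[OF Suc.prems(1)] gk Suc.prems(3)])
  qed
  then show ?case
    by (intro Ck_on_SucI[OF assms(1), where D = "\<lambda>x v. \<Sum>i\<in>Basis. (frechet_derivative g (at x) v \<bullet> i) *\<^sub>R
        frechet_derivative F (at (g x)) i"] hd)
qed

lemma smooth_on_cong: "open U \<Longrightarrow> (\<And>x. x \<in> U \<Longrightarrow> F x = G x) \<Longrightarrow> smooth_on U F \<longleftrightarrow> smooth_on U G"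
  unfolding smooth_on_def using Ck_on_cong by blast

lemma smooth_on_subset: "smooth_on U F \<Longrightarrow> V \<subseteq> U \<Longrightarrow> smooth_on V F"
  unfolding smooth_on_def using Ck_on_subset by blast

lemma smooth_on_continuous: "smooth_on U F \<Longrightarrow> continuous_on U F"
  unfolding smooth_on_def using Ck_on_continuous by blast

lemma smooth_on_differentiable: "smooth_on U F \<Longrightarrow> x \<in> U \<Longrightarrow> F differentiable (at x)"
  unfolding smooth_on_def by (drule spec[of _ "Suc 0"]) simp

lemma smooth_on_has_derivative:
  "smooth_on U F \<Longrightarrow> x \<in> U \<Longrightarrow> (F has_derivative frechet_derivative F (at x)) (at x)"
  using smooth_on_differentiable frechet_derivative_works by blast

lemma smooth_on_frechet_derivative:
  "smooth_on U F \<Longrightarrow> smooth_on U (\<lambda>x. frechet_derivative F (at x) v)"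
  unfolding smooth_on_def using Ck_on_SucE(2) by blast

lemma smooth_on_const: "smooth_on U (\<lambda>x. c)"
  unfolding smooth_on_def using Ck_on_const by blast

lemma smooth_on_id: "smooth_on U (\<lambda>x. x)"
  unfolding smooth_on_def using Ck_on_id by blast

lemma smooth_on_linear: "bounded_linear L \<Longrightarrow> open U \<Longrightarrow> smooth_on U F \<Longrightarrow> smooth_on U (\<lambda>x. L (F x))"
  unfolding smooth_on_def using Ck_on_linear by blast

lemma smooth_on_add: "open U \<Longrightarrow> smooth_on U F \<Longrightarrow> smooth_on U G \<Longrightarrow> smooth_on U (\<lambda>x. F x + G x)"
  unfolding smooth_on_def using Ck_on_add by blast

lemma smooth_on_minus: "open U \<Longrightarrow> smooth_on U F \<Longrightarrow> smooth_on U (\<lambda>x. - F x)"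
  by (rule smooth_on_linear[where L = uminus]) (auto simp: bounded_linear_minus[OF bounded_linear_ident])

lemma smooth_on_diff: "open U \<Longrightarrow> smooth_on U F \<Longrightarrow> smooth_on U G \<Longrightarrow> smooth_on U (\<lambda>x. F x - G x)"
  using smooth_on_add[of U F "\<lambda>x. - G x"] smooth_on_minus by auto

lemma smooth_on_bilinear:
  "bounded_bilinear B \<Longrightarrow> open U \<Longrightarrow> smooth_on U F \<Longrightarrow> smooth_on U G \<Longrightarrow> smooth_on U (\<lambda>x. B (F x) (G x))"
  unfolding smooth_on_def using Ck_on_bilinear by blast

lemmas smooth_on_scaleR = smooth_on_bilinear[OF bounded_bilinear_scaleR]
lemmas smooth_on_inner = smooth_on_bilinear[OF bounded_bilinear_inner]
lemmas smooth_on_mult = smooth_on_bilinear[OF bounded_bilinear_mult]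

lemma smooth_on_sum:
  "open U \<Longrightarrow> (\<And>i. i \<in> I \<Longrightarrow> smooth_on U (F i)) \<Longrightarrow> smooth_on U (\<lambda>x. \<Sum>i\<in>I. F i x)"
  unfolding smooth_on_def by (intro allI Ck_on_sum; simp)

lemma smooth_on_compose:
  fixes F :: "'b::euclidean_space \<Rightarrow> 'c::real_normed_vector"
  assumes "open U" "open V" "smooth_on V F" "smooth_on U g" "\<And>x. x \<in> U \<Longrightarrow> g x \<in> V"
  shows "smooth_on U (\<lambda>x. F (g x))"
  unfolding smooth_on_def
proof
  show "Ck_on k U (\<lambda>x. F (g x))" for k
    using Ck_on_compose[OF assms(1,2), of k F g] assms(3-5) unfolding smooth_on_def by blast
qed

text \<open>The multiples of real powers are closed under differentiation; the induction therefore
  lets both the factor and the exponent vary.\<close>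

lemma Ck_on_powr: "Ck_on k {0<..} (\<lambda>x::real. c * x powr a)"
proof (induction k arbitrary: a c)
  case 0
  show ?case by (auto intro!: continuous_intros)
next
  case (Suc k)
  have hd: "((\<lambda>x::real. c * x powr a) has_derivative (\<lambda>v. (c * a * v) * x powr (a - 1))) (at x)"
    if "x \<in> {0<..}" for x
  proof -
    have "((\<lambda>x. c * x powr a) has_real_derivative c * (a * x powr (a - 1))) (at x)"
      using that by (intro DERIV_cmult has_real_derivative_powr) simp
    then show ?thesis
      unfolding has_field_derivative_def by (rule has_derivative_eq_rhs) (simp add: fun_eq_iff)
  qed
  show ?case
  proof (rule Ck_on_SucI[OF open_greaterThan, where D = "\<lambda>x v. (c * a * v) * x powr (a - 1)"])
    show "Ck_on k {0<..} (\<lambda>x::real. (c * a * v) * x powr (a - 1))" for v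
      by (rule Suc.IH)
  qed (rule hd)
qed

lemma smooth_on_powr:
  assumes "open U" "smooth_on U F" "\<And>x. x \<in> U \<Longrightarrow> F x > (0::real)"
  shows "smooth_on U (\<lambda>x. F x powr a)"
proof -
  have "smooth_on {0<..} (\<lambda>x::real. x powr a)"
    unfolding smooth_on_def using Ck_on_powr[of _ 1 a] by auto
  from smooth_on_compose[OF assms(1) open_greaterThan this assms(2)] assms(3)
  show ?thesis by simp
qed

section \<open>Symmetry of second derivatives and the smooth inverse function theorem\<close>

text \<open>Two mean value theorems, in direction \<open>a\<close> for the increment along
  \<open>b\<close> and then in direction \<open>b\<close> for the derivative along \<open>a\<close>,
  express the second difference by a mixed derivative at a nearby point. The second difference is
  symmetric in \<open>a\<close> and \<open>b\<close>, and this is what yields the symmetry of second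
  derivatives.\<close>

lemma second_difference_limit:
  fixes F :: "'a::real_normed_vector \<Rightarrow> real"
  assumes U: "open U" "x \<in> U" and F: "smooth_on U F" and e: "e > 0"
  shows "\<exists>d>0. \<forall>h. 0 < h \<and> h < d \<longrightarrow>
    \<bar>(F (x + h *\<^sub>R a + h *\<^sub>R b) - F (x + h *\<^sub>R a) - F (x + h *\<^sub>R b) + F x) / h\<^sup>2
      - frechet_derivative (\<lambda>y. frechet_derivative F (at y) a) (at x) b\<bar> < e"
proof -
  define Fa where "Fa y = frechet_derivative F (at y) a" for y
  define Fab where "Fab y = frechet_derivative Fa (at y) b" for y
  have sFa: "smooth_on U Fa" unfolding Fa_def[abs_def] by (rule smooth_on_frechet_derivative[OF F])
  have sFab: "smooth_on U Fab" unfolding Fab_def[abs_def] by (rule smooth_on_frechet_derivative[OF sFa])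
  have "isCont Fab x" using smooth_on_continuous[OF sFab] U continuous_on_eq_continuous_at by blast
  then obtain r1 where r1: "r1 > 0" "\<And>y. dist y x < r1 \<Longrightarrow> dist (Fab y) (Fab x) < e"
    using e unfolding continuous_at_eps_delta by blast
  obtain r2 where r2: "r2 > 0" "ball x r2 \<subseteq> U" using U open_contains_ball by blast
  define r where "r = min r1 r2"
  \<comment> \<open>The parallelogram with sides \<open>h *\<^sub>R a\<close> and
    \<open>h *\<^sub>R b\<close> then stays in the ball of radius \<open>r\<close>; the
    \<open>1\<close> covers \<open>a = b = 0\<close>.\<close>
  define d where "d = r / (norm a + norm b + 1)"
  have d: "d > 0" using r1 r2 by (simp add: d_def r_def add_nonneg_pos)
  have near: "dist (x + s *\<^sub>R a + t *\<^sub>R b) x < r" if "0 \<le> s" "s \<le> h" "0 \<le> t" "t \<le> h" "h < d" for s t h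
  proof -
    have "norm (s *\<^sub>R a + t *\<^sub>R b) \<le> \<bar>s\<bar> * norm a + \<bar>t\<bar> * norm b"
      using norm_triangle_ineq[of "s *\<^sub>R a" "t *\<^sub>R b"] by simp
    also have "\<dots> \<le> h * norm a + h * norm b"
      using that by (intro add_mono mult_right_mono) auto
    also have "\<dots> \<le> h * (norm a + norm b + 1)" using that by (simp add: algebra_simps)
    also have "\<dots> < d * (norm a + norm b + 1)"
      using that by (intro mult_strict_right_mono) (auto simp: add_nonneg_pos)
    also have "\<dots> = r" unfolding d_def using add_nonneg_pos[of "norm a + norm b" 1] by simp
    finally show ?thesis by (simp add: dist_norm add.assoc)
  qed
  have inU: "x + s *\<^sub>R a + t *\<^sub>R b \<in> U" if "0 \<le> s" "s \<le> h" "0 \<le> t" "t \<le> h" "h < d" for s t h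
    using near[OF that] r2(2) by (auto simp: r_def dist_commute subset_iff)
  have "\<bar>(F (x + h *\<^sub>R a + h *\<^sub>R b) - F (x + h *\<^sub>R a) - F (x + h *\<^sub>R b) + F x) / h\<^sup>2 - Fab x\<bar> < e"
    if h: "0 < h" "h < d" for h
  proof -
    define \<phi> where "\<phi> s = F (x + s *\<^sub>R a + h *\<^sub>R b) - F (x + s *\<^sub>R a + 0 *\<^sub>R b)" for s
    have hdF: "((\<lambda>s. F (x + s *\<^sub>R a + t *\<^sub>R b)) has_real_derivative Fa (x + s *\<^sub>R a + t *\<^sub>R b)) (at s)"
      if "0 \<le> s" "s \<le> h" "0 \<le> t" "t \<le> h" for s t
    proof -
      have "((\<lambda>s. x + s *\<^sub>R a + t *\<^sub>R b) has_derivative (\<lambda>v. v *\<^sub>R a)) (at s)"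
        by (auto intro!: derivative_eq_intros)
      from has_derivative_compose[OF this smooth_on_has_derivative[OF F inU[OF that h(2)]]]
      have "((\<lambda>s. F (x + s *\<^sub>R a + t *\<^sub>R b)) has_derivative
          (\<lambda>v. frechet_derivative F (at (x + s *\<^sub>R a + t *\<^sub>R b)) (v *\<^sub>R a))) (at s)" .
      moreover have "linear (frechet_derivative F (at (x + s *\<^sub>R a + t *\<^sub>R b)))"
        using smooth_on_has_derivative[OF F inU[OF that h(2)]] has_derivative_linear by blast
      ultimately show ?thesis unfolding has_field_derivative_def Fa_def
        by (simp add: linear_cmul mult.commute[of _ "frechet_derivative _ _ _"] mult_commute_abs)
    qed
    have hdFa: "((\<lambda>t. Fa (x + s *\<^sub>R a + t *\<^sub>R b)) has_real_derivative Fab (x + s *\<^sub>R a + t *\<^sub>R b)) (at t)"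
      if "0 \<le> s" "s \<le> h" "0 \<le> t" "t \<le> h" for s t
    proof -
      have "((\<lambda>t. x + s *\<^sub>R a + t *\<^sub>R b) has_derivative (\<lambda>v. v *\<^sub>R b)) (at t)"
        by (auto intro!: derivative_eq_intros)
      from has_derivative_compose[OF this smooth_on_has_derivative[OF sFa inU[OF that h(2)]]]
      have "((\<lambda>t. Fa (x + s *\<^sub>R a + t *\<^sub>R b)) has_derivative
          (\<lambda>v. frechet_derivative Fa (at (x + s *\<^sub>R a + t *\<^sub>R b)) (v *\<^sub>R b))) (at t)" .
      moreover have "linear (frechet_derivative Fa (at (x + s *\<^sub>R a + t *\<^sub>R b)))"
        using smooth_on_has_derivative[OF sFa inU[OF that h(2)]] has_derivative_linear by blast
      ultimately show ?thesis unfolding has_field_derivative_def Fab_def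
        by (simp add: linear_cmul mult.commute[of _ "frechet_derivative _ _ _"] mult_commute_abs)
    qed
    have "(\<phi> has_real_derivative (Fa (x + s *\<^sub>R a + h *\<^sub>R b) - Fa (x + s *\<^sub>R a + 0 *\<^sub>R b))) (at s)"
      if "0 \<le> s" "s \<le> h" for s
      unfolding \<phi>_def by (intro DERIV_diff hdF) (use that h in auto)
    from MVT2[OF h(1), of \<phi>, OF this] obtain s where s: "0 < s" "s < h"
      "\<phi> h - \<phi> 0 = (h - 0) * (Fa (x + s *\<^sub>R a + h *\<^sub>R b) - Fa (x + s *\<^sub>R a + 0 *\<^sub>R b))" by blast
    from MVT2[OF h(1), of "\<lambda>t. Fa (x + s *\<^sub>R a + t *\<^sub>R b)", OF hdFa] s
    obtain t where t: "0 < t" "t < h"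
      "Fa (x + s *\<^sub>R a + h *\<^sub>R b) - Fa (x + s *\<^sub>R a + 0 *\<^sub>R b) = (h - 0) * Fab (x + s *\<^sub>R a + t *\<^sub>R b)"
      by auto
    have "(F (x + h *\<^sub>R a + h *\<^sub>R b) - F (x + h *\<^sub>R a) - F (x + h *\<^sub>R b) + F x) = \<phi> h - \<phi> 0"
      by (simp add: \<phi>_def)
    also have "\<dots> = h\<^sup>2 * Fab (x + s *\<^sub>R a + t *\<^sub>R b)" using s(3) t(3) by (simp add: power2_eq_square)
    finally have "(F (x + h *\<^sub>R a + h *\<^sub>R b) - F (x + h *\<^sub>R a) - F (x + h *\<^sub>R b) + F x) / h\<^sup>2
      = Fab (x + s *\<^sub>R a + t *\<^sub>R b)" using h by simp
    moreover have "dist (x + s *\<^sub>R a + t *\<^sub>R b) x < r1"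
      using near[of s h t] s t h by (auto simp: r_def)
    ultimately show ?thesis using r1(2) by (auto simp: dist_real_def)
  qed
  then show ?thesis using d unfolding Fab_def Fa_def[abs_def] by blast
qed

lemma second_derivative_symmetric_real:
  fixes F :: "'a::real_normed_vector \<Rightarrow> real"
  assumes U: "open U" "x \<in> U" and F: "smooth_on U F"
  shows "frechet_derivative (\<lambda>y. frechet_derivative F (at y) a) (at x) b =
    frechet_derivative (\<lambda>y. frechet_derivative F (at y) b) (at x) a" (is "?ab = ?ba")
proof (rule ccontr)
  assume ne: "?ab \<noteq> ?ba"
  define e where "e = \<bar>?ab - ?ba\<bar> / 2"
  have e: "e > 0" using ne by (simp add: e_def)
  obtain d1 where d1: "d1 > 0" "\<And>h. 0 < h \<and> h < d1 \<Longrightarrow>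
    \<bar>(F (x + h *\<^sub>R a + h *\<^sub>R b) - F (x + h *\<^sub>R a) - F (x + h *\<^sub>R b) + F x) / h\<^sup>2 - ?ab\<bar> < e"
    using second_difference_limit[OF U F e, of a b] by blast
  obtain d2 where d2: "d2 > 0" "\<And>h. 0 < h \<and> h < d2 \<Longrightarrow>
    \<bar>(F (x + h *\<^sub>R b + h *\<^sub>R a) - F (x + h *\<^sub>R b) - F (x + h *\<^sub>R a) + F x) / h\<^sup>2 - ?ba\<bar> < e"
    using second_difference_limit[OF U F e, of b a] by blast
  define h where "h = min d1 d2 / 2"
  define q where "q = (F (x + h *\<^sub>R a + h *\<^sub>R b) - F (x + h *\<^sub>R a) - F (x + h *\<^sub>R b) + F x) / h\<^sup>2"
  have h: "0 < h" "h < d1" "h < d2" using d1 d2 by (auto simp: h_def)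
  have q2: "(F (x + h *\<^sub>R b + h *\<^sub>R a) - F (x + h *\<^sub>R b) - F (x + h *\<^sub>R a) + F x) / h\<^sup>2 = q"
    by (simp add: q_def algebra_simps)
  have contra: False if "\<bar>q - a\<bar> < \<bar>a - b\<bar> / 2" "\<bar>q - b\<bar> < \<bar>a - b\<bar> / 2" for a b :: real
    using that by (auto simp: abs_if split: if_splits)
  have "\<bar>q - ?ab\<bar> < e" "\<bar>q - ?ba\<bar> < e"
    using d1(2)[of h] d2(2)[of h] h unfolding q2 by (auto simp: q_def)
  then show False unfolding e_def by (rule contra)
qed

lemma frechet_derivative_inner_left:
  assumes "F differentiable (at x)"
  shows "frechet_derivative (\<lambda>y. F y \<bullet> c) (at x) v = frechet_derivative F (at x) v \<bullet> c"
proof -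
  have "((\<lambda>y. F y \<bullet> c) has_derivative (\<lambda>v. frechet_derivative F (at x) v \<bullet> c)) (at x)"
    using assms by (intro has_derivative_inner_left) (simp add: frechet_derivative_works[symmetric])
  from frechet_derivative_at[OF this] show ?thesis by metis
qed

lemma second_derivative_symmetric:
  fixes F :: "'a::real_normed_vector \<Rightarrow> 'b::euclidean_space"
  assumes U: "open U" "x \<in> U" and F: "smooth_on U F"
  shows "frechet_derivative (\<lambda>y. frechet_derivative F (at y) a) (at x) b =
    frechet_derivative (\<lambda>y. frechet_derivative F (at y) b) (at x) a"
proof (rule euclidean_eqI)
  fix i :: 'b assume "i \<in> Basis"
  have s: "smooth_on U (\<lambda>y. F y \<bullet> i)"
    by (rule smooth_on_linear[OF bounded_linear_inner_left U(1) F])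
  have "frechet_derivative (\<lambda>y. frechet_derivative F (at y) a) (at x) b \<bullet> i =
      frechet_derivative (\<lambda>y. frechet_derivative (\<lambda>y. F y \<bullet> i) (at y) a) (at x) b" for a b
  proof -
    have "frechet_derivative (\<lambda>y. frechet_derivative F (at y) a) (at x) b \<bullet> i =
        frechet_derivative (\<lambda>y. frechet_derivative F (at y) a \<bullet> i) (at x) b"
      by (rule frechet_derivative_inner_left[symmetric])
        (rule smooth_on_differentiable[OF smooth_on_frechet_derivative[OF F] U(2)])
    also have "\<dots> = frechet_derivative (\<lambda>y. frechet_derivative (\<lambda>y. F y \<bullet> i) (at y) a) (at x) b"
      by (subst frechet_derivative_cong_open(2)[OF U, where G = "\<lambda>y. frechet_derivative (\<lambda>y. F y \<bullet> i) (at y) a"])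
        (simp_all add: frechet_derivative_inner_left smooth_on_differentiable[OF F])
    finally show ?thesis .
  qed
  then show "frechet_derivative (\<lambda>y. frechet_derivative F (at y) a) (at x) b \<bullet> i =
    frechet_derivative (\<lambda>y. frechet_derivative F (at y) b) (at x) a \<bullet> i"
    using second_derivative_symmetric_real[OF U s] by metis
qed

text \<open>Where one factor vanishes, the product rule asks only for continuity of the other. This
  allows the inverse of a matrix function to be differentiated knowing merely that it is
  continuous.\<close>

lemma has_derivative_scaleR_vanishing:
  assumes r: "(r has_derivative r') (at y)" "r y = (0::real)" and c: "isCont c y"
  shows "((\<lambda>z. r z *\<^sub>R c z) has_derivative (\<lambda>v. r' v *\<^sub>R c y)) (at y)"
proof -
  have 1: "((\<lambda>z. r z *\<^sub>R c y) has_derivative (\<lambda>v. r' v *\<^sub>R c y)) (at y)"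
    by (intro has_derivative_scaleR_left r)
  obtain K where K: "K > 0" "\<And>v. norm (r' v) \<le> norm v * K"
    using bounded_linear.pos_bounded[OF has_derivative_bounded_linear[OF r(1)]] by blast
  have 2: "((\<lambda>z. r z *\<^sub>R (c z - c y)) has_derivative (\<lambda>v. 0)) (at y)"
    unfolding has_derivative_at_alt
  proof (intro conjI allI impI)
    fix e :: real assume e: "e > 0"
    obtain d1 where d1: "d1 > 0" "\<And>z. norm (z - y) < d1 \<Longrightarrow> norm (r z - r y - r' (z - y)) \<le> 1 * norm (z - y)"
      using r(1) unfolding has_derivative_at_alt by (metis zero_less_one)
    obtain d2 where d2: "d2 > 0" "\<And>z. dist z y < d2 \<Longrightarrow> dist (c z) (c y) < e / (K + 1)"
      using c e K(1) unfolding continuous_at_eps_delta by (metis add_pos_pos divide_pos_pos zero_less_one)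
    have "norm (r z *\<^sub>R (c z - c y) - r y *\<^sub>R (c y - c y) - 0) \<le> e * norm (z - y)"
      if z: "norm (z - y) < min d1 d2" for z
    proof -
      have "\<bar>r z\<bar> \<le> norm (r z - r y - r' (z - y)) + norm (r' (z - y))" using r(2) by simp
      also have "\<dots> \<le> (K + 1) * norm (z - y)"
        using d1(2)[of z] K(2)[of "z - y"] z by (simp add: algebra_simps)
      finally have a: "\<bar>r z\<bar> \<le> (K + 1) * norm (z - y)" .
      have b: "norm (c z - c y) \<le> e / (K + 1)" using d2(2)[of z] z by (simp add: dist_norm less_imp_le)
      have "\<bar>r z\<bar> * norm (c z - c y) \<le> ((K + 1) * norm (z - y)) * (e / (K + 1))"
        using a b K(1) by (intro mult_mono) auto
      also have "\<dots> = e * norm (z - y)" using K(1) by simp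
      finally show ?thesis by simp
    qed
    then show "\<exists>d>0. \<forall>z. norm (z - y) < d \<longrightarrow>
        norm (r z *\<^sub>R (c z - c y) - r y *\<^sub>R (c y - c y) - 0) \<le> e * norm (z - y)"
      using d1(1) d2(1) by (intro exI[of _ "min d1 d2"]) auto
  qed simp
  show ?thesis using has_derivative_add[OF 1 2] by (simp add: algebra_simps)
qed

lemma linear_inverse_bounded_below:
  fixes L :: "'a::euclidean_space \<Rightarrow> 'a"
  assumes "linear K" "\<And>v. K (L v) = v"
  obtains m where "m > 0" "\<And>v. norm (L v) \<ge> m * norm v"
proof -
  obtain C where C: "C > 0" "\<And>v. norm (K v) \<le> C * norm v"
    using linear_bounded_pos[OF assms(1)] by blast
  have "norm (L v) \<ge> (1 / C) * norm v" for v
    using C(2)[of "L v"] C(1) assms(2)[of v] by (simp add: field_simps)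
  then show thesis using that[of "1 / C"] C(1) by simp
qed

text \<open>Bootstrapping: \<open>A y\<close> inverts the derivative of \<open>\<Phi>\<close> at
  \<open>\<psi> y\<close>. It is shown to be continuous, then differentiable, with a derivative that
  is polynomial in \<open>A\<close> and in the second derivatives of \<open>\<Phi>\<close> along
  \<open>\<psi>\<close>. So each order of regularity of \<open>A\<close> passes to
  \<open>\<psi>\<close> and from there back to \<open>A\<close> with one order more.\<close>

lemma smooth_on_inverse_map:
  fixes \<Phi> :: "'a::euclidean_space \<Rightarrow> 'a"
  assumes U: "open U" and V: "open V" and sm: "smooth_on U \<Phi>"
    and \<psi>: "\<And>y. y \<in> V \<Longrightarrow> \<psi> y \<in> U"
    and d\<psi>: "\<And>y. y \<in> V \<Longrightarrow> (\<psi> has_derivative A y) (at y)"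
    and AL: "\<And>y v. y \<in> V \<Longrightarrow> A y (frechet_derivative \<Phi> (at (\<psi> y)) v) = v"
    and AR: "\<And>y v. y \<in> V \<Longrightarrow> frechet_derivative \<Phi> (at (\<psi> y)) (A y v) = v"
  shows "smooth_on V \<psi>"
proof -
  define M where "M y v = frechet_derivative \<Phi> (at (\<psi> y)) v" for y v
  define M2 where "M2 l y w = frechet_derivative (\<lambda>x. frechet_derivative \<Phi> (at x) l) (at (\<psi> y)) w" for l y w
  have linM: "linear (M y)" if "y \<in> V" for y
    unfolding M_def[abs_def] using smooth_on_has_derivative[OF sm \<psi>[OF that]] has_derivative_linear by blast
  have linA: "linear (A y)" if "y \<in> V" for y using d\<psi>[OF that] has_derivative_linear by blast
  have hM: "((\<lambda>y. M y l) has_derivative (\<lambda>w. M2 l y (A y w))) (at y)" if "y \<in> V" for y l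
    unfolding M_def M2_def
    by (rule has_derivative_compose[OF d\<psi>[OF that]
        smooth_on_has_derivative[OF smooth_on_frechet_derivative[OF sm] \<psi>[OF that]]])
  \<comment> \<open>The resolvent identity for the inverses at \<open>y\<close> and
    \<open>y'\<close>. The coefficients of \<open>A y' i\<close> vanish at \<open>y' = y\<close>, so
    that \<open>has_derivative_scaleR_vanishing\<close> will apply.\<close>
  have ident: "A y' v = A y v - (\<Sum>i\<in>Basis. ((M y' (A y v) - v) \<bullet> i) *\<^sub>R A y' i)"
    if "y \<in> V" "y' \<in> V" for y y' v
  proof -
    have "(\<Sum>i\<in>Basis. ((M y' (A y v) - v) \<bullet> i) *\<^sub>R A y' i) = A y' (M y' (A y v) - v)"
      by (rule bounded_linear_euclidean_sum[OF linA[OF that(2)], symmetric])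
    also have "\<dots> = A y v - A y' v"
      using AL[OF that(2)] by (simp add: linear_diff[OF linA[OF that(2)]] M_def)
    finally show ?thesis by simp
  qed
  have contM: "isCont (\<lambda>y. M y l) y" if "y \<in> V" for y l
    using hM[OF that] has_derivative_continuous by blast
  have contA: "isCont (\<lambda>y. A y v) y" if y: "y \<in> V" for y v
  proof -
    obtain m where m: "m > 0" "\<And>v. norm (M y v) \<ge> m * norm v"
      using linear_inverse_bounded_below[OF linA[OF y], of "M y"] AL[OF y] unfolding M_def by blast
    have "((\<lambda>y'. \<Sum>i\<in>Basis. norm (M y' i - M y i)) \<longlongrightarrow> (\<Sum>i\<in>(Basis::'a set). norm (M y i - M y i))) (at y)"
      by (intro tendsto_intros contM[OF y, unfolded isCont_def])
    then have ev1: "\<forall>\<^sub>F y' in at y. (\<Sum>i\<in>Basis. norm (M y' i - M y i)) < m / 2"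
      using m(1) by (intro order_tendstoD(2)[where y = 0]) auto
    have ev2: "\<forall>\<^sub>F y' in at y. y' \<in> V" using V y by (simp add: eventually_at_in_open')
    have ev: "\<forall>\<^sub>F y' in at y. norm (A y' v - A y v) \<le> (2 / m) * norm (M y' (A y v) - v)"
      using ev1 ev2
    proof eventually_elim
      case (elim y')
      have "norm (M y' u - M y u) \<le> (m / 2) * norm u" for u
      proof -
        have "M y' u - M y u = (\<Sum>i\<in>Basis. (u \<bullet> i) *\<^sub>R (M y' i - M y i))"
          using bounded_linear_euclidean_sum[OF linM[OF elim(2)], of u] bounded_linear_euclidean_sum[OF linM[OF y], of u]
          by (simp add: sum_subtractf scaleR_diff_right)
        also have "norm \<dots> \<le> (\<Sum>i\<in>Basis. norm ((u \<bullet> i) *\<^sub>R (M y' i - M y i)))" by (rule norm_sum)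
        also have "\<dots> \<le> (\<Sum>i\<in>Basis. norm u * norm (M y' i - M y i))"
          by (intro sum_mono) (auto intro!: mult_right_mono Basis_le_norm)
        also have "\<dots> = norm u * (\<Sum>i\<in>Basis. norm (M y' i - M y i))" by (simp add: sum_distrib_left)
        also have "\<dots> \<le> norm u * (m / 2)" using elim(1) by (intro mult_left_mono) auto
        finally show ?thesis by (simp add: mult.commute)
      qed
      \<comment> \<open>The lower bound \<open>m\<close> for \<open>M y\<close> persists nearby as
        \<open>m / 2\<close>, which bounds the inverses \<open>A y'\<close> uniformly.\<close>
      then have low: "norm (M y' u) \<ge> (m / 2) * norm u" for u
        using m(2)[of u] norm_triangle_ineq3[of "M y' u" "M y u"] by (smt (verit) mult.commute field_sum_of_halves distrib_right mult_left_mono)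
      have "A y' v - A y v = - A y' (M y' (A y v) - v)"
        using AL[OF elim(2)] by (simp add: linear_diff[OF linA[OF elim(2)]] M_def)
      then have "norm (A y' v - A y v) = norm (A y' (M y' (A y v) - v))" by simp
      also have "\<dots> \<le> (2 / m) * norm (M y' (A y v) - v)"
        using low[of "A y' (M y' (A y v) - v)"] AR[OF elim(2)] m(1) by (simp add: M_def field_simps)
      finally show ?case .
    qed
    have "((\<lambda>y'. (2 / m) * norm (M y' (A y v) - v)) \<longlongrightarrow> (2 / m) * norm (M y (A y v) - v)) (at y)"
      by (intro tendsto_intros contM[OF y, unfolded isCont_def])
    then have "((\<lambda>y'. (2 / m) * norm (M y' (A y v) - v)) \<longlongrightarrow> 0) (at y)"
      using AR[OF y] by (simp add: M_def)
    from Lim_null_comparison[OF ev this] show ?thesis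
      unfolding isCont_def by (simp add: LIM_zero_iff)
  qed
  have hA: "((\<lambda>y. A y v) has_derivative
      (\<lambda>w. - (\<Sum>i\<in>Basis. ((\<Sum>l\<in>Basis. (A y v \<bullet> l) *\<^sub>R M2 l y (A y w)) \<bullet> i) *\<^sub>R A y i))) (at y)"
    if y: "y \<in> V" for y v
  proof -
    have r: "((\<lambda>y'. (\<Sum>l\<in>Basis. (A y v \<bullet> l) *\<^sub>R M y' l) - v) has_derivative
        (\<lambda>w. (\<Sum>l\<in>Basis. (A y v \<bullet> l) *\<^sub>R M2 l y (A y w)) - 0)) (at y)"
      by (intro has_derivative_diff has_derivative_sum has_derivative_scaleR_right hM[OF y] has_derivative_const)
    have r0: "(\<Sum>l\<in>Basis. (A y v \<bullet> l) *\<^sub>R M y l) - v = 0"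
      using bounded_linear_euclidean_sum[OF linM[OF y], of "A y v"] AR[OF y, of v] by (simp add: M_def)
    have "((\<lambda>y'. A y v - (\<Sum>i\<in>Basis. (((\<Sum>l\<in>Basis. (A y v \<bullet> l) *\<^sub>R M y' l) - v) \<bullet> i) *\<^sub>R A y' i)) has_derivative
      (\<lambda>w. 0 - (\<Sum>i\<in>Basis. (((\<Sum>l\<in>Basis. (A y v \<bullet> l) *\<^sub>R M2 l y (A y w)) - 0) \<bullet> i) *\<^sub>R A y i))) (at y)"
      by (intro has_derivative_diff has_derivative_const has_derivative_sum has_derivative_scaleR_vanishing
          has_derivative_inner_left r contA[OF y]) (simp add: r0)
    then have "((\<lambda>y'. A y' v) has_derivative
      (\<lambda>w. 0 - (\<Sum>i\<in>Basis. (((\<Sum>l\<in>Basis. (A y v \<bullet> l) *\<^sub>R M2 l y (A y w)) - 0) \<bullet> i) *\<^sub>R A y i))) (at y)"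
    proof (rule has_derivative_transform_within_open[OF _ V y])
      fix y' assume y': "y' \<in> V"
      show "A y v - (\<Sum>i\<in>Basis. (((\<Sum>l\<in>Basis. (A y v \<bullet> l) *\<^sub>R M y' l) - v) \<bullet> i) *\<^sub>R A y' i) = A y' v"
        using ident[OF y y', of v] bounded_linear_euclidean_sum[OF linM[OF y'], of "A y v"] by simp
    qed
    then show ?thesis by simp
  qed
  have M2lin: "M2 l y (A y w) = (\<Sum>j\<in>Basis. (A y w \<bullet> j) *\<^sub>R M2 l y j)" if "y \<in> V" for l y w
    unfolding M2_def
    by (rule bounded_linear_euclidean_sum)
      (rule has_derivative_linear[OF smooth_on_has_derivative[OF smooth_on_frechet_derivative[OF sm] \<psi>[OF that]]])
  have CkA: "Ck_on k V (\<lambda>y. A y v)" for k v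
  proof (induction k arbitrary: v)
    case 0
    show ?case using contA by (auto intro: continuous_at_imp_continuous_on)
  next
    case (Suc k)
    have "Ck_on (Suc k) V \<psi>" by (rule Ck_on_SucI[OF V, of \<psi> A]) (use d\<psi> Suc.IH in auto)
    then have \<psi>k: "Ck_on k V \<psi>" by (rule Ck_on_SucD)
    have M2k: "Ck_on k V (\<lambda>y. M2 l y j)" for l j
      unfolding M2_def
      by (rule Ck_on_compose[OF V U _ \<psi>k])
        (use smooth_on_frechet_derivative[OF smooth_on_frechet_derivative[OF sm]] \<psi> in \<open>auto simp: smooth_on_def\<close>)
    have "Ck_on k V (\<lambda>y. - (\<Sum>i\<in>Basis. ((\<Sum>l\<in>Basis. (A y v \<bullet> l) *\<^sub>R (\<Sum>j\<in>Basis. (A y w \<bullet> j) *\<^sub>R M2 l y j)) \<bullet> i) *\<^sub>R A y i))" for w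
      by (rule Ck_on_linear[OF bounded_linear_minus[OF bounded_linear_ident] V] Ck_on_sum[OF V]
          Ck_on_bilinear[OF bounded_bilinear_scaleR V] Ck_on_linear[OF bounded_linear_inner_left V] Suc.IH M2k)+
    then have "Ck_on k V (\<lambda>y. - (\<Sum>i\<in>Basis. ((\<Sum>l\<in>Basis. (A y v \<bullet> l) *\<^sub>R M2 l y (A y w)) \<bullet> i) *\<^sub>R A y i))" for w
      by (subst Ck_on_cong[OF V]) (auto simp: M2lin)
    then show ?case
      by (intro Ck_on_SucI[OF V, where D = "\<lambda>y w. - (\<Sum>i\<in>Basis. ((\<Sum>l\<in>Basis. (A y v \<bullet> l) *\<^sub>R M2 l y (A y w)) \<bullet> i) *\<^sub>R A y i)"] hA)
  qed
  show ?thesis unfolding smooth_on_def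
  proof
    show "Ck_on k V \<psi>" for k
      by (rule Ck_on_SucD, rule Ck_on_SucI[OF V, of \<psi> A]) (use d\<psi> CkA in auto)
  qed
qed

text \<open>The inverse function theorem for continuously differentiable maps provides
  \<open>\<psi>\<close> and its derivative; smoothness comes from
  \<open>smooth_on_inverse_map\<close>.\<close>

lemma smooth_inverse_function:
  fixes \<Phi> :: "'a::euclidean_space \<Rightarrow> 'a"
  assumes U: "open U" "x0 \<in> U" and sm: "smooth_on U \<Phi>"
    and inj: "\<And>v. frechet_derivative \<Phi> (at x0) v = 0 \<Longrightarrow> v = 0"
  obtains U' V \<psi> where "open U'" "U' \<subseteq> U" "x0 \<in> U'" "open V" "\<Phi> x0 \<in> V" "homeomorphism U' V \<Phi> \<psi>"
    "smooth_on V \<psi>" "\<And>v. frechet_derivative \<psi> (at (\<Phi> x0)) (frechet_derivative \<Phi> (at x0) v) = v"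
proof -
  define f' where "f' x = Blinfun (frechet_derivative \<Phi> (at x))" for x
  have f': "blinfun_apply (f' x) = frechet_derivative \<Phi> (at x)" if "x \<in> U" for x
    unfolding f'_def using smooth_on_has_derivative[OF sm that]
    by (intro bounded_linear_Blinfun_apply has_derivative_bounded_linear)
  have d: "(\<Phi> has_derivative blinfun_apply (f' x)) (at x)" if "x \<in> U" for x
    using f'[OF that] smooth_on_has_derivative[OF sm that] by simp
  have c: "continuous_on U f'"
  proof (rule continuous_on_blinfun_componentwise)
    fix i :: 'a
    have "continuous_on U (\<lambda>x. frechet_derivative \<Phi> (at x) i)"
      by (rule smooth_on_continuous[OF smooth_on_frechet_derivative[OF sm]])
    then show "continuous_on U (\<lambda>x. blinfun_apply (f' x) i)"
      using f' by (simp cong: continuous_on_cong)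
  qed
  have lin: "linear (frechet_derivative \<Phi> (at x0))"
    using has_derivative_linear[OF smooth_on_has_derivative[OF sm U(2)]] .
  have "inj (frechet_derivative \<Phi> (at x0))" using inj linear_injective_0[OF lin] by blast
  then obtain g where g: "linear g" "g \<circ> frechet_derivative \<Phi> (at x0) = id"
    using linear_injective_left_inverse[OF lin] by blast
  have inv: "Blinfun g o\<^sub>L f' x0 = id_blinfun"
  proof (rule blinfun_eqI)
    fix v
    have "blinfun_apply (Blinfun g) = g" using g(1) linear_conv_bounded_linear bounded_linear_Blinfun_apply by blast
    then show "blinfun_apply (Blinfun g o\<^sub>L f' x0) v = blinfun_apply id_blinfun v"
      using f'[OF U(2)] g(2) by (simp add: fun_eq_iff)
  qed
  obtain U' V \<psi> \<psi>' where r: "open U'" "U' \<subseteq> U" "x0 \<in> U'" "open V" "\<Phi> x0 \<in> V" "homeomorphism U' V \<Phi> \<psi>"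
    "\<And>y. y \<in> V \<Longrightarrow> (\<psi> has_derivative (\<psi>' y)) (at y)"
    "\<And>y. y \<in> V \<Longrightarrow> \<psi>' y = inv (blinfun_apply (f'(\<psi> y)))"
    "\<And>y. y \<in> V \<Longrightarrow> bij (blinfun_apply (f'(\<psi> y)))"
    using inverse_function_theorem[OF U(1) d c U(2) inv] by metis
  have \<psi>U: "\<psi> y \<in> U" if "y \<in> V" for y using r(2,6) that unfolding homeomorphism_def by blast
  have L: "\<psi>' y (frechet_derivative \<Phi> (at (\<psi> y)) v) = v" if "y \<in> V" for y v
    using r(8,9)[OF that] f'[OF \<psi>U[OF that]] bij_is_inj inv_f_f by metis
  have R: "frechet_derivative \<Phi> (at (\<psi> y)) (\<psi>' y v) = v" if "y \<in> V" for y v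
    using r(8,9)[OF that] f'[OF \<psi>U[OF that]] bij_is_surj surj_f_inv_f by metis
  have s: "smooth_on V \<psi>"
    by (rule smooth_on_inverse_map[OF U(1) r(4) sm \<psi>U r(7) L R])
  have "\<psi> (\<Phi> x0) = x0" using r(3,6) unfolding homeomorphism_def by blast
  moreover have "frechet_derivative \<psi> (at (\<Phi> x0)) = \<psi>' (\<Phi> x0)"
    using frechet_derivative_at[OF r(7)[OF r(5)]] by simp
  ultimately have "frechet_derivative \<psi> (at (\<Phi> x0)) (frechet_derivative \<Phi> (at x0) v) = v" for v
    using L[OF r(5), of v] by simp
  with r s show thesis using that by blast
qed

section \<open>Slice charts, tangent vectors and level sets\<close>

lemma has_vector_derivative_line:
  assumes "F differentiable (at u)"
  shows "((\<lambda>t. F (u + t *\<^sub>R b)) has_vector_derivative frechet_derivative F (at u) b) (at 0)"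
proof -
  have F: "(F has_derivative frechet_derivative F (at u)) (at (u + 0 *\<^sub>R b))"
    using assms by (simp add: frechet_derivative_works[symmetric])
  have "((\<lambda>t. u + t *\<^sub>R b) has_derivative (\<lambda>t. t *\<^sub>R b)) (at 0)"
    by (auto intro!: derivative_eq_intros)
  from has_derivative_compose[OF this F] show ?thesis
    unfolding has_vector_derivative_def
    using linear_cmul[OF has_derivative_linear[OF F]] by simp
qed

lemma pd_eqI: "((\<lambda>t. F (u + t *\<^sub>R b)) has_vector_derivative D) (at 0) \<Longrightarrow> pd b F u = D"
  unfolding pd_def by (rule vector_derivative_at)

lemma pd_eq_frechet: "F differentiable (at u) \<Longrightarrow> pd b F u = frechet_derivative F (at u) b"
  by (rule pd_eqI[OF has_vector_derivative_line])

lemma pd_cong: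
  assumes "\<forall>\<^sub>F t in nhds 0. F (u + t *\<^sub>R b) = G (u + t *\<^sub>R b)"
  shows "pd b F u = pd b G u"
proof -
  have "((\<lambda>t. F (u + t *\<^sub>R b)) has_vector_derivative D) (at 0) \<longleftrightarrow>
      ((\<lambda>t. G (u + t *\<^sub>R b)) has_vector_derivative D) (at 0)" for D
    by (rule has_vector_derivative_cong_ev)
      (use assms eventually_nhds_x_imp_x[OF assms] in \<open>auto elim: eventually_mono\<close>)
  then show ?thesis unfolding pd_def vector_derivative_def by simp
qed

lemma eventually_line_in_open:
  fixes u :: "'a::real_normed_vector"
  assumes "open U" "u \<in> U"
  shows "\<forall>\<^sub>F t in nhds 0. u + t *\<^sub>R b \<in> U"
proof -
  have "((\<lambda>t. u + t *\<^sub>R b) \<longlongrightarrow> u + 0 *\<^sub>R b) (nhds 0)" by (intro tendsto_intros filterlim_ident)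
  then show ?thesis using assms by (simp add: tendsto_def)
qed

lemma eventually_line_in_slice:
  fixes u :: "'a::euclidean_space"
  assumes "open U" "u \<in> U \<inter> span B" "b \<in> span B"
  shows "\<forall>\<^sub>F t in nhds 0. u + t *\<^sub>R b \<in> U \<inter> span B"
  using eventually_line_in_open[OF assms(1), of u b] assms(2,3)
  by (auto elim!: eventually_mono intro: span_add span_scale)

lemma pd_cong_slice:
  fixes u :: "'a::euclidean_space"
  assumes "open U" "u \<in> U \<inter> span B" "b \<in> span B" "\<And>x. x \<in> U \<inter> span B \<Longrightarrow> F x = G x"
  shows "pd b F u = pd b G u"
  by (rule pd_cong) (use eventually_line_in_slice[OF assms(1-3)] assms(4) in \<open>auto elim!: eventually_mono\<close>)

lemma tendsto_difference_quotient:
  assumes "(c has_vector_derivative v) (at 0)"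
  shows "((\<lambda>t. (1 / t) *\<^sub>R (c t - c 0)) \<longlongrightarrow> v) (at 0)"
proof -
  have "((\<lambda>t. norm (c (0 + t) - c 0 - t *\<^sub>R v) / norm t) \<longlongrightarrow> 0) (at 0)"
    using assms unfolding has_vector_derivative_def has_derivative_at by blast
  then have "((\<lambda>t. norm ((1 / t) *\<^sub>R (c t - c 0) - v)) \<longlongrightarrow> 0) (at 0)"
  proof (rule Lim_transform_eventually)
    have "norm (c (0 + t) - c 0 - t *\<^sub>R v) / norm t = norm ((1 / t) *\<^sub>R (c t - c 0) - v)" if "t \<noteq> 0" for t
    proof -
      have "(1 / t) *\<^sub>R (c t - c 0) - v = (1 / t) *\<^sub>R (c (0 + t) - c 0 - t *\<^sub>R v)"
        using that by (simp add: scaleR_diff_right)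
      then show ?thesis by simp
    qed
    then show "\<forall>\<^sub>F t in at 0. norm (c (0 + t) - c 0 - t *\<^sub>R v) / norm t = norm ((1 / t) *\<^sub>R (c t - c 0) - v)"
      by (simp add: eventually_at_filter)
  qed
  then show ?thesis by (simp add: LIM_zero_iff tendsto_norm_zero_iff)
qed

lemma curve_velocity_in_subspace:
  fixes c :: "real \<Rightarrow> 'a::euclidean_space"
  assumes "(c has_vector_derivative v) (at 0)" "\<forall>\<^sub>F t in nhds 0. c t \<in> S" "subspace S"
  shows "v \<in> S"
proof (rule Lim_in_closed_set[OF closed_subspace[OF assms(3)] _ _ tendsto_difference_quotient[OF assms(1)]])
  have "c 0 \<in> S" using eventually_nhds_x_imp_x[OF assms(2)] .
  moreover have "\<forall>\<^sub>F t in at 0. c t \<in> S" using assms(2) by (simp add: eventually_nhds_conv_at)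
  ultimately show "\<forall>\<^sub>F t in at 0. (1 / t) *\<^sub>R (c t - c 0) \<in> S"
    by (auto elim!: eventually_mono intro: subspace_scale[OF assms(3)] subspace_diff[OF assms(3)])
qed simp

text \<open>Tangency by means of curves refers to no chart, so it can be used for any set and
  transported by maps before a submanifold structure is known.\<close>

definition velocity :: "'a::euclidean_space set \<Rightarrow> 'a \<Rightarrow> 'a \<Rightarrow> bool" where
  "velocity M p v \<longleftrightarrow>
     (\<exists>c. c 0 = p \<and> (c has_vector_derivative v) (at 0) \<and> (\<forall>\<^sub>F t in nhds 0. c t \<in> M))"

lemma velocity_constant_map:
  assumes "velocity M p v" "open W" "p \<in> W" "F differentiable (at p)"
    "\<And>x. x \<in> W \<inter> M \<Longrightarrow> F x = k"
  shows "frechet_derivative F (at p) v = 0"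
proof -
  obtain c where c: "c 0 = p" "(c has_vector_derivative v) (at 0)" "\<forall>\<^sub>F t in nhds 0. c t \<in> M"
    using assms(1) unfolding velocity_def by blast
  have "isCont c 0" using c(2) has_vector_derivative_continuous by blast
  then have cont: "(c \<longlongrightarrow> p) (nhds 0)"
    using c(1) by (metis tendsto_at_iff_tendsto_nhds isCont_def)
  have "((\<lambda>t. F (c t)) has_vector_derivative frechet_derivative F (at p) v) (at 0)"
  proof -
    have F: "(F has_derivative frechet_derivative F (at p)) (at (c 0))"
      using assms(4) c(1) by (simp add: frechet_derivative_works[symmetric])
    from has_derivative_compose[OF c(2)[unfolded has_vector_derivative_def] F]
    show ?thesis unfolding has_vector_derivative_def
      using linear_cmul[OF has_derivative_linear[OF F]] by simp
  qed
  moreover have ev: "\<forall>\<^sub>F t in nhds 0. F (c t) = k"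
    using topological_tendstoD[OF cont assms(2,3)] c(3)
    by eventually_elim (use assms(5) in auto)
  then have "((\<lambda>t. F (c t)) has_vector_derivative 0) (at 0)"
    by (subst has_vector_derivative_cong_ev[where g = "\<lambda>_. k"])
      (use eventually_nhds_x_imp_x[OF ev] in \<open>auto elim: eventually_mono\<close>)
  ultimately show ?thesis by (rule vector_derivative_unique_at)
qed

lemma slice_chartD:
  assumes "slice_chart M B U \<phi>"
  shows "B \<subseteq> Basis" "finite B" "open U" "open (\<phi> ` U)" "inj_on \<phi> U" "smooth_on U \<phi>"
    "smooth_on (\<phi> ` U) (inv_into U \<phi>)" "\<phi> ` (U \<inter> span B) = M \<inter> \<phi> ` U"
    "\<And>x. x \<in> U \<Longrightarrow> inv_into U \<phi> (\<phi> x) = x"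
  using assms finite_subset[OF _ finite_Basis] unfolding slice_chart_def by auto

lemma slice_chart_inverse_derivative:
  assumes sc: "slice_chart M B U \<phi>" and u: "u \<in> U"
  shows "frechet_derivative (inv_into U \<phi>) (at (\<phi> u)) (frechet_derivative \<phi> (at u) v) = v"
    and "frechet_derivative \<phi> (at u) (frechet_derivative (inv_into U \<phi>) (at (\<phi> u)) v) = v"
proof -
  note D = slice_chartD[OF sc]
  let ?\<psi> = "inv_into U \<phi>"
  have d\<phi>: "(\<phi> has_derivative frechet_derivative \<phi> (at u)) (at u)"
    using smooth_on_has_derivative[OF D(6) u] .
  have d\<psi>: "(?\<psi> has_derivative frechet_derivative ?\<psi> (at (\<phi> u))) (at (\<phi> u))"
    using smooth_on_has_derivative[OF D(7)] u by blast
  have d\<phi>': "(\<phi> has_derivative frechet_derivative \<phi> (at u)) (at (?\<psi> (\<phi> u)))" using d\<phi> D(9)[OF u] by simp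
  have "((\<lambda>x. ?\<psi> (\<phi> x)) has_derivative (\<lambda>v. v)) (at u)"
    by (rule has_derivative_transform_within_open[OF has_derivative_ident D(3) u]) (simp add: D(9))
  from has_derivative_unique[OF has_derivative_compose[OF d\<phi> d\<psi>] this]
  show "frechet_derivative ?\<psi> (at (\<phi> u)) (frechet_derivative \<phi> (at u) v) = v" by metis
  have "((\<lambda>y. \<phi> (?\<psi> y)) has_derivative (\<lambda>v. v)) (at (\<phi> u))"
    by (rule has_derivative_transform_within_open[OF has_derivative_ident D(4)])
      (use u D(9) in auto)
  from has_derivative_unique[OF has_derivative_compose[OF d\<psi> d\<phi>'] this]
  show "frechet_derivative \<phi> (at u) (frechet_derivative ?\<psi> (at (\<phi> u)) v) = v" by metis
qed

lemma span_pd_chart: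
  assumes sc: "slice_chart M B U \<phi>" and u: "u \<in> U"
  shows "span ((\<lambda>b. pd b \<phi> u) ` B) = frechet_derivative \<phi> (at u) ` span B"
proof -
  have d: "\<phi> differentiable (at u)" using smooth_on_differentiable[OF slice_chartD(6)[OF sc] u] .
  have "(\<lambda>b. pd b \<phi> u) ` B = frechet_derivative \<phi> (at u) ` B" using pd_eq_frechet[OF d] by auto
  then show ?thesis using linear_span_image[OF linear_frechet_derivative[OF d]] by simp
qed

text \<open>Straight lines in the slice give one direction; for the other a curve is pulled back to
  the slice. Since \<open>velocity\<close> refers to no chart, all charts at a point have the same
  tangent vectors.\<close>

lemma slice_chart_velocity:
  assumes sc: "slice_chart M B U \<phi>" and u: "u \<in> U \<inter> span B"
  shows "velocity M (\<phi> u) v \<longleftrightarrow> v \<in> span ((\<lambda>b. pd b \<phi> u) ` B)"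
proof
  note D = slice_chartD[OF sc]
  assume "v \<in> span ((\<lambda>b. pd b \<phi> u) ` B)"
  then obtain \<beta> where \<beta>: "\<beta> \<in> span B" "v = frechet_derivative \<phi> (at u) \<beta>"
    using span_pd_chart[OF sc] u by blast
  have "((\<lambda>t. \<phi> (u + t *\<^sub>R \<beta>)) has_vector_derivative v) (at 0)"
    unfolding \<beta>(2) using has_vector_derivative_line smooth_on_differentiable[OF D(6)] u by blast
  moreover have "\<forall>\<^sub>F t in nhds 0. \<phi> (u + t *\<^sub>R \<beta>) \<in> M"
    using eventually_line_in_slice[OF D(3) u \<beta>(1)] by eventually_elim (use D(8) in blast)
  ultimately show "velocity M (\<phi> u) v"
    unfolding velocity_def by (intro exI[of _ "\<lambda>t. \<phi> (u + t *\<^sub>R \<beta>)"]) auto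
next
  note D = slice_chartD[OF sc]
  let ?\<psi> = "inv_into U \<phi>"
  assume "velocity M (\<phi> u) v"
  then obtain c where c: "c 0 = \<phi> u" "(c has_vector_derivative v) (at 0)" "\<forall>\<^sub>F t in nhds 0. c t \<in> M"
    unfolding velocity_def by blast
  have "isCont c 0" using c(2) has_vector_derivative_continuous by blast
  then have cont: "(c \<longlongrightarrow> \<phi> u) (nhds 0)"
    using c(1) by (metis tendsto_at_iff_tendsto_nhds isCont_def)
  have "\<forall>\<^sub>F t in nhds 0. c t \<in> \<phi> ` U"
    using topological_tendstoD[OF cont D(4)] u by blast
  then have ev: "\<forall>\<^sub>F t in nhds 0. ?\<psi> (c t) \<in> span B"
    using c(3)
  proof eventually_elim
    case (elim t)
    then obtain y where "y \<in> U \<inter> span B" "c t = \<phi> y" using D(8) by blast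
    then show ?case using D(9) by simp
  qed
  have "((\<lambda>t. ?\<psi> (c t)) has_vector_derivative frechet_derivative ?\<psi> (at (\<phi> u)) v) (at 0)"
  proof -
    have F: "(?\<psi> has_derivative frechet_derivative ?\<psi> (at (\<phi> u))) (at (c 0))"
      using smooth_on_has_derivative[OF D(7)] u c(1) by auto
    from has_derivative_compose[OF c(2)[unfolded has_vector_derivative_def] F]
    show ?thesis unfolding has_vector_derivative_def
      using linear_cmul[OF has_derivative_linear[OF F]] by simp
  qed
  from curve_velocity_in_subspace[OF this ev subspace_span]
  have "frechet_derivative ?\<psi> (at (\<phi> u)) v \<in> span B" .
  then show "v \<in> span ((\<lambda>b. pd b \<phi> u) ` B)"
    using span_pd_chart[OF sc] slice_chart_inverse_derivative(2)[OF sc] u by (metis IntD1 image_eqI)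
qed

lemma tangent_space_velocity: "v \<in> tangent_space M p \<Longrightarrow> velocity M p v"
  unfolding tangent_space_def using slice_chart_velocity by blast

text \<open>Two smooth extensions of \<open>F\<close> differ by a map that vanishes on
  \<open>M\<close>, and its derivative kills velocities of curves in \<open>M\<close>; this makes
  the description in \<open>differential\<close> unique.\<close>

lemma differential_eq:
  assumes v: "velocity M p v" and H: "open W" "p \<in> W" "smooth_on W H" "\<And>x. x \<in> W \<inter> M \<Longrightarrow> H x = F x"
  shows "differential M F p v = frechet_derivative H (at p) v"
  unfolding differential_def
proof (rule the_equality)
  show "\<exists>W H'. open W \<and> p \<in> W \<and> smooth_on W H' \<and> (\<forall>x\<in>W \<inter> M. H' x = F x) \<and>
      frechet_derivative H (at p) v = frechet_derivative H' (at p) v"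
    using H by blast
  fix w assume "\<exists>W H'. open W \<and> p \<in> W \<and> smooth_on W H' \<and> (\<forall>x\<in>W \<inter> M. H' x = F x) \<and>
      w = frechet_derivative H' (at p) v"
  then obtain W' H' where H': "open W'" "p \<in> W'" "smooth_on W' H'" "\<And>x. x \<in> W' \<inter> M \<Longrightarrow> H' x = F x"
    and w: "w = frechet_derivative H' (at p) v" by blast
  have d: "(\<lambda>x. H' x - H x) differentiable (at p)"
    using smooth_on_differentiable[OF H(3,2)] smooth_on_differentiable[OF H'(3,2)] by (rule differentiable_diff[rotated])
  have "frechet_derivative (\<lambda>x. H' x - H x) (at p) v = 0"
    by (rule velocity_constant_map[OF v open_Int[OF H(1) H'(1)] _ d, of 0]) (use H H' in auto)
  moreover have "((\<lambda>x. H' x - H x) has_derivative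
      (\<lambda>v. frechet_derivative H' (at p) v - frechet_derivative H (at p) v)) (at p)"
    by (intro has_derivative_diff smooth_on_has_derivative[OF H(3,2)] smooth_on_has_derivative[OF H'(3,2)])
  ultimately show "w = frechet_derivative H (at p) v"
    using w fun_cong[OF frechet_derivative_at, of "\<lambda>x. H' x - H x" _ p v] by fastforce
qed

text \<open>A slice chart wants the slice spanned by standard basis vectors; \<open>T\<close> moves
  an arbitrary subspace into such a position.\<close>

lemma subspace_coordinate_isomorphism:
  fixes S :: "'a::euclidean_space set"
  assumes "subspace S"
  obtains T :: "'a \<Rightarrow> 'a" and B where "linear T" "inj T" "B \<subseteq> Basis" "card B = dim S" "T ` S = span B"
proof -
  obtain b0 where b0: "b0 \<subseteq> S" "independent b0" "span b0 = S" "card b0 = dim S"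
    using basis_subspace_exists[OF assms] by metis
  obtain b1 where b1': "b0 \<subseteq> b1" "b1 \<subseteq> UNIV" "independent b1" "UNIV \<subseteq> span b1"
    by (rule maximal_independent_subset_extend[OF subset_UNIV b0(2)])
  then have b1: "b0 \<subseteq> b1" "independent b1" "span b1 = UNIV" by auto
  have "card b1 = DIM('a)" using dim_eq_card[of b1 UNIV] b1 by simp
  moreover have "finite b1" using b1(2) independent_imp_finite by blast
  ultimately obtain h where h: "bij_betw h b1 (Basis::'a set)"
    using finite_same_card_bij[OF _ finite_Basis] by metis
  obtain T where T: "linear T" "\<And>x. x \<in> b1 \<Longrightarrow> T x = h x"
    using linear_independent_extend[OF b1(2), of h] by blast
  have "T ` b1 = Basis" using T(2) h by (auto simp: bij_betw_def)
  then have "range T = UNIV"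
    using linear_span_image[OF T(1), of b1] b1(3) by (simp add: span_Basis)
  then have inj: "inj T" using linear_surjective_imp_injective[OF T(1)] by blast
  have "T ` S = span (h ` b0)"
    using linear_span_image[OF T(1), of b0] T(2) b0(3) b1(1) by (metis (no_types, lifting) image_cong subsetD)
  moreover have "h ` b0 \<subseteq> Basis" using h b1(1) by (auto simp: bij_betw_def)
  moreover have "card (h ` b0) = dim S"
    using b0(4) card_image h b1(1) by (metis bij_betw_def inj_on_subset)
  ultimately show thesis using that[of T "h ` b0"] T(1) inj by simp
qed

text \<open>The equations of \<open>M\<close> are packed into a map \<open>h\<close> whose values
  lie in the range of a projection \<open>\<pi>\<close> of the same space and whose derivative at
  \<open>z\<close> has the kernel of \<open>\<pi>\<close>. This handles every codimension without a
  separate target space.\<close>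

lemma level_chart:
  fixes h :: "'a::euclidean_space \<Rightarrow> 'a"
  assumes W: "open W" "z \<in> W" and h: "smooth_on W h" and \<pi>: "linear \<pi>" "\<And>v. \<pi> (\<pi> v) = \<pi> v"
    and \<pi>h: "\<And>x. x \<in> W \<Longrightarrow> \<pi> (h x) = h x" and hz: "h z = 0"
    and ker: "\<And>v. \<pi> v = 0 \<Longrightarrow> frechet_derivative h (at z) v = 0"
    and inj: "\<And>v. frechet_derivative h (at z) v = 0 \<Longrightarrow> \<pi> v = 0"
    and M: "\<And>x. x \<in> W \<Longrightarrow> x \<in> M \<longleftrightarrow> h x = 0"
  obtains B U \<phi> where "slice_chart M B U \<phi>" "0 \<in> U" "\<phi> 0 = z" "card B = dim {v. \<pi> v = 0}"
    "span ((\<lambda>b. pd b \<phi> 0) ` B) = {v. \<pi> v = 0}"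
proof -
  have "subspace {v. \<pi> v = 0}" using linear_subspace_kernel[OF \<pi>(1)] .
  then obtain T :: "'a \<Rightarrow> 'a" and B where T: "linear T" "inj T" "B \<subseteq> Basis" "card B = dim {v. \<pi> v = 0}"
    "T ` {v. \<pi> v = 0} = span B"
    by (rule subspace_coordinate_isomorphism)
  have bT: "bounded_linear T" and b\<pi>: "bounded_linear \<pi>" using T(1) \<pi>(1) linear_conv_bounded_linear by blast+
  \<comment> \<open>The part of \<open>x - z\<close> in the kernel of \<open>\<pi>\<close> is kept
    and the complementary part is replaced by \<open>h x\<close>. The derivative at \<open>z\<close>
    is injective, and \<open>h x = 0\<close> means that the image lies in the slice.\<close>
  define \<Phi> where "\<Phi> x = T ((x - z) - \<pi> (x - z) + h x)" for x
  have s\<Phi>: "smooth_on W \<Phi>"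
    unfolding \<Phi>_def[abs_def]
    by (intro smooth_on_linear[OF bT W(1)] smooth_on_add[OF W(1)] smooth_on_diff[OF W(1)]
        smooth_on_linear[OF b\<pi> W(1)] smooth_on_id smooth_on_const h)
  have hdh: "(h has_derivative frechet_derivative h (at z)) (at z)"
    using smooth_on_has_derivative[OF h W(2)] .
  have hd: "(\<Phi> has_derivative (\<lambda>v. T ((v - 0) - \<pi> (v - 0) + frechet_derivative h (at z) v))) (at z)"
    unfolding \<Phi>_def[abs_def]
    by (intro bounded_linear.has_derivative[OF bT] has_derivative_add has_derivative_diff
        bounded_linear.has_derivative[OF b\<pi>] has_derivative_ident has_derivative_const hdh)
  have fd: "frechet_derivative \<Phi> (at z) v = T (v - \<pi> v + frechet_derivative h (at z) v)" for v
    using fun_cong[OF frechet_derivative_at[OF hd], of v] by simp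
  have \<pi>Dh: "\<pi> (frechet_derivative h (at z) v) = frechet_derivative h (at z) v" for v
  proof -
    have "((\<lambda>x. \<pi> (h x)) has_derivative (\<lambda>v. \<pi> (frechet_derivative h (at z) v))) (at z)"
      by (rule bounded_linear.has_derivative[OF b\<pi> hdh])
    then have "(h has_derivative (\<lambda>v. \<pi> (frechet_derivative h (at z) v))) (at z)"
      by (rule has_derivative_transform_within_open[OF _ W]) (rule \<pi>h)
    from has_derivative_unique[OF this hdh] show ?thesis by metis
  qed
  have "v = 0" if "frechet_derivative \<Phi> (at z) v = 0" for v
  proof -
    have 0: "v - \<pi> v + frechet_derivative h (at z) v = 0"
      using that fd T(1,2) linear_injective_0 by metis
    then have "\<pi> (v - \<pi> v + frechet_derivative h (at z) v) = 0" using linear_0[OF \<pi>(1)] by simp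
    then have "frechet_derivative h (at z) v = 0"
      by (simp add: linear_add[OF \<pi>(1)] linear_diff[OF \<pi>(1)] \<pi>(2) \<pi>Dh)
    then show ?thesis using 0 inj by auto
  qed
  then obtain U' V \<psi> where r: "open U'" "U' \<subseteq> W" "z \<in> U'" "open V" "\<Phi> z \<in> V" "homeomorphism U' V \<Phi> \<psi>"
    "smooth_on V \<psi>" "\<And>v. frechet_derivative \<psi> (at (\<Phi> z)) (frechet_derivative \<Phi> (at z) v) = v"
    using smooth_inverse_function[OF W s\<Phi>] by blast
  have z0: "\<Phi> z = 0" using linear_0[OF \<pi>(1)] linear_0[OF T(1)] by (simp add: \<Phi>_def hz)
  have hm: "\<And>x. x \<in> U' \<Longrightarrow> \<psi> (\<Phi> x) = x" "\<Phi> ` U' = V" "\<And>y. y \<in> V \<Longrightarrow> \<Phi> (\<psi> y) = y" "\<psi> ` V = U'"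
    using r(6) unfolding homeomorphism_def by auto
  have injV: "inj_on \<psi> V" using hm(3) by (rule inj_on_inverseI)
  have in_slice: "\<Phi> x \<in> span B \<longleftrightarrow> x \<in> M" if "x \<in> W" for x
  proof -
    have "\<Phi> x \<in> span B \<longleftrightarrow> \<pi> ((x - z) - \<pi> (x - z) + h x) = 0"
      unfolding \<Phi>_def T(5)[symmetric] using T(2) by (auto simp: inj_image_mem_iff)
    also have "\<dots> \<longleftrightarrow> h x = 0"
      by (simp add: linear_add[OF \<pi>(1)] linear_diff[OF \<pi>(1)] \<pi>(2) \<pi>h[OF that])
    finally show ?thesis using M[OF that] by simp
  qed
  have sc: "slice_chart M B V \<psi>"
    unfolding slice_chart_def
  proof (intro conjI)
    show "smooth_on (\<psi> ` V) (inv_into V \<psi>)"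
    proof -
      have "smooth_on U' \<Phi>" by (rule smooth_on_subset[OF s\<Phi> r(2)])
      moreover have "inv_into V \<psi> x = \<Phi> x" if "x \<in> U'" for x
        using that hm injV by (metis image_eqI inv_into_f_f)
      ultimately show ?thesis using smooth_on_cong[OF r(1)] hm(4) by metis
    qed
    show "\<psi> ` (V \<inter> span B) = M \<inter> \<psi> ` V"
    proof (intro equalityI subsetI)
      fix x assume "x \<in> \<psi> ` (V \<inter> span B)"
      then obtain y where y: "y \<in> V" "y \<in> span B" "x = \<psi> y" by blast
      then have "x \<in> U'" "\<Phi> x = y" using hm by auto
      then show "x \<in> M \<inter> \<psi> ` V" using in_slice[of x] y r(2) by auto
    next
      fix x assume x: "x \<in> M \<inter> \<psi> ` V"
      then have "x \<in> U'" using hm by auto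
      then have "\<Phi> x \<in> V \<inter> span B" "\<psi> (\<Phi> x) = x" using in_slice[of x] x r(2) hm by auto
      then show "x \<in> \<psi> ` (V \<inter> span B)" by (metis image_eqI)
    qed
  qed (use T r hm injV in auto)
  have sp: "span ((\<lambda>b. pd b \<psi> 0) ` B) = frechet_derivative \<psi> (at 0) ` span B"
    using span_pd_chart[OF sc] r(5) z0 by simp
  also have "\<dots> = {v. \<pi> v = 0}"
  proof -
    have "frechet_derivative \<psi> (at 0) (T v) = v" if "\<pi> v = 0" for v
      using r(8)[of v] fd[of v] ker[OF that] that z0 by simp
    then show ?thesis unfolding T(5)[symmetric] by force
  qed
  finally show thesis
    using that[OF sc] r(3,5) z0 hm(1) T(4) by metis
qed

lemma tangent_space_level:
  fixes h :: "'a::euclidean_space \<Rightarrow> 'a"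
  assumes W: "open W" "z \<in> W" and h: "smooth_on W h" and \<pi>: "linear \<pi>" "\<And>v. \<pi> (\<pi> v) = \<pi> v"
    and \<pi>h: "\<And>x. x \<in> W \<Longrightarrow> \<pi> (h x) = h x" and hz: "h z = 0"
    and ker: "\<And>v. \<pi> v = 0 \<Longrightarrow> frechet_derivative h (at z) v = 0"
    and inj: "\<And>v. frechet_derivative h (at z) v = 0 \<Longrightarrow> \<pi> v = 0"
    and M: "\<And>x. x \<in> W \<Longrightarrow> x \<in> M \<longleftrightarrow> h x = 0"
  shows "velocity M z v \<longleftrightarrow> \<pi> v = 0" and "v \<in> tangent_space M z \<longleftrightarrow> \<pi> v = 0"
proof -
  obtain B U \<phi> where c: "slice_chart M B U \<phi>" "0 \<in> U" "\<phi> 0 = z"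
    "span ((\<lambda>b. pd b \<phi> 0) ` B) = {v. \<pi> v = 0}"
    using level_chart[OF assms] by metis
  show *: "velocity M z v \<longleftrightarrow> \<pi> v = 0"
    using slice_chart_velocity[OF c(1), of 0 v] c(2-4) by (simp add: span_0)
  have "v \<in> tangent_space M z" if "\<pi> v = 0"
    unfolding tangent_space_def using c that span_0 by fastforce
  then show "v \<in> tangent_space M z \<longleftrightarrow> \<pi> v = 0" using tangent_space_velocity * by blast
qed

section \<open>Dual frames and the gradient in a chart\<close>

lemma span_orthogonal_eq_0:
  fixes v :: "'a::real_inner"
  assumes "v \<in> span S" "\<And>x. x \<in> S \<Longrightarrow> v \<bullet> x = 0"
  shows "v = 0"
proof -
  have "v \<bullet> w = 0" if "w \<in> span S" for w
    using that by (induction rule: span_induct_alt) (auto simp: inner_add_right assms(2))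
  then have "v \<bullet> v = 0" using assms(1) by blast
  then show ?thesis by simp
qed

lemma dual_basis_expansion:
  fixes X Y :: "'b \<Rightarrow> 'a::real_inner"
  assumes "finite B" "\<And>b c. b \<in> B \<Longrightarrow> c \<in> B \<Longrightarrow> Y b \<bullet> X c = (if b = c then 1 else 0)" "v \<in> span (X ` B)"
  shows "(\<Sum>b\<in>B. (Y b \<bullet> v) *\<^sub>R X b) = v"
  using assms(3)
proof (induction rule: span_induct_alt)
  case base
  show ?case by simp
next
  case (step c x y)
  then obtain a where a: "a \<in> B" "x = X a" by blast
  have "(\<Sum>b\<in>B. (Y b \<bullet> x) *\<^sub>R X b) = (\<Sum>b\<in>B. if b = a then X b else 0)"
    by (rule sum.cong) (auto simp: a assms(2))
  also have "\<dots> = x" using a assms(1) by simp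
  finally have 1: "(\<Sum>b\<in>B. (Y b \<bullet> x) *\<^sub>R X b) = x" .
  have "(\<Sum>b\<in>B. (Y b \<bullet> (c *\<^sub>R x + y)) *\<^sub>R X b) = c *\<^sub>R (\<Sum>b\<in>B. (Y b \<bullet> x) *\<^sub>R X b) + (\<Sum>b\<in>B. (Y b \<bullet> y) *\<^sub>R X b)"
    by (simp add: inner_add_right scaleR_add_left sum.distrib scaleR_sum_right)
  then show ?case using 1 step by simp
qed

text \<open>Expansion in the frame shows that the products of the dual vectors invert the Gram
  matrix. For uniqueness, a column of another inverse defines a vector of the span having the same
  products with the frame as a dual vector, hence equal to it.\<close>

lemma metric_inverse_dual:
  fixes X Y :: "'a::euclidean_space \<Rightarrow> 'b::real_inner"
  assumes B: "finite B" and dual: "\<And>b c. b \<in> B \<Longrightarrow> c \<in> B \<Longrightarrow> Y b \<bullet> X c = (if b = c then 1 else 0)"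
    and Ysp: "\<And>b. b \<in> B \<Longrightarrow> Y b \<in> span (X ` B)"
    and G: "\<And>b c. b \<in> B \<Longrightarrow> c \<in> B \<Longrightarrow> G b c u = X b \<bullet> X c"
    and b: "b \<in> B" and c: "c \<in> B"
  shows "metric_inverse B G b c u = Y b \<bullet> Y c"
proof -
  define h0 where "h0 x y = (if x \<in> B \<and> y \<in> B then Y x \<bullet> Y y else 0)" for x y
  have GY: "(\<Sum>z\<in>B. (X x \<bullet> X z) * (Y z \<bullet> w)) = X x \<bullet> w" if "w \<in> span (X ` B)" for x w
    using arg_cong[OF dual_basis_expansion[OF B dual that], of "\<lambda>v. X x \<bullet> v"]
    by (simp add: inner_sum_right mult.commute)
  have "(THE h. (\<forall>x y. x \<notin> B \<or> y \<notin> B \<longrightarrow> h x y = 0) \<and>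
             (\<forall>x\<in>B. \<forall>y\<in>B. (\<Sum>z\<in>B. G x z u * h z y) = (if x = y then 1 else 0))) = h0"
  proof (rule the_equality, intro conjI allI impI ballI)
    fix x y assume "x \<notin> B \<or> y \<notin> B" then show "h0 x y = 0" by (auto simp: h0_def)
  next
    fix x y assume xy: "x \<in> B" "y \<in> B"
    have "(\<Sum>z\<in>B. G x z u * h0 z y) = (\<Sum>z\<in>B. (X x \<bullet> X z) * (Y z \<bullet> Y y))"
      by (rule sum.cong) (auto simp: G xy h0_def)
    also have "\<dots> = X x \<bullet> Y y" by (rule GY[OF Ysp[OF xy(2)]])
    finally show "(\<Sum>z\<in>B. G x z u * h0 z y) = (if x = y then 1 else 0)"
      using dual[OF xy(2,1)] by (auto simp: inner_commute)
  next
    fix h :: "'a \<Rightarrow> 'a \<Rightarrow> real"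
    assume h: "(\<forall>x y. x \<notin> B \<or> y \<notin> B \<longrightarrow> h x y = 0) \<and>
             (\<forall>x\<in>B. \<forall>y\<in>B. (\<Sum>z\<in>B. G x z u * h z y) = (if x = y then 1 else 0))"
    have "h w y = h0 w y" if wy: "w \<in> B" "y \<in> B" for w y
    proof -
      define H where "H = (\<Sum>z\<in>B. h z y *\<^sub>R X z)"
      have "X x \<bullet> H = X x \<bullet> Y y" if x: "x \<in> B" for x
      proof -
        have "X x \<bullet> H = (\<Sum>z\<in>B. G x z u * h z y)"
          unfolding H_def by (simp add: inner_sum_right G x mult.commute)
        then show ?thesis using h x wy dual[OF wy(2) x] by (auto simp: inner_commute)
      qed
      moreover have "H - Y y \<in> span (X ` B)"
        unfolding H_def by (intro span_diff span_sum span_scale Ysp wy span_base) auto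
      ultimately have "H - Y y = 0"
        by (intro span_orthogonal_eq_0[of _ "X ` B"]) (auto simp: inner_commute inner_diff_right inner_diff_left)
      then have "Y w \<bullet> Y y = Y w \<bullet> H" by simp
      also have "\<dots> = (\<Sum>z\<in>B. if z = w then h z y else 0)"
        unfolding H_def inner_sum_right by (rule sum.cong) (auto simp: dual wy)
      also have "\<dots> = h w y" using wy B by simp
      finally show ?thesis by (simp add: h0_def wy)
    qed
    then show "h = h0" using h by (intro ext) (metis h0_def)
  qed
  then show ?thesis unfolding metric_inverse_def using b c by (simp add: h0_def)
qed

text \<open>The differential of the coordinate \<open>b\<close> is represented by an ambient vector
  \<open>Y0 b\<close>; projecting it to the tangent space does not change its products with tangent
  vectors.\<close>

lemma slice_chart_dual:
  assumes sc: "slice_chart M B U \<phi>" and u: "u \<in> U"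
  obtains Y where "\<And>b c. b \<in> B \<Longrightarrow> c \<in> B \<Longrightarrow> Y b \<bullet> pd c \<phi> u = (if b = c then 1 else 0)"
    "\<And>b. b \<in> B \<Longrightarrow> Y b \<in> span ((\<lambda>b. pd b \<phi> u) ` B)"
proof -
  note D = slice_chartD[OF sc]
  define L where "L = frechet_derivative (inv_into U \<phi>) (at (\<phi> u))"
  have linL: "linear L" unfolding L_def
    using has_derivative_linear[OF smooth_on_has_derivative[OF D(7)]] u by blast
  define Y0 where "Y0 b = (\<Sum>i\<in>Basis. (b \<bullet> L i) *\<^sub>R i)" for b
  have Y0: "Y0 b \<bullet> v = b \<bullet> L v" for b v
  proof -
    have "Y0 b \<bullet> v = b \<bullet> (\<Sum>i\<in>Basis. (v \<bullet> i) *\<^sub>R L i)"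
      by (simp add: Y0_def inner_sum_left inner_sum_right mult.commute inner_commute)
    then show ?thesis using bounded_linear_euclidean_sum[OF linL, of v] by simp
  qed
  have pdX: "pd c \<phi> u = frechet_derivative \<phi> (at u) c" for c
    using pd_eq_frechet smooth_on_differentiable[OF D(6) u] by blast
  have Y0X: "Y0 b \<bullet> pd c \<phi> u = (if b = c then 1 else 0)" if "b \<in> B" "c \<in> B" for b c
    using slice_chart_inverse_derivative(1)[OF sc u, of c] that D(1)
    by (auto simp: Y0 pdX L_def inner_Basis subset_iff)
  have "\<exists>y. y \<in> span ((\<lambda>b. pd b \<phi> u) ` B) \<and> (\<forall>w\<in>span ((\<lambda>b. pd b \<phi> u) ` B). (Y0 b - y) \<bullet> w = 0)" for b
  proof -
    obtain y z where yz: "y \<in> span ((\<lambda>b. pd b \<phi> u) ` B)" "\<And>w. w \<in> span ((\<lambda>b. pd b \<phi> u) ` B) \<Longrightarrow> orthogonal z w" "Y0 b = y + z"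
      using orthogonal_subspace_decomp_exists[of "(\<lambda>b. pd b \<phi> u) ` B" "Y0 b"] by metis
    then show ?thesis by (intro exI[of _ y]) (auto simp: orthogonal_def)
  qed
  then obtain Y where Y: "\<And>b. Y b \<in> span ((\<lambda>b. pd b \<phi> u) ` B)"
    "\<And>b w. w \<in> span ((\<lambda>b. pd b \<phi> u) ` B) \<Longrightarrow> (Y0 b - Y b) \<bullet> w = 0" by metis
  have "Y b \<bullet> pd c \<phi> u = (if b = c then 1 else 0)" if "b \<in> B" "c \<in> B" for b c
    using Y(2)[of "pd c \<phi> u" b] Y0X[OF that] that by (simp add: inner_diff_left span_base)
  then show thesis using that Y(1) by blast
qed

text \<open>The equation for the gradient of \<open>f\<close> is given in charts; this turns it into
  an equation for the tangent vector \<open>J\<close> that represents the derivative of an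
  extension.\<close>

lemma grad_norm_sq_chart:
  assumes sc: "slice_chart M B U \<phi>" and u: "u \<in> U \<inter> span B"
    and H: "open W" "\<phi> u \<in> W" "smooth_on W H" "\<And>x. x \<in> W \<inter> M \<Longrightarrow> H x = f x"
    and J: "J \<in> span ((\<lambda>b. pd b \<phi> u) ` B)"
      "\<And>v. v \<in> span ((\<lambda>b. pd b \<phi> u) ` B) \<Longrightarrow> frechet_derivative H (at (\<phi> u)) v = J \<bullet> v"
  shows "grad_norm_sq B (induced_metric \<phi>) (f \<circ> \<phi>) u = J \<bullet> J"
proof -
  note D = slice_chartD[OF sc]
  define X where "X b = pd b \<phi> u" for b
  obtain Y where Y: "\<And>b c. b \<in> B \<Longrightarrow> c \<in> B \<Longrightarrow> Y b \<bullet> X c = (if b = c then 1 else 0)"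
    "\<And>b. b \<in> B \<Longrightarrow> Y b \<in> span (X ` B)"
    using slice_chart_dual[OF sc] u unfolding X_def by (metis IntD1)
  have d\<phi>: "\<phi> differentiable (at u)" using smooth_on_differentiable[OF D(6)] u by blast
  have pdf: "pd b (f \<circ> \<phi>) u = J \<bullet> X b" if b: "b \<in> B" for b
  proof -
    have "isCont \<phi> u" using d\<phi> differentiable_imp_continuous_within by blast
    then have "\<exists>U'. open U' \<and> u \<in> U' \<and> U' \<subseteq> U \<and> \<phi> ` U' \<subseteq> W"
      using H(1,2) D(3) u smooth_on_continuous[OF D(6)]
      by (intro exI[of _ "U \<inter> \<phi> -` W"]) (auto intro: continuous_open_preimage)
    then obtain U' where U': "open U'" "u \<in> U'" "U' \<subseteq> U" "\<phi> ` U' \<subseteq> W" by blast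
    have "pd b (f \<circ> \<phi>) u = pd b (\<lambda>x. H (\<phi> x)) u"
    proof (rule pd_cong_slice[OF U'(1), of u B])
      show "(f \<circ> \<phi>) x = H (\<phi> x)" if x: "x \<in> U' \<inter> span B" for x
      proof -
        have "\<phi> x \<in> M" using x D(8) U'(3) by blast
        then show ?thesis using H(4)[of "\<phi> x"] x U'(4) by auto
      qed
    qed (use U' u b span_base in auto)
    also have "\<dots> = frechet_derivative H (at (\<phi> u)) (X b)"
    proof -
      have "((\<lambda>x. H (\<phi> x)) has_derivative
          (\<lambda>v. frechet_derivative H (at (\<phi> u)) (frechet_derivative \<phi> (at u) v))) (at u)"
        by (rule has_derivative_compose[where f = \<phi> and g = H])
          (use d\<phi> smooth_on_has_derivative[OF H(3,2)] in \<open>simp_all add: frechet_derivative_works[symmetric]\<close>)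
      from frechet_derivative_at[OF this] this show ?thesis
        unfolding X_def using pd_eq_frechet[OF d\<phi>] pd_eq_frechet[of "\<lambda>x. H (\<phi> x)" u b]
        by (metis differentiable_def)
    qed
    also have "\<dots> = J \<bullet> X b" using J(2) b unfolding X_def by (blast intro: span_base)
    finally show ?thesis .
  qed
  have "grad_norm_sq B (induced_metric \<phi>) (f \<circ> \<phi>) u =
      (\<Sum>b\<in>B. \<Sum>c\<in>B. (Y b \<bullet> Y c) * (J \<bullet> X b) * (J \<bullet> X c))"
    unfolding grad_norm_sq_def
    by (intro sum.cong refl arg_cong2[where f = "(*)"] pdf metric_inverse_dual[where X = X] D(2) Y)
      (auto simp: induced_metric_def X_def)
  also have "\<dots> = (\<Sum>b\<in>B. (J \<bullet> X b) *\<^sub>R Y b) \<bullet> (\<Sum>c\<in>B. (J \<bullet> X c) *\<^sub>R Y c)"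
    by (subst sum.swap) (simp add: inner_sum_left inner_sum_right sum_distrib_left sum_distrib_right mult_ac)
  also have "(\<Sum>b\<in>B. (J \<bullet> X b) *\<^sub>R Y b) = J"
  proof -
    have "(\<Sum>b\<in>B. (J \<bullet> X b) *\<^sub>R Y b) - J = 0"
    proof (rule span_orthogonal_eq_0[of _ "X ` B"])
      show "(\<Sum>b\<in>B. (J \<bullet> X b) *\<^sub>R Y b) - J \<in> span (X ` B)"
        using J(1) Y(2) unfolding X_def by (intro span_diff span_sum span_scale) auto
      fix x assume "x \<in> X ` B"
      then obtain c where c: "c \<in> B" "x = X c" by blast
      have "(\<Sum>b\<in>B. (J \<bullet> X b) *\<^sub>R Y b) \<bullet> X c = (\<Sum>b\<in>B. if b = c then J \<bullet> X b else 0)"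
        unfolding inner_sum_left by (rule sum.cong) (auto simp: Y(1) c)
      also have "\<dots> = J \<bullet> X c" using c D(2) by simp
      finally show "((\<Sum>b\<in>B. (J \<bullet> X b) *\<^sub>R Y b) - J) \<bullet> x = 0" by (simp add: inner_diff_left c)
    qed
    then show ?thesis by simp
  qed
  finally show ?thesis .
qed

section \<open>Transnormal functions on the sphere\<close>

lemma gronwall_zero_right:
  fixes y :: "real \<Rightarrow> 'a::real_inner"
  assumes T: "0 \<le> T" and d: "\<And>t. 0 \<le> t \<Longrightarrow> t \<le> T \<Longrightarrow> (y has_vector_derivative y' t) (at t)"
    and b: "\<And>t. 0 \<le> t \<Longrightarrow> t \<le> T \<Longrightarrow> norm (y' t) \<le> K * norm (y t)" and 0: "y 0 = 0"
  shows "y T = 0"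
proof -
  define g where "g t = (y t \<bullet> y t) * exp (- 2 * K * t)" for t
  have dg: "(g has_real_derivative (2 * (y t \<bullet> y' t) - 2 * K * (y t \<bullet> y t)) * exp (- 2 * K * t)) (at t)"
    if "0 \<le> t" "t \<le> T" for t
  proof -
    have "((\<lambda>t. y t \<bullet> y t) has_real_derivative (y t \<bullet> y' t + y' t \<bullet> y t)) (at t)"
      using has_derivative_inner[OF d[OF that, unfolded has_vector_derivative_def] d[OF that, unfolded has_vector_derivative_def]]
      unfolding has_field_derivative_def
      by (rule has_derivative_eq_rhs) (auto simp: algebra_simps)
    moreover have "((\<lambda>t. exp (- 2 * K * t)) has_real_derivative exp (- 2 * K * t) * (- 2 * K)) (at t)"
      by (auto intro!: derivative_eq_intros)
    ultimately show ?thesis unfolding g_def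
      by (auto intro!: derivative_eq_intros simp: inner_commute algebra_simps)
  qed
  have "g T \<le> g 0"
  proof (rule DERIV_nonpos_imp_nonincreasing[OF T])
    fix t assume t: "0 \<le> t" "t \<le> T"
    have "y t \<bullet> y' t \<le> norm (y t) * norm (y' t)" by (rule norm_cauchy_schwarz)
    also have "\<dots> \<le> norm (y t) * (K * norm (y t))" by (intro mult_left_mono b t) auto
    also have "\<dots> = K * (y t \<bullet> y t)" by (simp add: dot_square_norm power2_eq_square)
    finally have "(2 * (y t \<bullet> y' t) - 2 * K * (y t \<bullet> y t)) * exp (- 2 * K * t) \<le> 0"
      by (intro mult_nonpos_nonneg) auto
    then show "\<exists>z. (g has_real_derivative z) (at t) \<and> z \<le> 0" using dg[OF t] by blast
  qed
  then have "(y T \<bullet> y T) * exp (- 2 * K * T) \<le> 0" by (simp add: g_def 0)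
  then have "y T \<bullet> y T \<le> 0" by (simp add: mult_le_0_iff)
  then show ?thesis by (metis inner_ge_zero inner_eq_zero_iff order_antisym)
qed

text \<open>With \<open>K = 0\<close> this is the constancy of a function with derivative zero, and
  with negative \<open>T\<close> it runs backwards; both uses occur.\<close>

lemma gronwall_zero:
  fixes y :: "real \<Rightarrow> 'a::real_inner"
  assumes d: "\<And>t. t \<in> closed_segment 0 T \<Longrightarrow> (y has_vector_derivative y' t) (at t)"
    and b: "\<And>t. t \<in> closed_segment 0 T \<Longrightarrow> norm (y' t) \<le> K * norm (y t)" and 0: "y 0 = 0"
  shows "y T = 0"
proof (cases "0 \<le> T")
  case True
  then show ?thesis
    using gronwall_zero_right[of T y y' K] d b 0 by (auto simp: closed_segment_eq_real_ivl)
next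
  case False
  have "y (- (- T)) = 0"
  proof (rule gronwall_zero_right[where y = "\<lambda>t. y (- t)" and T = "- T" and y' = "\<lambda>t. - y' (- t)" and K = K])
    fix t assume t: "0 \<le> t" "t \<le> - T"
    then have s: "- t \<in> closed_segment 0 T" using False by (auto simp: closed_segment_eq_real_ivl)
    have "((\<lambda>t. - t) has_vector_derivative - 1) (at t)" by (auto intro!: derivative_eq_intros)
    from vector_diff_chain_at[OF this d[OF s]]
    show "((\<lambda>t. y (- t)) has_vector_derivative - y' (- t)) (at t)" by (simp add: o_def)
    show "norm (- y' (- t)) \<le> K * norm (y (- t))" using b[OF s] by simp
  qed (use False 0 in auto)
  then show ?thesis by simp
qed

definition grd :: "('a::euclidean_space \<Rightarrow> real) \<Rightarrow> 'a \<Rightarrow> 'a" where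
  "grd F x = (\<Sum>i\<in>Basis. frechet_derivative F (at x) i *\<^sub>R i)"

lemma grd_inner:
  assumes "F differentiable (at x)"
  shows "grd F x \<bullet> v = frechet_derivative F (at x) v"
  using bounded_linear_euclidean_sum[OF linear_frechet_derivative[OF assms], of v]
  by (simp add: grd_def inner_sum_left inner_sum_right inner_commute[of _ v] mult.commute)

lemma smooth_on_grd: "open U \<Longrightarrow> smooth_on U F \<Longrightarrow> smooth_on U (grd F)"
  unfolding grd_def[abs_def]
  by (intro smooth_on_sum smooth_on_scaleR smooth_on_const smooth_on_frechet_derivative)

text \<open>
  \<open>F\<close> is the extension, constant along rays, of a function on the unit sphere with
  \<open>|grad F|\<^sup>2 = b(F)\<close>; \<open>J\<close> is its gradient and \<open>H\<close> its Hessian.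
\<close>

locale radial_extension =
  fixes F :: "'a::euclidean_space \<Rightarrow> real"
  assumes smF: "smooth_on (- {0}) F"
    and hom: "\<And>r x. r > 0 \<Longrightarrow> x \<noteq> 0 \<Longrightarrow> F (r *\<^sub>R x) = F x"
begin

abbreviation "J \<equiv> grd F"

lemma open_punctured: "open (- {0::'a})" by (simp add: open_Compl)

lemma smJ: "smooth_on (- {0}) J" by (rule smooth_on_grd[OF open_punctured smF])

lemma dF: "x \<noteq> 0 \<Longrightarrow> (F has_derivative (\<lambda>v. J x \<bullet> v)) (at x)"
  using smooth_on_has_derivative[OF smF, of x] grd_inner[OF smooth_on_differentiable[OF smF, of x]] by simp

lemma J_radial: assumes "x \<noteq> 0" shows "J x \<bullet> x = 0"
proof -
  have "velocity {y. F y = F x} x x"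
    unfolding velocity_def
  proof (intro exI[of _ "\<lambda>t. (1 + t) *\<^sub>R x"] conjI)
    show "((\<lambda>t. (1 + t) *\<^sub>R x) has_vector_derivative x) (at 0)"
      by (auto intro!: derivative_eq_intros)
    have "\<forall>\<^sub>F t in nhds 0. t > (-1::real)" using eventually_nhds_in_open[of "{-1<..}" "0::real"] by simp
    then show "\<forall>\<^sub>F t in nhds 0. (1 + t) *\<^sub>R x \<in> {y. F y = F x}"
      by eventually_elim (use hom assms in auto)
  qed auto
  from velocity_constant_map[OF this open_UNIV UNIV_I smooth_on_differentiable[OF smF], of "F x"] assms
  have "frechet_derivative F (at x) x = 0" by auto
  then show ?thesis using grd_inner[OF smooth_on_differentiable[OF smF, of x]] assms by simp
qed

lemma J_hom: assumes "r > 0" "x \<noteq> 0" shows "J (r *\<^sub>R x) = (1 / r) *\<^sub>R J x"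
proof -
  have rx: "r *\<^sub>R x \<noteq> 0" using assms by simp
  have 1: "((\<lambda>y. F (r *\<^sub>R y)) has_derivative (\<lambda>v. J (r *\<^sub>R x) \<bullet> (r *\<^sub>R v))) (at x)"
    by (rule has_derivative_compose[where f = "\<lambda>y. r *\<^sub>R y", OF _ dF[OF rx]])
      (auto intro!: derivative_eq_intros)
  have "((\<lambda>y. F (r *\<^sub>R y)) has_derivative (\<lambda>v. J x \<bullet> v)) (at x)"
    by (rule has_derivative_transform_within_open[OF dF[OF assms(2)] open_punctured])
      (use assms hom in auto)
  from has_derivative_unique[OF 1 this] have "J (r *\<^sub>R x) \<bullet> (r *\<^sub>R v) = J x \<bullet> v" for v by metis
  then have "(r *\<^sub>R J (r *\<^sub>R x)) \<bullet> v = J x \<bullet> v" for v by simp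
  then have "r *\<^sub>R J (r *\<^sub>R x) = J x" by (metis vector_eq_ldot inner_commute)
  then show ?thesis using assms by (metis divide_self_if less_irrefl pth_1 scaleR_one scaleR_scaleR times_divide_eq_left mult.left_neutral)
qed

end

locale transnormal = radial_extension F for F :: "'a::euclidean_space \<Rightarrow> real" +
  fixes b :: "real \<Rightarrow> real"
  assumes smb: "smooth_on UNIV b"
    and eikonal: "\<And>x. norm x = 1 \<Longrightarrow> grd F x \<bullet> grd F x = b (F x)"
begin

definition H where "H x v = frechet_derivative J (at x) v"

definition b' where "b' t = frechet_derivative b (at t) 1"

lemma dJ: "x \<noteq> 0 \<Longrightarrow> (J has_derivative H x) (at x)"
  unfolding H_def[abs_def] using smooth_on_has_derivative[OF smJ, of x] by simp

lemma linH: "x \<noteq> 0 \<Longrightarrow> linear (H x)"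
  using has_derivative_linear[OF dJ] .

lemma smH: "smooth_on (- {0}) (\<lambda>x. H x v)"
  unfolding H_def by (rule smooth_on_frechet_derivative[OF smJ])

lemma db: "(b has_real_derivative b' t) (at t)"
proof -
  have d: "(b has_derivative frechet_derivative b (at t)) (at t)"
    using smooth_on_has_derivative[OF smb] by blast
  have "frechet_derivative b (at t) = (\<lambda>v. b' t * v)"
  proof
    show "frechet_derivative b (at t) v = b' t * v" for v
      unfolding b'_def using linear_cmul[OF has_derivative_linear[OF d], of v 1] by (simp add: mult.commute)
  qed
  then show ?thesis using d unfolding has_field_derivative_def by simp
qed

lemma smb': "smooth_on UNIV b'" unfolding b'_def[abs_def] by (rule smooth_on_frechet_derivative[OF smb])

lemma contb: "continuous_on A b" and contb': "continuous_on A b'"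
  using continuous_on_subset[OF smooth_on_continuous[OF smb]] continuous_on_subset[OF smooth_on_continuous[OF smb']] by auto

lemma contF: "continuous_on (- {0}) F" and contJ: "continuous_on (- {0}) J" and contH: "continuous_on (- {0}) (\<lambda>x. H x v)"
  using smooth_on_continuous smF smJ smH by blast+

lemma Hsym:
  assumes "x \<noteq> 0"
  shows "H x v \<bullet> u = H x u \<bullet> v"
proof -
  have *: "H x v \<bullet> u = frechet_derivative (\<lambda>y. frechet_derivative F (at y) u) (at x) v" for u v
  proof -
    have "((\<lambda>y. J y \<bullet> u) has_derivative (\<lambda>v. H x v \<bullet> u)) (at x)"
      by (intro has_derivative_inner_left dJ assms)
    then have "((\<lambda>y. frechet_derivative F (at y) u) has_derivative (\<lambda>v. H x v \<bullet> u)) (at x)"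
      by (rule has_derivative_transform_within_open[OF _ open_punctured])
        (use assms grd_inner[OF smooth_on_differentiable[OF smF]] in auto)
    from fun_cong[OF frechet_derivative_at[OF this], of v] show ?thesis .
  qed
  show ?thesis unfolding * using second_derivative_symmetric[OF open_punctured _ smF, of x v u] assms by simp
qed

text \<open>The gradient of a function constant along rays has degree \<open>- 1\<close>. The factor
  \<open>x \<bullet> x\<close> compensates for it, so the equation holds on an open set and can be
  differentiated in all directions.\<close>

lemma eikonal_cone: assumes "x \<noteq> 0" shows "(J x \<bullet> J x) * (x \<bullet> x) = b (F x)"
proof -
  define u where "u = (1 / norm x) *\<^sub>R x"
  have u: "norm u = 1" "u \<noteq> 0" "x = norm x *\<^sub>R u" using assms by (auto simp: u_def)
  have "J x = (1 / norm x) *\<^sub>R J u" using J_hom[of "norm x" u] u assms by simp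
  moreover have "F x = F u" using hom[of "norm x" u] u assms by simp
  ultimately show ?thesis
    using eikonal[OF u(1)] assms by (simp add: dot_square_norm power2_eq_square)
qed

lemma eikonal_derivative:
  assumes "x \<noteq> 0"
  shows "2 * (H x (J x) \<bullet> v) * (x \<bullet> x) + 2 * (J x \<bullet> J x) * (x \<bullet> v) = b' (F x) * (J x \<bullet> v)"
proof -
  have 1: "((\<lambda>y. (J y \<bullet> J y) * (y \<bullet> y)) has_derivative
      (\<lambda>v. (J x \<bullet> J x) * (x \<bullet> v + v \<bullet> x) + (J x \<bullet> H x v + H x v \<bullet> J x) * (x \<bullet> x))) (at x)"
    by (intro has_derivative_mult has_derivative_inner dJ assms has_derivative_ident)
  have "((\<lambda>y. b (F y)) has_derivative (\<lambda>v. b' (F x) * (J x \<bullet> v))) (at x)"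
    using has_derivative_compose[OF dF[OF assms] db[unfolded has_field_derivative_def]] .
  then have "((\<lambda>y. (J y \<bullet> J y) * (y \<bullet> y)) has_derivative (\<lambda>v. b' (F x) * (J x \<bullet> v))) (at x)"
    by (rule has_derivative_transform_within_open[OF _ open_punctured]) (use assms eikonal_cone in auto)
  from fun_cong[OF has_derivative_unique[OF 1 this], of v] show ?thesis
    using Hsym[OF assms, of v "J x"] by (simp add: inner_commute algebra_simps)
qed

text \<open>Half the derivative of the eikonal equation, read through the symmetry of
  \<open>H\<close>; the radial term comes from differentiating the factor
  \<open>x \<bullet> x\<close>.\<close>

lemma H_J:
  assumes "norm x = 1"
  shows "H x (J x) = (b' (F x) / 2) *\<^sub>R J x - b (F x) *\<^sub>R x"
proof -
  have x: "x \<noteq> 0" "x \<bullet> x = 1" using assms by (auto simp: dot_square_norm)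
  have "H x (J x) \<bullet> v = ((b' (F x) / 2) *\<^sub>R J x - b (F x) *\<^sub>R x) \<bullet> v" for v
    using eikonal_derivative[OF x(1), of v] eikonal[OF assms] x(2) by (simp add: inner_diff_left)
  then show ?thesis by (metis vector_eq_ldot inner_commute)
qed

section \<open>The unit normal field and its great circles\<close>

definition regular where "regular = {x. x \<noteq> 0 \<and> b (F x) > 0}"

text \<open>On the unit sphere \<open>b (F x)\<close> is the squared length of \<open>J x\<close>,
  so this is the unit normal of the level through \<open>x\<close>; elsewhere its length is
  \<open>1 / norm x\<close>, as \<open>w_cone\<close> shows.\<close>

definition w where "w x = (b (F x)) powr (- 1 / 2) *\<^sub>R J x"

definition W where "W x v = frechet_derivative w (at x) v"

lemma open_regular: "open regular"
proof -
  have "open ((- {0}) \<inter> (\<lambda>x. b (F x)) -` {0<..})"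
    by (rule continuous_open_preimage[OF _ open_punctured open_greaterThan])
      (rule continuous_on_compose2[OF contb contF], auto)
  also have "(- {0}) \<inter> (\<lambda>x. b (F x)) -` {0<..} = regular" by (auto simp: regular_def)
  finally show ?thesis .
qed

lemma smw: "smooth_on regular w"
proof -
  have s: "regular \<subseteq> - {0}" by (auto simp: regular_def)
  have "smooth_on regular (\<lambda>x. b (F x))"
    by (rule smooth_on_compose[OF open_regular open_UNIV smb smooth_on_subset[OF smF s]]) auto
  then show ?thesis
    unfolding w_def[abs_def]
    by (intro smooth_on_scaleR open_regular smooth_on_powr smooth_on_subset[OF smJ s]) (auto simp: regular_def)
qed

lemma w_eq: "b (F x) > 0 \<Longrightarrow> w x = (1 / sqrt (b (F x))) *\<^sub>R J x"
  by (simp add: w_def powr_minus powr_half_sqrt inverse_eq_divide)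

lemma J_eq: "x \<in> regular \<Longrightarrow> J x = sqrt (b (F x)) *\<^sub>R w x"
  by (simp add: w_eq regular_def)

lemma dw: "x \<in> regular \<Longrightarrow> (w has_derivative W x) (at x)"
  unfolding W_def[abs_def] by (rule smooth_on_has_derivative[OF smw])

lemma linW: "x \<in> regular \<Longrightarrow> linear (W x)"
  using has_derivative_linear[OF dw] .

lemma w_unit: "x \<in> regular \<Longrightarrow> norm x = 1 \<Longrightarrow> w x \<bullet> w x = 1"
  using eikonal[of x] by (simp add: w_eq regular_def field_simps)

lemma w_cone: "x \<in> regular \<Longrightarrow> (w x \<bullet> w x) * (x \<bullet> x) = 1"
  using eikonal_cone[of x] by (simp add: w_eq regular_def field_simps)

lemma w_radial: "x \<in> regular \<Longrightarrow> w x \<bullet> x = 0"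
  using J_radial[of x] by (simp add: w_def regular_def)

text \<open>The normalising factor \<open>sqrt (b (F x))\<close> varies only in the direction of
  \<open>w\<close>; hence on vectors orthogonal to \<open>w\<close> the Hessian is this factor times
  the derivative \<open>W\<close> of the normal.\<close>

lemma H_W:
  assumes "x \<in> regular"
  shows "H x v = sqrt (b (F x)) *\<^sub>R W x v + (b' (F x) / 2 * (w x \<bullet> v)) *\<^sub>R w x"
proof -
  have x: "x \<noteq> 0" "b (F x) > 0" using assms by (auto simp: regular_def)
  have "((\<lambda>y. sqrt (b (F y))) has_derivative (\<lambda>v. (b' (F x) * (J x \<bullet> v)) * (inverse (sqrt (b (F x))) / 2))) (at x)"
    using has_derivative_compose[OF has_derivative_compose[OF dF[OF x(1)] db[unfolded has_field_derivative_def]]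
        DERIV_real_sqrt[OF x(2), unfolded has_field_derivative_def]] by (simp add: mult.commute)
  from has_derivative_scaleR[OF this dw[OF assms]]
  have "(J has_derivative (\<lambda>v. sqrt (b (F x)) *\<^sub>R W x v +
      ((b' (F x) * (J x \<bullet> v)) * (inverse (sqrt (b (F x))) / 2)) *\<^sub>R w x)) (at x)"
    by (rule has_derivative_transform_within_open[OF _ open_regular assms]) (simp add: J_eq)
  from fun_cong[OF has_derivative_unique[OF dJ[OF x(1)] this], of v]
  show ?thesis using x(2) by (simp add: J_eq[OF assms] field_simps)
qed

lemma W_sym:
  assumes "x \<in> regular"
  shows "W x v \<bullet> u = W x u \<bullet> v"
proof -
  have x: "x \<noteq> 0" "b (F x) > 0" using assms by (auto simp: regular_def)
  have "sqrt (b (F x)) * (W x v \<bullet> u) = sqrt (b (F x)) * (W x u \<bullet> v)"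
    using Hsym[OF x(1), of v u] unfolding H_W[OF assms] by (simp add: inner_add_left mult_ac)
  then show ?thesis using x(2) by simp
qed

text \<open>Since \<open>W\<close> is symmetric, the derivative of the length relation
  \<open>w_cone\<close> computes \<open>W x (w x)\<close>. The value says that integral curves of
  \<open>w\<close> on the sphere have acceleration \<open>- x\<close>, that is, are great
  circles.\<close>

lemma W_w:
  assumes "x \<in> regular" "norm x = 1"
  shows "W x (w x) = - x"
proof -
  have x: "x \<bullet> x = 1" using assms(2) by (simp add: dot_square_norm)
  have 1: "((\<lambda>y. (w y \<bullet> w y) * (y \<bullet> y)) has_derivative
      (\<lambda>v. (w x \<bullet> w x) * (x \<bullet> v + v \<bullet> x) + (w x \<bullet> W x v + W x v \<bullet> w x) * (x \<bullet> x))) (at x)"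
    by (intro has_derivative_mult has_derivative_inner dw assms has_derivative_ident)
  have "((\<lambda>y. (w y \<bullet> w y) * (y \<bullet> y)) has_derivative (\<lambda>v. 0)) (at x)"
    by (rule has_derivative_transform_within_open[OF has_derivative_const[of 1] open_regular assms(1)]) (simp add: w_cone)
  note D = fun_cong[OF has_derivative_unique[OF 1 this]]
  have "W x (w x) \<bullet> v = (- x) \<bullet> v" for v
    using D[of v] W_sym[OF assms(1), of v "w x"] x w_unit[OF assms] by (simp add: inner_commute)
  then show ?thesis by (metis vector_eq_ldot inner_commute)
qed

lemma W_x:
  assumes "x \<in> regular"
  shows "W x x = - w x"
proof -
  have "((\<lambda>y. w y \<bullet> y) has_derivative (\<lambda>v. w x \<bullet> v + W x v \<bullet> x)) (at x)"
    by (intro has_derivative_inner dw assms has_derivative_ident)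
  moreover have "((\<lambda>y. w y \<bullet> y) has_derivative (\<lambda>v. 0)) (at x)"
    by (rule has_derivative_transform_within_open[OF has_derivative_const[of 0] open_regular assms(1)]) (simp add: w_radial)
  ultimately have "w x \<bullet> v + W x v \<bullet> x = 0" for v using has_derivative_unique by metis
  then have "W x x \<bullet> v = (- w x) \<bullet> v" for v using W_sym[OF assms, of v x] by (simp add: add_eq_0_iff2)
  then show ?thesis by (metis vector_eq_ldot inner_commute)
qed

definition geo where "geo p s = cos s *\<^sub>R p + sin s *\<^sub>R w p"

definition geo' where "geo' p s = - sin s *\<^sub>R p + cos s *\<^sub>R w p"

lemma d_geo: "(geo p has_vector_derivative geo' p s) (at s)"
  unfolding geo_def[abs_def] geo'_def by (auto intro!: derivative_eq_intros)

lemma d_geo': "(geo' p has_vector_derivative - geo p s) (at s)"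
  unfolding geo_def geo'_def[abs_def] by (auto intro!: derivative_eq_intros)

lemma cont_geo: "continuous_on A (geo p)" and cont_geo': "continuous_on A (geo' p)"
  unfolding geo_def[abs_def] geo'_def[abs_def] by (intro continuous_intros)+

lemma geo_orthonormal:
  assumes "p \<in> regular" "norm p = 1"
  shows "geo p s \<bullet> geo p s = 1" "geo' p s \<bullet> geo' p s = 1" "geo p s \<bullet> geo' p s = 0" "norm (geo p s) = 1"
    "norm (geo' p s) = 1" "geo p s \<noteq> 0"
proof -
  have pp: "p \<bullet> p = 1" "w p \<bullet> w p = 1" "w p \<bullet> p = 0" "p \<bullet> w p = 0"
    using assms w_unit w_radial by (auto simp: dot_square_norm inner_commute)
  have cs: "cos s * cos s + sin s * sin s = 1" using sin_cos_squared_add[of s] by (simp add: power2_eq_square)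
  show 1: "geo p s \<bullet> geo p s = 1" "geo' p s \<bullet> geo' p s = 1" "geo p s \<bullet> geo' p s = 0"
    using cs by (auto simp: geo_def geo'_def inner_add_left inner_add_right pp algebra_simps)
  then show "norm (geo p s) = 1" "norm (geo' p s) = 1" by (simp_all add: norm_eq_1)
  then show "geo p s \<noteq> 0" by auto
qed

text \<open>By \<open>W_w\<close> the difference of \<open>w\<close> along the great circle and of
  the velocity of this circle solves the linear equation \<open>y' = - W y\<close> and starts at
  zero.\<close>

lemma geo_is_integral_curve:
  assumes p: "p \<in> regular" "norm p = 1" and s: "\<And>t. t \<in> closed_segment 0 s \<Longrightarrow> geo p t \<in> regular"
  shows "w (geo p s) = geo' p s"
proof -
  define y where "y t = w (geo p t) - geo' p t" for t
  have dy: "(y has_vector_derivative - W (geo p t) (y t)) (at t)" if "t \<in> closed_segment 0 s" for t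
  proof -
    have "((\<lambda>t. w (geo p t)) has_vector_derivative W (geo p t) (geo' p t)) (at t)"
      using has_derivative_compose[OF d_geo[unfolded has_vector_derivative_def] dw[OF s[OF that]]]
        linear_cmul[OF linW[OF s[OF that]]]
      unfolding has_vector_derivative_def by simp
    from has_vector_derivative_diff[OF this d_geo'[of p t]]
    have "(y has_vector_derivative W (geo p t) (geo' p t) - (- geo p t)) (at t)" unfolding y_def .
    moreover have "- W (geo p t) (y t) = W (geo p t) (geo' p t) - (- geo p t)"
      using W_w[OF s[OF that]] geo_orthonormal(4)[OF p] by (simp add: y_def linear_diff[OF linW[OF s[OF that]]])
    ultimately show ?thesis by simp
  qed
  have contW: "continuous_on (closed_segment 0 s) (\<lambda>t. W (geo p t) i)" for i
    by (rule continuous_on_compose2[of regular "\<lambda>x. W x i" _ "geo p", OF _ cont_geo])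
      (use s smooth_on_continuous[OF smooth_on_frechet_derivative[OF smw]] in \<open>auto simp: W_def[abs_def]\<close>)
  have "compact ((\<lambda>t. \<Sum>i\<in>Basis. norm (W (geo p t) i)) ` closed_segment 0 s)"
    by (intro compact_continuous_image continuous_on_sum continuous_on_norm contW) simp
  then obtain K where "\<And>z. z \<in> ((\<lambda>t. \<Sum>i\<in>Basis. norm (W (geo p t) i)) ` closed_segment 0 s) \<Longrightarrow> norm z \<le> K"
    using compact_imp_bounded bounded_iff by metis
  then have K: "(\<Sum>i\<in>Basis. norm (W (geo p t) i)) \<le> K" if "t \<in> closed_segment 0 s" for t
    using that by (metis (no_types, lifting) abs_le_D1 imageI real_norm_def)
  have "y s = 0"
  proof (rule gronwall_zero[where y' = "\<lambda>t. - W (geo p t) (y t)" and K = K])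
    fix t assume t: "t \<in> closed_segment 0 s"
    show "(y has_vector_derivative - W (geo p t) (y t)) (at t)" by (rule dy[OF t])
    have "norm (- W (geo p t) (y t)) = norm (\<Sum>i\<in>Basis. (y t \<bullet> i) *\<^sub>R W (geo p t) i)"
      using bounded_linear_euclidean_sum[OF linW[OF s[OF t]], of "y t"] by simp
    also have "\<dots> \<le> (\<Sum>i\<in>Basis. norm ((y t \<bullet> i) *\<^sub>R W (geo p t) i))" by (rule norm_sum)
    also have "\<dots> \<le> (\<Sum>i\<in>Basis. norm (W (geo p t) i) * norm (y t))"
      by (intro sum_mono) (auto simp: mult.commute intro!: mult_right_mono Basis_le_norm)
    also have "\<dots> \<le> K * norm (y t)"
      unfolding sum_distrib_right[symmetric] by (intro mult_right_mono K t) auto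
    finally show "norm (- W (geo p t) (y t)) \<le> K * norm (y t)" .
  next
    show "y 0 = 0" by (simp add: y_def geo_def geo'_def)
  qed
  then show ?thesis by (simp add: y_def)
qed

lemma neg_grd: assumes "x \<noteq> 0" shows "grd (\<lambda>x. - F x) x = - J x"
proof -
  have "frechet_derivative (\<lambda>x. - F x) (at x) = (\<lambda>v. - (J x \<bullet> v))"
    using frechet_derivative_at[OF has_derivative_minus[OF dF[OF assms]]] by simp
  moreover have "J x \<bullet> i = frechet_derivative F (at x) i" for i
    using grd_inner smooth_on_differentiable[OF smF] assms by auto
  ultimately show ?thesis by (simp add: grd_def sum_negf)
qed

lemma neg_transnormal: "transnormal (\<lambda>x. - F x) (\<lambda>t. b (- t))"
proof
  show "smooth_on (- {0}) (\<lambda>x. - F x)" by (rule smooth_on_minus[OF open_punctured smF])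
  show "smooth_on UNIV (\<lambda>t. b (- t))"
    by (rule smooth_on_compose[OF open_UNIV open_UNIV smb smooth_on_minus[OF open_UNIV smooth_on_id]]) simp
  show "grd (\<lambda>x. - F x) x \<bullet> grd (\<lambda>x. - F x) x = b (- (- F x))" if "norm x = 1" for x
    using neg_grd[of x] eikonal[OF that] that by (cases "x = 0") auto
qed (use hom in auto)

end

section \<open>The distance from a regular level to a focal set\<close>

text \<open>
  The parameter \<open>tp\<close> is the zero of \<open>b\<close> next to \<open>t0\<close>; \<open>b\<close> need not vanish at \<open>tm\<close>. The set \<open>K\<close> consists of
  the principal curvatures of \<open>{F = t0}\<close> for the normal \<open>w\<close>, whose shape operator is \<open>- W p\<close>.
\<close>

locale isoparam = transnormal F b for F :: "'a::euclidean_space \<Rightarrow> real" and b +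
  fixes tm t0 tp :: real and K :: "real set"
  assumes dim3: "3 \<le> DIM('a)"
    and t_order: "tm < t0" "t0 < tp"
    and b_pos: "\<And>t. tm < t \<Longrightarrow> t < tp \<Longrightarrow> b t > 0"
    and b_tp: "b tp = 0"
    and M_ne: "{x. norm x = 1 \<and> F x = t0} \<noteq> {}"
    and M_conn: "connected {x. norm x = 1 \<and> F x = t0}"
    and E_span: "\<And>p X. norm p = 1 \<Longrightarrow> F p = t0 \<Longrightarrow> X \<bullet> p = 0 \<Longrightarrow> X \<bullet> w p = 0 \<Longrightarrow>
      X \<in> span (\<Union>\<kappa>\<in>K. {X. X \<bullet> p = 0 \<and> X \<bullet> w p = 0 \<and> W p X = - \<kappa> *\<^sub>R X})"
    and E_ne: "\<And>p \<kappa>. norm p = 1 \<Longrightarrow> F p = t0 \<Longrightarrow> \<kappa> \<in> K \<Longrightarrow>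
      {X. X \<bullet> p = 0 \<and> X \<bullet> w p = 0 \<and> W p X = - \<kappa> *\<^sub>R X} \<noteq> {0}"
begin

definition M where "M = {x. norm x = 1 \<and> F x = t0}"
definition E where "E p \<kappa> = {X. X \<bullet> p = 0 \<and> X \<bullet> w p = 0 \<and> W p X = - \<kappa> *\<^sub>R X}"
definition \<Omega> where "\<Omega> = {x. norm x = 1 \<and> tm < F x \<and> F x < tp}"
text \<open>The signed distance of \<open>{F = t}\<close> from \<open>M\<close> along the normal geodesics.\<close>

definition L :: "real \<Rightarrow> real" where "L t = (LBINT y=t0..t. 1 / sqrt (b y))"

lemma \<Omega>_regular: "x \<in> \<Omega> \<Longrightarrow> x \<in> regular" and \<Omega>_norm: "x \<in> \<Omega> \<Longrightarrow> norm x = 1"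
  and \<Omega>_F: "x \<in> \<Omega> \<Longrightarrow> tm < F x" "x \<in> \<Omega> \<Longrightarrow> F x < tp" and \<Omega>_ne0: "x \<in> \<Omega> \<Longrightarrow> x \<noteq> 0"
  using b_pos by (auto simp: \<Omega>_def regular_def)

lemma M_\<Omega>: "p \<in> M \<Longrightarrow> p \<in> \<Omega>" using t_order by (auto simp: M_def \<Omega>_def)

lemmas M_regular = \<Omega>_regular[OF M_\<Omega>]

lemma M_norm: "p \<in> M \<Longrightarrow> norm p = 1" by (simp add: M_def)

lemma dL:
  assumes "tm < t" "t < tp"
  shows "(L has_real_derivative 1 / sqrt (b t)) (at t)"
proof -
  obtain a where a: "tm < a" "a < min t t0" using dense[of tm "min t t0"] assms t_order by auto
  obtain e where e: "max t t0 < e" "e < tp" using dense[of "max t t0" tp] assms t_order by auto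
  have c: "continuous_on {a..e} (\<lambda>y. 1 / sqrt (b y))"
  proof (intro continuous_on_divide continuous_on_const continuous_on_real_sqrt contb ballI)
    fix y assume "y \<in> {a..e}"
    then have "b y > 0" using a e by (intro b_pos) auto
    then show "sqrt (b y) \<noteq> 0" by simp
  qed
  have "(L has_vector_derivative 1 / sqrt (b t)) (at t within {a..e})"
    unfolding L_def[abs_def] by (rule interval_integral_FTC2[OF _ _ c]) (use a e in auto)
  then show ?thesis
    using at_within_Icc_at[of a t e] a e by (simp add: has_real_derivative_iff_has_vector_derivative)
qed

lemma L_t0: "L t0 = 0" by (simp add: L_def)

lemma L_mono: assumes "tm < s" "s < t" "t < tp" shows "L s < L t"
proof (rule DERIV_pos_imp_increasing[OF assms(2)])
  fix x assume "s \<le> x" "x \<le> t"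
  then have x: "tm < x" "x < tp" using assms by auto
  show "\<exists>y. (L has_real_derivative y) (at x) \<and> 0 < y"
    using dL[OF x] b_pos[OF x] by (intro exI[of _ "1 / sqrt (b x)"]) auto
qed

lemma L_le_iff: "tm < s \<Longrightarrow> s < tp \<Longrightarrow> tm < t \<Longrightarrow> t < tp \<Longrightarrow> L s \<le> L t \<longleftrightarrow> s \<le> t"
  using L_mono[of s t] L_mono[of t s] by (cases s t rule: linorder_cases) auto

text \<open>Along a normal great circle \<open>F\<close> increases at the rate
  \<open>sqrt (b F)\<close>, while \<open>L\<close> has the derivative
  \<open>1 / sqrt b\<close>.\<close>

lemma geo_L:
  assumes p: "p \<in> \<Omega>" and s: "\<And>t. t \<in> closed_segment 0 s \<Longrightarrow> geo p t \<in> \<Omega>"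
  shows "L (F (geo p s)) = L (F p) + s"
proof -
  define y where "y t = L (F (geo p t)) - L (F p) - t" for t
  have "y s = 0"
  proof (rule gronwall_zero[where y = y and T = s and y' = "\<lambda>t. 0" and K = 0])
    fix t assume t: "t \<in> closed_segment 0 s"
    have "closed_segment 0 t \<subseteq> closed_segment 0 s" using t by (auto simp: closed_segment_eq_real_ivl split: if_splits)
    then have "w (geo p t) = geo' p t"
      using s t by (intro geo_is_integral_curve \<Omega>_regular \<Omega>_norm p) auto
    then have J: "J (geo p t) \<bullet> geo' p t = sqrt (b (F (geo p t)))"
      using J_eq[OF \<Omega>_regular[OF s[OF t]]] geo_orthonormal(2)[OF \<Omega>_regular[OF p] \<Omega>_norm[OF p]] by simp
    have "((\<lambda>t. F (geo p t)) has_real_derivative sqrt (b (F (geo p t)))) (at t)"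
      using has_derivative_compose[OF d_geo[unfolded has_vector_derivative_def] dF[OF \<Omega>_ne0[OF s[OF t]]]] J
      unfolding has_field_derivative_def by (simp add: mult_commute_abs)
    from DERIV_chain2[OF dL[OF \<Omega>_F[OF s[OF t]]] this]
    have "((\<lambda>t. L (F (geo p t))) has_real_derivative 1) (at t)"
      using b_pos[OF \<Omega>_F[OF s[OF t]]] by simp
    then have "(y has_real_derivative 1 - 0 - 1) (at t)"
      unfolding y_def by (intro DERIV_diff DERIV_const DERIV_ident)
    then show "(y has_vector_derivative 0) (at t)"
      by (simp add: has_real_derivative_iff_has_vector_derivative)
  qed (auto simp: y_def geo_def)
  then show ?thesis by (simp add: y_def)
qed

text \<open>Suppose that the arc leaves \<open>\<Omega>\<close>, and consider the first exit. Before
  it \<open>geo_L\<close> confines \<open>F\<close> to the compact interval between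
  \<open>lo\<close> and \<open>hi\<close>, which lies inside the open range; by continuity this
  persists at the exit, a contradiction.\<close>

lemma geo_in_\<Omega>:
  assumes p: "p \<in> \<Omega>" and t1: "tm < t1" "t1 < tp" and t2: "tm < t2" "t2 < tp"
    and s: "L t1 \<le> L (F p) + s" "L (F p) + s \<le> L t2" and t: "t \<in> closed_segment 0 s"
  shows "geo p t \<in> \<Omega>"
proof -
  define lo where "lo = min t1 (F p)"
  define hi where "hi = max t2 (F p)"
  \<comment> \<open>Scaling the parameter to the unit interval treats arcs in both directions
    together.\<close>
  define f where "f \<tau> = F (geo p (\<tau> * s))" for \<tau>
  have n1: "norm (geo p t) = 1" for t using geo_orthonormal(4)[OF \<Omega>_regular[OF p] \<Omega>_norm[OF p]] .
  then have n0: "geo p t \<noteq> 0" for t by (metis norm_zero zero_neq_one)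
  have cf: "continuous_on A f" for A
    unfolding f_def using n0
    by (intro continuous_on_compose2[OF contF] continuous_on_compose2[OF cont_geo] continuous_intros) auto
  have inO: "geo p (\<tau> * s) \<in> \<Omega> \<longleftrightarrow> f \<tau> \<in> {tm<..<tp}" for \<tau> using n1 by (auto simp: \<Omega>_def f_def)
  have "f \<tau> \<in> {tm<..<tp}" if "\<tau> \<in> {0..1}" for \<tau>
  proof (rule ccontr)
    assume neg: "f \<tau> \<notin> {tm<..<tp}"
    define A where "A = {0..1} \<inter> f -` (- {tm<..<tp})"
    have "closed A" unfolding A_def
      by (intro continuous_closed_preimage cf) auto
    moreover have "A \<noteq> {}" using neg that by (auto simp: A_def)
    moreover have bA: "bdd_below A" by (auto simp: A_def intro: bdd_belowI[of _ 0])
    ultimately have "Inf A \<in> A" by (intro closed_contains_Inf)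
    define u where "u = Inf A"
    have u: "u \<in> A" using \<open>Inf A \<in> A\<close> by (simp add: u_def)
    have "f 0 = F p" by (simp add: f_def geo_def)
    then have "u \<noteq> 0" using u \<Omega>_F[OF p] by (auto simp: A_def)
    then have u0: "u > 0" using u by (auto simp: A_def)
    have below: "f v \<in> {lo..hi}" if v: "v \<in> {0..<u}" for v
    proof -
      have inA: "v' \<notin> A" if "v' < u" for v' using that cInf_lower[of v' A, OF _ bA] by (fastforce simp: u_def)
      have *: "geo p t \<in> \<Omega>" if tt: "t \<in> closed_segment 0 (v * s)" for t
      proof (cases "s = 0")
        case True
        then show ?thesis using that p by (simp add: geo_def)
      next
        case False
        obtain z where z: "0 \<le> z" "z \<le> 1" "t = (1 - z) *\<^sub>R 0 + z *\<^sub>R (v * s)"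
          using tt by (auto simp: in_segment)
        then have "t / s = z * v" using False by simp
        then have "t / s \<in> {0..v}" using z v mult_right_mono[of z 1 v] by auto
        then have "t / s \<notin> A" "t / s \<in> {0..1}" using v u inA by (auto simp: A_def)
        then have "f (t / s) \<in> {tm<..<tp}" by (auto simp: A_def)
        then show ?thesis using inO[of "t / s"] False by simp
      qed
      have eq: "L (f v) = L (F p) + v * s" using geo_L[OF p *] by (simp add: f_def)
      have fv: "tm < f v" "f v < tp" using *[of "v * s"] inO[of v] by auto
      have v01: "0 \<le> v" "v \<le> 1" using v u by (auto simp: A_def)
      have lo: "tm < lo" "lo < tp" and hi: "tm < hi" "hi < tp"
        using t1 t2 \<Omega>_F[OF p] by (auto simp: lo_def hi_def)
      have "L lo \<le> L (f v)"
      proof (cases "s \<ge> 0")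
        case True
        then have "L (F p) \<le> L (f v)" using eq v01 by simp
        moreover have "L lo \<le> L (F p)" using L_le_iff[OF lo \<Omega>_F[OF p]] by (simp add: lo_def)
        ultimately show ?thesis by simp
      next
        case False
        then have "v * s \<ge> s" using v01 mult_right_mono_neg[of v 1 s] by simp
        then have "L t1 \<le> L (f v)" using eq s(1) by simp
        moreover have "L lo \<le> L t1" using L_le_iff[OF lo t1] by (simp add: lo_def)
        ultimately show ?thesis by simp
      qed
      moreover have "L (f v) \<le> L hi"
      proof (cases "s \<ge> 0")
        case True
        then have "v * s \<le> s" using v01 mult_right_mono[of v 1 s] by simp
        then have "L (f v) \<le> L t2" using eq s(2) by simp
        moreover have "L t2 \<le> L hi" using L_le_iff[OF t2 hi] by (simp add: hi_def)
        ultimately show ?thesis by simp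
      next
        case False
        then have "L (f v) \<le> L (F p)" using eq v01 by (simp add: mult_nonneg_nonpos)
        moreover have "L (F p) \<le> L hi" using L_le_iff[OF \<Omega>_F[OF p] hi] by (simp add: hi_def)
        ultimately show ?thesis by simp
      qed
      ultimately show ?thesis using L_le_iff[OF lo fv] L_le_iff[OF fv hi] by simp
    qed
    have "closure {0..<u} = {0..u}" using u0 by simp
    then have "f ` {0..u} \<subseteq> {lo..hi}"
      using image_closure_subset[of "{0..<u}" f "{lo..hi}"] cf below by (metis closed_atLeastAtMost image_subsetI)
    then have "f u \<in> {lo..hi}" using u0 subsetD[OF \<open>f ` {0..u} \<subseteq> {lo..hi}\<close> imageI[of u "{0..u}" f]] by simp
    then have "f u \<in> {tm<..<tp}" using t1 t2 \<Omega>_F[OF p] by (auto simp: lo_def hi_def min_def max_def split: if_splits)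
    then show False using u by (auto simp: A_def)
  qed
  moreover obtain \<tau> where "\<tau> \<in> {0..1}" "t = \<tau> * s"
    using t by (auto simp: closed_segment_def)
  ultimately show ?thesis using inO by auto
qed

section \<open>The length \<open>d\<close> and the zero of \<open>b\<close> at
  \<open>tp\<close>\<close>

lemma geo_2pi: "geo p (2 * pi) = p" by (simp add: geo_def)

text \<open>A great circle returns after \<open>2 * pi\<close>, but by \<open>geo_L\<close> the
  value of \<open>L\<close> would have grown by \<open>2 * pi\<close> along it.\<close>

lemma L_bound: assumes "p \<in> \<Omega>" "tm < t" "t < tp" shows "L t < L (F p) + 2 * pi"
proof (rule ccontr)
  assume "\<not> ?thesis"
  then have ge: "L (F p) + 2 * pi \<le> L t" by simp
  have "L (F (geo p (2 * pi))) = L (F p) + 2 * pi"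
    by (rule geo_L[OF assms(1) geo_in_\<Omega>[OF assms(1) \<Omega>_F[OF assms(1)] assms(2,3) _ ge]]) auto
  then show False using geo_2pi by simp
qed

text \<open>\<open>L\<close> increases up to the end \<open>tp\<close>, so its supremum is the
  length at which every normal great circle from \<open>M\<close> arrives at the level
  \<open>tp\<close>.\<close>

definition d where "d = Sup (L ` {tm<..<tp})"

lemma L_bdd: "bdd_above (L ` {tm<..<tp})"
proof -
  obtain p where "p \<in> M" using M_ne by (auto simp: M_def)
  then show ?thesis using L_bound[OF M_\<Omega>] by (intro bdd_aboveI[of _ "L (F p) + 2 * pi"]) (force intro: less_imp_le)
qed

lemma L_less_d: assumes "tm < t" "t < tp" shows "L t < d"
proof -
  obtain u where u: "t < u" "u < tp" using dense assms by blast
  then have "L u \<le> d" unfolding d_def using assms L_bdd by (intro cSup_upper) auto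
  then show ?thesis using L_mono[of t u] u assms by simp
qed

lemma less_d: assumes "s < d" obtains t where "tm < t" "t < tp" "s < L t"
proof -
  have "L ` {tm<..<tp} \<noteq> {}" using t_order by auto
  then show thesis using less_cSupD[of "L ` {tm<..<tp}" s] assms that unfolding d_def by auto
qed

lemma d_pos: "d > 0" using L_less_d[of t0] t_order L_t0 by simp

lemma M_geo:
  assumes p: "p \<in> M" and s: "0 \<le> s" "s < d"
  shows "geo p s \<in> \<Omega>" "L (F (geo p s)) = s" "w (geo p s) = geo' p s"
proof -
  obtain t where t: "tm < t" "t < tp" "s < L t" using less_d[OF s(2)] .
  have L0: "L (F p) = 0" using p L_t0 by (simp add: M_def)
  have *: "geo p u \<in> \<Omega>" if "u \<in> closed_segment 0 s" for u
    by (rule geo_in_\<Omega>[OF M_\<Omega>[OF p] \<Omega>_F[OF M_\<Omega>[OF p]] t(1,2) _ _ that]) (use t s L0 in auto)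
  then show "geo p s \<in> \<Omega>" by simp
  show "L (F (geo p s)) = s" using geo_L[OF M_\<Omega>[OF p] *] L0 by simp
  show "w (geo p s) = geo' p s"
    by (rule geo_is_integral_curve[OF M_regular[OF p] M_norm[OF p]]) (use * \<Omega>_regular in blast)
qed

lemmas M_orthonormal = geo_orthonormal[OF M_regular M_norm]

lemma cont_F_geo: "p \<in> M \<Longrightarrow> continuous_on A (\<lambda>s. F (geo p s))"
  using M_orthonormal(6) by (intro continuous_on_compose2[OF contF cont_geo]) auto

lemma F_geo_d: assumes p: "p \<in> M" shows "F (geo p d) = tp"
proof -
  have cl: "closure {s..<d} = {s..d}" if "s < d" for s using that by simp
  have "(\<lambda>s. F (geo p s)) ` {0..d} \<subseteq> {..tp}"
  proof -
    have "(\<lambda>s. F (geo p s)) ` {0..<d} \<subseteq> {..tp}"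
      using \<Omega>_F(2)[OF M_geo(1)[OF p]] by (auto intro: less_imp_le)
    then show ?thesis
      using image_closure_subset[of "{0..<d}" "\<lambda>s. F (geo p s)" "{..tp}"] cl[OF d_pos] cont_F_geo[OF p] by simp
  qed
  then have le: "F (geo p d) \<le> tp" using d_pos subsetD[OF \<open>(\<lambda>s. F (geo p s)) ` {0..d} \<subseteq> {..tp}\<close> imageI[of d "{0..d}" "\<lambda>s. F (geo p s)"]] by simp
  have "t \<le> F (geo p d)" if t: "t0 < t" "t < tp" for t
  proof -
    have tm: "tm < t" using t t_order by simp
    have Lt: "0 < L t" "L t < d" using L_mono[of t0 t] L_t0 t t_order L_less_d[OF tm t(2)] by auto
    have "t \<le> F (geo p s)" if "s \<in> {L t..<d}" for s
      using M_geo[OF p, of s] that Lt L_le_iff[OF tm t(2), of "F (geo p s)"] \<Omega>_F by auto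
    then have "(\<lambda>s. F (geo p s)) ` {L t..d} \<subseteq> {t..}"
      using image_closure_subset[of "{L t..<d}" "\<lambda>s. F (geo p s)" "{t..}"] cl[OF Lt(2)] cont_F_geo[OF p]
      by force
    then show ?thesis using Lt subsetD[OF \<open>(\<lambda>s. F (geo p s)) ` {L t..d} \<subseteq> {t..}\<close> imageI[of d "{L t..d}" "\<lambda>s. F (geo p s)"]] by simp
  qed
  then have "tp \<le> F (geo p d)" using dense_ge_bounded[OF t_order(2)] dense_le_bounded[OF t_order(2)] by blast
  then show ?thesis using le by simp
qed

text \<open>\<open>H_nu\<close> exhibits \<open>- c\<close> as the eigenvalue of the Hessian in the
  normal directions of the singular level.\<close>

definition c where "c = - b' tp / 2"

lemma norm_J: "norm x = 1 \<Longrightarrow> norm (J x) = sqrt (b (F x))"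
  using eikonal[of x] by (simp add: norm_eq_sqrt_inner)

lemma b_nonneg: "norm x = 1 \<Longrightarrow> b (F x) \<ge> 0"
  using eikonal[of x] by (metis inner_ge_zero)

text \<open>If \<open>b'\<close> vanished at \<open>tp\<close>, then \<open>b t\<close> would be at
  most a multiple of the square of \<open>tp - t\<close>, and along a normal great circle the
  derivative of \<open>tp - F\<close> would be bounded by a multiple of \<open>tp - F\<close>.
  Uniqueness, run backwards from the arrival at \<open>s = d\<close>, would give
  \<open>F = tp\<close> on \<open>M\<close>.\<close>

lemma c_pos: "c > 0"
proof -
  have "b' tp \<le> 0"
  proof (rule ccontr)
    assume "\<not> b' tp \<le> 0"
    then obtain e where e: "e > 0" "\<And>h. 0 < h \<Longrightarrow> h < e \<Longrightarrow> b (tp - h) < b tp"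
      using DERIV_pos_inc_left[OF db[of tp]] by (metis not_le)
    define h where "h = min e (tp - t0) / 2"
    have "0 < h" "h < e" "tm < tp - h" "tp - h < tp" using e t_order by (auto simp: h_def min_def field_simps)
    then show False using e(2)[of h] b_pos[of "tp - h"] b_tp by simp
  qed
  moreover have "b' tp \<noteq> 0"
  proof
    assume b0: "b' tp = 0"
    have db': "(b' has_real_derivative frechet_derivative b' (at t) 1) (at t)" for t
    proof -
      have d: "(b' has_derivative frechet_derivative b' (at t)) (at t)"
        using smooth_on_has_derivative[OF smb'] by blast
      have "frechet_derivative b' (at t) = (\<lambda>v. frechet_derivative b' (at t) 1 * v)"
      proof
        show "frechet_derivative b' (at t) v = frechet_derivative b' (at t) 1 * v" for v
          using linear_cmul[OF has_derivative_linear[OF d], of v 1] by (simp add: mult.commute)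
      qed
      then show ?thesis using d unfolding has_field_derivative_def by simp
    qed
    have "continuous_on {t0..tp} (\<lambda>t. frechet_derivative b' (at t) 1)"
      using smooth_on_continuous[OF smooth_on_frechet_derivative[OF smb']] continuous_on_subset by blast
    then have "compact ((\<lambda>t. frechet_derivative b' (at t) 1) ` {t0..tp})"
      by (intro compact_continuous_image) auto
    then obtain C0 where C0: "\<And>t. t \<in> {t0..tp} \<Longrightarrow> \<bar>frechet_derivative b' (at t) 1\<bar> \<le> C0"
      using compact_imp_bounded bounded_iff by (metis (no_types, lifting) imageI real_norm_def)
    define C where "C = max C0 0"
    have C: "C \<ge> 0" "\<And>t. t \<in> {t0..tp} \<Longrightarrow> \<bar>frechet_derivative b' (at t) 1\<bar> \<le> C"
      using C0 by (auto simp: C_def le_max_iff_disj)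
    have b2: "b t \<le> C * (tp - t)\<^sup>2" if t: "t0 \<le> t" "t < tp" for t
    proof -
      obtain z where z: "t < z" "z < tp" "b tp - b t = (tp - t) * b' z"
        using MVT2[OF t(2), of b b'] db by blast
      obtain y where y: "z < y" "y < tp" "b' tp - b' z = (tp - z) * frechet_derivative b' (at y) 1"
        using MVT2[OF z(2), of b' "\<lambda>t. frechet_derivative b' (at t) 1"] db' by blast
      have "b t = (tp - t) * ((tp - z) * frechet_derivative b' (at y) 1)"
        using z(3) y(3) b0 b_tp by (simp add: algebra_simps)
      also have "\<dots> \<le> (tp - t) * ((tp - z) * \<bar>frechet_derivative b' (at y) 1\<bar>)"
        using z t by (intro mult_left_mono abs_ge_self) auto
      also have "\<dots> \<le> (tp - t) * ((tp - t) * C)"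
        using C(2)[of y] z y t by (intro mult_left_mono mult_mono) auto
      finally show ?thesis by (simp add: power2_eq_square mult_ac)
    qed
    obtain p where p: "p \<in> M" using M_ne by (auto simp: M_def)
    have "tp - F (geo p (d - d)) = 0"
    proof (rule gronwall_zero[where y = "\<lambda>s. tp - F (geo p (d - s))" and T = d and y' = "\<lambda>s. J (geo p (d - s)) \<bullet> geo' p (d - s)" and K = "sqrt C"])
      fix s assume "s \<in> closed_segment 0 d"
      then have s: "0 \<le> s" "s \<le> d" using d_pos by (auto simp: closed_segment_eq_real_ivl)
      have "((\<lambda>s. F (geo p s)) has_vector_derivative J (geo p u) \<bullet> geo' p u) (at u)" for u
        using has_derivative_compose[OF d_geo[unfolded has_vector_derivative_def] dF[OF M_orthonormal(6)[OF p p]]]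
        unfolding has_vector_derivative_def by simp
      moreover have "((\<lambda>s. d - s) has_vector_derivative - 1) (at s)" by (auto intro!: derivative_eq_intros)
      ultimately have "((\<lambda>s. F (geo p (d - s))) has_vector_derivative - (J (geo p (d - s)) \<bullet> geo' p (d - s))) (at s)"
        using vector_diff_chain_at[of "\<lambda>s. d - s" "-1" s "\<lambda>s. F (geo p s)"] by (simp add: o_def)
      from has_vector_derivative_diff[OF has_vector_derivative_const[of tp] this]
      show "((\<lambda>s. tp - F (geo p (d - s))) has_vector_derivative J (geo p (d - s)) \<bullet> geo' p (d - s)) (at s)" by simp
      have n1: "norm (geo p (d - s)) = 1" using M_orthonormal(4)[OF p p] .
      have "norm (J (geo p (d - s)) \<bullet> geo' p (d - s)) \<le> norm (J (geo p (d - s))) * norm (geo' p (d - s))"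
        using Cauchy_Schwarz_ineq2 by auto
      also have "\<dots> = sqrt (b (F (geo p (d - s))))" using norm_J[OF n1] M_orthonormal(5)[OF p p] by simp
      also have "\<dots> \<le> sqrt C * norm (tp - F (geo p (d - s)))"
      proof (cases "s = 0")
        case True
        then show ?thesis using F_geo_d[OF p] b_tp by simp
      next
        case False
        then have "geo p (d - s) \<in> \<Omega>" "L (F (geo p (d - s))) = d - s" using M_geo[OF p, of "d - s"] s by auto
        then have "t0 \<le> F (geo p (d - s))" "F (geo p (d - s)) < tp"
          using L_le_iff[of t0 "F (geo p (d - s))"] L_t0 t_order s \<Omega>_F by auto
        from b2[OF this] this show ?thesis
          by (metis abs_of_pos diff_gt_0_iff_gt real_norm_def real_sqrt_abs real_sqrt_le_mono real_sqrt_mult)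
      qed
      finally show "norm (J (geo p (d - s)) \<bullet> geo' p (d - s)) \<le> sqrt C * norm (tp - F (geo p (d - s)))" .
    qed (use F_geo_d[OF p] in auto)
    then have "tp = F p" by (simp add: geo_def)
    then show False using p t_order by (simp add: M_def)
  qed
  ultimately show ?thesis by (simp add: c_def)
qed

lemma connected_F_sphere: "connected (F ` sphere 0 1)"
proof (rule connected_continuous_image)
  show "continuous_on (sphere 0 1) F" by (rule continuous_on_subset[OF contF]) auto
  show "connected (sphere (0::'a) 1)" using connected_sphere[of "0::'a" 1] dim3 by simp
qed

text \<open>The sign of \<open>b' tp\<close> makes \<open>b\<close> negative just above
  \<open>tp\<close>. If \<open>F\<close> exceeded \<open>tp\<close>, it would take such values,
  since the sphere is connected; but \<open>b (F y)\<close> is a squared length.\<close>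

lemma F_le_tp: assumes "norm x = 1" shows "F x \<le> tp"
proof (rule ccontr)
  assume neg: "\<not> ?thesis"
  have "b' tp < 0" using c_pos by (simp add: c_def)
  then obtain e where e: "e > 0" "\<And>h. 0 < h \<Longrightarrow> h < e \<Longrightarrow> b tp > b (tp + h)"
    using DERIV_neg_dec_right[OF db[of tp]] by blast
  obtain p where p: "p \<in> M" using M_ne by (auto simp: M_def)
  define h where "h = min (e / 2) (F x - tp)"
  have h: "0 < h" "h < e" "tp + h \<le> F x" using e neg by (auto simp: h_def)
  have "tp + h \<in> F ` sphere 0 1"
  proof (rule connectedD_interval[OF connected_F_sphere])
    show "F p \<in> F ` sphere 0 1" "F x \<in> F ` sphere 0 1" using assms M_norm[OF p] by auto
    show "F p \<le> tp + h" "tp + h \<le> F x" using h p t_order by (auto simp: M_def)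
  qed
  then obtain y where y: "norm y = 1" "F y = tp + h" by auto
  then show False using b_nonneg[OF y(1)] e(2)[OF h(1,2)] b_tp by simp
qed

end

section \<open>The Hessian on the focal set\<close>

lemma velocity_transform:
  assumes "velocity M p v" "open V" "p \<in> V" "(G has_derivative D) (at p)" "\<And>x. x \<in> V \<inter> M \<Longrightarrow> G x \<in> N"
  shows "velocity N (G p) (D v)"
proof -
  obtain cv where cv: "cv 0 = p" "(cv has_vector_derivative v) (at 0)" "\<forall>\<^sub>F t in nhds 0. cv t \<in> M"
    using assms(1) unfolding velocity_def by blast
  have "isCont cv 0" using cv(2) has_vector_derivative_continuous by blast
  then have cont: "(cv \<longlongrightarrow> p) (nhds 0)" using cv(1) by (metis tendsto_at_iff_tendsto_nhds isCont_def)
  have G: "(G has_derivative D) (at (cv 0))" using assms(4) cv(1) by simp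
  have "((\<lambda>t. G (cv t)) has_vector_derivative D v) (at 0)"
    using has_derivative_compose[OF cv(2)[unfolded has_vector_derivative_def] G]
    unfolding has_vector_derivative_def using linear_cmul[OF has_derivative_linear[OF G]] by simp
  moreover have "\<forall>\<^sub>F t in nhds 0. G (cv t) \<in> N"
    using topological_tendstoD[OF cont assms(2,3)] cv(3) by eventually_elim (use assms(5) in auto)
  ultimately show ?thesis unfolding velocity_def using cv(1) by (intro exI[of _ "\<lambda>t. G (cv t)"]) auto
qed

text \<open>Equations that hold only along \<open>M\<close>, such as
  \<open>w (geo p s) = geo' p s\<close>, may thus be differentiated in directions tangent to
  \<open>M\<close>.\<close>

lemma velocity_derivative_eq:
  assumes v: "velocity M p v" and V: "open V" "p \<in> V"
    and G: "(G has_derivative D) (at p)" and G': "(G' has_derivative D') (at p)"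
    and eq: "\<And>x. x \<in> V \<inter> M \<Longrightarrow> G x = G' x"
  shows "D v = D' v"
proof -
  have h: "((\<lambda>x. G x - G' x) has_derivative (\<lambda>v. D v - D' v)) (at p)"
    by (intro has_derivative_diff G G')
  have "frechet_derivative (\<lambda>x. G x - G' x) (at p) v = 0"
    by (rule velocity_constant_map[OF v V, of _ 0]) (use h eq in \<open>auto simp: differentiable_def\<close>)
  then show ?thesis using fun_cong[OF frechet_derivative_at[OF h], of v] by simp
qed

context transnormal
begin

lemma H_radial: assumes "x \<noteq> 0" shows "H x x = - J x"
proof -
  have "((\<lambda>y. J y \<bullet> y) has_derivative (\<lambda>v. J x \<bullet> v + H x v \<bullet> x)) (at x)"
    by (intro has_derivative_inner dJ assms has_derivative_ident)
  moreover have "((\<lambda>y. J y \<bullet> y) has_derivative (\<lambda>v. 0)) (at x)"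
    by (rule has_derivative_transform_within_open[OF has_derivative_const[of 0] open_punctured])
      (use J_radial assms in auto)
  ultimately have "J x \<bullet> v + H x v \<bullet> x = 0" for v using has_derivative_unique by metis
  then have "H x x \<bullet> v = (- J x) \<bullet> v" for v using Hsym[OF assms, of v x] by (simp add: add_eq_0_iff2)
  then show ?thesis by (metis vector_eq_ldot inner_commute)
qed

lemma H_expand: "x \<noteq> 0 \<Longrightarrow> H x v = (\<Sum>i\<in>Basis. (v \<bullet> i) *\<^sub>R H x i)"
  by (rule bounded_linear_euclidean_sum[OF linH])

lemma continuous_on_H:
  assumes "continuous_on A f" "continuous_on A g" "\<And>s. s \<in> A \<Longrightarrow> f s \<noteq> 0"
  shows "continuous_on A (\<lambda>s. H (f s) (g s))"
proof -
  have "continuous_on A (\<lambda>s. \<Sum>i\<in>Basis. (g s \<bullet> i) *\<^sub>R H (f s) i)"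
    by (intro continuous_intros assms continuous_on_compose2[OF contH assms(1)]) (use assms(3) in auto)
  then show ?thesis by (subst continuous_on_cong[OF refl H_expand[OF assms(3)]])
qed

definition HH where "HH x v u = frechet_derivative (\<lambda>y. H y u) (at x) v"

lemma d_H_const: "x \<noteq> 0 \<Longrightarrow> ((\<lambda>y. H y u) has_derivative (\<lambda>v. HH x v u)) (at x)"
  unfolding HH_def using smooth_on_has_derivative[OF smH, of x u] by simp

lemma HH_expand: assumes "x \<noteq> 0" shows "HH x v u = (\<Sum>i\<in>Basis. (u \<bullet> i) *\<^sub>R HH x v i)"
proof -
  have "((\<lambda>y. \<Sum>i\<in>Basis. (u \<bullet> i) *\<^sub>R H y i) has_derivative (\<lambda>v. \<Sum>i\<in>Basis. (u \<bullet> i) *\<^sub>R HH x v i)) (at x)"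
    by (intro has_derivative_sum has_derivative_scaleR_right d_H_const assms)
  then have "((\<lambda>y. H y u) has_derivative (\<lambda>v. \<Sum>i\<in>Basis. (u \<bullet> i) *\<^sub>R HH x v i)) (at x)"
    by (rule has_derivative_transform_within_open[OF _ open_punctured]) (use assms in \<open>auto simp: H_expand[symmetric]\<close>)
  from has_derivative_unique[OF d_H_const[OF assms, of u] this] show ?thesis by metis
qed

lemma d_H:
  assumes x: "G p \<noteq> 0" and G: "(G has_derivative D) (at p)" and N: "(N has_derivative D') (at p)"
  shows "((\<lambda>y. H (G y) (N y)) has_derivative (\<lambda>v. HH (G p) (D v) (N p) + H (G p) (D' v))) (at p)"
proof -
  have 1: "((\<lambda>y. \<Sum>i\<in>Basis. (N y \<bullet> i) *\<^sub>R H (G y) i) has_derivative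
      (\<lambda>v. \<Sum>i\<in>Basis. ((N p \<bullet> i) *\<^sub>R HH (G p) (D v) i + (D' v \<bullet> i) *\<^sub>R H (G p) i))) (at p)"
    by (intro has_derivative_sum has_derivative_scaleR has_derivative_inner_left N
        has_derivative_compose[OF G d_H_const[OF x]])
  have ev: "\<forall>\<^sub>F y in nhds p. G y \<noteq> 0"
  proof -
    have "(G \<longlongrightarrow> G p) (nhds p)" using has_derivative_continuous[OF G] tendsto_at_iff_tendsto_nhds isCont_def by metis
    from topological_tendstoD[OF this open_punctured] x show ?thesis by auto
  qed
  have "((\<lambda>y. H (G y) (N y)) has_derivative
      (\<lambda>v. \<Sum>i\<in>Basis. ((N p \<bullet> i) *\<^sub>R HH (G p) (D v) i + (D' v \<bullet> i) *\<^sub>R H (G p) i))) (at p)"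
  proof (rule has_derivative_transform_eventually[OF 1])
    show "\<forall>\<^sub>F y in at p within UNIV. (\<Sum>i\<in>Basis. (N y \<bullet> i) *\<^sub>R H (G y) i) = H (G y) (N y)"
      using ev by (simp add: eventually_nhds_conv_at) (auto elim!: eventually_mono simp: H_expand[symmetric])
  qed (simp_all add: H_expand[OF x, symmetric])
  then show ?thesis by (simp add: sum.distrib HH_expand[OF x, symmetric] H_expand[OF x, symmetric])
qed

lemma level_tangent:
  assumes p: "p \<in> regular" and p1: "norm p = 1"
  defines "M \<equiv> {x. norm x = 1 \<and> F x = F p}"
  shows "velocity M p v \<longleftrightarrow> v \<bullet> p = 0 \<and> v \<bullet> w p = 0"
    and "v \<in> tangent_space M p \<longleftrightarrow> v \<bullet> p = 0 \<and> v \<bullet> w p = 0"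
proof -
  \<comment> \<open>The two scalar equations of the level are placed along the orthonormal vectors
    \<open>p\<close> and \<open>w p\<close>, so that \<open>tangent_space_level\<close> applies with
    the projection onto their span.\<close>
  define h where "h x = ((x \<bullet> x - 1) / 2) *\<^sub>R p + (F x - F p) *\<^sub>R w p" for x
  define \<pi> where "\<pi> v = (v \<bullet> p) *\<^sub>R p + (v \<bullet> w p) *\<^sub>R w p" for v
  have pp: "p \<bullet> p = 1" "w p \<bullet> w p = 1" "w p \<bullet> p = 0" "p \<bullet> w p = 0"
    using p1 w_unit[OF p] w_radial[OF p]
    by (auto simp: dot_square_norm inner_commute)
  have p0: "p \<noteq> 0" using p by (simp add: regular_def)
  have b0: "b (F p) > 0" using p by (simp add: regular_def)
  have ne: "\<pi> v = 0 \<longleftrightarrow> v \<bullet> p = 0 \<and> v \<bullet> w p = 0" for v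
  proof
    assume "\<pi> v = 0"
    then have "\<pi> v \<bullet> p = 0" "\<pi> v \<bullet> w p = 0" by auto
    then show "v \<bullet> p = 0 \<and> v \<bullet> w p = 0" by (simp add: \<pi>_def inner_add_left pp)
  qed (simp add: \<pi>_def)
  have h0: "h x = 0 \<longleftrightarrow> x \<in> M" for x
  proof
    assume "h x = 0"
    then have "h x \<bullet> p = 0" "h x \<bullet> w p = 0" by auto
    then show "x \<in> M" by (simp add: h_def inner_add_left pp M_def norm_eq_1)
  qed (simp add: h_def M_def norm_eq_1)
  have hd: "(h has_derivative (\<lambda>v. (v \<bullet> p) *\<^sub>R p + (sqrt (b (F p)) * (v \<bullet> w p)) *\<^sub>R w p)) (at p)"
  proof -
    have "(h has_derivative (\<lambda>v. (((p \<bullet> v + v \<bullet> p) - 0) / 2) *\<^sub>R p + (J p \<bullet> v - 0) *\<^sub>R w p)) (at p)"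
      unfolding h_def[abs_def]
      by (intro has_derivative_add has_derivative_scaleR_left has_derivative_diff has_derivative_const dF p0
          has_derivative_divide' has_derivative_inner has_derivative_ident bounded_linear.has_derivative[OF bounded_linear_divide])
    then show ?thesis by (simp add: J_eq[OF p] inner_commute)
  qed
  have lev: "open (- {0::'a})" "p \<in> - {0}" "smooth_on (- {0}) h" "linear \<pi>" "\<And>v. \<pi> (\<pi> v) = \<pi> v"
    "\<And>x. x \<in> - {0} \<Longrightarrow> \<pi> (h x) = h x" "h p = 0" "\<And>v. \<pi> v = 0 \<Longrightarrow> frechet_derivative h (at p) v = 0"
    "\<And>v. frechet_derivative h (at p) v = 0 \<Longrightarrow> \<pi> v = 0" "\<And>x. x \<in> - {0} \<Longrightarrow> x \<in> M \<longleftrightarrow> h x = 0"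
  proof -
    show "open (- {0::'a})" "p \<in> - {0}" using open_punctured p0 by auto
    show "smooth_on (- {0}) h"
      unfolding h_def[abs_def] divide_inverse
      by (intro smooth_on_add smooth_on_scaleR smooth_on_const smooth_on_diff smF open_punctured smooth_on_mult
        smooth_on_inner smooth_on_id)
    show "linear \<pi>" unfolding \<pi>_def by (intro linearI) (auto simp: inner_add_left scaleR_add_left scaleR_add_right)
    show "\<pi> (\<pi> v) = \<pi> v" for v by (simp add: \<pi>_def inner_add_left pp)
    show "\<pi> (h x) = h x" for x by (simp add: \<pi>_def h_def inner_add_left pp)
    show "h p = 0" by (simp add: h_def pp)
    have fd: "frechet_derivative h (at p) v = (v \<bullet> p) *\<^sub>R p + (sqrt (b (F p)) * (v \<bullet> w p)) *\<^sub>R w p" for v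
      using fun_cong[OF frechet_derivative_at[OF hd], of v] by simp
    show "frechet_derivative h (at p) v = 0" if "\<pi> v = 0" for v using that by (simp add: fd ne)
    show "\<pi> v = 0" if "frechet_derivative h (at p) v = 0" for v
    proof -
      have "frechet_derivative h (at p) v \<bullet> p = 0" "frechet_derivative h (at p) v \<bullet> w p = 0" using that by auto
      then show ?thesis using b0 by (simp add: fd ne inner_add_left pp)
    qed
    show "x \<in> M \<longleftrightarrow> h x = 0" for x using h0 by simp
  qed
  show "velocity M p v \<longleftrightarrow> v \<bullet> p = 0 \<and> v \<bullet> w p = 0" "v \<in> tangent_space M p \<longleftrightarrow> v \<bullet> p = 0 \<and> v \<bullet> w p = 0"
    using tangent_space_level[OF lev, of v] ne by auto
qed

lemma d_geo_base:
  assumes "p \<in> regular"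
  shows "((\<lambda>x. geo x s) has_derivative (\<lambda>v. cos s *\<^sub>R v + sin s *\<^sub>R W p v)) (at p)"
    and "((\<lambda>x. geo' x s) has_derivative (\<lambda>v. - sin s *\<^sub>R v + cos s *\<^sub>R W p v)) (at p)"
  unfolding geo_def geo'_def
  by (intro has_derivative_add has_derivative_scaleR_right dw assms has_derivative_ident)+

end

context isoparam
begin

lemma M_level:
  assumes p: "p \<in> M"
  shows "velocity M p v \<longleftrightarrow> v \<bullet> p = 0 \<and> v \<bullet> w p = 0"
  using level_tangent(1)[OF M_regular[OF p] M_norm[OF p], of v] p by (simp add: M_def)

lemma E_D: "X \<in> E p \<kappa> \<Longrightarrow> X \<bullet> p = 0" "X \<in> E p \<kappa> \<Longrightarrow> X \<bullet> w p = 0" "X \<in> E p \<kappa> \<Longrightarrow> W p X = - \<kappa> *\<^sub>R X"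
  by (auto simp: E_def)

lemma E_geo: "X \<in> E p \<kappa> \<Longrightarrow> X \<bullet> geo p s = 0" "X \<in> E p \<kappa> \<Longrightarrow> X \<bullet> geo' p s = 0"
  by (auto simp: geo_def geo'_def inner_add_right inner_diff_right E_D)

text \<open>Derivative of \<open>w (geo p s) = geo' p s\<close> in the base point, in the direction
  \<open>X\<close>. As \<open>X\<close> is an eigenvector of \<open>W p\<close>, the variations of
  \<open>geo\<close> and \<open>geo'\<close> remain multiples of the fixed vector \<open>X\<close>;
  the factor \<open>cos s - \<kappa> * sin s\<close> is that of the Jacobi field.\<close>

lemma jacobi_field:
  assumes p: "p \<in> M" and X: "X \<in> E p \<kappa>" and s: "0 \<le> s" "s < d"
  shows "(cos s - \<kappa> * sin s) *\<^sub>R W (geo p s) X = - (sin s + \<kappa> * cos s) *\<^sub>R X"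
proof -
  have v: "velocity M p X" using M_level[OF p] E_D[OF X] by blast
  note r = M_regular[OF p]
  have gr: "geo p s \<in> regular" using M_geo(1)[OF p s] \<Omega>_regular by blast
  have "W (geo p s) (cos s *\<^sub>R X + sin s *\<^sub>R W p X) = - sin s *\<^sub>R X + cos s *\<^sub>R W p X"
    by (rule velocity_derivative_eq[OF v open_UNIV UNIV_I
        has_derivative_compose[OF d_geo_base(1)[OF r, of s] dw[OF gr]] d_geo_base(2)[OF r, of s]])
      (use M_geo(3) s in auto)
  moreover have "cos s *\<^sub>R X + sin s *\<^sub>R W p X = (cos s - \<kappa> * sin s) *\<^sub>R X"
    by (simp add: E_D[OF X] algebra_simps)
  moreover have "- sin s *\<^sub>R X + cos s *\<^sub>R W p X = - (sin s + \<kappa> * cos s) *\<^sub>R X"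
    by (simp add: E_D[OF X] algebra_simps)
  ultimately show ?thesis using linear_cmul[OF linW[OF gr]] by simp
qed

lemma E_nontrivial:
  assumes "p \<in> M" "\<kappa> \<in> K" obtains X where "X \<in> E p \<kappa>" "X \<noteq> 0"
proof -
  have "E p \<kappa> \<noteq> {0}" using E_ne[of p \<kappa>] assms by (simp add: E_def M_def)
  moreover have "0 \<in> E p \<kappa>" using linear_0[OF linW[OF M_regular[OF assms(1)]]] by (simp add: E_def)
  ultimately show thesis using that by blast
qed

text \<open>Where the Jacobi field vanishes, \<open>jacobi_field\<close> makes its derivative vanish
  as well, which the relation between sine and cosine excludes.\<close>

lemma no_focal_before:
  assumes "\<kappa> \<in> K" "0 \<le> s" "s < d"
  shows "cos s \<noteq> \<kappa> * sin s"
proof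
  assume eq: "cos s = \<kappa> * sin s"
  obtain p where p: "p \<in> M" using M_ne by (auto simp: M_def)
  obtain X where X: "X \<in> E p \<kappa>" "X \<noteq> 0" using E_nontrivial[OF p assms(1)] .
  have z: "sin s + \<kappa> * cos s = 0" using jacobi_field[OF p X(1) assms(2,3)] eq X(2) by simp
  have "cos s * cos s + sin s * sin s = (cos s - \<kappa> * sin s) * cos s + (sin s + \<kappa> * cos s) * sin s"
    by (simp add: algebra_simps)
  also have "\<dots> = 0" using z eq by simp
  finally show False using sin_cos_squared_add[of s] by (simp add: power2_eq_square)
qed

section \<open>Eigenvectors of the Hessian at a focal point\<close>

abbreviation "foc p \<equiv> geo p d"
abbreviation "nu p \<equiv> geo' p d"

definition \<Sigma> where "\<Sigma> = {x. norm x = 1 \<and> F x = tp}"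

lemma foc_\<Sigma>: "p \<in> M \<Longrightarrow> foc p \<in> \<Sigma>"
  using F_geo_d M_orthonormal(4) by (simp add: \<Sigma>_def)

lemma \<Sigma>_norm: "q \<in> \<Sigma> \<Longrightarrow> norm q = 1" and \<Sigma>_ne0: "q \<in> \<Sigma> \<Longrightarrow> q \<noteq> 0" and \<Sigma>_F: "q \<in> \<Sigma> \<Longrightarrow> F q = tp"
  by (auto simp: \<Sigma>_def)

lemma J_\<Sigma>: "q \<in> \<Sigma> \<Longrightarrow> J q = 0"
  using norm_J[of q] b_tp by (simp add: \<Sigma>_def)

lemma continuous_zero_at_d:
  fixes f :: "real \<Rightarrow> 'b::real_normed_vector"
  assumes "continuous_on {0..d} f" "\<And>s. 0 \<le> s \<Longrightarrow> s < d \<Longrightarrow> f s = 0"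
  shows "f d = 0"
proof -
  have cl: "closure {0..<d} = {0..d}" using d_pos by simp
  have "f ` {0..d} \<subseteq> {0}"
    using image_closure_subset[of "{0..<d}" f "{0}"] cl assms by auto
  from subsetD[OF this imageI[of d "{0..d}" f]] show ?thesis using d_pos by simp
qed

text \<open>On the regular part \<open>H_J\<close>, divided by the length of \<open>J\<close>,
  expresses \<open>H\<close> at \<open>geo p s\<close> on \<open>geo' p s\<close> by
  \<open>b' / 2\<close> times \<open>geo' p s\<close> minus \<open>sqrt b\<close> times
  \<open>geo p s\<close>. Everything is continuous up to \<open>s = d\<close>, where
  \<open>b = 0\<close>.\<close>

lemma H_nu: assumes p: "p \<in> M" shows "H (foc p) (nu p) = - c *\<^sub>R nu p"
proof -
  define f where "f s = H (geo p s) (geo' p s) - (b' (F (geo p s)) / 2) *\<^sub>R geo' p s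
      + sqrt (b (F (geo p s))) *\<^sub>R geo p s" for s
  have "f d = 0"
  proof (rule continuous_zero_at_d)
    show "continuous_on {0..d} f"
      unfolding f_def
      by (intro continuous_intros continuous_on_H cont_geo cont_geo' cont_F_geo[OF p] M_orthonormal(6)[OF p p]
          continuous_on_compose2[OF contb cont_F_geo[OF p]] continuous_on_compose2[OF contb' cont_F_geo[OF p]]) auto
    fix s assume s: "0 \<le> s" "s < d"
    note g = M_geo[OF p s]
    have b0: "b (F (geo p s)) > 0" using \<Omega>_regular[OF g(1)] by (simp add: regular_def)
    have n0: "geo p s \<noteq> 0" using M_orthonormal(6)[OF p p] .
    have J: "J (geo p s) = sqrt (b (F (geo p s))) *\<^sub>R geo' p s" using J_eq[OF \<Omega>_regular[OF g(1)]] g(3) by simp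
    have "sqrt (b (F (geo p s))) *\<^sub>R H (geo p s) (geo' p s) =
        sqrt (b (F (geo p s))) *\<^sub>R ((b' (F (geo p s)) / 2) *\<^sub>R geo' p s - sqrt (b (F (geo p s))) *\<^sub>R geo p s)"
      using H_J[OF \<Omega>_norm[OF g(1)]] b0 unfolding J linear_cmul[OF linH[OF n0]]
      by (simp add: scaleR_diff_right mult.commute)
    then show "f s = 0" using b0 unfolding f_def by simp
  qed
  then show ?thesis using F_geo_d[OF p] b_tp by (simp add: f_def c_def)
qed

lemma H_jacobi:
  assumes p: "p \<in> M" and X: "X \<in> E p \<kappa>" and s: "0 \<le> s" "s < d"
  shows "(cos s - \<kappa> * sin s) *\<^sub>R H (geo p s) X = - (sqrt (b (F (geo p s))) * (sin s + \<kappa> * cos s)) *\<^sub>R X"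
proof -
  note g = M_geo[OF p s]
  have "H (geo p s) X = sqrt (b (F (geo p s))) *\<^sub>R W (geo p s) X"
    using H_W[OF \<Omega>_regular[OF g(1)], of X] E_geo[OF X, of s] g(3) by (simp add: inner_commute)
  then have "(cos s - \<kappa> * sin s) *\<^sub>R H (geo p s) X =
      sqrt (b (F (geo p s))) *\<^sub>R ((cos s - \<kappa> * sin s) *\<^sub>R W (geo p s) X)" by (simp add: mult.commute)
  then show ?thesis unfolding jacobi_field[OF assms] by (simp add: algebra_simps)
qed

lemma H_E_regular:
  assumes p: "p \<in> M" and X: "X \<in> E p \<kappa>" and \<kappa>: "cos d \<noteq> \<kappa> * sin d"
  shows "H (foc p) X = 0"
proof -
  define f where "f s = (cos s - \<kappa> * sin s) *\<^sub>R H (geo p s) X + (sqrt (b (F (geo p s))) * (sin s + \<kappa> * cos s)) *\<^sub>R X" for s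
  have "f d = 0"
  proof (rule continuous_zero_at_d)
    show "continuous_on {0..d} f"
      unfolding f_def
      by (intro continuous_intros continuous_on_H cont_geo cont_F_geo[OF p] M_orthonormal(6)[OF p p]
          continuous_on_compose2[OF contb cont_F_geo[OF p]]) auto
    show "f s = 0" if "0 \<le> s" "s < d" for s unfolding f_def H_jacobi[OF p X that] by simp
  qed
  then show ?thesis using F_geo_d[OF p] b_tp \<kappa> by (simp add: f_def)
qed

text \<open>At \<open>s = d\<close> the equation \<open>H_jacobi\<close> degenerates to
  \<open>0 = 0\<close>. Dividing by \<open>s - d\<close> before the limit replaces both vanishing
  factors by their derivatives, and \<open>k0 \<noteq> 0\<close> leaves the eigenvalue
  \<open>- c\<close>: directions in which the focal map collapses become normal.\<close>

lemma H_E_focal: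
  assumes p: "p \<in> M" and X: "X \<in> E p \<kappa>" and \<kappa>: "cos d = \<kappa> * sin d"
  shows "H (foc p) X = - c *\<^sub>R X"
proof -
  define k0 where "k0 = sin d + \<kappa> * cos d"
  have k0: "k0 \<noteq> 0"
  proof
    assume "k0 = 0"
    have "cos d * cos d + sin d * sin d = (cos d - \<kappa> * sin d) * cos d + k0 * sin d"
      by (simp add: k0_def algebra_simps)
    also have "\<dots> = 0" using \<open>k0 = 0\<close> \<kappa> by simp
    finally show False using sin_cos_squared_add[of d] by (simp add: power2_eq_square)
  qed
  define G where "G s = J (geo p s) \<bullet> geo' p s" for s
  define A where "A s = cos s - \<kappa> * sin s" for s
  have n0: "geo p s \<noteq> 0" for s using M_orthonormal(6)[OF p p] .
  have Jd: "J (geo p d) = 0" using J_\<Sigma>[OF foc_\<Sigma>[OF p]] .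
  have dG: "(G has_real_derivative - c) (at d)"
  proof -
    have 1: "((\<lambda>s. J (geo p s)) has_vector_derivative H (foc p) (nu p)) (at d)"
      using has_derivative_compose[OF d_geo[unfolded has_vector_derivative_def] dJ[OF n0]]
        linear_cmul[OF linH[OF n0]] unfolding has_vector_derivative_def by simp
    have "(G has_derivative (\<lambda>h. J (geo p d) \<bullet> (h *\<^sub>R - geo p d) + (h *\<^sub>R H (foc p) (nu p)) \<bullet> geo' p d)) (at d)"
      unfolding G_def
      by (intro has_derivative_inner 1[unfolded has_vector_derivative_def] d_geo'[unfolded has_vector_derivative_def])
    then show ?thesis unfolding has_field_derivative_def
      by (rule has_derivative_eq_rhs) (auto simp: Jd H_nu[OF p] M_orthonormal(2)[OF p p])
  qed
  have dA: "(A has_real_derivative - k0) (at d)"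
    unfolding A_def k0_def by (auto intro!: derivative_eq_intros)
  have eqn: "A s *\<^sub>R H (geo p s) X = - (G s * (sin s + \<kappa> * cos s)) *\<^sub>R X" if "0 \<le> s" "s < d" for s
  proof -
    note g = M_geo[OF p that]
    have "G s = sqrt (b (F (geo p s)))"
      unfolding G_def using J_eq[OF \<Omega>_regular[OF g(1)]] g(3) M_orthonormal(2)[OF p p] by simp
    then show ?thesis using H_jacobi[OF p X that] by (simp add: A_def)
  qed
  have limA: "((\<lambda>s. A s / (s - d)) \<longlongrightarrow> - k0) (at_left d)"
    using dA \<kappa> unfolding has_field_derivative_iff by (auto simp: A_def intro: tendsto_mono[OF at_le])
  have Gd: "G d = 0" by (simp add: G_def Jd)
  have limG: "((\<lambda>s. G s / (s - d)) \<longlongrightarrow> - c) (at_left d)"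
    using dG Gd unfolding has_field_derivative_iff by (auto intro: tendsto_mono[OF at_le])
  have "continuous_on UNIV (\<lambda>s. H (geo p s) X)"
    by (intro continuous_on_H cont_geo continuous_on_const n0)
  then have limH: "((\<lambda>s. H (geo p s) X) \<longlongrightarrow> H (foc p) X) (at_left d)"
    by (auto simp: continuous_on_def intro: tendsto_mono[OF at_le])
  have lims: "((\<lambda>s. sin s + \<kappa> * cos s) \<longlongrightarrow> k0) (at_left d)"
    unfolding k0_def by (intro tendsto_intros)
  have l1: "((\<lambda>s. (A s / (s - d)) *\<^sub>R H (geo p s) X) \<longlongrightarrow> (- k0) *\<^sub>R H (foc p) X) (at_left d)"
    by (intro tendsto_scaleR limA limH)
  have l2: "((\<lambda>s. (- (G s / (s - d) * (sin s + \<kappa> * cos s))) *\<^sub>R X) \<longlongrightarrow> (- (- c * k0)) *\<^sub>R X) (at_left d)"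
    by (intro tendsto_scaleR tendsto_minus tendsto_mult limG lims tendsto_const)
  have "\<forall>\<^sub>F s in at_left d. s \<in> {0<..<d}" using d_pos by (intro eventually_at_leftI) auto
  then have "\<forall>\<^sub>F s in at_left d. (A s / (s - d)) *\<^sub>R H (geo p s) X = (- (G s / (s - d) * (sin s + \<kappa> * cos s))) *\<^sub>R X"
  proof eventually_elim
    case (elim s)
    then have "(1 / (s - d)) *\<^sub>R (A s *\<^sub>R H (geo p s) X) = (1 / (s - d)) *\<^sub>R (- (G s * (sin s + \<kappa> * cos s)) *\<^sub>R X)"
      using eqn[of s] by simp
    then show ?case by simp
  qed
  from Lim_transform_eventually[OF l1 this]
  have "(- k0) *\<^sub>R H (foc p) X = (- (- c * k0)) *\<^sub>R X"
    by (rule tendsto_unique[OF trivial_limit_at_left_real _ l2])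
  then have "k0 *\<^sub>R (H (foc p) X + c *\<^sub>R X) = 0" by (simp add: scaleR_add_right add_eq_0_iff mult.commute)
  then show ?thesis using k0 by (simp add: add_eq_0_iff2)
qed

section \<open>Reaching all points and all unit normals of the singular level\<close>

lemma geo_backwards:
  assumes x: "x \<in> \<Omega>"
  defines "r \<equiv> L (F x)"
  shows "geo x (- r) \<in> M" "w (geo x (- r)) = geo' x (- r)" "geo (geo x (- r)) r = x" "geo' (geo x (- r)) r = w x"
proof -
  have t0: "tm < t0" "t0 < tp" using t_order by auto
  have *: "geo x t \<in> \<Omega>" if "t \<in> closed_segment 0 (- r)" for t
    by (rule geo_in_\<Omega>[OF x t0 t0 _ _ that]) (simp_all add: r_def L_t0)
  have e: "geo x (- r) \<in> \<Omega>" using * by simp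
  have "L (F (geo x (- r))) = L t0" using geo_L[OF x *] by (simp add: r_def L_t0)
  then have "F (geo x (- r)) = t0"
    using L_le_iff[OF \<Omega>_F[OF e] t0] L_le_iff[OF t0 \<Omega>_F[OF e]] by auto
  then show "geo x (- r) \<in> M" using \<Omega>_norm[OF e] by (simp add: M_def)
  show 1: "w (geo x (- r)) = geo' x (- r)"
    by (rule geo_is_integral_curve[OF \<Omega>_regular[OF x] \<Omega>_norm[OF x]]) (use * \<Omega>_regular in blast)
  have cs: "cos r * cos r + sin r * sin r = 1" using sin_cos_squared_add[of r] by (simp add: power2_eq_square)
  have a: "(cos r * cos r) *\<^sub>R v + (sin r * sin r) *\<^sub>R v = v" "(sin r * sin r) *\<^sub>R v + (cos r * cos r) *\<^sub>R v = v" for v :: 'a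
    using cs by (simp_all add: scaleR_add_left[symmetric] add.commute)
  show "geo (geo x (- r)) r = x" "geo' (geo x (- r)) r = w x"
    using a unfolding geo_def[of "geo x (- r)"] geo'_def[of "geo x (- r)"] 1
    by (auto simp: geo_def geo'_def scaleR_add_right scaleR_diff_right algebra_simps)
qed

lemma closed_M: "closed M"
proof -
  have "closed (sphere 0 1 \<inter> F -` {t0})"
    by (rule continuous_closed_preimage[OF continuous_on_subset[OF contF]]) auto
  also have "sphere 0 1 \<inter> F -` {t0} = M" by (auto simp: M_def)
  finally show ?thesis .
qed

lemma compact_M: "compact M"
  using closed_M by (rule compact_Int_closed[OF compact_sphere[of 0 1], THEN back_subst[of compact]]) (auto simp: M_def)

lemma L_tendsto_d:
  assumes "(f \<longlongrightarrow> tp) G" "\<forall>\<^sub>F x in G. tm < f x \<and> f x < tp"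
  shows "((\<lambda>x. L (f x)) \<longlongrightarrow> d) G"
proof (rule order_tendstoI)
  fix a assume "a < d"
  then obtain t where t: "tm < t" "t < tp" "a < L t" by (rule less_d)
  have "\<forall>\<^sub>F x in G. t < f x" using order_tendstoD(1)[OF assms(1) t(2)] .
  then show "\<forall>\<^sub>F x in G. a < L (f x)"
    using assms(2) by eventually_elim (use t L_mono[of t] in force)
next
  fix a assume "d < a"
  show "\<forall>\<^sub>F x in G. L (f x) < a"
    using assms(2) by eventually_elim (use L_less_d \<open>d < a\<close> in force)
qed

lemma contw: "continuous_on regular w" using smooth_on_continuous[OF smw] .

text \<open>The circle leaving \<open>q\<close> in the direction \<open>- \<eta>\<close> enters
  \<open>\<Omega>\<close>, because to first order \<open>J\<close> on it is \<open>e * c\<close>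
  times \<open>\<eta>\<close>; hence \<open>w\<close> tends to \<open>\<eta>\<close>. Going back
  along the normals by \<open>L (F (x e))\<close>, which tends to \<open>d\<close>, gives points of
  \<open>M\<close> converging to the wanted \<open>p\<close>.\<close>

lemma normal_from_M:
  assumes q: "q \<in> \<Sigma>" and \<eta>: "norm \<eta> = 1" "H q \<eta> = - c *\<^sub>R \<eta>"
  obtains p where "p \<in> M" "foc p = q" "nu p = \<eta>"
proof -
  note q0 = \<Sigma>_ne0[OF q] and q1 = \<Sigma>_norm[OF q]
  have "c * (\<eta> \<bullet> q) = 0"
    using Hsym[OF q0, of \<eta> q] \<eta>(2) H_radial[OF q0] J_\<Sigma>[OF q] by simp
  then have \<eta>q: "\<eta> \<bullet> q = 0" using c_pos by simp
  define x where "x e = cos e *\<^sub>R q - sin e *\<^sub>R \<eta>" for e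
  have x1: "norm (x e) = 1" for e
  proof -
    have "x e \<bullet> x e = (cos e)\<^sup>2 + (sin e)\<^sup>2"
      using q1 \<eta>(1) \<eta>q by (simp add: x_def inner_diff_left inner_diff_right norm_eq_1 inner_commute power2_eq_square)
    then show ?thesis by (simp add: norm_eq_1)
  qed
  then have x0: "x e \<noteq> 0" for e by (metis norm_zero zero_neq_one)
  have xz: "x 0 = q" by (simp add: x_def)
  have dx: "(x has_vector_derivative - \<eta>) (at 0)"
    unfolding x_def by (auto intro!: derivative_eq_intros)
  have limx: "(x \<longlongrightarrow> q) (at_right 0)"
  proof -
    have "(x \<longlongrightarrow> cos 0 *\<^sub>R q - sin 0 *\<^sub>R \<eta>) (at_right 0)" unfolding x_def by (intro tendsto_intros)
    then show ?thesis by simp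
  qed
  define j where "j e = (1 / e) *\<^sub>R (J (x e) - J (x 0))" for e
  have limj: "(j \<longlongrightarrow> c *\<^sub>R \<eta>) (at_right 0)"
  proof -
    have Jq: "(J has_derivative H q) (at (x 0))" using dJ[OF q0] xz by simp
    have "((\<lambda>e. J (x e)) has_vector_derivative c *\<^sub>R \<eta>) (at 0)"
      using has_derivative_compose[OF dx[unfolded has_vector_derivative_def] Jq]
      unfolding has_vector_derivative_def
      by (rule has_derivative_eq_rhs) (auto simp: linear_cmul[OF linH[OF q0]] linear_neg[OF linH[OF q0]] \<eta>(2))
    from tendsto_difference_quotient[OF this] show ?thesis
      unfolding j_def by (rule tendsto_mono[OF at_le, rotated]) auto
  qed
  have Jx: "J (x e) = e *\<^sub>R j e" if "e > 0" for e using that J_\<Sigma>[OF q] xz by (simp add: j_def)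
  have limnj: "((\<lambda>e. norm (j e)) \<longlongrightarrow> c) (at_right 0)"
    using tendsto_norm[OF limj] \<eta>(1) c_pos by simp
  have evpos: "\<forall>\<^sub>F e in at_right 0. e > (0::real)" by (simp add: eventually_at_filter)
  have Fq: "isCont F q" using dF[OF q0] has_derivative_continuous by blast
  have limF: "((\<lambda>e. F (x e)) \<longlongrightarrow> tp) (at_right 0)"
    using isCont_tendsto_compose[OF Fq limx] \<Sigma>_F[OF q] by simp
  have evO: "\<forall>\<^sub>F e in at_right 0. x e \<in> \<Omega> \<and> w (x e) = (1 / norm (j e)) *\<^sub>R j e"
    using evpos order_tendstoD(1)[OF limnj c_pos] order_tendstoD(1)[OF limF less_trans[OF t_order(1) t_order(2)]]
  proof eventually_elim
    case (elim e)
    have nJ: "norm (J (x e)) = e * norm (j e)" "norm (J (x e)) > 0" using Jx[OF elim(1)] elim by auto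
    then have "sqrt (b (F (x e))) > 0" using norm_J[OF x1, of e] by simp
    then have b0: "b (F (x e)) > 0" by simp
    then have "F (x e) \<noteq> tp" using b_tp by auto
    then have O: "x e \<in> \<Omega>" using F_le_tp[OF x1, of e] elim x1[of e] by (auto simp: \<Omega>_def)
    have "w (x e) = (1 / (e * norm (j e))) *\<^sub>R (e *\<^sub>R j e)"
      using w_eq[OF b0] norm_J[OF x1, of e] nJ(1) Jx[OF elim(1)] by simp
    then show ?case using O elim(1) by simp
  qed
  have limw: "((\<lambda>e. w (x e)) \<longlongrightarrow> \<eta>) (at_right 0)"
  proof -
    have "((\<lambda>e. (1 / norm (j e)) *\<^sub>R j e) \<longlongrightarrow> (1 / c) *\<^sub>R (c *\<^sub>R \<eta>)) (at_right 0)"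
      using c_pos by (intro tendsto_intros limnj limj) auto
    then have "((\<lambda>e. (1 / norm (j e)) *\<^sub>R j e) \<longlongrightarrow> \<eta>) (at_right 0)" using c_pos by simp
    then show ?thesis by (rule Lim_transform_eventually) (use evO in \<open>auto elim: eventually_mono\<close>)
  qed
  have limL: "((\<lambda>e. L (F (x e))) \<longlongrightarrow> d) (at_right 0)"
    by (rule L_tendsto_d[OF limF]) (use evO \<Omega>_F in \<open>auto elim!: eventually_mono\<close>)
  define pe where "pe e = geo (x e) (- L (F (x e)))" for e
  define p where "p = cos d *\<^sub>R q - sin d *\<^sub>R \<eta>"
  have limp: "(pe \<longlongrightarrow> p) (at_right 0)"
  proof -
    have "(pe \<longlongrightarrow> cos (- d) *\<^sub>R q + sin (- d) *\<^sub>R \<eta>) (at_right 0)"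
      unfolding pe_def geo_def by (intro tendsto_intros limL limx limw)
    then show ?thesis by (simp add: p_def)
  qed
  have "\<forall>\<^sub>F e in at_right 0. pe e \<in> M"
    using evO by eventually_elim (use geo_backwards(1) in \<open>auto simp: pe_def\<close>)
  then have pM: "p \<in> M"
    by (rule Lim_in_closed_set[OF closed_M _ trivial_limit_at_right_real limp])
  have "isCont w p" using contw open_regular M_regular[OF pM] continuous_on_eq_continuous_at by blast
  from isCont_tendsto_compose[OF this limp]
  have 1: "((\<lambda>e. w (pe e)) \<longlongrightarrow> w p) (at_right 0)" .
  have "((\<lambda>e. geo' (x e) (- L (F (x e)))) \<longlongrightarrow> - sin (- d) *\<^sub>R q + cos (- d) *\<^sub>R \<eta>) (at_right 0)"
    unfolding geo'_def by (intro tendsto_intros limL limx limw)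
  moreover have "\<forall>\<^sub>F e in at_right 0. geo' (x e) (- L (F (x e))) = w (pe e)"
    using evO by eventually_elim (use geo_backwards(2) in \<open>auto simp: pe_def\<close>)
  ultimately have "((\<lambda>e. w (pe e)) \<longlongrightarrow> - sin (- d) *\<^sub>R q + cos (- d) *\<^sub>R \<eta>) (at_right 0)"
    by (rule Lim_transform_eventually)
  from tendsto_unique[OF trivial_limit_at_right_real 1 this]
  have wp: "w p = sin d *\<^sub>R q + cos d *\<^sub>R \<eta>" by simp
  have cs: "cos d * cos d + sin d * sin d = 1" using sin_cos_squared_add[of d] by (simp add: power2_eq_square)
  have a: "(cos d * cos d) *\<^sub>R v + (sin d * sin d) *\<^sub>R v = v" "(sin d * sin d) *\<^sub>R v + (cos d * cos d) *\<^sub>R v = v" for v :: 'a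
    using cs by (simp_all add: scaleR_add_left[symmetric] add.commute)
  have "foc p = q" "nu p = \<eta>"
    using a unfolding geo_def geo'_def wp by (auto simp: p_def scaleR_add_right scaleR_diff_right algebra_simps)
  then show thesis using that pM by blast
qed

text \<open>The set \<open>A\<close> of missed points is open in the sphere: points outside it that
  converge to \<open>x \<in> A\<close> would eventually lie in \<open>\<Omega>\<close>, hence on
  normal circles from the compact \<open>M\<close>, and their limit would be focal. So
  \<open>H\<close> vanishes on \<open>A\<close>, while \<open>H_nu\<close> shows it nonzero at focal
  points; this makes \<open>A\<close> closed. As the sphere is connected and \<open>M\<close> is
  disjoint from \<open>A\<close>, it is empty.\<close>

lemma foc_surj: assumes q: "q \<in> \<Sigma>" obtains p where "p \<in> M" "foc p = q"
proof -
  define A where "A = \<Sigma> - foc ` M"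
  have cont_foc: "continuous_on M foc"
    unfolding geo_def by (intro continuous_intros continuous_on_subset[OF contw]) (use M_regular in auto)
  then have compf: "compact (foc ` M)" using compact_M compact_continuous_image by blast
  have A_open: "\<exists>e>0. \<forall>y. norm y = 1 \<and> dist y x < e \<longrightarrow> y \<in> A" if x: "x \<in> A" for x
  proof (rule ccontr)
    assume neg: "\<not> ?thesis"
    have "\<forall>n. \<exists>y. norm y = 1 \<and> dist y x < 1 / real (Suc n) \<and> y \<notin> A"
      using neg by (metis of_nat_0_less_iff zero_less_Suc zero_less_divide_1_iff)
    then obtain y where y: "\<And>n. norm (y n) = 1" "\<And>n. dist (y n) x < 1 / real (Suc n)" "\<And>n. y n \<notin> A" by metis
    have limy: "y \<longlonglongrightarrow> x"
    proof (rule tendsto_dist_iff[THEN iffD2], rule tendsto_sandwich[of "\<lambda>_. 0" _ _ "\<lambda>n. 1 / real (Suc n)"])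
      show "(\<lambda>n. 1 / real (Suc n)) \<longlonglongrightarrow> 0" using LIMSEQ_inverse_real_of_nat by (simp add: inverse_eq_divide)
      show "\<forall>\<^sub>F n in sequentially. dist (y n) x \<le> 1 / real (Suc n)"
        by (intro always_eventually allI less_imp_le y(2))
    qed auto
    have x\<Sigma>: "x \<in> \<Sigma>" "x \<notin> foc ` M" using x by (auto simp: A_def)
    have "open (- (foc ` M))" using compf compact_imp_closed by blast
    from topological_tendstoD[OF limy this] x\<Sigma>(2)
    have ev1: "\<forall>\<^sub>F n in sequentially. y n \<notin> foc ` M" by auto
    have Fx: "isCont F x" using dF[OF \<Sigma>_ne0[OF x\<Sigma>(1)]] has_derivative_continuous by blast
    have limF: "(\<lambda>n. F (y n)) \<longlonglongrightarrow> tp" using isCont_tendsto_compose[OF Fx limy] \<Sigma>_F[OF x\<Sigma>(1)] by simp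
    have ev2: "\<forall>\<^sub>F n in sequentially. y n \<in> \<Omega> \<and> t0 \<le> F (y n)"
      using ev1 order_tendstoD(1)[OF limF t_order(2)]
    proof eventually_elim
      case (elim n)
      then have "F (y n) \<noteq> tp" using y(1,3)[of n] by (auto simp: A_def \<Sigma>_def)
      then show ?case using elim F_le_tp[OF y(1), of n] t_order y(1)[of n] by (auto simp: \<Omega>_def)
    qed
    have limL: "(\<lambda>n. L (F (y n))) \<longlonglongrightarrow> d"
      by (rule L_tendsto_d[OF limF]) (use ev2 \<Omega>_F in \<open>auto elim!: eventually_mono\<close>)
    \<comment> \<open>The default value keeps the whole sequence in \<open>M\<close> for the
      compactness argument; only finitely many terms take it.\<close>
    define pn where "pn n = (if y n \<in> \<Omega> then geo (y n) (- L (F (y n))) else SOME p. p \<in> M)" for n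
    have pnM: "pn n \<in> M" for n
      using geo_backwards(1)[of "y n"] someI_ex[of "\<lambda>p. p \<in> M"] M_ne by (auto simp: pn_def M_def)
    obtain l r where lr: "l \<in> M" "strict_mono r" "(pn \<circ> r) \<longlonglongrightarrow> l"
      using compact_M pnM unfolding compact_def by blast
    have "isCont w l" using contw open_regular M_regular[OF lr(1)] continuous_on_eq_continuous_at by blast
    from isCont_tendsto_compose[OF this lr(3)] have limw: "(\<lambda>n. w (pn (r n))) \<longlonglongrightarrow> w l" by (simp add: o_def)
    have limLr: "(\<lambda>n. L (F (y (r n)))) \<longlonglongrightarrow> d" using LIMSEQ_subseq_LIMSEQ[OF limL lr(2)] by (simp add: o_def)
    have "(\<lambda>n. geo (pn (r n)) (L (F (y (r n))))) \<longlonglongrightarrow> foc l"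
      unfolding geo_def using lr(3) by (intro tendsto_intros limw limLr) (simp add: o_def)
    moreover have "\<forall>\<^sub>F n in sequentially. geo (pn n) (L (F (y n))) = y n"
      using ev2 by eventually_elim (use geo_backwards(3) in \<open>auto simp: pn_def\<close>)
    from eventually_subseq[OF lr(2) this]
    have "\<forall>\<^sub>F n in sequentially. geo (pn (r n)) (L (F (y (r n)))) = y (r n)" .
    ultimately have "(\<lambda>n. y (r n)) \<longlonglongrightarrow> foc l" by (rule Lim_transform_eventually)
    moreover have "(\<lambda>n. y (r n)) \<longlonglongrightarrow> x" using LIMSEQ_subseq_LIMSEQ[OF limy lr(2)] by (simp add: o_def)
    ultimately have "x = foc l" using LIMSEQ_unique by blast
    then show False using x\<Sigma>(2) lr(1) by blast
  qed
  have H0: "H x = (\<lambda>v. 0)" if x: "x \<in> A" for x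
  proof -
    obtain e where e: "e > 0" "\<And>y. norm y = 1 \<Longrightarrow> dist y x < e \<Longrightarrow> y \<in> A" using A_open[OF x] by blast
    have x1: "norm x = 1" "x \<noteq> 0" using x by (auto simp: A_def \<Sigma>_def)
    have "isCont (\<lambda>y. (1 / norm y) *\<^sub>R y) x" using x1 by (intro continuous_intros) auto
    then have "((\<lambda>y. (1 / norm y) *\<^sub>R y) \<longlongrightarrow> x) (nhds x)"
      using x1 tendsto_at_iff_tendsto_nhds[of "\<lambda>y. (1 / norm y) *\<^sub>R y" x] by (simp add: isCont_def)
    from tendstoD[OF this e(1)] have "\<forall>\<^sub>F y in nhds x. dist ((1 / norm y) *\<^sub>R y) x < e" .
    moreover have "\<forall>\<^sub>F y in nhds x. y \<noteq> 0" using eventually_nhds_in_open[OF open_punctured, of x] x1 by simp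
    ultimately have ev: "\<forall>\<^sub>F y in nhds x. J y = 0"
    proof eventually_elim
      case (elim y)
      then have "(1 / norm y) *\<^sub>R y \<in> A" by (intro e(2)) auto
      then have "J ((1 / norm y) *\<^sub>R y) = 0" using J_\<Sigma> by (auto simp: A_def)
      then show ?case using J_hom[of "1 / norm y" y] elim by simp
    qed
    have "(J has_derivative (\<lambda>v. 0)) (at x)"
      by (rule has_derivative_transform_eventually[OF has_derivative_const[of 0]])
        (use ev eventually_nhds_x_imp_x[OF ev] in \<open>auto simp: eventually_nhds_conv_at elim: eventually_mono\<close>)
    then show ?thesis using has_derivative_unique[OF dJ[OF x1(2)]] by blast
  qed
  have "A = {}"
  proof (rule ccontr)
    assume ne: "A \<noteq> {}"
    have sub: "A \<subseteq> sphere 0 1" by (auto simp: A_def \<Sigma>_def)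
    have "closed \<Sigma>"
    proof -
      have "closed (sphere 0 1 \<inter> F -` {tp})"
        by (rule continuous_closed_preimage[OF continuous_on_subset[OF contF]]) auto
      also have "sphere 0 1 \<inter> F -` {tp} = \<Sigma>" by (auto simp: \<Sigma>_def)
      finally show ?thesis .
    qed
    have clA: "closed A"
    proof (rule closed_sequential_limits[THEN iffD2], intro allI impI, elim conjE)
      fix y l assume y: "\<forall>n. y n \<in> A" "y \<longlonglongrightarrow> l"
      have l\<Sigma>: "l \<in> \<Sigma>"
        using y \<open>closed \<Sigma>\<close> closed_sequentially[of \<Sigma> y l] by (auto simp: A_def)
      have Hl: "H l v = 0" for v
      proof -
        have "isCont (\<lambda>x. H x v) l" using contH open_punctured \<Sigma>_ne0[OF l\<Sigma>] continuous_on_eq_continuous_at by blast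
        from isCont_tendsto_compose[OF this y(2)] have "(\<lambda>n. H (y n) v) \<longlonglongrightarrow> H l v" .
        moreover have "H (y n) v = 0" for n using H0 y(1) by simp
        ultimately show ?thesis using LIMSEQ_unique[of "\<lambda>n. 0" 0] by auto
      qed
      have "l \<notin> foc ` M"
      proof
        assume "l \<in> foc ` M"
        then obtain p where p: "p \<in> M" "l = foc p" by blast
        then have "c *\<^sub>R nu p = 0" using H_nu[OF p(1)] Hl by simp
        then show False using c_pos M_orthonormal(5)[OF p(1) p(1), of d] by auto
      qed
      then show "l \<in> A" using l\<Sigma> by (simp add: A_def)
    qed
    have "openin (top_of_set (sphere 0 1)) A"
      unfolding openin_euclidean_subtopology_iff
    proof (intro conjI sub ballI)
      fix x assume "x \<in> A"
      from A_open[OF this] show "\<exists>e>0. \<forall>x'\<in>sphere 0 1. dist x' x < e \<longrightarrow> x' \<in> A"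
        by (metis dist_0_norm mem_sphere)
    qed
    moreover have "closedin (top_of_set (sphere 0 1)) A"
      using clA sub closed_subset by blast
    moreover have "connected (sphere (0::'a) 1)" using connected_sphere[of "0::'a" 1] dim3 by simp
    ultimately have "A = sphere 0 1" using ne unfolding connected_clopen by blast
    moreover obtain p where "p \<in> M" using M_ne by (auto simp: M_def)
    ultimately have "p \<in> A" using M_norm by auto
    then show False using \<open>p \<in> M\<close> t_order by (auto simp: A_def M_def \<Sigma>_def)
  qed
  then show thesis using q that by (auto simp: A_def)
qed

text \<open>
  For \<open>\<kappa> = cot \<theta>\<close> these are \<open>\<alpha> \<kappa> = sin (\<theta> - d) / sin \<theta>\<close>, which vanishes if and only if \<open>\<Sigma>\<close> is focal in the
  direction of \<open>E p \<kappa>\<close>, and \<open>lam \<kappa> = cot (\<theta> - d)\<close>, otherwise a principal curvature of \<open>\<Sigma>\<close>.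
\<close>

definition \<alpha> where "\<alpha> \<kappa> = cos d - \<kappa> * sin d"

definition lam where "lam \<kappa> = (sin d + \<kappa> * cos d) / \<alpha> \<kappa>"

text \<open>Derivative of \<open>H_nu\<close> along \<open>M\<close> in the direction
  \<open>X\<close>: the focal point moves by \<open>\<alpha> \<kappa> *\<^sub>R X\<close>, its
  normal by \<open>- (\<alpha> \<kappa> * lam \<kappa>) *\<^sub>R X\<close>, and \<open>H\<close>
  kills \<open>X\<close>. So \<open>HH\<close> with the normal inserted acts as \<open>c\<close>
  times the shape operator.\<close>

lemma focal_E:
  assumes p: "p \<in> M" and X: "X \<in> E p \<kappa>" and \<kappa>: "\<alpha> \<kappa> \<noteq> 0"
  shows "HH (foc p) X (nu p) = (c * lam \<kappa>) *\<^sub>R X" and "velocity \<Sigma> (foc p) (\<alpha> \<kappa> *\<^sub>R X)"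
proof -
  have v: "velocity M p X" using M_level[OF p] E_D[OF X] by blast
  note r = M_regular[OF p]
  have n0: "foc p \<noteq> 0" using M_orthonormal(6)[OF p p] .
  have 1: "cos d *\<^sub>R X + sin d *\<^sub>R W p X = \<alpha> \<kappa> *\<^sub>R X" and 2: "- sin d *\<^sub>R X + cos d *\<^sub>R W p X = - (\<alpha> \<kappa> * lam \<kappa>) *\<^sub>R X"
  proof -
    show "cos d *\<^sub>R X + sin d *\<^sub>R W p X = \<alpha> \<kappa> *\<^sub>R X" by (simp add: E_D[OF X] \<alpha>_def algebra_simps)
    have "\<alpha> \<kappa> * lam \<kappa> = sin d + \<kappa> * cos d" using \<kappa> by (simp add: lam_def)
    then show "- sin d *\<^sub>R X + cos d *\<^sub>R W p X = - (\<alpha> \<kappa> * lam \<kappa>) *\<^sub>R X"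
      by (simp add: E_D[OF X] algebra_simps)
  qed
  show "velocity \<Sigma> (foc p) (\<alpha> \<kappa> *\<^sub>R X)"
    using velocity_transform[OF v open_UNIV UNIV_I d_geo_base(1)[OF r, of d], of \<Sigma>] foc_\<Sigma> 1 by auto
  have "HH (foc p) (cos d *\<^sub>R X + sin d *\<^sub>R W p X) (nu p) + H (foc p) (- sin d *\<^sub>R X + cos d *\<^sub>R W p X)
      = - c *\<^sub>R (- sin d *\<^sub>R X + cos d *\<^sub>R W p X)"
    by (rule velocity_derivative_eq[OF v open_UNIV UNIV_I
        d_H[where G = "\<lambda>x. geo x d" and N = "\<lambda>x. geo' x d", OF n0 d_geo_base[OF r]]
        has_derivative_scaleR_right[OF d_geo_base(2)[OF r], of "- c" d]])
      (use H_nu in auto)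
  moreover have "H (foc p) X = 0" using H_E_regular[OF p X] \<kappa> by (simp add: \<alpha>_def)
  moreover have "linear (\<lambda>v. HH (foc p) v (nu p))" using d_H_const[OF n0] has_derivative_linear by blast
  ultimately have "\<alpha> \<kappa> *\<^sub>R HH (foc p) X (nu p) = \<alpha> \<kappa> *\<^sub>R ((c * lam \<kappa>) *\<^sub>R X)"
    unfolding 1 2 using linear_cmul[OF linH[OF n0]] linear_cmul[of "\<lambda>v. HH (foc p) v (nu p)"]
      linear_neg[OF linH[OF n0]]
    by (simp add: mult_ac)
  then show "HH (foc p) X (nu p) = (c * lam \<kappa>) *\<^sub>R X" by (rule scaleR_left_imp_eq[OF \<kappa>])
qed

end

section \<open>The Ricci tensor in terms of the tangential projection\<close>

definition trc :: "('a::euclidean_space \<Rightarrow> 'a) \<Rightarrow> real" where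
  "trc A = (\<Sum>i\<in>Basis. A i \<bullet> i)"

definition frob :: "('a::euclidean_space \<Rightarrow> 'a) \<Rightarrow> ('a \<Rightarrow> 'a) \<Rightarrow> real" where
  "frob S T = (\<Sum>i\<in>Basis. S i \<bullet> T i)"

lemma trc_commute:
  fixes A C :: "'a::euclidean_space \<Rightarrow> 'a"
  assumes "linear A" "linear C"
  shows "trc (\<lambda>x. A (C x)) = trc (\<lambda>x. C (A x))"
proof -
  have e: "trc (\<lambda>x. A (C x)) = (\<Sum>i\<in>Basis. \<Sum>j\<in>Basis. (C i \<bullet> j) * (A j \<bullet> i))"
    if "linear A" for A C :: "'a \<Rightarrow> 'a"
    unfolding trc_def
    by (subst bounded_linear_euclidean_sum[OF that]) (simp add: inner_sum_left)
  show ?thesis unfolding e[OF assms(1), of C] e[OF assms(2), of A]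
    by (subst sum.swap) (simp add: mult.commute)
qed

lemma trc_add: "trc (\<lambda>x. A x + C x) = trc A + trc C"
  by (simp add: trc_def inner_add_left sum.distrib)

lemma frob_trc:
  assumes "\<And>v u. S v \<bullet> u = v \<bullet> S u"
  shows "frob S T = trc (\<lambda>x. S (T x))"
proof -
  have "S i \<bullet> T i = S (T i) \<bullet> i" for i unfolding assms[of i] by (rule inner_commute)
  then show ?thesis by (simp add: frob_def trc_def)
qed

text \<open>
  The last hypothesis says that the diagonal blocks of \<open>T\<close> relative to the orthogonal projection \<open>P\<close>
  vanish; by symmetry the two off-diagonal blocks contribute equally.
\<close>

lemma frob_off_diagonal:
  fixes S T P :: "'a::euclidean_space \<Rightarrow> 'a"
  assumes lin: "linear S" "linear T" "linear P"
    and sym: "\<And>v u. S v \<bullet> u = v \<bullet> S u" "\<And>v u. T v \<bullet> u = v \<bullet> T u" "\<And>v u. P v \<bullet> u = v \<bullet> P u"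
    and P: "\<And>v. P (P v) = P v" and T: "\<And>v. T v = T (P v) + P (T v)"
  shows "frob S T = 2 * (\<Sum>i\<in>Basis. S (P i) \<bullet> T (P i))"
    and "frob S T = 2 * (\<Sum>i\<in>Basis. S (i - P i) \<bullet> T (i - P i))"
proof -
  have trans: "trc (\<lambda>x. S (P (T x))) = trc (\<lambda>x. T (P (S x)))"
  proof -
    have "S (P (T i)) \<bullet> i = T (P (S i)) \<bullet> i" for i
      unfolding sym(1)[of "P (T i)"] sym(3)[of "T i"] sym(2)[of i] by (rule inner_commute)
    then show ?thesis by (simp add: trc_def)
  qed
  have PP: "(\<Sum>i\<in>Basis. S (P i) \<bullet> T (P i)) = trc (\<lambda>x. S (T (P x)))"
  proof -
    have "S (P i) \<bullet> T (P i) = P (S (T (P i))) \<bullet> i" for i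
      unfolding sym(1)[of "P i"] sym(3)[of i] by (rule inner_commute)
    then have "(\<Sum>i\<in>Basis. S (P i) \<bullet> T (P i)) = trc (\<lambda>x. P (S (T (P x))))"
      by (simp add: trc_def)
    also have "\<dots> = trc (\<lambda>x. S (T (P (P x))))"
      by (rule trc_commute[of P "\<lambda>x. S (T (P x))"])
        (use lin linear_compose[unfolded o_def] in blast)+
    finally show ?thesis using P by simp
  qed
  have full: "frob S T = trc (\<lambda>x. S (T x))" by (rule frob_trc[OF sym(1)])
  have "trc (\<lambda>x. S (T x)) = trc (\<lambda>x. S (T (P x))) + trc (\<lambda>x. S (P (T x)))"
  proof -
    have "S (T x) = S (T (P x)) + S (P (T x))" for x
      using arg_cong[OF T[of x], of S] unfolding linear_add[OF lin(1)] .
    then have "(\<lambda>x. S (T x)) = (\<lambda>x. S (T (P x)) + S (P (T x)))" by (rule ext)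
    from arg_cong[OF this, of trc] show ?thesis unfolding trc_add .
  qed
  also have "trc (\<lambda>x. S (P (T x))) = trc (\<lambda>x. T (P (S x)))" by (rule trans)
  also have "\<dots> = trc (\<lambda>x. S (T (P x)))"
    by (rule trc_commute[of "\<lambda>x. T (P x)" S]) (use lin linear_compose[unfolded o_def] in blast)+
  finally have half: "frob S T = 2 * trc (\<lambda>x. S (T (P x)))" using full by simp
  then show "frob S T = 2 * (\<Sum>i\<in>Basis. S (P i) \<bullet> T (P i))" using PP by simp
  have "(\<Sum>i\<in>Basis. S (i - P i) \<bullet> T (i - P i)) =
      (\<Sum>i\<in>Basis. S i \<bullet> T i) - (\<Sum>i\<in>Basis. S i \<bullet> T (P i)) - (\<Sum>i\<in>Basis. S (P i) \<bullet> T i) + (\<Sum>i\<in>Basis. S (P i) \<bullet> T (P i))"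
    by (simp add: linear_diff[OF lin(1)] linear_diff[OF lin(2)] inner_diff_left inner_diff_right sum.distrib sum_subtractf)
  also have "(\<Sum>i\<in>Basis. S i \<bullet> T (P i)) = trc (\<lambda>x. S (T (P x)))"
  proof -
    have "S i \<bullet> T (P i) = S (T (P i)) \<bullet> i" for i unfolding sym(1)[of i] by (rule inner_commute)
    then show ?thesis by (simp add: trc_def)
  qed
  also have "(\<Sum>i\<in>Basis. S (P i) \<bullet> T i) = trc (\<lambda>x. P (S (T x)))"
  proof -
    have "S (P i) \<bullet> T i = P (S (T i)) \<bullet> i" for i
      unfolding sym(1)[of "P i"] sym(3)[of i] by (rule inner_commute)
    then show ?thesis by (simp add: trc_def)
  qed
  also have "\<dots> = trc (\<lambda>x. S (T (P x)))"
    by (rule trc_commute[of P "\<lambda>x. S (T x)"]) (use lin linear_compose[unfolded o_def] in blast)+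
  finally show "frob S T = 2 * (\<Sum>i\<in>Basis. S (i - P i) \<bullet> T (i - P i))"
    using half PP by (simp add: frob_def)
qed

text \<open>
  On the eigenvectors of \<open>A\<close>, with eigenvalues among \<open>0, 1, -1\<close>, the hypothesis says that \<open>T x y z\<close> vanishes
  unless the three eigenvalues are pairwise distinct, in which case they add up to zero.
\<close>

lemma trilinear_cubic:
  fixes T :: "'a \<Rightarrow> 'a \<Rightarrow> 'a \<Rightarrow> real"
  assumes sym: "\<And>x y z. T x y z = T y x z" "\<And>x y z. T x y z = T x z y"
    and A3: "\<And>x. A (A (A x)) = A x"
    and rel: "\<And>x y z. T x (A (A y)) z + T x (A y) (A z) + T x y (A (A z)) = T x y z"
  shows "T (A x) y z + T x (A y) z + T x y (A z) = 0"
proof -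
  define S where "S x y z = T (A x) y z + T x (A y) z + T x y (A z)" for x y z
  have rel13: "T (A (A x)) y z + T (A x) y (A z) + T x y (A (A z)) = T x y z" for x y z
    using rel[of y x z] by (simp add: sym(1)[of y])
  have rel12: "T (A (A x)) y z + T (A x) (A y) z + T x (A (A y)) z = T x y z" for x y z
    using rel13[of x z y] by (simp add: sym(2)[of _ z])
  \<comment> \<open>Thus \<open>A\<close> can be moved between the arguments of \<open>S\<close>.
    The three terms of the relation for \<open>S\<close> then agree, and
    \<open>A (A (A x)) = A x\<close> gives \<open>3 * S (A x) y z = S (A x) y z\<close>.\<close>
  have S12: "S x (A y) z = S (A x) y z" for x y z
    using rel[of x y z] rel13[of x y z] by (simp add: S_def)
  have S13: "3 * S (A (A x)) y z = S x y z" for x y z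
  proof -
    have "S (A (A x)) y z + S (A x) (A y) z + S x (A (A y)) z = S x y z"
      using rel12[of "A x" y z] rel12[of x "A y" z] rel12[of x y "A z"] by (simp add: S_def A3)
    then show ?thesis using S12[of "A x" y z] S12[of x "A y" z] S12[of "A x" y z] by simp
  qed
  have "S (A x) y z = 0" for x y z using S13[of "A x" y z] by (simp add: A3)
  then have "S x y z = 0" using S13[of x y z] by simp
  then show ?thesis by (simp add: S_def)
qed

text \<open>
  \<open>P u\<close> is the orthogonal projection onto the tangent space at \<open>\<phi> u\<close>, extended smoothly
  off the slice, \<open>X\<close> is the coordinate frame and \<open>Y\<close> the dual frame. The derivatives \<open>PD\<close>
  of \<open>P\<close> encode the second fundamental form.
\<close>

locale chart_geometry =
  fixes N :: "'a::euclidean_space set" and B U \<phi> and Op :: "'a set" and P :: "'a \<Rightarrow> 'a \<Rightarrow> 'a"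
  assumes sc: "slice_chart N B U \<phi>"
    and Op: "open Op" "Op \<subseteq> U"
    and smP: "\<And>v. smooth_on Op (\<lambda>u. P u v)"
    and linP: "\<And>u. u \<in> Op \<Longrightarrow> linear (P u)"
    and symP: "\<And>u v x. u \<in> Op \<inter> span B \<Longrightarrow> P u v \<bullet> x = v \<bullet> P u x"
    and idemP: "\<And>u v. u \<in> Op \<inter> span B \<Longrightarrow> P u (P u v) = P u v"
    and PX0: "\<And>u b. u \<in> Op \<inter> span B \<Longrightarrow> b \<in> B \<Longrightarrow> P u (pd b \<phi> u) = pd b \<phi> u"
    and P_span: "\<And>u v. u \<in> Op \<inter> span B \<Longrightarrow> P u v \<in> span ((\<lambda>b. pd b \<phi> u) ` B)"
    and unit: "\<And>u. u \<in> Op \<inter> span B \<Longrightarrow> \<phi> u \<bullet> \<phi> u = 1"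
begin

definition V where "V = Op \<inter> span B"
definition X where "X b u = pd b \<phi> u"
definition Y0 where "Y0 b u = (\<Sum>i\<in>Basis. (b \<bullet> frechet_derivative (inv_into U \<phi>) (at (\<phi> u)) i) *\<^sub>R i)"
definition Y where "Y b u = P u (Y0 b u)"
definition PD where "PD a u v = pd a (\<lambda>u. P u v) u"
definition PDD where "PDD a b u v = pd a (\<lambda>u. PD b u v) u"
abbreviation "sm f \<equiv> smooth_on Op f"
abbreviation "G \<equiv> induced_metric \<phi>"

section \<open>Calculus along the slice\<close>

lemmas D = slice_chartD[OF sc]

lemma VD: "u \<in> V \<Longrightarrow> u \<in> Op" "u \<in> V \<Longrightarrow> u \<in> U" "u \<in> V \<Longrightarrow> u \<in> Op \<inter> span B" "u \<in> V \<Longrightarrow> u \<in> U \<inter> span B"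
  using Op by (auto simp: V_def)

lemmas PV = symP[OF VD(3)] idemP[OF VD(3)]

lemma sm_pd_eq: "sm f \<Longrightarrow> u \<in> Op \<Longrightarrow> pd a f u = frechet_derivative f (at u) a"
  using pd_eq_frechet smooth_on_differentiable by blast

lemma sm_pd: assumes "sm f" shows "sm (pd a f)"
  using smooth_on_cong[OF Op(1), of "pd a f" "\<lambda>u. frechet_derivative f (at u) a"] sm_pd_eq[OF assms]
    smooth_on_frechet_derivative[OF assms] by blast

lemma sm_line:
  assumes "sm f" "u \<in> Op"
  shows "((\<lambda>t. f (u + t *\<^sub>R a)) has_vector_derivative pd a f u) (at 0)"
  using has_vector_derivative_line[OF smooth_on_differentiable[OF assms]] sm_pd_eq[OF assms] by simp

lemma pd_const: "pd a (\<lambda>u. k) u = 0"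
  by (rule pd_eqI) (rule has_vector_derivative_const)

lemma pd_add: "sm f \<Longrightarrow> sm g \<Longrightarrow> u \<in> Op \<Longrightarrow> pd a (\<lambda>u. f u + g u) u = pd a f u + pd a g u"
  by (intro pd_eqI has_vector_derivative_add sm_line)

lemma pd_diff: "sm f \<Longrightarrow> sm g \<Longrightarrow> u \<in> Op \<Longrightarrow> pd a (\<lambda>u. f u - g u) u = pd a f u - pd a g u"
  by (intro pd_eqI has_vector_derivative_diff sm_line)

lemma pd_sum: "(\<And>i. i \<in> I \<Longrightarrow> sm (f i)) \<Longrightarrow> u \<in> Op \<Longrightarrow> pd a (\<lambda>u. \<Sum>i\<in>I. f i u) u = (\<Sum>i\<in>I. pd a (f i) u)"
  by (intro pd_eqI has_vector_derivative_sum sm_line)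

lemma pd_scaleR:
  fixes f :: "'a \<Rightarrow> real" and g :: "'a \<Rightarrow> 'c::real_normed_vector"
  assumes "sm f" "sm g" "u \<in> Op"
  shows "pd a (\<lambda>u. f u *\<^sub>R g u) u = f u *\<^sub>R pd a g u + pd a f u *\<^sub>R g u"
  using has_vector_derivative_scaleR[OF _ sm_line[OF assms(2,3)], of "\<lambda>t. f (u + t *\<^sub>R a)" "pd a f u"]
    sm_line[OF assms(1,3)] by (intro pd_eqI) (simp add: has_real_derivative_iff_has_vector_derivative)

lemma pd_inner:
  assumes "sm f" "sm g" "u \<in> Op"
  shows "pd a (\<lambda>u. f u \<bullet> g u) u = f u \<bullet> pd a g u + pd a f u \<bullet> g u"
  using bounded_bilinear.has_vector_derivative[OF bounded_bilinear_inner sm_line[OF assms(1,3)] sm_line[OF assms(2,3)]]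
  by (intro pd_eqI) simp

lemma pd_mult:
  fixes f g :: "'a \<Rightarrow> real"
  assumes "sm f" "sm g" "u \<in> Op"
  shows "pd a (\<lambda>u. f u * g u) u = f u * pd a g u + pd a f u * g u"
  using pd_scaleR[OF assms] by simp

lemma pd_comm:
  fixes f :: "'a \<Rightarrow> 'c::euclidean_space"
  assumes "sm f" "u \<in> Op"
  shows "pd a (pd b f) u = pd b (pd a f) u"
proof -
  have "pd a (pd b f) u = frechet_derivative (\<lambda>y. frechet_derivative f (at y) b) (at u) a" for a b
    unfolding sm_pd_eq[OF sm_pd[OF assms(1)] assms(2)]
    by (subst frechet_derivative_cong_open(2)[OF Op(1) assms(2)]) (use sm_pd_eq[OF assms(1)] in auto)
  then show ?thesis using second_derivative_symmetric[OF Op(1) assms(2,1)] by metis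
qed

text \<open>The extended objects satisfy their geometric identities only on the slice, but lines in
  the directions of \<open>B\<close> do not leave it.\<close>

lemma pd_V:
  assumes "u \<in> V" "b \<in> B" "\<And>x. x \<in> V \<Longrightarrow> f x = g x"
  shows "pd b f u = pd b g u"
  by (rule pd_cong_slice[OF Op(1) VD(3)[OF assms(1)] span_base[OF assms(2)]]) (use assms(3) in \<open>auto simp: V_def\<close>)

lemma sm_op:
  fixes A :: "'a \<Rightarrow> 'a \<Rightarrow> 'a"
  assumes "\<And>u. u \<in> Op \<Longrightarrow> linear (A u)" "\<And>v. sm (\<lambda>u. A u v)" "sm g"
  shows "sm (\<lambda>u. A u (g u))"
proof -
  have "sm (\<lambda>u. \<Sum>i\<in>Basis. (g u \<bullet> i) *\<^sub>R A u i)"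
    by (intro smooth_on_sum smooth_on_scaleR smooth_on_inner smooth_on_const Op(1) assms)
  then show ?thesis
    using smooth_on_cong[OF Op(1), of "\<lambda>u. A u (g u)" "\<lambda>u. \<Sum>i\<in>Basis. (g u \<bullet> i) *\<^sub>R A u i"]
      bounded_linear_euclidean_sum[OF assms(1)] by blast
qed

lemma pd_op_linear:
  fixes A :: "'a \<Rightarrow> 'a \<Rightarrow> 'a"
  assumes "\<And>u. u \<in> Op \<Longrightarrow> linear (A u)" "\<And>v. sm (\<lambda>u. A u v)" "u \<in> Op"
  shows "pd a (\<lambda>u. A u v) u = (\<Sum>i\<in>Basis. (v \<bullet> i) *\<^sub>R pd a (\<lambda>u. A u i) u)" and "linear (\<lambda>v. pd a (\<lambda>u. A u v) u)"
proof -
  have e: "pd a (\<lambda>u. A u v) u = (\<Sum>i\<in>Basis. (v \<bullet> i) *\<^sub>R pd a (\<lambda>u. A u i) u)" for v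
  proof -
    have "pd a (\<lambda>u. A u v) u = pd a (\<lambda>u. \<Sum>i\<in>Basis. (v \<bullet> i) *\<^sub>R A u i) u"
      by (rule pd_cong)
        (use eventually_line_in_open[OF Op(1) assms(3), of a] in \<open>eventually_elim, metis bounded_linear_euclidean_sum assms(1)\<close>)
    also have "\<dots> = (\<Sum>i\<in>Basis. (v \<bullet> i) *\<^sub>R pd a (\<lambda>u. A u i) u)"
      by (subst pd_sum) (auto intro!: smooth_on_scaleR smooth_on_const Op(1) assms sum.cong simp: pd_scaleR[OF smooth_on_const assms(2,3)] pd_const)
    finally show ?thesis .
  qed
  then show "pd a (\<lambda>u. A u v) u = (\<Sum>i\<in>Basis. (v \<bullet> i) *\<^sub>R pd a (\<lambda>u. A u i) u)" .
  show "linear (\<lambda>v. pd a (\<lambda>u. A u v) u)"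
  proof (rule ssubst[of _ _ linear])
    show "(\<lambda>v. pd a (\<lambda>u. A u v) u) = (\<lambda>v. \<Sum>i\<in>Basis. (v \<bullet> i) *\<^sub>R pd a (\<lambda>u. A u i) u)"
      by (rule ext) (rule e)
    show "linear (\<lambda>v. \<Sum>i\<in>Basis. (v \<bullet> i) *\<^sub>R pd a (\<lambda>u. A u i) u)"
      by (intro linearI) (auto simp: inner_add_left scaleR_add_left sum.distrib scaleR_sum_right)
  qed
qed

lemma pd_op:
  fixes A :: "'a \<Rightarrow> 'a \<Rightarrow> 'a"
  assumes A: "\<And>u. u \<in> Op \<Longrightarrow> linear (A u)" "\<And>v. sm (\<lambda>u. A u v)" and g: "sm g" and u: "u \<in> Op"
  shows "pd a (\<lambda>u. A u (g u)) u = pd a (\<lambda>x. A x (g u)) u + A u (pd a g u)"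
proof -
  have "pd a (\<lambda>u. A u (g u)) u = pd a (\<lambda>u. \<Sum>i\<in>Basis. (g u \<bullet> i) *\<^sub>R A u i) u"
    by (rule pd_cong)
      (use eventually_line_in_open[OF Op(1) u, of a] in \<open>eventually_elim, metis bounded_linear_euclidean_sum A(1)\<close>)
  also have "\<dots> = (\<Sum>i\<in>Basis. (g u \<bullet> i) *\<^sub>R pd a (\<lambda>u. A u i) u + (pd a g u \<bullet> i) *\<^sub>R A u i)"
    by (subst pd_sum)
      (auto intro!: smooth_on_scaleR smooth_on_inner smooth_on_const Op(1) A g u sum.cong
        simp: pd_scaleR[OF smooth_on_inner[OF Op(1) g smooth_on_const] A(2) u] pd_inner[OF g smooth_on_const u] pd_const)
  also have "\<dots> = pd a (\<lambda>x. A x (g u)) u + A u (pd a g u)"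
    using pd_op_linear(1)[OF A u, of a "g u"] bounded_linear_euclidean_sum[OF A(1)[OF u], of "pd a g u"]
    by (simp add: sum.distrib)
  finally show ?thesis .
qed

lemma sm\<phi>: "sm \<phi>" by (rule smooth_on_subset[OF D(6) Op(2)])

lemma smX: "sm (X b)" unfolding X_def[abs_def] by (rule sm_pd[OF sm\<phi>])

lemma smPD: "sm (\<lambda>u. PD a u v)" unfolding PD_def by (rule sm_pd[OF smP])

lemma linPD: "u \<in> Op \<Longrightarrow> linear (PD a u)"
  unfolding PD_def[abs_def] by (rule pd_op_linear(2)[OF linP smP])

lemma linPDD: "u \<in> Op \<Longrightarrow> linear (PDD a b u)"
  unfolding PDD_def[abs_def] by (rule pd_op_linear(2)[OF linPD smPD])

lemma smY0: "sm (Y0 b)"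
proof -
  have "sm (\<lambda>u. frechet_derivative (inv_into U \<phi>) (at (\<phi> u)) i)" for i
    by (rule smooth_on_compose[OF Op(1) D(4) smooth_on_frechet_derivative[OF D(7)] sm\<phi>]) (use Op(2) in auto)
  then show ?thesis unfolding Y0_def[abs_def]
    by (intro smooth_on_sum smooth_on_scaleR smooth_on_inner smooth_on_const Op(1))
qed

lemma smY: "sm (Y b)" unfolding Y_def[abs_def] by (rule sm_op[OF linP smP smY0])

lemma PX: "u \<in> V \<Longrightarrow> b \<in> B \<Longrightarrow> P u (X b u) = X b u"
  unfolding X_def by (rule PX0[OF VD(3)])

lemma PspanX: "u \<in> V \<Longrightarrow> P u v \<in> span ((\<lambda>b. X b u) ` B)"
  unfolding X_def using P_span[OF VD(3)] by simp

lemma PY: "u \<in> V \<Longrightarrow> P u (Y b u) = Y b u"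
  by (simp add: Y_def PV)

lemma dual: assumes u: "u \<in> V" and bc: "b \<in> B" "c \<in> B" shows "Y b u \<bullet> X c u = (if b = c then 1 else 0)"
proof -
  let ?L = "frechet_derivative (inv_into U \<phi>) (at (\<phi> u))"
  have linL: "linear ?L"
    using has_derivative_linear[OF smooth_on_has_derivative[OF D(7)]] VD(2)[OF u] by blast
  have "Y b u \<bullet> X c u = Y0 b u \<bullet> X c u" using PV(1)[OF u] PX[OF u bc(2)] by (simp add: Y_def)
  also have "\<dots> = b \<bullet> (\<Sum>i\<in>Basis. (X c u \<bullet> i) *\<^sub>R ?L i)"
    by (simp add: Y0_def inner_sum_left inner_sum_right mult.commute inner_commute)
  also have "\<dots> = b \<bullet> ?L (X c u)" using bounded_linear_euclidean_sum[OF linL, of "X c u"] by simp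
  also have "?L (X c u) = c"
    using slice_chart_inverse_derivative(1)[OF sc VD(2)[OF u], of c]
      pd_eq_frechet[OF smooth_on_differentiable[OF D(6) VD(2)[OF u]]] by (simp add: X_def)
  finally show ?thesis using bc D(1) by (auto simp: inner_Basis subset_iff)
qed

lemma expand: "u \<in> V \<Longrightarrow> (\<Sum>b\<in>B. (Y b u \<bullet> v) *\<^sub>R X b u) = P u v"
proof -
  assume u: "u \<in> V"
  have "(\<Sum>b\<in>B. (Y b u \<bullet> v) *\<^sub>R X b u) = (\<Sum>b\<in>B. (Y b u \<bullet> P u v) *\<^sub>R X b u)"
    using PV(1)[OF u, of "Y _ u" v] PY[OF u] by simp
  also have "\<dots> = P u v"
    by (rule dual_basis_expansion[OF D(2) dual[OF u] PspanX[OF u]])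
  finally show ?thesis .
qed

lemma metric_inv: "u \<in> V \<Longrightarrow> b \<in> B \<Longrightarrow> c \<in> B \<Longrightarrow> metric_inverse B G b c u = Y b u \<bullet> Y c u"
proof (rule metric_inverse_dual[where X = "\<lambda>b. X b u", OF D(2)])
  assume u: "u \<in> V"
  show "Y b u \<bullet> X c u = (if b = c then 1 else 0)" if "b \<in> B" "c \<in> B" for b c by (rule dual[OF u that])
  show "Y b u \<in> span ((\<lambda>b. X b u) ` B)" for b using PspanX[OF u, of "Y b u"] PY[OF u] by simp
qed (simp_all add: induced_metric_def X_def)

text \<open>The tangential part of the second derivatives of the embedding;
  \<open>christoffel_eq\<close> identifies it with the Christoffel symbol.\<close>

definition \<Gamma> where "\<Gamma> e a b u = Y e u \<bullet> pd a (X b) u"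

lemma X_comm: "u \<in> Op \<Longrightarrow> pd a (X b) u = pd b (X a) u"
  using pd_comm[OF sm\<phi>, of u a b] by (simp add: X_def[abs_def])

lemma \<Gamma>_sym: "u \<in> Op \<Longrightarrow> \<Gamma> e a b u = \<Gamma> e b a u"
  by (simp add: \<Gamma>_def X_comm)

lemma pd_G: "u \<in> Op \<Longrightarrow> pd a (G b c) u = X b u \<bullet> pd a (X c) u + pd a (X b) u \<bullet> X c u"
  using pd_inner[OF smX smX, of u a b c] by (simp add: induced_metric_def[abs_def] X_def[abs_def])

lemma christoffel_eq:
  assumes u: "u \<in> V" and dbc: "d \<in> B" "b \<in> B" "c \<in> B"
  shows "christoffel B G d b c u = \<Gamma> d b c u"
proof -
  have uO: "u \<in> Op" using VD(1)[OF u] .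
  have "pd b (G e c) u + pd c (G e b) u - pd e (G b c) u = 2 * (X e u \<bullet> pd b (X c) u)" for e
    using X_comm[OF uO, of c b] X_comm[OF uO, of e b] X_comm[OF uO, of e c]
    by (simp add: pd_G[OF uO] inner_commute)
  then have "christoffel B G d b c u = (\<Sum>e\<in>B. (Y d u \<bullet> Y e u) * (2 * (X e u \<bullet> pd b (X c) u))) / 2"
    unfolding christoffel_def by (simp add: metric_inv[OF u dbc(1)])
  also have "\<dots> = (\<Sum>e\<in>B. (Y e u \<bullet> Y d u) *\<^sub>R X e u) \<bullet> pd b (X c) u"
    by (simp add: inner_sum_left sum_divide_distrib inner_commute[of "Y d u"])
  also have "\<dots> = \<Gamma> d b c u" unfolding expand[OF u] PY[OF u] \<Gamma>_def ..
  finally show ?thesis .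
qed

lemma P_second: "u \<in> V \<Longrightarrow> (\<Sum>e\<in>B. \<Gamma> e a b u *\<^sub>R X e u) = P u (pd a (X b) u)"
  unfolding \<Gamma>_def by (rule expand)

text \<open>Derivative of \<open>P X = X\<close>. On tangent vectors \<open>PD\<close> is thus the
  normal part of the second derivatives of the embedding, the second fundamental form, and its
  symmetry is that of second derivatives.\<close>

lemma PD_X: assumes "u \<in> V" "a \<in> B" "b \<in> B" shows "PD a u (X b u) = pd a (X b) u - P u (pd a (X b) u)"
proof -
  have "pd a (\<lambda>u. P u (X b u)) u = pd a (X b) u"
    by (rule pd_V[OF assms(1,2)]) (use PX assms(3) in auto)
  then show ?thesis using pd_op[OF linP smP smX VD(1)[OF assms(1)], of a b] by (simp add: PD_def algebra_simps)
qed

lemma II_sym: "u \<in> V \<Longrightarrow> a \<in> B \<Longrightarrow> b \<in> B \<Longrightarrow> PD a u (X b u) = PD b u (X a u)"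
  using PD_X X_comm VD(1) by metis

lemma PD_sym: assumes "u \<in> V" "a \<in> B" shows "PD a u v \<bullet> x = v \<bullet> PD a u x"
proof -
  have "pd a (\<lambda>u. P u v \<bullet> x) u = pd a (\<lambda>u. v \<bullet> P u x) u"
    by (rule pd_V[OF assms]) (use PV in auto)
  then show ?thesis
    using pd_inner[OF smP smooth_on_const VD(1)[OF assms(1)], of a v x]
      pd_inner[OF smooth_on_const smP VD(1)[OF assms(1)], of a v x] by (simp add: PD_def pd_const)
qed

lemma PD_idem: assumes "u \<in> V" "a \<in> B" shows "PD a u v = PD a u (P u v) + P u (PD a u v)"
proof -
  have "pd a (\<lambda>u. P u (P u v)) u = pd a (\<lambda>u. P u v) u"
    by (rule pd_V[OF assms]) (use PV in auto)
  then show ?thesis using pd_op[OF linP smP smP VD(1)[OF assms(1)], of a v] by (simp add: PD_def)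
qed

text \<open>Derivative of an idempotent: range and kernel are exchanged, here and in
  \<open>PD_tangent\<close>.\<close>

lemma PD_normal: "u \<in> V \<Longrightarrow> a \<in> B \<Longrightarrow> P u v = v \<Longrightarrow> P u (PD a u v) = 0"
  using PD_idem[of u a v] by simp

lemma PD_tangent: "u \<in> V \<Longrightarrow> a \<in> B \<Longrightarrow> P u v = 0 \<Longrightarrow> P u (PD a u v) = PD a u v"
  using PD_idem[of u a v] linear_0[OF linPD] VD(1) by simp

lemma X_radial: assumes "u \<in> V" "b \<in> B" shows "X b u \<bullet> \<phi> u = 0"
proof -
  have "pd b (\<lambda>u. \<phi> u \<bullet> \<phi> u) u = pd b (\<lambda>u. 1::real) u"
    by (rule pd_V[OF assms]) (use unit VD(3) in auto)
  then show ?thesis using pd_inner[OF sm\<phi> sm\<phi> VD(1)[OF assms(1)], of b] by (simp add: pd_const X_def inner_commute)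
qed

lemma P_radial: assumes u: "u \<in> V" shows "P u (\<phi> u) = 0"
proof (rule span_orthogonal_eq_0[OF PspanX[OF u]])
  fix x assume "x \<in> (\<lambda>b. X b u) ` B"
  then obtain b where b: "b \<in> B" "x = X b u" by blast
  then show "P u (\<phi> u) \<bullet> x = 0"
    using PV(1)[OF u, of "\<phi> u" "X b u"] PX[OF u b(1)] X_radial[OF u b(1)] by (simp add: inner_commute)
qed

lemma PD_radial: assumes "u \<in> V" "a \<in> B" shows "PD a u (\<phi> u) = - X a u"
proof -
  have "pd a (\<lambda>u. P u (\<phi> u)) u = pd a (\<lambda>u. 0) u"
    by (rule pd_V[OF assms]) (rule P_radial)
  then have "PD a u (\<phi> u) + P u (X a u) = 0"
    using pd_op[OF linP smP sm\<phi> VD(1)[OF assms(1)], of a] by (simp add: PD_def pd_const X_def)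
  then show ?thesis using PX[OF assms] by (simp add: add_eq_0_iff2)
qed

text \<open>The Gauss equation in a flat space. Third derivatives of the embedding cancel, the
  products of Christoffel symbols cancel against the tangential parts in the derivative of
  \<open>Y d u \<bullet> pd b (X c) u\<close>, and the products of normal parts remain.\<close>

lemma riemann_eq:
  assumes u: "u \<in> V" and abcd: "a \<in> B" "b \<in> B" "c \<in> B" "d \<in> B"
  shows "riemann B G d c a b u = PD a u (Y d u) \<bullet> PD b u (X c u) - PD b u (Y d u) \<bullet> PD a u (X c u)"
proof -
  have uO: "u \<in> Op" using VD(1)[OF u] .
  have pdY: "pd a (Y d) u = PD a u (Y d u) + P u (pd a (Y d) u)" if "a \<in> B" for a
  proof -
    have "pd a (\<lambda>u. P u (Y d u)) u = pd a (Y d) u"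
      by (rule pd_V[OF u that]) (rule PY)
    then show ?thesis using pd_op[OF linP smP smY uO, of a d] by (simp add: PD_def)
  qed
  have YX: "pd a (Y d) u \<bullet> X e u = - \<Gamma> d a e u" if "a \<in> B" "e \<in> B" for a e
  proof -
    have "pd a (\<lambda>u. Y d u \<bullet> X e u) u = pd a (\<lambda>u. (if d = e then 1 else 0)::real) u"
      by (rule pd_V[OF u that(1)]) (rule dual[OF _ abcd(4) that(2)])
    then show ?thesis using pd_inner[OF smY smX uO, of a d e] by (simp add: \<Gamma>_def pd_const)
  qed
  have pdG: "pd a (christoffel B G d b c) u = Y d u \<bullet> pd a (pd b (X c)) u + PD a u (Y d u) \<bullet> PD b u (X c u)
      - (\<Sum>e\<in>B. \<Gamma> d a e u * \<Gamma> e b c u)" if ab: "a \<in> B" "b \<in> B" for a b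
  proof -
    have "pd a (christoffel B G d b c) u = pd a (\<lambda>u. Y d u \<bullet> pd b (X c) u) u"
      by (rule pd_V[OF u ab(1)]) (use christoffel_eq abcd ab in \<open>auto simp: \<Gamma>_def\<close>)
    also have "\<dots> = Y d u \<bullet> pd a (pd b (X c)) u + pd a (Y d) u \<bullet> pd b (X c) u"
      by (rule pd_inner[OF smY sm_pd[OF smX] uO])
    also have "pd b (X c) u = PD b u (X c u) + (\<Sum>e\<in>B. \<Gamma> e b c u *\<^sub>R X e u)"
      using PD_X[OF u ab(2) abcd(3)] P_second[OF u] by simp
    also have "pd a (Y d) u \<bullet> (PD b u (X c u) + (\<Sum>e\<in>B. \<Gamma> e b c u *\<^sub>R X e u)) =
        pd a (Y d) u \<bullet> PD b u (X c u) - (\<Sum>e\<in>B. \<Gamma> d a e u * \<Gamma> e b c u)"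
      by (simp add: inner_add_right inner_sum_right YX[OF ab(1)] sum_negf mult.commute)
    also have "pd a (Y d) u \<bullet> PD b u (X c u) = PD a u (Y d u) \<bullet> PD b u (X c u)"
    proof -
      have "P u (pd a (Y d) u) \<bullet> PD b u (X c u) = 0"
        using PV(1)[OF u] PD_normal[OF u ab(2) PX[OF u abcd(3)]] by simp
      then show ?thesis using pdY[OF ab(1)] by (metis add.right_neutral inner_add_left)
    qed
    finally show ?thesis by simp
  qed
  have comm: "pd a (pd b (X c)) u = pd b (pd a (X c)) u" by (rule pd_comm[OF smX uO])
  have "(\<Sum>e\<in>B. christoffel B G d a e u * christoffel B G e b c u - christoffel B G d b e u * christoffel B G e a c u)
      = (\<Sum>e\<in>B. \<Gamma> d a e u * \<Gamma> e b c u) - (\<Sum>e\<in>B. \<Gamma> d b e u * \<Gamma> e a c u)"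
    using abcd by (simp add: christoffel_eq[OF u] sum_subtractf)
  then show ?thesis
    unfolding riemann_def pdG[OF abcd(1,2)] pdG[OF abcd(2,1)] comm by simp
qed

text \<open>Replaces a trace over the moving frame by one over the fixed ambient basis, so that
  later derivatives do not meet the frame.\<close>

lemma sum_dual:
  assumes u: "u \<in> V" and S: "linear S" and T: "linear T"
  shows "(\<Sum>a\<in>B. S (Y a u) \<bullet> T (X a u)) = (\<Sum>i\<in>Basis. S (P u i) \<bullet> T (P u i))"
proof -
  have "(\<Sum>i\<in>Basis. S (P u i) \<bullet> T (P u i)) = (\<Sum>i\<in>Basis. \<Sum>a\<in>B. (Y a u \<bullet> i) * (S (P u i) \<bullet> T (X a u)))"
    by (simp add: expand[OF u, symmetric] linear_sum[OF T] linear_cmul[OF T] inner_sum_right)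
  also have "\<dots> = (\<Sum>a\<in>B. (\<Sum>i\<in>Basis. (Y a u \<bullet> i) *\<^sub>R S (P u i)) \<bullet> T (X a u))"
    by (subst sum.swap) (simp add: inner_sum_left)
  also have "\<dots> = (\<Sum>a\<in>B. S (P u (Y a u)) \<bullet> T (X a u))"
  proof -
    have "linear (\<lambda>v. S (P u v))" using linear_compose[OF linP[OF VD(1)[OF u]] S] by (simp add: o_def)
    note * = bounded_linear_euclidean_sum[OF this, symmetric]
    show ?thesis by (simp only: *)
  qed
  finally show ?thesis by (simp add: PY[OF u])
qed

text \<open>In the trace of the Gauss equation, minimality in the sphere leaves only the radial
  component of \<open>m\<close>, which produces the multiple of the metric. The factor is
  \<open>card B\<close>, not \<open>card B - 1\<close>, because half the Frobenius product contains
  one copy of the metric, contributed by the radial normal.\<close>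

lemma ricci_eq:
  assumes u: "u \<in> V" and bc: "b \<in> B" "c \<in> B"
    and minimal: "\<And>\<nu>. P u \<nu> = 0 \<Longrightarrow> \<nu> \<bullet> \<phi> u = 0 \<Longrightarrow> (\<Sum>a\<in>B. Y a u \<bullet> PD a u \<nu>) = 0"
  shows "ricci B G b c u = card B * G b c u - frob (PD b u) (PD c u) / 2"
proof -
  note uO = VD(1)[OF u]
  define m where "m = (\<Sum>a\<in>B. PD a u (Y a u))"
  have mv: "m \<bullet> v = (\<Sum>a\<in>B. Y a u \<bullet> PD a u v)" for v
    unfolding m_def inner_sum_left by (rule sum.cong) (auto simp: PD_sym[OF u])
  have Pm: "P u m = 0"
    unfolding m_def linear_sum[OF linP[OF uO]] by (rule sum.neutral) (use PD_normal[OF u _ PY[OF u]] in auto)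
  have m\<phi>: "m \<bullet> \<phi> u = - real (card B)"
  proof -
    have "m \<bullet> \<phi> u = (\<Sum>a\<in>B. - 1)"
      unfolding mv by (rule sum.cong) (auto simp: PD_radial[OF u] dual[OF u])
    then show ?thesis by simp
  qed
  define n where "n = PD b u (X c u)"
  have Pn: "P u n = 0" unfolding n_def by (rule PD_normal[OF u bc(1) PX[OF u bc(2)]])
  have n\<phi>: "n \<bullet> \<phi> u = - G b c u"
    unfolding n_def PD_sym[OF u bc(1)] PD_radial[OF u bc(1)]
    by (simp add: induced_metric_def X_def inner_commute)
  have "m \<bullet> (n - (n \<bullet> \<phi> u) *\<^sub>R \<phi> u) = 0"
    unfolding mv
    by (rule minimal) (simp_all add: linear_diff[OF linP[OF uO]] linear_cmul[OF linP[OF uO]] Pn P_radial[OF u]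
        inner_diff_left unit[OF VD(3)[OF u]])
  then have mn: "m \<bullet> n = card B * G b c u" by (simp add: inner_diff_right inner_add_right m\<phi> n\<phi> algebra_simps)
  have "ricci B G b c u = (\<Sum>a\<in>B. PD a u (Y a u) \<bullet> PD b u (X c u) - PD b u (Y a u) \<bullet> PD a u (X c u))"
    unfolding ricci_def by (rule sum.cong) (auto simp: riemann_eq[OF u _ bc])
  also have "\<dots> = m \<bullet> n - (\<Sum>a\<in>B. PD b u (Y a u) \<bullet> PD c u (X a u))"
    unfolding sum_subtractf m_def n_def inner_sum_left
    by (intro arg_cong2[where f = "(-)"] refl sum.cong) (auto simp: II_sym[OF u _ bc(2)])
  also have "(\<Sum>a\<in>B. PD b u (Y a u) \<bullet> PD c u (X a u)) = (\<Sum>i\<in>Basis. PD b u (P u i) \<bullet> PD c u (P u i))"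
    by (rule sum_dual[OF u linPD[OF uO] linPD[OF uO]])
  also have "\<dots> = frob (PD b u) (PD c u) / 2"
    using frob_off_diagonal(1)[OF linPD[OF uO] linPD[OF uO] linP[OF uO] PD_sym[OF u bc(1)] PD_sym[OF u bc(2)]
      PV(1)[OF u] PV(2)[OF u] PD_idem[OF u bc(2)]] by simp
  finally show ?thesis using mn by simp
qed

text \<open>The second covariant derivative of \<open>P\<close>.\<close>

definition Hs where "Hs a b u v = PDD a b u v - (\<Sum>e\<in>B. \<Gamma> e a b u *\<^sub>R PD e u v)"

lemma Hs_comm: "u \<in> Op \<Longrightarrow> Hs a b u v = Hs b a u v"
proof -
  assume u: "u \<in> Op"
  have e: "(\<lambda>u. PD c u v) = pd c (\<lambda>u. P u v)" for c by (simp add: fun_eq_iff PD_def)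
  show ?thesis unfolding Hs_def PDD_def e pd_comm[OF smP u, of a b v] \<Gamma>_sym[OF u, of _ a b] ..
qed

lemma linHs: "u \<in> Op \<Longrightarrow> linear (Hs a b u)"
  unfolding Hs_def[abs_def]
  by (intro linearI)
    (simp_all add: linear_add[OF linPD] linear_add[OF linPDD] linear_cmul[OF linPD] linear_cmul[OF linPDD]
      scaleR_add_right sum.distrib scaleR_sum_right scaleR_diff_right mult.commute)

lemma Hs_sym: assumes u: "u \<in> V" and ab: "a \<in> B" "b \<in> B" shows "Hs a b u v \<bullet> x = v \<bullet> Hs a b u x"
proof -
  have "pd a (\<lambda>u. PD b u v \<bullet> x) u = pd a (\<lambda>u. v \<bullet> PD b u x) u"
    by (rule pd_V[OF u ab(1)]) (use PD_sym ab(2) in auto)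
  then have "PDD a b u v \<bullet> x = v \<bullet> PDD a b u x"
    using pd_inner[OF smPD smooth_on_const VD(1)[OF u], of a b v x]
      pd_inner[OF smooth_on_const smPD VD(1)[OF u], of a v b x] by (simp add: PDD_def pd_const)
  moreover have "(\<Sum>e\<in>B. \<Gamma> e a b u *\<^sub>R PD e u v) \<bullet> x = v \<bullet> (\<Sum>e\<in>B. \<Gamma> e a b u *\<^sub>R PD e u x)"
    unfolding inner_sum_left inner_sum_right by (rule sum.cong) (auto simp: PD_sym[OF u])
  ultimately show ?thesis by (simp add: Hs_def inner_diff_left inner_diff_right)
qed

text \<open>The metric is parallel, and the Christoffel terms of \<open>nabla_ricci\<close> turn the
  second derivatives of \<open>P\<close> into the covariant ones, \<open>Hs\<close>.\<close>

lemma nabla_ricci_eq: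
  assumes u: "u \<in> V" and abc: "a \<in> B" "b \<in> B" "c \<in> B"
    and minimal: "\<And>u \<nu>. u \<in> V \<Longrightarrow> P u \<nu> = 0 \<Longrightarrow> \<nu> \<bullet> \<phi> u = 0 \<Longrightarrow> (\<Sum>a\<in>B. Y a u \<bullet> PD a u \<nu>) = 0"
  shows "nabla_ricci B G a b c u = - (frob (Hs a b u) (PD c u) + frob (PD b u) (Hs a c u)) / 2"
proof -
  note uO = VD(1)[OF u]
  define k where "k = real (card B)"
  have ric: "ricci B G b c u = k * G b c u - frob (PD b u) (PD c u) / 2" if "u \<in> V" "b \<in> B" "c \<in> B" for u b c
    unfolding k_def by (rule ricci_eq[OF that minimal[OF that(1)]])
  have smG: "sm (G b c)"
    unfolding induced_metric_def[abs_def] by (intro smooth_on_inner Op(1) smX[unfolded X_def[abs_def]])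
  have smF: "sm (\<lambda>u. PD b u i \<bullet> PD c u i)" for i by (intro smooth_on_inner Op(1) smPD)
  have "pd a (ricci B G b c) u = pd a (\<lambda>u. k * G b c u - (\<Sum>i\<in>Basis. PD b u i \<bullet> PD c u i) * (1 / 2)) u"
    by (rule pd_V[OF u abc(1)]) (simp add: ric abc frob_def)
  also have "\<dots> = k * pd a (G b c) u - (\<Sum>i\<in>Basis. PD b u i \<bullet> PDD a c u i + PDD a b u i \<bullet> PD c u i) * (1 / 2)"
    by (subst pd_diff pd_mult pd_sum pd_inner | intro smooth_on_mult smooth_on_const smG Op(1) smooth_on_sum smF smPD uO
       | simp add: pd_const PDD_def)+
  finally have 1: "pd a (ricci B G b c) u = k * pd a (G b c) u -
      (\<Sum>i\<in>Basis. PD b u i \<bullet> PDD a c u i + PDD a b u i \<bullet> PD c u i) * (1 / 2)" .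
  have metric: "pd a (G b c) u = (\<Sum>e\<in>B. \<Gamma> e a b u * G e c u + \<Gamma> e a c u * G b e u)"
  proof -
    have "pd a (G b c) u = P u (X b u) \<bullet> pd a (X c) u + pd a (X b) u \<bullet> P u (X c u)"
      by (simp add: pd_G[OF uO] PX[OF u] abc)
    also have "\<dots> = X b u \<bullet> P u (pd a (X c) u) + P u (pd a (X b) u) \<bullet> X c u"
      using PV(1)[OF u] by simp
    also have "\<dots> = (\<Sum>e\<in>B. \<Gamma> e a b u * G e c u + \<Gamma> e a c u * G b e u)"
      unfolding P_second[OF u, symmetric]
      by (simp add: inner_sum_left inner_sum_right sum.distrib induced_metric_def X_def add.commute)
    finally show ?thesis .
  qed
  have 2: "(\<Sum>e\<in>B. christoffel B G e a b u * ricci B G e c u + christoffel B G e a c u * ricci B G b e u) =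
      (\<Sum>e\<in>B. \<Gamma> e a b u * (k * G e c u - frob (PD e u) (PD c u) / 2) + \<Gamma> e a c u * (k * G b e u - frob (PD b u) (PD e u) / 2))"
    by (rule sum.cong) (auto simp: christoffel_eq[OF u] ric[OF u] abc)
  also have "\<dots> = k * pd a (G b c) u - ((\<Sum>e\<in>B. \<Gamma> e a b u * frob (PD e u) (PD c u)) + (\<Sum>e\<in>B. \<Gamma> e a c u * frob (PD b u) (PD e u))) / 2"
    unfolding metric sum_distrib_left sum.distrib[symmetric] sum_divide_distrib sum_subtractf[symmetric]
    by (rule sum.cong) (auto simp: algebra_simps)
  finally have 2: "(\<Sum>e\<in>B. christoffel B G e a b u * ricci B G e c u + christoffel B G e a c u * ricci B G b e u) =
      k * pd a (G b c) u - ((\<Sum>e\<in>B. \<Gamma> e a b u * frob (PD e u) (PD c u)) + (\<Sum>e\<in>B. \<Gamma> e a c u * frob (PD b u) (PD e u))) / 2" .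
  have 3: "frob (Hs a b u) (PD c u) = (\<Sum>i\<in>Basis. PDD a b u i \<bullet> PD c u i) - (\<Sum>e\<in>B. \<Gamma> e a b u * frob (PD e u) (PD c u))"
    unfolding frob_def Hs_def inner_diff_left sum_subtractf inner_sum_left
    by (subst sum.swap) (simp add: sum_distrib_left)
  have 4: "frob (PD b u) (Hs a c u) = (\<Sum>i\<in>Basis. PD b u i \<bullet> PDD a c u i) - (\<Sum>e\<in>B. \<Gamma> e a c u * frob (PD b u) (PD e u))"
    unfolding frob_def Hs_def inner_diff_right sum_subtractf inner_sum_right
    by (subst sum.swap) (simp add: sum_distrib_left)
  show ?thesis unfolding nabla_ricci_def 1 2 3 4 by (simp add: sum.distrib field_simps)
qed

end

section \<open>Shape operators satisfying a cubic relation\<close>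

context chart_geometry
begin

text \<open>At \<open>X a u\<close> the value is \<open>PD a u \<nu>\<close>, which is minus the
  tangential derivative of a normal field through \<open>\<nu>\<close>: this is the shape operator
  of \<open>\<nu>\<close>.\<close>

definition shp where "shp u \<nu> y = (\<Sum>a\<in>B. (Y a u \<bullet> y) *\<^sub>R PD a u \<nu>)"

text \<open>Differentiating the cubic relation \<open>A\<^sup>3 = |\<eta>|\<^sup>2 A\<close> for the shape operators along a normal field \<open>\<eta>\<close>.\<close>

lemma normal_cyclic:
  assumes cubic: "\<And>u \<nu> y. u \<in> V \<Longrightarrow> P u \<nu> = 0 \<Longrightarrow> \<nu> \<bullet> \<phi> u = 0 \<Longrightarrow>
      shp u \<nu> (shp u \<nu> (shp u \<nu> y)) = (\<nu> \<bullet> \<nu>) *\<^sub>R shp u \<nu> y"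
    and u: "u \<in> V" and \<nu>: "P u \<nu> = 0" "\<nu> \<bullet> \<phi> u = 0" "\<nu> \<bullet> \<nu> = 1"
    and abc: "a \<in> B" "b \<in> B" "c \<in> B"
  shows "Hs a b u \<nu> \<bullet> PD c u \<nu> + Hs b c u \<nu> \<bullet> PD a u \<nu> + Hs c a u \<nu> \<bullet> PD b u \<nu> = 0"
proof -
  note uO = VD(1)[OF u]
  \<comment> \<open>Extends \<open>\<nu>\<close> to a normal field by projection. At
    \<open>u\<close> its derivative is \<open>- PD e u \<nu>\<close>, which is tangential, so the
    field is parallel there for the normal connection.\<close>
  define \<eta> where "\<eta> x = \<nu> - P x \<nu> - (\<phi> x \<bullet> \<nu>) *\<^sub>R \<phi> x" for x
  define A where "A x y = (\<Sum>e\<in>B. (Y e x \<bullet> y) *\<^sub>R PD e x (\<eta> x))" for x y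
  have sm\<phi>\<nu>: "sm (\<lambda>x. (\<phi> x \<bullet> \<nu>) *\<^sub>R \<phi> x)"
    by (intro smooth_on_scaleR smooth_on_inner smooth_on_const Op(1) sm\<phi>)
  have sm\<nu>P: "sm (\<lambda>x. \<nu> - P x \<nu>)" by (intro smooth_on_diff smooth_on_const Op(1) smP)
  have sm\<eta>: "sm \<eta>"
    unfolding \<eta>_def[abs_def] by (rule smooth_on_diff[OF Op(1) sm\<nu>P sm\<phi>\<nu>])
  have linA: "linear (A x)" for x
    unfolding A_def[abs_def]
    by (intro linearI) (simp_all add: inner_add_right scaleR_add_left sum.distrib scaleR_sum_right)
  have smA: "sm (\<lambda>x. A x y)" for y
    unfolding A_def
    by (intro smooth_on_sum Op(1) smooth_on_scaleR smooth_on_inner smY smooth_on_const sm_op[OF linPD smPD sm\<eta>])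
  have \<eta>N: "P x (\<eta> x) = 0" "\<eta> x \<bullet> \<phi> x = 0" if x: "x \<in> V" for x
  proof -
    note xO = VD(1)[OF x]
    show "P x (\<eta> x) = 0"
      by (simp add: \<eta>_def linear_diff[OF linP[OF xO]] linear_cmul[OF linP[OF xO]] PV(2)[OF x] P_radial[OF x])
    show "\<eta> x \<bullet> \<phi> x = 0"
      using PV(1)[OF x, of \<nu> "\<phi> x"]
      by (simp add: \<eta>_def inner_diff_left P_radial[OF x] unit[OF VD(3)[OF x]] inner_commute[of \<nu> "\<phi> x"])
  qed
  have \<eta>u: "\<eta> u = \<nu>" using \<nu> by (simp add: \<eta>_def inner_commute)
  have cubV: "A x (A x (A x y)) = (\<eta> x \<bullet> \<eta> x) *\<^sub>R A x y" if "x \<in> V" for x y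
    using cubic[OF that \<eta>N[OF that]] by (simp add: A_def shp_def)
  have PA: "P x (A x y) = A x y" if x: "x \<in> V" for x y
    unfolding A_def linear_sum[OF linP[OF VD(1)[OF x]]] linear_cmul[OF linP[OF VD(1)[OF x]]]
    by (rule sum.cong) (simp_all add: PD_tangent[OF x _ \<eta>N(1)[OF x]])
  have AP: "A x (P x y) = A x y" if x: "x \<in> V" for x y
    unfolding A_def by (rule sum.cong) (simp_all add: PV(1)[OF x, symmetric] PY[OF x])
  have Aexp: "A x y \<bullet> z = (\<Sum>e\<in>B. \<Sum>f\<in>B. (Y e x \<bullet> y) * (Y f x \<bullet> z) * (\<eta> x \<bullet> PD e x (X f x)))" if x: "x \<in> V" for x y z
  proof -
    have "A x y \<bullet> z = A x y \<bullet> P x z" using PA[OF x, of y] PV(1)[OF x] by metis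
    also have "\<dots> = (\<Sum>e\<in>B. \<Sum>f\<in>B. (Y e x \<bullet> y) * ((Y f x \<bullet> z) * (PD e x (\<eta> x) \<bullet> X f x)))"
      unfolding expand[OF x, symmetric] A_def inner_sum_left inner_sum_right
      by (subst sum.swap) (simp add: sum_distrib_left mult.left_commute)
    finally show ?thesis by (simp add: PD_sym[OF x] mult.assoc)
  qed
  have Asym: "A x y \<bullet> z = A x z \<bullet> y" if x: "x \<in> V" for x y z
    unfolding Aexp[OF x] by (subst sum.swap) (intro sum.cong refl, simp add: II_sym[OF x] mult_ac)
  have AX: "A x (X e x) = PD e x (\<eta> x)" if x: "x \<in> V" and e: "e \<in> B" for x e
  proof -
    have "A x (X e x) = (\<Sum>f\<in>B. if f = e then PD f x (\<eta> x) else 0)"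
      unfolding A_def by (rule sum.cong) (auto simp: dual[OF x _ e])
    then show ?thesis using e D(2) by simp
  qed
  have tangent: "P u (PD e u \<nu>) = PD e u \<nu>" if "e \<in> B" for e by (rule PD_tangent[OF u that \<nu>(1)])
  have pd\<eta>: "pd e \<eta> u = - PD e u \<nu>" if e: "e \<in> B" for e
  proof -
    have X\<nu>: "X e u \<bullet> \<nu> = 0" using PV(1)[OF u, of "X e u" \<nu>] PX[OF u e] \<nu>(1) by simp
    have "pd e \<eta> u = pd e (\<lambda>x. \<nu> - P x \<nu>) u - pd e (\<lambda>x. (\<phi> x \<bullet> \<nu>) *\<^sub>R \<phi> x) u"
      unfolding \<eta>_def[abs_def] by (rule pd_diff[OF sm\<nu>P sm\<phi>\<nu> uO])
    also have "pd e (\<lambda>x. \<nu> - P x \<nu>) u = - PD e u \<nu>"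
      using pd_diff[OF smooth_on_const smP uO, of e \<nu> \<nu>] by (simp add: pd_const PD_def)
    also have "pd e (\<lambda>x. (\<phi> x \<bullet> \<nu>) *\<^sub>R \<phi> x) u = (\<phi> u \<bullet> \<nu>) *\<^sub>R pd e \<phi> u + pd e (\<lambda>x. \<phi> x \<bullet> \<nu>) u *\<^sub>R \<phi> u"
      by (rule pd_scaleR[OF smooth_on_inner[OF Op(1) sm\<phi> smooth_on_const] sm\<phi> uO])
    also have "\<dots> = 0"
      using pd_inner[OF sm\<phi> smooth_on_const uO, of e \<nu>] X\<nu> \<nu>(2) by (simp add: pd_const X_def inner_commute)
    finally show ?thesis by simp
  qed
  define Ac where "Ac e y = pd e (\<lambda>x. A x y) u" for e y
  have linAc: "linear (Ac e)" for e unfolding Ac_def[abs_def] by (rule pd_op_linear(2)[OF linA smA uO])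
  have smAA: "sm (\<lambda>x. A x (A x y))" for y by (rule sm_op[OF linA smA smA])
  \<comment> \<open>The cubic relation is differentiated at \<open>u\<close>; the factor
    \<open>\<eta> \<bullet> \<eta>\<close> is stationary there.\<close>
  have relA: "Ac e (A u (A u y)) + A u (Ac e (A u y)) + A u (A u (Ac e y)) = Ac e y" if e: "e \<in> B" for e y
  proof -
    have "pd e (\<lambda>x. A x (A x (A x y))) u = pd e (\<lambda>x. (\<eta> x \<bullet> \<eta> x) *\<^sub>R A x y) u"
      by (rule pd_V[OF u e]) (rule cubV)
    also have "\<dots> = (\<eta> u \<bullet> \<eta> u) *\<^sub>R Ac e y + pd e (\<lambda>x. \<eta> x \<bullet> \<eta> x) u *\<^sub>R A u y"
      unfolding Ac_def by (rule pd_scaleR[OF smooth_on_inner[OF Op(1) sm\<eta> sm\<eta>] smA uO])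
    also have "pd e (\<lambda>x. \<eta> x \<bullet> \<eta> x) u = 0"
    proof -
      have "\<nu> \<bullet> PD e u \<nu> = 0" using PV(1)[OF u, of \<nu> "PD e u \<nu>"] tangent[OF e] \<nu>(1) by simp
      then show ?thesis using pd_inner[OF sm\<eta> sm\<eta> uO, of e] by (simp add: pd\<eta>[OF e] \<eta>u inner_commute)
    qed
    finally have 1: "pd e (\<lambda>x. A x (A x (A x y))) u = Ac e y" by (simp add: \<eta>u \<nu>)
    have 2: "pd e (\<lambda>x. A x (A x (A x y))) u = Ac e (A u (A u y)) + A u (pd e (\<lambda>x. A x (A x y)) u)"
      unfolding Ac_def by (rule pd_op[OF linA smA smAA uO])
    have 3: "pd e (\<lambda>x. A x (A x y)) u = Ac e (A u y) + A u (Ac e y)"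
      unfolding Ac_def by (rule pd_op[OF linA smA smA uO])
    show ?thesis using 1 unfolding 2 3 linear_add[OF linA] by (simp add: add.assoc)
  qed
  have Acsym: "Ac e y \<bullet> z = Ac e z \<bullet> y" if e: "e \<in> B" for e y z
  proof -
    have "pd e (\<lambda>x. A x y \<bullet> z) u = pd e (\<lambda>x. A x z \<bullet> y) u"
      by (rule pd_V[OF u e]) (rule Asym)
    then show ?thesis
      using pd_inner[OF smA smooth_on_const uO, of e y z] pd_inner[OF smA smooth_on_const uO, of e z y]
      by (simp add: Ac_def pd_const)
  qed
  \<comment> \<open>Derivative of \<open>A (X f) = PD f \<eta>\<close>. The term from the derivative
    of \<open>\<eta>\<close> is normal and disappears against tangent vectors.\<close>
  have AcX: "Ac e (X f u) \<bullet> P u z = Hs e f u \<nu> \<bullet> P u z" if e: "e \<in> B" and f: "f \<in> B" for e f z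
  proof -
    have "pd e (\<lambda>x. A x (X f x)) u = pd e (\<lambda>x. PD f x (\<eta> x)) u"
      by (rule pd_V[OF u e]) (rule AX[OF _ f])
    then have "Ac e (X f u) + A u (pd e (X f) u) = PDD e f u \<nu> + PD f u (pd e \<eta> u)"
      using pd_op[OF linA smA smX uO, of e f] pd_op[OF linPD smPD sm\<eta> uO, of e f] by (simp add: Ac_def PDD_def \<eta>u)
    moreover have "A u (pd e (X f) u) = (\<Sum>g\<in>B. \<Gamma> g e f u *\<^sub>R PD g u \<nu>)"
    proof -
      have "A u (pd e (X f) u) = A u (\<Sum>g\<in>B. \<Gamma> g e f u *\<^sub>R X g u)" unfolding P_second[OF u] AP[OF u] ..
      then show ?thesis by (simp add: linear_sum[OF linA] linear_cmul[OF linA] AX[OF u] \<eta>u)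
    qed
    ultimately have "Ac e (X f u) = Hs e f u \<nu> - PD f u (PD e u \<nu>)"
      by (simp add: Hs_def pd\<eta>[OF e] linear_neg[OF linPD[OF uO]] algebra_simps)
    moreover have "PD f u (PD e u \<nu>) \<bullet> P u z = 0"
      unfolding PV(1)[OF u, symmetric] PD_normal[OF u f tangent[OF e]] by simp
    ultimately show ?thesis by (simp add: inner_diff_left)
  qed
  \<comment> \<open>The derivative of the shape operators as a trilinear form on tangent vectors. It
    is symmetric in the first two arguments since \<open>Hs\<close> is, which is the Codazzi
    equation, and in the last two since each \<open>Ac e\<close> is.\<close>
  define T where "T x y z = (\<Sum>e\<in>B. \<Sum>f\<in>B. (Y e u \<bullet> x) * (Y f u \<bullet> y) * (Hs e f u \<nu> \<bullet> P u z))" for x y z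
  have Talt: "T x y z = (\<Sum>e\<in>B. (Y e u \<bullet> x) * (Ac e (P u y) \<bullet> P u z))" for x y z
    unfolding T_def
  proof (rule sum.cong[OF refl])
    fix e assume e: "e \<in> B"
    have "Ac e (P u y) \<bullet> P u z = Ac e (\<Sum>f\<in>B. (Y f u \<bullet> y) *\<^sub>R X f u) \<bullet> P u z" unfolding expand[OF u] ..
    also have "\<dots> = (\<Sum>f\<in>B. (Y f u \<bullet> y) * (Hs e f u \<nu> \<bullet> P u z))"
      by (simp add: linear_sum[OF linAc] linear_cmul[OF linAc] inner_sum_left AcX[OF e])
    finally show "(\<Sum>f\<in>B. (Y e u \<bullet> x) * (Y f u \<bullet> y) * (Hs e f u \<nu> \<bullet> P u z)) = (Y e u \<bullet> x) * (Ac e (P u y) \<bullet> P u z)"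
      by (simp add: sum_distrib_left mult.assoc)
  qed
  have sym1: "T x y z = T y x z" for x y z
    unfolding T_def by (subst sum.swap) (intro sum.cong refl, simp add: Hs_comm[OF uO] mult_ac)
  have sym2: "T x y z = T x z y" for x y z
    unfolding Talt using Acsym by (intro sum.cong refl) auto
  have A3: "A u (A u (A u y)) = A u y" for y using cubV[OF u, of y] by (simp add: \<eta>u \<nu>)
  have rel: "T x (A u (A u y)) z + T x (A u y) (A u z) + T x y (A u (A u z)) = T x y z" for x y z
  proof -
    have "Ac e (P u (A u (A u y))) \<bullet> P u z + Ac e (P u (A u y)) \<bullet> P u (A u z) + Ac e (P u y) \<bullet> P u (A u (A u z))
        = Ac e (P u y) \<bullet> P u z" if e: "e \<in> B" for e
    proof -
      have 1: "Ac e (P u (A u (A u y))) = Ac e (A u (A u (P u y)))" by (simp add: PA[OF u] AP[OF u])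
      have "Ac e (P u (A u y)) \<bullet> P u (A u z) = Ac e (A u (P u y)) \<bullet> A u (P u z)" by (simp add: PA[OF u] AP[OF u])
      also have "\<dots> = A u (Ac e (A u (P u y))) \<bullet> P u z"
        unfolding Asym[OF u, of "Ac e (A u (P u y))"] by (rule inner_commute)
      finally have 2: "Ac e (P u (A u y)) \<bullet> P u (A u z) = A u (Ac e (A u (P u y))) \<bullet> P u z" .
      have "Ac e (P u y) \<bullet> P u (A u (A u z)) = Ac e (P u y) \<bullet> A u (A u (P u z))" by (simp add: PA[OF u] AP[OF u])
      also have "\<dots> = A u (Ac e (P u y)) \<bullet> A u (P u z)"
        unfolding Asym[OF u, of "Ac e (P u y)"] by (rule inner_commute)
      also have "\<dots> = A u (A u (Ac e (P u y))) \<bullet> P u z"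
        unfolding Asym[OF u, of "A u (Ac e (P u y))"] by (rule inner_commute)
      finally have 3: "Ac e (P u y) \<bullet> P u (A u (A u z)) = A u (A u (Ac e (P u y))) \<bullet> P u z" .
      show ?thesis unfolding 1 2 3 inner_add_left[symmetric] relA[OF e] ..
    qed
    then show ?thesis
      unfolding Talt sum.distrib[symmetric] distrib_left[symmetric] by (intro sum.cong refl) auto
  qed
  have TX: "T (X e u) (X f u) (A u (X g u)) = Hs e f u \<nu> \<bullet> PD g u \<nu>" if efg: "e \<in> B" "f \<in> B" "g \<in> B" for e f g
  proof -
    have "T (X e u) (X f u) (A u (X g u)) = (\<Sum>e'\<in>B. \<Sum>f'\<in>B. if e' = e then (if f' = f then Hs e' f' u \<nu> \<bullet> P u (A u (X g u)) else 0) else 0)"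
      unfolding T_def by (intro sum.cong refl) (simp add: dual[OF u] efg)
    also have "\<dots> = (\<Sum>e'\<in>B. if e' = e then Hs e' f u \<nu> \<bullet> P u (A u (X g u)) else 0)"
      by (rule sum.cong) (use efg D(2) in auto)
    also have "\<dots> = Hs e f u \<nu> \<bullet> P u (A u (X g u))"
      using efg D(2) by simp
    finally show ?thesis by (simp add: AX[OF u] efg \<eta>u tangent)
  qed
  have "T (A u (X a u)) (X b u) (X c u) + T (X a u) (A u (X b u)) (X c u) + T (X a u) (X b u) (A u (X c u)) = 0"
    by (rule trilinear_cubic[of T "A u", OF sym1 sym2 A3 rel])
  moreover have "T (A u (X a u)) (X b u) (X c u) = T (X b u) (X c u) (A u (X a u))"
    using sym1 sym2 by metis
  moreover have "T (X a u) (A u (X b u)) (X c u) = T (X c u) (X a u) (A u (X b u))"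
    using sym1 sym2 by metis
  ultimately show ?thesis using TX abc by simp
qed

text \<open>By \<open>frob_off_diagonal\<close> the cyclic sum is a multiple of the trace of
  \<open>\<beta>\<close> over the normal space in the ambient space. On normals tangent to the
  sphere \<open>\<beta> \<nu> \<nu>\<close> vanishes by \<open>normal_cyclic\<close>, at
  \<open>\<phi> u\<close> it vanishes by \<open>PD_radial\<close>, and the mixed terms cancel in the
  trace because these two parts of the normal space are orthogonal.\<close>

theorem cyclic_nabla_ricci:
  assumes minimal: "\<And>u \<nu>. u \<in> V \<Longrightarrow> P u \<nu> = 0 \<Longrightarrow> \<nu> \<bullet> \<phi> u = 0 \<Longrightarrow> (\<Sum>a\<in>B. Y a u \<bullet> PD a u \<nu>) = 0"
    and cubic: "\<And>u \<nu> y. u \<in> V \<Longrightarrow> P u \<nu> = 0 \<Longrightarrow> \<nu> \<bullet> \<phi> u = 0 \<Longrightarrow>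
      shp u \<nu> (shp u \<nu> (shp u \<nu> y)) = (\<nu> \<bullet> \<nu>) *\<^sub>R shp u \<nu> y"
    and u: "u \<in> V" and abc: "a \<in> B" "b \<in> B" "c \<in> B"
  shows "nabla_ricci B G a b c u + nabla_ricci B G b c a u + nabla_ricci B G c a b u = 0"
proof -
  note uO = VD(1)[OF u]
  define \<beta> where "\<beta> x y = Hs a b u x \<bullet> PD c u y + Hs b c u x \<bullet> PD a u y + Hs c a u x \<bullet> PD b u y" for x y
  have add1: "\<beta> (x + y) z = \<beta> x z + \<beta> y z" and add2: "\<beta> z (x + y) = \<beta> z x + \<beta> z y"
    and mul1: "\<beta> (r *\<^sub>R x) z = r * \<beta> x z" and mul2: "\<beta> z (r *\<^sub>R x) = r * \<beta> z x" for x y z r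
    unfolding \<beta>_def
    by (simp_all add: linear_add[OF linHs[OF uO]] linear_add[OF linPD[OF uO]] linear_cmul[OF linHs[OF uO]]
        linear_cmul[OF linPD[OF uO]] inner_add_left inner_add_right distrib_left)
  have z1: "\<beta> 0 x = 0" and z2: "\<beta> x 0 = 0" for x using mul1[of 0 0 x] mul2[of x 0 0] by simp_all
  have sum1: "\<beta> (\<Sum>i\<in>I. f i) z = (\<Sum>i\<in>I. \<beta> (f i) z)" and sum2: "\<beta> z (\<Sum>i\<in>I. f i) = (\<Sum>i\<in>I. \<beta> z (f i))" for I :: "'a set" and f z
    by (induction I rule: infinite_finite_induct) (auto simp: z1 z2 add1 add2)
  have normal: "\<beta> \<nu> \<nu> = 0" if \<nu>: "P u \<nu> = 0" "\<nu> \<bullet> \<phi> u = 0" for \<nu>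
  proof (cases "\<nu> = 0")
    case True
    then show ?thesis by (simp add: z1)
  next
    case False
    define \<nu>1 where "\<nu>1 = (1 / norm \<nu>) *\<^sub>R \<nu>"
    have \<nu>1: "P u \<nu>1 = 0" "\<nu>1 \<bullet> \<phi> u = 0" "\<nu>1 \<bullet> \<nu>1 = 1"
      using False \<nu> by (simp_all add: \<nu>1_def linear_cmul[OF linP[OF uO]] dot_square_norm power2_eq_square)
    have "\<beta> \<nu>1 \<nu>1 = 0"
      unfolding \<beta>_def by (rule normal_cyclic[OF _ u \<nu>1 abc]) (rule cubic)
    then show ?thesis using False by (simp add: \<nu>1_def mul1 mul2)
  qed
  have radial: "Hs e f u (\<phi> u) \<bullet> X g u = 0" if efg: "e \<in> B" "f \<in> B" "g \<in> B" for e f g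
  proof -
    have "pd e (\<lambda>x. PD f x (\<phi> x)) u = pd e (\<lambda>x. - X f x) u"
      by (rule pd_V[OF u efg(1)]) (rule PD_radial[OF _ efg(2)])
    moreover have "pd e (\<lambda>x. - X f x) u = - pd e (X f) u"
      by (intro pd_eqI has_vector_derivative_minus sm_line[OF smX uO])
    ultimately have 1: "PDD e f u (\<phi> u) = - pd e (X f) u - PD f u (X e u)"
      using pd_op[OF linPD smPD sm\<phi> uO, of e f] by (simp add: PDD_def X_def algebra_simps)
    have 2: "(\<Sum>g\<in>B. \<Gamma> g e f u *\<^sub>R PD g u (\<phi> u)) = - P u (pd e (X f) u)"
      unfolding P_second[OF u, symmetric] sum_negf[symmetric] by (rule sum.cong) (auto simp: PD_radial[OF u])
    have "Hs e f u (\<phi> u) = - PD e u (X f u) - PD f u (X e u)"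
      unfolding Hs_def 1 2 using PD_X[OF u efg(1,2)] by simp
    moreover have "PD e u (X f u) \<bullet> X g u = 0" if "e \<in> B" "f \<in> B" for e f
      using PV(1)[OF u, of "PD e u (X f u)" "X g u"] PX[OF u efg(3)] PD_normal[OF u that(1) PX[OF u that(2)]] by simp
    ultimately show ?thesis using efg by (simp add: inner_diff_left)
  qed
  have radial\<beta>: "\<beta> (\<phi> u) (\<phi> u) = 0"
    unfolding \<beta>_def using radial abc by (simp add: PD_radial[OF u])
  define \<mu> where "\<mu> i = i - P u i - (\<phi> u \<bullet> i) *\<^sub>R \<phi> u" for i
  have \<mu>N: "P u (\<mu> i) = 0" "\<mu> i \<bullet> \<phi> u = 0" for i
    using PV(1)[OF u, of i "\<phi> u"]
    by (simp_all add: \<mu>_def linear_diff[OF linP[OF uO]] linear_cmul[OF linP[OF uO]] PV(2)[OF u] P_radial[OF u]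
        inner_diff_left unit[OF VD(3)[OF u]] inner_commute[of i "\<phi> u"])
  have \<beta>i: "\<beta> (i - P u i) (i - P u i) = (\<phi> u \<bullet> i) * \<beta> (\<mu> i) (\<phi> u) + (\<phi> u \<bullet> i) * \<beta> (\<phi> u) (\<mu> i)" for i
  proof -
    have e: "i - P u i = \<mu> i + (\<phi> u \<bullet> i) *\<^sub>R \<phi> u" by (simp add: \<mu>_def)
    show ?thesis unfolding e add1 add2 mul1 mul2 radial\<beta> normal[OF \<mu>N] by simp
  qed
  \<comment> \<open>The mixed terms of \<open>\<beta>i\<close> add up to values of
    \<open>\<beta>\<close> at this sum, which is the image of \<open>\<phi> u\<close> under a
    projection that kills it.\<close>
  have \<mu>sum: "(\<Sum>i\<in>Basis. (\<phi> u \<bullet> i) *\<^sub>R \<mu> i) = 0"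
  proof -
    have "linear \<mu>" unfolding \<mu>_def[abs_def]
      by (intro linearI) (simp_all add: linear_add[OF linP[OF uO]] linear_cmul[OF linP[OF uO]] inner_add_right algebra_simps)
    then have "(\<Sum>i\<in>Basis. (\<phi> u \<bullet> i) *\<^sub>R \<mu> i) = \<mu> (\<phi> u)" by (rule bounded_linear_euclidean_sum[symmetric])
    then show ?thesis using unit[OF VD(3)[OF u]] P_radial[OF u] by (simp add: \<mu>_def)
  qed
  have "(\<Sum>i\<in>Basis. \<beta> (i - P u i) (i - P u i)) =
      \<beta> (\<Sum>i\<in>Basis. (\<phi> u \<bullet> i) *\<^sub>R \<mu> i) (\<phi> u) + \<beta> (\<phi> u) (\<Sum>i\<in>Basis. (\<phi> u \<bullet> i) *\<^sub>R \<mu> i)"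
    unfolding sum1 sum2 mul1 mul2 \<beta>i sum.distrib ..
  then have sum0: "(\<Sum>i\<in>Basis. \<beta> (i - P u i) (i - P u i)) = 0" by (simp add: \<mu>sum z1 z2)
  have fr: "frob (Hs e f u) (PD g u) = 2 * (\<Sum>i\<in>Basis. Hs e f u (i - P u i) \<bullet> PD g u (i - P u i))"
    if "e \<in> B" "f \<in> B" "g \<in> B" for e f g
    by (rule frob_off_diagonal(2)[OF linHs[OF uO] linPD[OF uO] linP[OF uO] Hs_sym[OF u that(1,2)]
        PD_sym[OF u that(3)] PV(1)[OF u] PV(2)[OF u] PD_idem[OF u that(3)]])
  have "frob (Hs a b u) (PD c u) + frob (Hs b c u) (PD a u) + frob (Hs c a u) (PD b u) =
      2 * (\<Sum>i\<in>Basis. \<beta> (i - P u i) (i - P u i))"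
    unfolding fr[OF abc] fr[OF abc(2,3,1)] fr[OF abc(3,1,2)] \<beta>_def sum.distrib by simp
  then have Z: "frob (Hs a b u) (PD c u) + frob (Hs b c u) (PD a u) + frob (Hs c a u) (PD b u) = 0"
    using sum0 by simp
  have fc: "frob S T = frob T S" for S T :: "'a \<Rightarrow> 'a" unfolding frob_def by (simp add: inner_commute)
  have hc: "Hs e f u = Hs f e u" for e f using Hs_comm[OF uO] by blast
  have halves: "- (p + r) / 2 + - (q + p) / 2 + - (r + q) / 2 = 0" if "p + q + r = 0" for p q r :: real
    using that by (simp add: field_simps)
  have n: "nabla_ricci B G e f g u = - (frob (Hs e f u) (PD g u) + frob (PD f u) (Hs e g u)) / 2"
    if "e \<in> B" "f \<in> B" "g \<in> B" for e f g
    using nabla_ricci_eq[OF u that] minimal by blast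
  show ?thesis
    unfolding n[OF abc] n[OF abc(2,3,1)] n[OF abc(3,1,2)] hc[of a c] hc[of b a] hc[of c b]
      fc[of "PD b u" "Hs c a u"] fc[of "PD c u" "Hs a b u"] fc[of "PD a u" "Hs b c u"]
    by (rule halves[OF Z])
qed

end

section \<open>Shape operators of the focal set\<close>

lemma trc_projection:
  fixes Q :: "'a::euclidean_space \<Rightarrow> 'a"
  assumes lin: "linear Q" and sym: "\<And>v x. Q v \<bullet> x = v \<bullet> Q x" and idem: "\<And>v. Q (Q v) = Q v"
  shows "trc Q = dim (range Q)"
proof -
  have sub: "subspace (range Q)" using linear_subspace_image[OF lin subspace_UNIV] .
  obtain Ob where Ob: "Ob \<subseteq> range Q" "pairwise orthogonal Ob" "\<And>x. x \<in> Ob \<Longrightarrow> norm x = 1"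
    "independent Ob" "card Ob = dim (range Q)" "span Ob = range Q"
    using orthonormal_basis_subspace[OF sub] by blast
  have fin: "finite Ob" using Ob(4) independent_imp_finite by blast
  have orth: "x \<bullet> y = (if x = y then 1 else 0)" if "x \<in> Ob" "y \<in> Ob" for x y
    using Ob(2,3) that by (auto simp: pairwise_def orthogonal_def norm_eq_1)
  have QO: "Q x = x" if "x \<in> Ob" for x using Ob(1) that idem by auto
  have Q: "Q v = (\<Sum>x\<in>Ob. (x \<bullet> v) *\<^sub>R x)" for v
  proof -
    have "(\<Sum>x\<in>Ob. (x \<bullet> Q v) *\<^sub>R x) = Q v"
      by (rule dual_basis_expansion[where X = "\<lambda>x. x" and Y = "\<lambda>x. x", OF fin orth]) (use Ob(6) in auto)
    moreover have "x \<bullet> Q v = x \<bullet> v" if "x \<in> Ob" for x using sym[of x v] QO[OF that] by simp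
    ultimately show ?thesis by simp
  qed
  have "trc Q = (\<Sum>i\<in>Basis. \<Sum>x\<in>Ob. (x \<bullet> i) * (x \<bullet> i))"
    unfolding trc_def Q by (simp add: inner_sum_left)
  also have "\<dots> = (\<Sum>x\<in>Ob. x \<bullet> x)"
    by (subst sum.swap) (simp add: euclidean_inner[symmetric])
  also have "\<dots> = real (card Ob)" by (simp add: orth)
  finally show ?thesis using Ob(5) by simp
qed

lemma integer_valued_constant:
  fixes f :: "'a::topological_space \<Rightarrow> real"
  assumes "connected S" "continuous_on S f" "\<And>x. x \<in> S \<Longrightarrow> f x \<in> \<int>" "x \<in> S" "y \<in> S"
  shows "f x = f y"
proof -
  have "f constant_on S"
  proof (rule continuous_discrete_range_constant[OF assms(1,2)])
    fix x assume x: "x \<in> S"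
    have "1 \<le> norm (f y - f x)" if y: "y \<in> S" "f y \<noteq> f x" for y
    proof -
      obtain m n where "f y = of_int m" "f x = of_int n"
        using assms(3)[OF x] assms(3)[OF y(1)] by (auto elim!: Ints_cases)
      then show ?thesis using y(2) by (auto simp: of_int_diff[symmetric] simp del: of_int_diff)
    qed
    then show "\<exists>e>0. \<forall>y. y \<in> S \<and> f y \<noteq> f x \<longrightarrow> e \<le> norm (f y - f x)" by (intro exI[of _ 1]) auto
  qed
  then show ?thesis using assms(4,5) by (auto simp: constant_on_def)
qed

text \<open>\<open>Q 1\<close> and \<open>Q (- 1)\<close> are the projections onto the eigenspaces
  for \<open>1\<close> and \<open>- 1\<close>; the trace is the difference of their ranks.\<close>

lemma trc_cubic_Ints:
  fixes A :: "'a::euclidean_space \<Rightarrow> 'a"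
  assumes lin: "linear A" and sym: "\<And>v x. A v \<bullet> x = v \<bullet> A x" and cubic: "\<And>v. A (A (A v)) = A v"
  shows "trc A \<in> \<int>"
proof -
  define Q where "Q r v = (1 / 2) *\<^sub>R (A (A v) + r *\<^sub>R A v)" for r v
  have linA: "A (v + x) = A v + A x" "A (k *\<^sub>R v) = k *\<^sub>R A v" for v x k
    using lin by (simp_all add: linear_add linear_cmul)
  have dimQ: "trc (Q r) = dim (range (Q r))" if "r * r = 1" for r
  proof (rule trc_projection)
    show "linear (Q r)" unfolding Q_def[abs_def] by (intro linearI) (simp_all add: linA algebra_simps)
    show "Q r v \<bullet> x = v \<bullet> Q r x" for v x by (simp add: Q_def inner_add_left inner_add_right sym)
    show "Q r (Q r v) = Q r v" for v
    proof -
      have a: "A (Q r v) = (1 / 2) *\<^sub>R (A v + r *\<^sub>R A (A v))"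
        and b: "A (A (Q r v)) = (1 / 2) *\<^sub>R (A (A v) + r *\<^sub>R A v)" by (simp_all add: Q_def linA cubic)
      have "Q r (Q r v) = (1 / 4) *\<^sub>R ((1 + r * r) *\<^sub>R A (A v) + (2 * r) *\<^sub>R A v)"
        unfolding Q_def[of r "Q r v"] b unfolding a
        by (rule euclidean_eqI) (simp add: inner_add_left field_simps)
      also have "\<dots> = Q r v" by (simp add: Q_def that scaleR_add_right)
      finally show ?thesis .
    qed
  qed
  have "trc A = trc (Q 1) - trc (Q (- 1))"
    by (simp add: trc_def Q_def inner_add_left inner_diff_left sum_subtractf[symmetric] algebra_simps)
  then show ?thesis using dimQ[of 1] dimQ[of "-1"] by simp
qed

context transnormal
begin

lemma HH_symmetric:
  assumes "x \<noteq> 0"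
  shows "HH x v u \<bullet> y = HH x v y \<bullet> u" "HH x v u = HH x u v"
proof -
  show "HH x v u = HH x u v"
    unfolding HH_def H_def using second_derivative_symmetric[OF open_punctured _ smJ, of x u v] assms by simp
  have "((\<lambda>z. H z u \<bullet> y) has_derivative (\<lambda>v. HH x v u \<bullet> y)) (at x)"
    by (intro has_derivative_inner_left d_H_const assms)
  then have "((\<lambda>z. H z y \<bullet> u) has_derivative (\<lambda>v. HH x v u \<bullet> y)) (at x)"
    by (rule has_derivative_transform_within_open[OF _ open_punctured]) (use assms Hsym in auto)
  moreover have "((\<lambda>z. H z y \<bullet> u) has_derivative (\<lambda>v. HH x v y \<bullet> u)) (at x)"
    by (intro has_derivative_inner_left d_H_const assms)
  ultimately show "HH x v u \<bullet> y = HH x v y \<bullet> u" using has_derivative_unique by metis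
qed

lemma linHH: "x \<noteq> 0 \<Longrightarrow> linear (\<lambda>v. HH x v u)" "x \<noteq> 0 \<Longrightarrow> linear (\<lambda>u. HH x v u)"
  using has_derivative_linear[OF d_H_const, of x u] has_derivative_linear[OF d_H_const, of x v]
  by (simp_all add: HH_symmetric(2)[of x v])

end

context isoparam
begin

text \<open>
  On \<open>\<Sigma>\<close> the Hessian \<open>H\<close> is \<open>- c\<close> times the projection onto the normal space, so \<open>TP\<close> projects
  onto the tangent space, and the derivative \<open>HH\<close> of \<open>H\<close> yields the shape operators.
\<close>

definition TP where "TP x v = v + (1 / c) *\<^sub>R H x v - (x \<bullet> v) *\<^sub>R x"

lemma linTP: "x \<noteq> 0 \<Longrightarrow> linear (TP x)"
  unfolding TP_def[abs_def]
  by (intro linearI) (simp_all add: linear_add[OF linH] linear_cmul[OF linH] inner_add_right algebra_simps)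

section \<open>The singular level as a submanifold\<close>

lemma M_from_foc:
  assumes "p \<in> M"
  shows "p = cos d *\<^sub>R foc p - sin d *\<^sub>R nu p" "w p = sin d *\<^sub>R foc p + cos d *\<^sub>R nu p"
proof -
  have cs: "cos d * cos d + sin d * sin d = 1" using sin_cos_squared_add[of d] by (simp add: power2_eq_square)
  have a: "(cos d * cos d) *\<^sub>R v + (sin d * sin d) *\<^sub>R v = v" "(sin d * sin d) *\<^sub>R v + (cos d * cos d) *\<^sub>R v = v" for v :: 'a
    using cs by (simp_all add: scaleR_add_left[symmetric] add.commute)
  show "p = cos d *\<^sub>R foc p - sin d *\<^sub>R nu p" "w p = sin d *\<^sub>R foc p + cos d *\<^sub>R nu p"
    using a by (auto simp: geo_def geo'_def scaleR_add_right scaleR_diff_right algebra_simps)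
qed

abbreviation "Et p \<equiv> (\<Union>\<kappa>\<in>{\<kappa> \<in> K. \<alpha> \<kappa> \<noteq> 0}. E p \<kappa>)"

lemma perp_span:
  assumes p: "p \<in> M" and v: "v \<bullet> foc p = 0" "v \<bullet> nu p = 0"
  shows "v \<in> span (\<Union>\<kappa>\<in>K. E p \<kappa>)"
proof -
  have "v \<bullet> p = 0" "v \<bullet> w p = 0"
    using arg_cong[OF M_from_foc(1)[OF p], of "\<lambda>x. v \<bullet> x"] arg_cong[OF M_from_foc(2)[OF p], of "\<lambda>x. v \<bullet> x"] v
    by (simp_all add: inner_diff_right inner_add_right)
  then show ?thesis using E_span[of p v] p by (simp add: M_def E_def)
qed

lemma H_E:
  assumes p: "p \<in> M" and X: "X \<in> E p \<kappa>"
  shows "H (foc p) X = (if \<alpha> \<kappa> = 0 then - c *\<^sub>R X else 0)"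
  using H_E_regular[OF p X] H_E_focal[OF p X] by (auto simp: \<alpha>_def)

lemma H_\<Sigma>_radial: "q \<in> \<Sigma> \<Longrightarrow> H q q = 0"
  using H_radial[OF \<Sigma>_ne0] J_\<Sigma> by simp

text \<open>\<open>H q\<close> is diagonal on the spanning set formed by \<open>q\<close>, the
  normal \<open>nu p\<close> of a point \<open>p\<close> with \<open>foc p = q\<close>, and the
  eigenspaces of \<open>M\<close> at \<open>p\<close>; the eigenvalues are \<open>0\<close> and
  \<open>- c\<close>.\<close>

lemma H_\<Sigma>_square: assumes q: "q \<in> \<Sigma>" shows "H q (H q v) = - c *\<^sub>R H q v"
proof -
  obtain p where p: "p \<in> M" "foc p = q" using foc_surj[OF q] .
  note lin = linH[OF \<Sigma>_ne0[OF q]]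
  note o = M_orthonormal[OF p(1) p(1), of d]
  define R where "R v = H q (H q v) + c *\<^sub>R H q v" for v
  have linR: "linear R" unfolding R_def[abs_def]
    by (intro linearI) (simp_all add: linear_add[OF lin] linear_cmul[OF lin] algebra_simps)
  define v' where "v' = v - (v \<bullet> q) *\<^sub>R q - (v \<bullet> nu p) *\<^sub>R nu p"
  have "v' \<bullet> foc p = 0" "v' \<bullet> nu p = 0"
    using o(1-3) p(2) by (simp_all add: v'_def inner_diff_left inner_commute[of "nu p" q])
  then have "v' \<in> span (\<Union>\<kappa>\<in>K. E p \<kappa>)" by (rule perp_span[OF p(1)])
  moreover have "R X = 0" if "X \<in> (\<Union>\<kappa>\<in>K. E p \<kappa>)" for X
    using that H_E[OF p(1)] by (auto simp: R_def p(2) linear_cmul[OF lin] linear_neg[OF lin] linear_0[OF lin])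
  ultimately have "R v' = 0" using linear_eq_0_on_span[OF linR] by blast
  moreover have "R q = 0" using H_\<Sigma>_radial[OF q] linear_0[OF lin] by (simp add: R_def)
  moreover have "R (nu p) = 0" using H_nu[OF p(1)] p(2) by (simp add: R_def linear_cmul[OF lin] linear_neg[OF lin])
  moreover have "R v = R (v' + (v \<bullet> q) *\<^sub>R q + (v \<bullet> nu p) *\<^sub>R nu p)" by (simp add: v'_def)
  ultimately have "R v = 0" by (simp add: linear_add[OF linR] linear_cmul[OF linR])
  then show ?thesis by (simp add: R_def add_eq_0_iff2)
qed

lemma H_inner_q: "q \<in> \<Sigma> \<Longrightarrow> H q v \<bullet> q = 0" "q \<in> \<Sigma> \<Longrightarrow> q \<bullet> H q v = 0"
  using Hsym[OF \<Sigma>_ne0, of q v q] H_\<Sigma>_radial by (simp_all add: inner_commute)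

lemma qq: "q \<in> \<Sigma> \<Longrightarrow> q \<bullet> q = 1"
  using \<Sigma>_norm by (simp add: norm_eq_1)

lemma TP_sym: assumes "q \<in> \<Sigma>" shows "TP q v \<bullet> x = v \<bullet> TP q x"
  using Hsym[OF \<Sigma>_ne0[OF assms], of v x]
  by (simp add: TP_def inner_add_left inner_add_right inner_diff_left inner_diff_right inner_commute)

definition Tan where "Tan q = {v. v \<bullet> q = 0 \<and> H q v = 0}"

lemma TP_Tan: assumes q: "q \<in> \<Sigma>" shows "TP q v \<in> Tan q"
  using qq[OF q] H_inner_q[OF q] H_\<Sigma>_square[OF q] H_\<Sigma>_radial[OF q] c_pos
  by (simp add: Tan_def TP_def inner_add_left inner_diff_left linear_add[OF linH[OF \<Sigma>_ne0[OF q]]]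
      linear_diff[OF linH[OF \<Sigma>_ne0[OF q]]] linear_cmul[OF linH[OF \<Sigma>_ne0[OF q]]] inner_commute[of v q])

lemma Tan_TP: "v \<in> Tan q \<Longrightarrow> TP q v = v"
  by (simp add: Tan_def TP_def inner_commute)

lemma TP_idem: "q \<in> \<Sigma> \<Longrightarrow> TP q (TP q v) = TP q v"
  using TP_Tan Tan_TP by blast

lemma range_TP: "q \<in> \<Sigma> \<Longrightarrow> range (TP q) = Tan q"
proof (intro equalityI subsetI)
  assume q: "q \<in> \<Sigma>"
  show "x \<in> Tan q" if "x \<in> range (TP q)" for x using that TP_Tan[OF q] by blast
  show "x \<in> range (TP q)" if "x \<in> Tan q" for x by (rule range_eqI[of _ _ x]) (simp add: Tan_TP[OF that])
qed

text \<open>\<open>R\<close> fixes the kernel of \<open>H\<close>, kills the focal eigenvectors and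
  leaves the others unchanged; applied to an expansion of \<open>v\<close>, it retains only the
  latter.\<close>

lemma Tan_span: assumes p: "p \<in> M" and v: "v \<in> Tan (foc p)" shows "v \<in> span (Et p)"
proof -
  note lin = linH[OF M_orthonormal(6)[OF p p, of d]]
  have Hv: "H (foc p) v = 0" "v \<bullet> foc p = 0" using v by (auto simp: Tan_def)
  have "c * (v \<bullet> nu p) = 0"
    using Hsym[OF M_orthonormal(6)[OF p p, of d], of v "nu p"] H_nu[OF p] Hv by (simp add: inner_commute)
  then have "v \<in> span (\<Union>\<kappa>\<in>K. E p \<kappa>)" using c_pos by (intro perp_span[OF p Hv(2)]) auto
  define R where "R x = x + (1 / c) *\<^sub>R H (foc p) x" for x
  have linR: "linear R" unfolding R_def[abs_def]
    by (intro linearI) (simp_all add: linear_add[OF lin] linear_cmul[OF lin] algebra_simps)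
  have "R X \<in> span (Et p)" if X: "X \<in> (\<Union>\<kappa>\<in>K. E p \<kappa>)" for X
  proof -
    obtain \<kappa> where \<kappa>: "\<kappa> \<in> K" "X \<in> E p \<kappa>" using X by blast
    show ?thesis
    proof (cases "\<alpha> \<kappa> = 0")
      case True
      then have "R X = 0" using H_E[OF p \<kappa>(2)] c_pos by (simp add: R_def)
      then show ?thesis by (simp add: span_0)
    next
      case False
      then have "R X = X" using H_E[OF p \<kappa>(2)] by (simp add: R_def)
      then show ?thesis using \<kappa> False by (auto intro: span_base)
    qed
  qed
  then have "R ` (\<Union>\<kappa>\<in>K. E p \<kappa>) \<subseteq> span (Et p)" by blast
  then have "R ` span (\<Union>\<kappa>\<in>K. E p \<kappa>) \<subseteq> span (Et p)"
    unfolding linear_span_image[OF linR, symmetric] by (simp add: span_minimal)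
  moreover have "R v = v" by (simp add: R_def Hv)
  moreover have "R v \<in> R ` span (\<Union>\<kappa>\<in>K. E p \<kappa>)"
    using \<open>v \<in> span (\<Union>\<kappa>\<in>K. E p \<kappa>)\<close> by (rule imageI)
  ultimately show ?thesis by auto
qed

lemma Et_Tan: assumes p: "p \<in> M" and X: "X \<in> Et p" shows "X \<in> Tan (foc p)"
proof -
  obtain \<kappa> where "\<alpha> \<kappa> \<noteq> 0" "X \<in> E p \<kappa>" using X by blast
  then show ?thesis using H_E[OF p] E_geo(1) by (auto simp: Tan_def)
qed

lemma \<Sigma>_foc: "\<Sigma> = foc ` M"
  using foc_\<Sigma> foc_surj by blast

lemma contfoc: "continuous_on M foc" and contnu: "continuous_on M nu"
  unfolding geo_def geo'_def
  by (intro continuous_intros continuous_on_subset[OF contw]; use M_regular in auto)+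

lemma connected_\<Sigma>: "connected \<Sigma>"
  unfolding \<Sigma>_foc using connected_continuous_image[OF contfoc] M_conn by (simp add: M_def)

text \<open>The dimension is the trace of the projection \<open>TP\<close>, which depends
  continuously on the point, and \<open>\<Sigma>\<close> is connected as the image of
  \<open>M\<close>.\<close>

lemma dim_Tan_constant: assumes "q \<in> \<Sigma>" "q' \<in> \<Sigma>" shows "dim (Tan q) = dim (Tan q')"
proof -
  have tr: "trc (TP q) = dim (Tan q)" if "q \<in> \<Sigma>" for q
    using trc_projection[OF linTP[OF \<Sigma>_ne0[OF that]] TP_sym[OF that] TP_idem[OF that]] range_TP[OF that] by simp
  have "continuous_on \<Sigma> (\<lambda>q. trc (TP q))"
    unfolding trc_def TP_def
    by (intro continuous_intros continuous_on_H) (use \<Sigma>_ne0 in auto)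
  from integer_valued_constant[OF connected_\<Sigma> this _ assms] tr have "trc (TP q) = trc (TP q')" by simp
  then show ?thesis using tr assms by simp
qed

text \<open>A Morse-Bott argument. The equation \<open>J = 0\<close> has too many components for
  \<open>level_chart\<close>, so only the part of \<open>J\<close> in the image of
  \<open>H z\<close> is required to vanish, together with the equation of the sphere.\<close>

lemma \<Sigma>_level:
  assumes z: "z \<in> \<Sigma>"
  obtains B U \<phi> where "slice_chart \<Sigma> B U \<phi>" "z \<in> \<phi> ` U" "card B = dim (Tan z)" "\<And>v. velocity \<Sigma> z v \<longleftrightarrow> v \<in> Tan z"
proof -
  note z0 = \<Sigma>_ne0[OF z] and lin = linH[OF \<Sigma>_ne0[OF z]]
  define h where "h x = (- 1 / c) *\<^sub>R H z (J x) + ((x \<bullet> x - 1) / 2) *\<^sub>R z" for x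
  define \<pi> where "\<pi> v = (- 1 / c) *\<^sub>R H z v + (v \<bullet> z) *\<^sub>R z" for v
  \<comment> \<open>In \<open>Wn\<close> the weaker equations force \<open>x\<close> into
    \<open>\<Sigma>\<close>: at a regular zero \<open>w x\<close> would lie in the kernel of
    \<open>H z\<close>, so that \<open>H x (w x)\<close> is shorter than \<open>c / 2\<close>,
    whereas its product with \<open>w x\<close> is \<open>b' (F x) / 2\<close>, below
    \<open>- c / 2\<close>.\<close>
  define Wn where "Wn = {x \<in> - {0}. t0 < F x \<and> b' (F x) < - c \<and> (\<Sum>i\<in>Basis. norm (H x i - H z i)) < c / 2}"
  have \<pi>0: "\<pi> v = 0 \<longleftrightarrow> v \<in> Tan z" for v
  proof
    assume 0: "\<pi> v = 0"
    then have "\<pi> v \<bullet> z = 0" by simp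
    then have "v \<bullet> z = 0" using H_inner_q[OF z] qq[OF z] by (simp add: \<pi>_def inner_diff_left)
    then show "v \<in> Tan z" using 0 c_pos by (simp add: \<pi>_def Tan_def)
  qed (simp add: \<pi>_def Tan_def)
  have openW: "open Wn"
  proof -
    have "open ((- {0}) \<inter> (\<lambda>x. (F x, b' (F x), \<Sum>i\<in>Basis. norm (H x i - H z i))) -` ({t0<..} \<times> {..<- c} \<times> {..<c / 2}))"
      by (intro continuous_open_preimage open_punctured continuous_on_Pair contF continuous_on_sum continuous_on_norm
          continuous_on_diff contH continuous_on_const continuous_on_compose2[OF contb' contF] open_Times
          open_greaterThan open_lessThan) auto
    also have "(- {0}) \<inter> (\<lambda>x. (F x, b' (F x), \<Sum>i\<in>Basis. norm (H x i - H z i))) -` ({t0<..} \<times> {..<- c} \<times> {..<c / 2}) = Wn"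
      by (auto simp: Wn_def)
    finally show ?thesis .
  qed
  have hd: "(h has_derivative (\<lambda>v. H z v + (v \<bullet> z) *\<^sub>R z)) (at z)"
  proof -
    have bl: "bounded_linear (H z)" using lin linear_conv_bounded_linear by blast
    have "(h has_derivative (\<lambda>v. (- 1 / c) *\<^sub>R H z (H z v) + (((z \<bullet> v + v \<bullet> z) - 0) / 2) *\<^sub>R z)) (at z)"
      unfolding h_def[abs_def]
      by (intro has_derivative_add has_derivative_scaleR_right has_derivative_scaleR_left bounded_linear.has_derivative[OF bl] dJ z0
          has_derivative_divide' has_derivative_inner has_derivative_ident has_derivative_diff has_derivative_const
          bounded_linear.has_derivative[OF bounded_linear_divide])
    then show ?thesis using c_pos by (simp add: H_\<Sigma>_square[OF z] inner_commute)
  qed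
  have fd: "frechet_derivative h (at z) v = H z v + (v \<bullet> z) *\<^sub>R z" for v
    using fun_cong[OF frechet_derivative_at[OF hd], of v] by simp
  have sub: "Wn \<subseteq> - {0}" by (auto simp: Wn_def)
  have smh: "smooth_on Wn h"
  proof -
    have bl: "bounded_linear (H z)" using lin linear_conv_bounded_linear by blast
    show ?thesis unfolding h_def[abs_def] divide_inverse
      by (intro smooth_on_add smooth_on_scaleR smooth_on_const smooth_on_diff openW smooth_on_mult
        smooth_on_inner smooth_on_id smooth_on_linear[OF bl] smooth_on_subset[OF smJ sub])
  qed
  have lev: "open Wn" "z \<in> Wn" "smooth_on Wn h" "linear \<pi>" "\<And>v. \<pi> (\<pi> v) = \<pi> v"
    "\<And>x. x \<in> Wn \<Longrightarrow> \<pi> (h x) = h x" "h z = 0" "\<And>v. \<pi> v = 0 \<Longrightarrow> frechet_derivative h (at z) v = 0"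
    "\<And>v. frechet_derivative h (at z) v = 0 \<Longrightarrow> \<pi> v = 0" "\<And>x. x \<in> Wn \<Longrightarrow> x \<in> \<Sigma> \<longleftrightarrow> h x = 0"
  proof -
    show "open Wn" "smooth_on Wn h" by fact+
    show "z \<in> Wn" using z0 \<Sigma>_F[OF z] t_order c_pos by (auto simp: Wn_def c_def)
    show "linear \<pi>" unfolding \<pi>_def[abs_def]
      by (intro linearI) (simp_all add: linear_add[OF lin] linear_cmul[OF lin] inner_add_left algebra_simps)
    show "\<pi> (\<pi> v) = \<pi> v" for v
      using c_pos by (simp add: \<pi>_def linear_add[OF lin] linear_diff[OF lin] linear_neg[OF lin] linear_cmul[OF lin] H_\<Sigma>_square[OF z] H_\<Sigma>_radial[OF z]
          inner_add_left inner_diff_left H_inner_q[OF z] qq[OF z])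
    show "\<pi> (h x) = h x" for x
      using c_pos by (simp add: \<pi>_def h_def linear_add[OF lin] linear_diff[OF lin] linear_neg[OF lin] linear_cmul[OF lin] H_\<Sigma>_square[OF z] H_\<Sigma>_radial[OF z]
          inner_add_left inner_diff_left H_inner_q[OF z] qq[OF z])
    show "h z = 0" using J_\<Sigma>[OF z] qq[OF z] linear_0[OF lin] by (simp add: h_def)
    show "frechet_derivative h (at z) v = 0" if "\<pi> v = 0" for v
      using that unfolding \<pi>0 by (simp add: fd Tan_def)
    show "\<pi> v = 0" if "frechet_derivative h (at z) v = 0" for v
    proof -
      have "frechet_derivative h (at z) v \<bullet> z = 0" using that by simp
      then have "v \<bullet> z = 0" by (simp add: fd inner_add_left H_inner_q[OF z] qq[OF z])
      then show ?thesis using that unfolding \<pi>0 by (simp add: fd Tan_def)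
    qed
    show "x \<in> \<Sigma> \<longleftrightarrow> h x = 0" if x: "x \<in> Wn" for x
    proof
      assume "x \<in> \<Sigma>"
      then show "h x = 0" using J_\<Sigma> qq linear_0[OF lin] by (simp add: h_def)
    next
      assume h0: "h x = 0"
      then have "h x \<bullet> z = 0" by simp
      then have "x \<bullet> x = 1" by (simp add: h_def inner_diff_left H_inner_q[OF z] qq[OF z])
      then have x1: "norm x = 1" by (simp add: norm_eq_1)
      have HJ: "H z (J x) = 0" using h0 \<open>x \<bullet> x = 1\<close> c_pos by (simp add: h_def)
      have xW: "x \<noteq> 0" "t0 < F x" "b' (F x) < - c" "(\<Sum>i\<in>Basis. norm (H x i - H z i)) < c / 2"
        using x by (auto simp: Wn_def)
      have "F x = tp"
      proof (rule ccontr)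
        assume "F x \<noteq> tp"
        then have O: "x \<in> \<Omega>" using F_le_tp[OF x1] xW(2) x1 t_order by (simp add: \<Omega>_def)
        note r = \<Omega>_regular[OF O]
        have b0: "b (F x) > 0" using r by (simp add: regular_def)
        have Hzw: "H z (w x) = 0" using HJ by (simp add: w_eq[OF b0] linear_cmul[OF lin])
        have "H x (J x) \<bullet> w x = b' (F x) / 2 * (J x \<bullet> w x)"
          using H_J[OF x1] w_radial[OF r] by (simp add: inner_diff_left inner_commute[of x "w x"])
        then have "sqrt (b (F x)) * (H x (w x) \<bullet> w x) = sqrt (b (F x)) * (b' (F x) / 2)"
          by (simp add: J_eq[OF r] linear_cmul[OF linH[OF xW(1)]] w_unit[OF r x1])
        then have Hxw: "H x (w x) \<bullet> w x = b' (F x) / 2" using b0 by simp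
        have nw: "norm (w x) = 1" using w_unit[OF r x1] by (simp add: norm_eq_1)
        have e: "H x (w x) - H z (w x) = (\<Sum>i\<in>Basis. (w x \<bullet> i) *\<^sub>R (H x i - H z i))"
          unfolding H_expand[OF xW(1), of "w x"] H_expand[OF z0, of "w x"] by (simp add: sum_subtractf scaleR_diff_right)
        have "norm (H x (w x) - H z (w x)) \<le> (\<Sum>i\<in>Basis. norm ((w x \<bullet> i) *\<^sub>R (H x i - H z i)))"
          unfolding e by (rule norm_sum)
        also have "\<dots> \<le> (\<Sum>i\<in>Basis. norm (H x i - H z i))"
        proof (rule sum_mono)
          fix i :: 'a assume "i \<in> Basis"
          then have "\<bar>w x \<bullet> i\<bar> \<le> 1" using Basis_le_norm[of i "w x"] nw by simp
          then show "norm ((w x \<bullet> i) *\<^sub>R (H x i - H z i)) \<le> norm (H x i - H z i)"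
            by (simp add: mult_left_le_one_le)
        qed
        finally have "norm (H x (w x)) < c / 2" using xW(4) Hzw by simp
        moreover have "\<bar>H x (w x) \<bullet> w x\<bar> \<le> norm (H x (w x))"
          using Cauchy_Schwarz_ineq2[of "H x (w x)" "w x"] nw by simp
        ultimately show False using Hxw xW(3) by linarith
      qed
      then show "x \<in> \<Sigma>" using x1 by (simp add: \<Sigma>_def)
    qed
  qed
  obtain B U \<phi> where ch: "slice_chart \<Sigma> B U \<phi>" "0 \<in> U" "\<phi> 0 = z" "card B = dim {v. \<pi> v = 0}"
    using level_chart[OF lev] by metis
  have "{v. \<pi> v = 0} = Tan z" using \<pi>0 by blast
  moreover have "z \<in> \<phi> ` U" using ch(2,3) by blast
  moreover have "velocity \<Sigma> z v \<longleftrightarrow> v \<in> Tan z" for v using tangent_space_level(1)[OF lev] \<pi>0 by blast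
  ultimately show thesis using that[OF ch(1)] ch(4) by simp
qed

lemma \<Sigma>_embedded: "\<exists>k. embedded_submanifold k \<Sigma>"
proof -
  obtain p where p: "p \<in> M" using M_ne by (auto simp: M_def)
  have "embedded_submanifold (dim (Tan (foc p))) \<Sigma>"
    unfolding embedded_submanifold_def
  proof
    fix q assume q: "q \<in> \<Sigma>"
    from \<Sigma>_level[OF q] dim_Tan_constant[OF q foc_\<Sigma>[OF p]]
    show "\<exists>B U \<phi>. slice_chart \<Sigma> B U \<phi> \<and> card B = dim (Tan (foc p)) \<and> q \<in> \<phi> ` U" by metis
  qed
  then show ?thesis by blast
qed

lemma \<Sigma>_velocity: "q \<in> \<Sigma> \<Longrightarrow> velocity \<Sigma> q v \<longleftrightarrow> v \<in> Tan q"
  using \<Sigma>_level by metis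

text \<open>The term \<open>H / c\<close> of \<open>TP\<close> contributes \<open>HH / c\<close> to
  the derivative of the tangential projection on normal vectors. Inserting \<open>TP q y\<close>
  makes the operator vanish on normal arguments.\<close>

definition shape where "shape q \<eta> y = (1 / c) *\<^sub>R HH q (TP q y) \<eta>"

lemma shape_E: assumes p: "p \<in> M" and X: "X \<in> E p \<kappa>" and \<kappa>: "\<kappa> \<in> K" "\<alpha> \<kappa> \<noteq> 0"
  shows "shape (foc p) (nu p) X = lam \<kappa> *\<^sub>R X"
proof -
  have "X \<in> Tan (foc p)" by (rule Et_Tan[OF p]) (use X \<kappa> in blast)
  then show ?thesis using focal_E(1)[OF p X \<kappa>(2)] c_pos by (simp add: shape_def Tan_TP)
qed

lemma linshape: assumes "q \<in> \<Sigma>" shows "linear (shape q \<eta>)"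
  unfolding shape_def[abs_def]
  using linear_compose[OF linTP[OF \<Sigma>_ne0[OF assms]] linHH(1)[OF \<Sigma>_ne0[OF assms], of \<eta>]]
  by (intro linear_compose_scale_right) (simp add: o_def)

lemma shape_Tan: assumes p: "p \<in> M" shows "shape (foc p) (nu p) y \<in> Tan (foc p)"
proof -
  let ?A = "shape (foc p) (nu p)"
  note q = foc_\<Sigma>[OF p]
  have sub: "subspace (Tan (foc p))"
    using linear_subspace_image[OF linTP[OF \<Sigma>_ne0[OF q]] subspace_UNIV] range_TP[OF q] by simp
  have "?A ` Et p \<subseteq> Tan (foc p)"
    using shape_E[OF p] Et_Tan[OF p] subspace_scale[OF sub] by fastforce
  then have "?A ` span (Et p) \<subseteq> Tan (foc p)"
    unfolding linear_span_image[OF linshape[OF q], symmetric] using sub by (simp add: span_minimal)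
  then have "?A (TP (foc p) y) \<in> Tan (foc p)" using Tan_span[OF p TP_Tan[OF q]] by blast
  then show ?thesis by (simp add: shape_def TP_idem[OF q])
qed

lemma shape_sym: assumes p: "p \<in> M" shows "shape (foc p) (nu p) v \<bullet> x = v \<bullet> shape (foc p) (nu p) x"
proof -
  note q = foc_\<Sigma>[OF p]
  note n0 = \<Sigma>_ne0[OF q]
  have "shape (foc p) (nu p) v \<bullet> x = (1 / c) * (HH (foc p) (TP (foc p) v) (nu p) \<bullet> TP (foc p) x)" for v x
  proof -
    have "shape (foc p) (nu p) v \<bullet> x = shape (foc p) (nu p) v \<bullet> TP (foc p) x"
      using Tan_TP[OF shape_Tan[OF p]] TP_sym[OF q] by metis
    then show ?thesis by (simp add: shape_def)
  qed
  moreover have "HH (foc p) v (nu p) \<bullet> x = HH (foc p) x (nu p) \<bullet> v" for v x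
    unfolding HH_symmetric(1)[OF n0, of v "nu p" x] HH_symmetric(2)[OF n0, of v x]
    by (rule HH_symmetric(1)[OF n0])
  ultimately show ?thesis by (simp add: inner_commute[of v])
qed

lemma shape_uminus: "q \<in> \<Sigma> \<Longrightarrow> shape q (- \<eta>) y = - shape q \<eta> y"
  and shape_scale: "q \<in> \<Sigma> \<Longrightarrow> shape q (r *\<^sub>R \<eta>) y = r *\<^sub>R shape q \<eta> y"
  using linear_neg[OF linHH(2)[OF \<Sigma>_ne0]] linear_cmul[OF linHH(2)[OF \<Sigma>_ne0]] by (simp_all add: shape_def)

lemma opposite_normal:
  assumes p: "p \<in> M"
  obtains p' where "p' \<in> M" "foc p' = foc p" "nu p' = - nu p"
proof (rule normal_from_M[OF foc_\<Sigma>[OF p]])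
  show "norm (- nu p) = 1" using M_orthonormal(5)[OF p p] by simp
  show "H (foc p) (- nu p) = - c *\<^sub>R - nu p"
    using H_nu[OF p] linear_neg[OF linH[OF M_orthonormal(6)[OF p p, of d]]] by simp
qed (use that in blast)

section \<open>Minimality and the cubic relation when every \<open>lam\<close> is \<open>1\<close>,
  \<open>0\<close> or \<open>- 1\<close>\<close>

context
  assumes spec: "\<And>\<kappa>. \<kappa> \<in> K \<Longrightarrow> \<alpha> \<kappa> \<noteq> 0 \<Longrightarrow> lam \<kappa> * lam \<kappa> * lam \<kappa> = lam \<kappa>"
begin

lemma shape_cubic: assumes p: "p \<in> M"
  shows "shape (foc p) (nu p) (shape (foc p) (nu p) (shape (foc p) (nu p) y)) = shape (foc p) (nu p) y"
proof -
  let ?A = "shape (foc p) (nu p)"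
  note q = foc_\<Sigma>[OF p]
  note linA = linshape[OF q, of "nu p"]
  define R where "R v = ?A (?A (?A v)) - ?A v" for v
  have linR: "linear R" unfolding R_def[abs_def]
    by (intro linearI) (simp_all add: linear_add[OF linA] linear_cmul[OF linA] algebra_simps)
  have "R X = 0" if X: "X \<in> Et p" for X
  proof -
    obtain \<kappa> where \<kappa>: "\<kappa> \<in> K" "\<alpha> \<kappa> \<noteq> 0" "X \<in> E p \<kappa>" using X by blast
    have "?A X = lam \<kappa> *\<^sub>R X" by (rule shape_E[OF p \<kappa>(3,1,2)])
    then show ?thesis using spec[OF \<kappa>(1,2)] by (simp add: R_def linear_cmul[OF linA] mult.assoc)
  qed
  then have "R (TP (foc p) y) = 0" using linear_eq_0_on_span[OF linR] Tan_span[OF p TP_Tan[OF q]] by blast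
  moreover have "?A (TP (foc p) y) = ?A y" by (simp add: shape_def TP_idem[OF q])
  ultimately show ?thesis by (simp add: R_def)
qed

lemma shape_trace: assumes p: "p \<in> M" shows "trc (shape (foc p) (nu p)) = 0"
proof -
  define f where "f p = trc (shape (foc p) (nu p))" for p
  have int: "f p \<in> \<int>" if "p \<in> M" for p
    unfolding f_def by (rule trc_cubic_Ints[OF linshape[OF foc_\<Sigma>[OF that]] shape_sym[OF that] shape_cubic[OF that]])
  have cHH: "continuous_on (- {0}) (\<lambda>x. HH x i j)" for i j
    unfolding HH_def by (rule smooth_on_continuous[OF smooth_on_frechet_derivative[OF smH]])
  have "continuous_on M (\<lambda>p. HH (foc p) (TP (foc p) i) (nu p))" for i
  proof -
    have e: "HH (foc p) (TP (foc p) i) (nu p) =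
        (\<Sum>k\<in>Basis. (nu p \<bullet> k) *\<^sub>R (\<Sum>j\<in>Basis. (TP (foc p) i \<bullet> j) *\<^sub>R HH (foc p) j k))" if "p \<in> M" for p
    proof -
      note n0 = \<Sigma>_ne0[OF foc_\<Sigma>[OF that]]
      show ?thesis
        by (subst HH_expand[OF n0], subst bounded_linear_euclidean_sum[OF linHH(1)[OF n0], of "TP (foc p) i"]) (rule refl)
    qed
    have "continuous_on M (\<lambda>p. \<Sum>k\<in>Basis. (nu p \<bullet> k) *\<^sub>R (\<Sum>j\<in>Basis. (TP (foc p) i \<bullet> j) *\<^sub>R HH (foc p) j k))"
      unfolding TP_def
      by (intro continuous_intros contfoc contnu continuous_on_H continuous_on_compose2[OF cHH contfoc])
        (use \<Sigma>_ne0[OF foc_\<Sigma>] in auto)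
    then show ?thesis by (subst continuous_on_cong[OF refl e])
  qed
  then have cont: "continuous_on M f"
    unfolding f_def trc_def shape_def by (intro continuous_intros)
  obtain p' where p': "p' \<in> M" "foc p' = foc p" "nu p' = - nu p" using opposite_normal[OF p] .
  have "f p' = f p"
    by (rule integer_valued_constant[OF _ cont int p'(1) p]) (use M_conn in \<open>auto simp: M_def\<close>)
  moreover have "f p' = - f p"
    unfolding f_def p'(2,3) trc_def shape_uminus[OF foc_\<Sigma>[OF p]] by (simp add: sum_negf)
  ultimately show ?thesis by (simp add: f_def)
qed

text \<open>The setting of \<open>chart_geometry\<close> is met with the projection
  \<open>TP (\<phi> u)\<close>, whose formula is smooth off the slice as well. Each unit normal at a
  point of \<open>\<Sigma>\<close> is \<open>nu p\<close> for some \<open>p\<close> over this point,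
  so the cubic relation and the vanishing trace hold for all normals by scaling.\<close>

theorem \<Sigma>_A_manifold: "A_manifold \<Sigma>"
  unfolding A_manifold_def
proof (intro conjI \<Sigma>_embedded allI impI ballI)
  fix B U \<phi> u a b c0
  assume sc: "slice_chart \<Sigma> B U \<phi>" and u: "u \<in> U \<inter> span B" and abc: "a \<in> B" "b \<in> B" "c0 \<in> B"
  note D = slice_chartD[OF sc]
  \<comment> \<open>Keeps \<open>\<phi>\<close> away from the origin, since smoothness of
    \<open>H\<close> is known only there; the slice is mapped into the sphere anyway.\<close>
  define Op where "Op = U \<inter> \<phi> -` (- {0})"
  have Op: "open Op" "Op \<subseteq> U"
    unfolding Op_def using continuous_open_preimage[OF smooth_on_continuous[OF D(6)] D(3) open_punctured] by auto
  have \<phi>\<Sigma>: "\<phi> x \<in> \<Sigma>" if "x \<in> Op \<inter> span B" for x using D(8) that Op(2) by blast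
  have tan: "v \<in> Tan (\<phi> x) \<longleftrightarrow> v \<in> span ((\<lambda>b. pd b \<phi> x) ` B)" if "x \<in> Op \<inter> span B" for x v
    using slice_chart_velocity[OF sc, of x v] \<Sigma>_velocity[OF \<phi>\<Sigma>[OF that]] that Op(2) by blast
  have sm\<phi>: "smooth_on Op \<phi>" by (rule smooth_on_subset[OF D(6) Op(2)])
  have smH\<phi>: "smooth_on Op (\<lambda>u. H (\<phi> u) v)" for v
    by (rule smooth_on_compose[OF Op(1) open_punctured smH sm\<phi>]) (simp add: Op_def)
  interpret cg: chart_geometry \<Sigma> B U \<phi> Op "\<lambda>u. TP (\<phi> u)"
  proof
    show "smooth_on Op (\<lambda>u. TP (\<phi> u) v)" for v
      unfolding TP_def
      by (intro smooth_on_diff smooth_on_add smooth_on_scaleR smooth_on_const smooth_on_inner sm\<phi> smH\<phi> Op(1))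
    have lin: "linear (TP (\<phi> x))" if "x \<in> Op" for x using linTP that by (simp add: Op_def)
    show "TP (\<phi> x) (v + y) = TP (\<phi> x) v + TP (\<phi> x) y" "TP (\<phi> x) (r *\<^sub>R v) = r *\<^sub>R TP (\<phi> x) v"
      if "x \<in> Op" for x v y r
      using linear_add[OF lin[OF that]] linear_cmul[OF lin[OF that]] by blast+
    fix x assume x: "x \<in> Op \<inter> span B"
    show "TP (\<phi> x) v \<bullet> y = v \<bullet> TP (\<phi> x) y" for v y by (rule TP_sym[OF \<phi>\<Sigma>[OF x]])
    show "TP (\<phi> x) (TP (\<phi> x) v) = TP (\<phi> x) v" for v by (rule TP_idem[OF \<phi>\<Sigma>[OF x]])
    show "TP (\<phi> x) (pd b \<phi> x) = pd b \<phi> x" if "b \<in> B" for b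
      using Tan_TP tan[OF x] that by (blast intro: span_base)
    show "TP (\<phi> x) v \<in> span ((\<lambda>b. pd b \<phi> x) ` B)" for v
      using TP_Tan[OF \<phi>\<Sigma>[OF x]] tan[OF x] by blast
    show "\<phi> x \<bullet> \<phi> x = 1" by (rule qq[OF \<phi>\<Sigma>[OF x]])
  qed (use sc Op in auto)
  have Xeq: "cg.X a x = frechet_derivative \<phi> (at x) a" if "x \<in> Op" for a x
    unfolding cg.X_def using pd_eq_frechet smooth_on_differentiable[OF sm\<phi> that] by blast
  have PDeq: "cg.PD a x \<nu> = (1 / c) *\<^sub>R HH (\<phi> x) (cg.X a x) \<nu>"
    if x: "x \<in> cg.V" and a: "a \<in> B" and \<nu>: "TP (\<phi> x) \<nu> = 0" "\<nu> \<bullet> \<phi> x = 0" for a x \<nu>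
  proof -
    have xO: "x \<in> Op" using cg.VD(1)[OF x] .
    have X\<nu>: "cg.X a x \<bullet> \<nu> = 0"
      using TP_sym[OF \<phi>\<Sigma>[OF cg.VD(3)[OF x]], of "cg.X a x" \<nu>] cg.PX[OF x a] \<nu>(1) by simp
    have dp: "(\<phi> has_derivative frechet_derivative \<phi> (at x)) (at x)" using smooth_on_has_derivative[OF sm\<phi> xO] .
    have "((\<lambda>x. H (\<phi> x) \<nu>) has_derivative (\<lambda>v. HH (\<phi> x) (frechet_derivative \<phi> (at x) v) \<nu>)) (at x)"
      by (rule has_derivative_compose[OF dp d_H_const]) (use xO in \<open>simp add: Op_def\<close>)
    then have pH: "pd a (\<lambda>x. H (\<phi> x) \<nu>) x = HH (\<phi> x) (cg.X a x) \<nu>"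
      using cg.sm_pd_eq[OF smH\<phi> xO] fun_cong[OF frechet_derivative_at, of "\<lambda>x. H (\<phi> x) \<nu>" _ x a] Xeq[OF xO] by metis
    have s1: "smooth_on Op (\<lambda>x. (1 / c) *\<^sub>R H (\<phi> x) \<nu>)" and s2: "smooth_on Op (\<lambda>x. (\<phi> x \<bullet> \<nu>) *\<^sub>R \<phi> x)"
      and s3: "smooth_on Op (\<lambda>x. \<phi> x \<bullet> \<nu>)" and s4: "smooth_on Op (\<lambda>x. \<nu> + (1 / c) *\<^sub>R H (\<phi> x) \<nu>)"
      by (intro smooth_on_add smooth_on_scaleR smooth_on_const smooth_on_inner sm\<phi> smH\<phi> Op(1))+
    have "cg.PD a x \<nu> = pd a (\<lambda>x. \<nu> + (1 / c) *\<^sub>R H (\<phi> x) \<nu>) x - pd a (\<lambda>x. (\<phi> x \<bullet> \<nu>) *\<^sub>R \<phi> x) x"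
      unfolding cg.PD_def TP_def by (rule cg.pd_diff[OF s4 s2 xO])
    also have "pd a (\<lambda>x. \<nu> + (1 / c) *\<^sub>R H (\<phi> x) \<nu>) x = (1 / c) *\<^sub>R HH (\<phi> x) (cg.X a x) \<nu>"
      using cg.pd_add[OF smooth_on_const s1 xO, of a \<nu>] cg.pd_scaleR[OF smooth_on_const smH\<phi> xO, of a "1 / c" \<nu>]
      by (simp add: cg.pd_const pH)
    also have "pd a (\<lambda>x. (\<phi> x \<bullet> \<nu>) *\<^sub>R \<phi> x) x = 0"
      using cg.pd_scaleR[OF s3 sm\<phi> xO, of a] cg.pd_inner[OF sm\<phi> smooth_on_const xO, of a \<nu>] X\<nu> \<nu>(2)
      by (simp add: cg.pd_const cg.X_def inner_commute)
    finally show ?thesis by simp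
  qed
  have shp: "cg.shp x \<nu> y = shape (\<phi> x) \<nu> y"
    if x: "x \<in> cg.V" and \<nu>: "TP (\<phi> x) \<nu> = 0" "\<nu> \<bullet> \<phi> x = 0" for x \<nu> y
  proof -
    note lin = linHH(1)[OF \<Sigma>_ne0[OF \<phi>\<Sigma>[OF cg.VD(3)[OF x]]], of \<nu>]
    have "cg.shp x \<nu> y = (\<Sum>a\<in>B. (cg.Y a x \<bullet> y) *\<^sub>R ((1 / c) *\<^sub>R HH (\<phi> x) (cg.X a x) \<nu>))"
      unfolding cg.shp_def by (rule sum.cong) (auto simp: PDeq[OF x _ \<nu>])
    also have "\<dots> = (1 / c) *\<^sub>R HH (\<phi> x) (\<Sum>a\<in>B. (cg.Y a x \<bullet> y) *\<^sub>R cg.X a x) \<nu>"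
      by (simp add: linear_sum[OF lin] linear_cmul[OF lin] scaleR_sum_right mult.commute)
    finally show ?thesis unfolding cg.expand[OF x] by (simp add: shape_def)
  qed
  have unitN: "\<exists>p\<in>M. \<phi> x = foc p \<and> \<nu> = norm \<nu> *\<^sub>R nu p"
    if x: "x \<in> cg.V" and \<nu>: "TP (\<phi> x) \<nu> = 0" "\<nu> \<bullet> \<phi> x = 0" "\<nu> \<noteq> 0" for x \<nu>
  proof -
    note q = \<phi>\<Sigma>[OF cg.VD(3)[OF x]]
    define \<eta> where "\<eta> = (1 / norm \<nu>) *\<^sub>R \<nu>"
    have "norm \<eta> = 1" using \<nu>(3) by (simp add: \<eta>_def)
    moreover have "H (\<phi> x) \<nu> = - c *\<^sub>R \<nu>"
    proof -
      have "c *\<^sub>R (\<nu> + (1 / c) *\<^sub>R H (\<phi> x) \<nu>) = 0" using \<nu>(1,2) by (simp add: TP_def inner_commute)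
      then show ?thesis using c_pos by (simp add: scaleR_add_right add_eq_0_iff)
    qed
    then have "H (\<phi> x) \<eta> = - c *\<^sub>R \<eta>" by (simp add: \<eta>_def linear_cmul[OF linH[OF \<Sigma>_ne0[OF q]]])
    ultimately obtain p where "p \<in> M" "foc p = \<phi> x" "nu p = \<eta>" using normal_from_M[OF q] by blast
    moreover have "\<nu> = norm \<nu> *\<^sub>R \<eta>" using \<nu>(3) by (simp add: \<eta>_def)
    ultimately show ?thesis by metis
  qed
  have cubic: "cg.shp x \<nu> (cg.shp x \<nu> (cg.shp x \<nu> y)) = (\<nu> \<bullet> \<nu>) *\<^sub>R cg.shp x \<nu> y"
    if x: "x \<in> cg.V" and \<nu>: "TP (\<phi> x) \<nu> = 0" "\<nu> \<bullet> \<phi> x = 0" for x \<nu> y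
  proof (cases "\<nu> = 0")
    case True
    then have "cg.shp x \<nu> y = 0" for y
      unfolding shp[OF x \<nu>] using linear_0[OF linHH(2)[OF \<Sigma>_ne0[OF \<phi>\<Sigma>[OF cg.VD(3)[OF x]]]]] by (simp add: shape_def)
    then show ?thesis by simp
  next
    case False
    then obtain p where p: "p \<in> M" "\<phi> x = foc p" "\<nu> = norm \<nu> *\<^sub>R nu p" using unitN[OF x \<nu>] by blast
    note q = foc_\<Sigma>[OF p(1)]
    have s: "cg.shp x \<nu> y = norm \<nu> *\<^sub>R shape (foc p) (nu p) y" for y
      unfolding shp[OF x \<nu>] p(2) using shape_scale[OF q, of "norm \<nu>" "nu p"] p(3) by metis
    show ?thesis unfolding s linear_cmul[OF linshape[OF q]] shape_cubic[OF p(1)]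
      by (simp add: dot_square_norm power2_eq_square mult_ac)
  qed
  have minimal: "(\<Sum>a\<in>B. cg.Y a x \<bullet> cg.PD a x \<nu>) = 0"
    if x: "x \<in> cg.V" and \<nu>: "TP (\<phi> x) \<nu> = 0" "\<nu> \<bullet> \<phi> x = 0" for x \<nu>
  proof (cases "\<nu> = 0")
    case True
    then show ?thesis using linear_0[OF cg.linPD[OF cg.VD(1)[OF x]]] by simp
  next
    case False
    then obtain p where p: "p \<in> M" "\<phi> x = foc p" "\<nu> = norm \<nu> *\<^sub>R nu p" using unitN[OF x \<nu>] by blast
    note q = foc_\<Sigma>[OF p(1)]
    let ?A = "shape (foc p) (nu p)"
    have "cg.PD a x \<nu> = norm \<nu> *\<^sub>R ?A (cg.X a x)" if a: "a \<in> B" for a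
    proof -
      have "TP (\<phi> x) (cg.X a x) = cg.X a x" using cg.PX[OF x a] .
      then have "cg.PD a x \<nu> = shape (\<phi> x) \<nu> (cg.X a x)" using PDeq[OF x a \<nu>] by (simp add: shape_def)
      then show ?thesis unfolding p(2) using shape_scale[OF q, of "norm \<nu>" "nu p"] p(3) by metis
    qed
    then have "(\<Sum>a\<in>B. cg.Y a x \<bullet> cg.PD a x \<nu>) = norm \<nu> * (\<Sum>a\<in>B. cg.Y a x \<bullet> ?A (cg.X a x))"
      by (simp add: sum_distrib_left)
    also have "(\<Sum>a\<in>B. cg.Y a x \<bullet> ?A (cg.X a x)) = (\<Sum>i\<in>Basis. TP (foc p) i \<bullet> ?A (TP (foc p) i))"
      using cg.sum_dual[OF x linear_ident linshape[OF q, of "nu p"]] p(2) by simp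
    also have "\<dots> = trc ?A"
    proof -
      have "TP (foc p) i \<bullet> ?A (TP (foc p) i) = ?A i \<bullet> i" for i
        unfolding TP_sym[OF q] Tan_TP[OF shape_Tan[OF p(1)]] by (simp add: shape_def TP_idem[OF q] inner_commute)
      then show ?thesis by (simp add: trc_def)
    qed
    finally show ?thesis using shape_trace[OF p(1)] by simp
  qed
  have "u \<in> Op" using u \<Sigma>_ne0 D(8) by (auto simp: Op_def)
  then have "u \<in> cg.V" using u by (simp add: cg.V_def)
  show "nabla_ricci B (induced_metric \<phi>) a b c0 u + nabla_ricci B (induced_metric \<phi>) b c0 a u +
      nabla_ricci B (induced_metric \<phi>) c0 a b u = 0"
    by (rule cg.cyclic_nabla_ricci[OF minimal cubic \<open>u \<in> cg.V\<close> abc])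
qed

end

end

section \<open>Double covers of the sphere, eigenvectors and focal angles\<close>

text \<open>
  \<open>\<omega>\<close> is defined up to sign on the sphere; the two choices form a double cover of the sphere,
  which is trivial since the sphere is simply connected.
\<close>

lemma no_sign_change:
  fixes g :: "'z::topological_space \<Rightarrow> 'a::euclidean_space" and \<omega> :: "'z \<Rightarrow> 'b::euclidean_space"
  assumes dim3: "3 \<le> DIM('a)" and Z: "compact Z" "connected Z"
    and g: "continuous_on Z g" "g ` Z = sphere 0 1"
    and \<omega>: "continuous_on Z \<omega>" "\<And>z. z \<in> Z \<Longrightarrow> norm (\<omega> z) = 1"
    and fib: "\<And>z z'. z \<in> Z \<Longrightarrow> z' \<in> Z \<Longrightarrow> g z = g z' \<Longrightarrow> \<omega> z' = \<omega> z \<or> \<omega> z' = - \<omega> z"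
    and z: "z \<in> Z" "z' \<in> Z" "g z = g z'"
  shows "\<omega> z' = \<omega> z"
proof -
  define S where "S = sphere (0::'a) 1"
  \<comment> \<open>Taking both signs makes the fibre over \<open>g z\<close> equal to
    \<open>\<omega> z\<close> and \<open>- \<omega> z\<close>, whatever point \<open>z\<close>
    represents it.\<close>
  define C where "C = (\<lambda>z. (g z, \<omega> z)) ` Z \<union> (\<lambda>z. (g z, - \<omega> z)) ` Z"
  have compC: "compact C" unfolding C_def
    by (intro compact_Un compact_continuous_image continuous_on_Pair continuous_on_minus g \<omega> Z)
  have C_D: "\<exists>z\<in>Z. g z = fst x \<and> (snd x = \<omega> z \<or> snd x = - \<omega> z)" if "x \<in> C" for x
    using that by (auto simp: C_def)
  have Cfib: "snd y = snd x \<or> snd y = - snd x" if xy: "x \<in> C" "y \<in> C" "fst x = fst y" for x y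
  proof -
    obtain zx zy where zz: "zx \<in> Z" "g zx = fst x" "snd x = \<omega> zx \<or> snd x = - \<omega> zx"
      "zy \<in> Z" "g zy = fst y" "snd y = \<omega> zy \<or> snd y = - \<omega> zy"
      using C_D[OF xy(1)] C_D[OF xy(2)] by blast
    then show ?thesis using fib[OF zz(1,4)] xy(3) by auto
  qed
  have Cminus: "(fst x, - snd x) \<in> C" if "x \<in> C" for x
    using that by (auto simp: C_def)
  have Cnorm: "norm (snd x) = 1" if "x \<in> C" for x using C_D[OF that] \<omega>(2) by auto
  have fstC: "fst ` C = S" using g(2) by (auto simp: C_def S_def image_Un image_image)
  have cfst: "continuous_on A fst" for A :: "('a \<times> 'b) set" by (intro continuous_intros)
  have cov: "covering_space C fst S"
    unfolding covering_space_def
  proof (intro conjI cfst fstC ballI)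
    fix x0 assume "x0 \<in> S"
    then obtain c0 where c0: "c0 \<in> C" "fst c0 = x0" using fstC by blast
    define v0 where "v0 = snd c0"
    have v0: "v0 \<bullet> v0 = 1" using Cnorm[OF c0(1)] by (simp add: v0_def norm_eq_1)
    \<comment> \<open>Away from the image of this compact set the two points of a fibre are told
      apart by the sign of their product with \<open>v0\<close>; this provides the evenly covered
      neighbourhood of \<open>x0\<close>.\<close>
    define Bad where "Bad = C \<inter> {x. \<bar>snd x \<bullet> v0\<bar> \<le> 1 / 2}"
    have "closed {x :: 'a \<times> 'b. \<bar>snd x \<bullet> v0\<bar> \<le> 1 / 2}" by (intro closed_Collect_le continuous_intros)
    then have "compact Bad" unfolding Bad_def using compC by (rule compact_Int_closed[rotated])
    then have closed_bad: "closed (fst ` Bad)" using compact_continuous_image[OF cfst] compact_imp_closed by blast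
    define T where "T = S \<inter> - (fst ` Bad)"
    define Us where "Us s = C \<inter> {x. fst x \<in> - (fst ` Bad) \<and> 1 / 2 < s * (snd x \<bullet> v0)}" for s :: real
    define Cs where "Cs s = C \<inter> {x. 1 / 2 \<le> s * (snd x \<bullet> v0)}" for s :: real
    have compCs: "compact (Cs s)" for s
    proof -
      have "closed {x :: 'a \<times> 'b. 1 / 2 \<le> s * (snd x \<bullet> v0)}" by (intro closed_Collect_le continuous_intros)
      then show ?thesis unfolding Cs_def using compC by (rule compact_Int_closed[rotated])
    qed
    have openUs: "openin (top_of_set C) (Us s)" for s
    proof -
      have "open {x :: 'a \<times> 'b. fst x \<in> - (fst ` Bad) \<and> 1 / 2 < s * (snd x \<bullet> v0)}"
      proof (intro open_Collect_conj)
        show "open {x :: 'a \<times> 'b. fst x \<in> - (fst ` Bad)}"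
          using open_vimage[OF open_Compl[OF closed_bad] cfst[of UNIV]] by (simp add: vimage_def)
        show "open {x :: 'a \<times> 'b. 1 / 2 < s * (snd x \<bullet> v0)}" by (intro open_Collect_less continuous_intros)
      qed
      then show ?thesis unfolding Us_def by (rule openin_open_Int)
    qed
    have big: "1 / 2 < \<bar>snd x \<bullet> v0\<bar>" if "x \<in> C" "fst x \<notin> fst ` Bad" for x
      using that by (force simp: Bad_def)
    have injCs: "inj_on fst (Cs s)" for s
    proof (rule inj_onI)
      fix x y assume xy: "x \<in> Cs s" "y \<in> Cs s" "fst x = fst y"
      then have "snd y = snd x \<or> snd y = - snd x" by (intro Cfib) (auto simp: Cs_def)
      moreover have "snd y \<noteq> - snd x" using xy by (auto simp: Cs_def)
      ultimately show "x = y" using xy(3) by (auto intro: prod_eqI)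
    qed
    have imgUs: "fst ` Us s = T" if s: "s = 1 \<or> s = - 1" for s
    proof (intro equalityI subsetI)
      show "y \<in> T" if "y \<in> fst ` Us s" for y using that fstC by (auto simp: Us_def T_def)
      fix y assume y: "y \<in> T"
      then obtain x where x: "x \<in> C" "fst x = y" using fstC by (auto simp: T_def)
      have yB: "y \<notin> fst ` Bad" using y by (simp add: T_def)
      then have "1 / 2 < s * (snd x \<bullet> v0) \<or> 1 / 2 < s * (- snd x \<bullet> v0)" using big[OF x(1)] x(2) s by auto
      then have "x \<in> Us s \<or> (fst x, - snd x) \<in> Us s" using x yB Cminus[OF x(1)] by (auto simp: Us_def)
      then show "y \<in> fst ` Us s" using x(2) by (metis fst_conv image_eqI)
    qed
    have homeo: "\<exists>q. homeomorphism (Us s) T fst q" if s: "s = 1 \<or> s = - 1" for s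
    proof -
      obtain q where q: "homeomorphism (Cs s) (fst ` Cs s) fst q"
        using homeomorphism_compact[OF compCs cfst refl injCs] by blast
      have sub: "Us s \<subseteq> Cs s" by (auto simp: Us_def Cs_def)
      then have "homeomorphism (Us s) T fst q"
        using homeomorphism_of_subsets[OF q sub, of T] imgUs[OF s] image_mono[OF sub, of fst] by simp
      then show ?thesis by blast
    qed
    have "x0 \<in> T"
    proof -
      have "x0 \<notin> fst ` Bad"
      proof
        assume "x0 \<in> fst ` Bad"
        then obtain x where x: "x \<in> C" "fst x = x0" "\<bar>snd x \<bullet> v0\<bar> \<le> 1 / 2" by (auto simp: Bad_def)
        then have "snd x = v0 \<or> snd x = - v0" using Cfib[OF c0(1) x(1)] c0(2) by (simp add: v0_def)
        then show False using x(3) v0 by auto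
      qed
      then show ?thesis using \<open>x0 \<in> S\<close> by (simp add: T_def)
    qed
    moreover have "openin (top_of_set S) T"
      unfolding T_def using closed_bad by (intro openin_open_Int) auto
    moreover have "\<Union> {Us 1, Us (- 1)} = C \<inter> fst -` T"
    proof (intro equalityI subsetI)
      show "x \<in> C \<inter> fst -` T" if "x \<in> \<Union> {Us 1, Us (- 1)}" for x
        using that fstC by (auto simp: Us_def T_def)
      fix x assume "x \<in> C \<inter> fst -` T"
      then have x: "x \<in> C" "fst x \<notin> fst ` Bad" by (auto simp: T_def)
      show "x \<in> \<Union> {Us 1, Us (- 1)}" using big[OF x] x by (auto simp: Us_def abs_if split: if_splits)
    qed
    moreover have "pairwise disjnt {Us 1, Us (- 1)}"
      by (auto simp: pairwise_def disjnt_def Us_def)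
    ultimately show "\<exists>T. x0 \<in> T \<and> openin (top_of_set S) T \<and>
        (\<exists>v. \<Union> v = C \<inter> fst -` T \<and> (\<forall>u\<in>v. openin (top_of_set C) u) \<and> pairwise disjnt v \<and>
          (\<forall>u\<in>v. \<exists>q. homeomorphism u T fst q))"
      using openUs homeo by (intro exI[of _ T] conjI exI[of _ "{Us 1, Us (- 1)}"]) auto
  qed
  have "simply_connected S" unfolding S_def using simply_connected_sphere dim3 by blast
  moreover have "locally path_connected S" unfolding S_def by (rule locally_path_connected_sphere)
  moreover have "continuous_on S (\<lambda>x. x)" "(\<lambda>x. x) \<in> S \<rightarrow> S" by (auto intro: continuous_intros)
  ultimately obtain \<sigma> where \<sigma>: "continuous_on S \<sigma>" "\<sigma> \<in> S \<rightarrow> C" "\<And>y. y \<in> S \<Longrightarrow> fst (\<sigma> y) = y"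
    using covering_space_lift[OF cov, of S "\<lambda>x. x"] by metis
  \<comment> \<open>Comparison with the section \<open>\<sigma>\<close>: the values are
    \<open>1\<close> and \<open>- 1\<close>, so \<open>f\<close> is constant on the connected
    \<open>Z\<close>.\<close>
  define f where "f z = snd (\<sigma> (g z)) \<bullet> \<omega> z" for z
  have gS: "g z \<in> S" if "z \<in> Z" for z using g(2) that by (auto simp: S_def)
  have \<sigma>\<omega>: "snd (\<sigma> (g z)) = \<omega> z \<or> snd (\<sigma> (g z)) = - \<omega> z" if "z \<in> Z" for z
    using Cfib[of "(g z, \<omega> z)" "\<sigma> (g z)"] \<sigma>(2,3) gS[OF that] that by (auto simp: C_def Pi_iff)
  have f1: "f z = 1 \<or> f z = - 1" if "z \<in> Z" for z
    using \<sigma>\<omega>[OF that] \<omega>(2)[OF that] by (auto simp: f_def norm_eq_1)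
  have "continuous_on Z f"
    unfolding f_def by (intro continuous_intros \<omega>(1) continuous_on_compose2[OF \<sigma>(1) g(1)]) (use gS in auto)
  then have eq: "f z = f z'" by (rule integer_valued_constant[OF Z(2) _ _ z(1,2)]) (use f1 in force)
  show ?thesis
    using fib[OF z] f1[OF z(1)] eq unfolding f_def z(3) by auto
qed

text \<open>A maximum of the quadratic form on the unit sphere of \<open>S\<close> is an
  eigenvector: otherwise a step along the residual \<open>r\<close> would violate the
  maximality.\<close>

lemma symmetric_eigenvector:
  fixes A :: "'a::euclidean_space \<Rightarrow> 'a"
  assumes lin: "linear A" and S: "subspace S" "S \<noteq> {0}"
    and inv: "\<And>x. x \<in> S \<Longrightarrow> A x \<in> S"
    and sym: "\<And>x y. x \<in> S \<Longrightarrow> y \<in> S \<Longrightarrow> A x \<bullet> y = x \<bullet> A y"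
  obtains x \<mu> where "x \<in> S" "x \<noteq> 0" "A x = \<mu> *\<^sub>R x"
proof -
  define U where "U = S \<inter> sphere 0 1"
  have cA: "continuous_on X A" for X using linear_continuous_on lin linear_conv_bounded_linear by blast
  obtain s where s: "s \<in> S" "s \<noteq> 0" using S subspace_0 by blast
  have "(1 / norm s) *\<^sub>R s \<in> U" using s subspace_scale[OF S(1)] by (simp add: U_def)
  moreover have "compact U" unfolding U_def using closed_subspace[OF S(1)] by (simp add: closed_Int_compact)
  moreover have "continuous_on U (\<lambda>x. A x \<bullet> x)" by (intro continuous_intros cA)
  ultimately obtain x where x: "x \<in> U" "\<And>y. y \<in> U \<Longrightarrow> A y \<bullet> y \<le> A x \<bullet> x"
    using continuous_attains_sup[of U "\<lambda>x. A x \<bullet> x"] by blast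
  define \<mu> where "\<mu> = A x \<bullet> x"
  have xS: "x \<in> S" "x \<bullet> x = 1" using x(1) by (auto simp: U_def norm_eq_1)
  have max: "A y \<bullet> y \<le> \<mu> * (y \<bullet> y)" if y: "y \<in> S" for y
  proof (cases "y = 0")
    case True
    then show ?thesis using linear_0[OF lin] by simp
  next
    case False
    have "(1 / norm y) *\<^sub>R y \<in> U" using y False subspace_scale[OF S(1)] by (simp add: U_def)
    from x(2)[OF this] have "(A y \<bullet> y) / (norm y * norm y) \<le> \<mu>" by (simp add: linear_cmul[OF lin] \<mu>_def)
    then show ?thesis using False by (simp add: dot_square_norm power2_eq_square field_simps)
  qed
  define r where "r = \<mu> *\<^sub>R x - A x"
  have rS: "r \<in> S" unfolding r_def by (intro subspace_diff subspace_scale S inv xS)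
  have lower: "0 \<le> 2 * t * (r \<bullet> r) + t\<^sup>2 * (\<mu> * (r \<bullet> r) - A r \<bullet> r)" for t
  proof -
    have "x + t *\<^sub>R r \<in> S" by (intro subspace_add subspace_scale S xS rS)
    note m = max[OF this]
    have "A r \<bullet> x = A x \<bullet> r" using sym[OF rS xS(1)] by (simp add: inner_commute)
    then have e: "A (x + t *\<^sub>R r) \<bullet> (x + t *\<^sub>R r) = \<mu> + 2 * t * (A x \<bullet> r) + t\<^sup>2 * (A r \<bullet> r)"
      by (simp add: linear_add[OF lin] linear_cmul[OF lin] inner_add_left inner_add_right \<mu>_def power2_eq_square algebra_simps)
    have e2: "(x + t *\<^sub>R r) \<bullet> (x + t *\<^sub>R r) = 1 + 2 * t * (x \<bullet> r) + t\<^sup>2 * (r \<bullet> r)"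
      using xS(2) by (simp add: inner_add_left inner_add_right inner_commute power2_eq_square algebra_simps)
    have rr: "r \<bullet> r = \<mu> * (x \<bullet> r) - A x \<bullet> r" unfolding r_def by (simp add: inner_diff_left)
    have "2 * t * (r \<bullet> r) = 2 * t * (\<mu> * (x \<bullet> r)) - 2 * t * (A x \<bullet> r)" unfolding rr by (simp add: algebra_simps)
    then show ?thesis using m unfolding e e2 by (simp add: algebra_simps)
  qed
  have "r \<bullet> r = 0"
  proof (rule ccontr)
    assume "r \<bullet> r \<noteq> 0"
    then have pos: "r \<bullet> r > 0" by (simp add: order_less_le)
    define k where "k = \<bar>\<mu> * (r \<bullet> r) - A r \<bullet> r\<bar> + 1"
    \<comment> \<open>With \<open>t\<close> negative and of this size the linear term in
      \<open>lower\<close> outweighs the quadratic one.\<close>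
    define t where "t = - (r \<bullet> r) / k"
    have k: "k > 0" "\<mu> * (r \<bullet> r) - A r \<bullet> r \<le> k" by (auto simp: k_def)
    have "2 * t * (r \<bullet> r) + t\<^sup>2 * (\<mu> * (r \<bullet> r) - A r \<bullet> r) \<le> 2 * t * (r \<bullet> r) + t\<^sup>2 * k"
      using k by (intro add_left_mono mult_left_mono) auto
    also have "\<dots> = - ((r \<bullet> r)\<^sup>2 / k)" using k(1) by (simp add: t_def power2_eq_square field_simps)
    also have "\<dots> < 0" using pos k by simp
    finally show False using lower[of t] by simp
  qed
  then have "A x = \<mu> *\<^sub>R x" by (simp add: r_def)
  moreover have "x \<noteq> 0" using xS(2) by auto
  ultimately show thesis using that xS(1) by blast
qed

text \<open>The orthogonal complement of all eigenvectors is invariant; an eigenvector in it would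
  be orthogonal to itself.\<close>

lemma symmetric_spectral_span:
  fixes A :: "'a::euclidean_space \<Rightarrow> 'a"
  assumes lin: "linear A" and S: "subspace S"
    and inv: "\<And>x. x \<in> S \<Longrightarrow> A x \<in> S"
    and sym: "\<And>x y. x \<in> S \<Longrightarrow> y \<in> S \<Longrightarrow> A x \<bullet> y = x \<bullet> A y"
    and v: "v \<in> S"
  shows "v \<in> span {x \<in> S. \<exists>\<mu>. A x = \<mu> *\<^sub>R x}"
proof -
  define V where "V = {x \<in> S. \<exists>\<mu>. A x = \<mu> *\<^sub>R x}"
  define Q where "Q = {x \<in> S. \<forall>y\<in>V. x \<bullet> y = 0}"
  have subQ: "subspace Q"
    using S by (auto simp: Q_def subspace_def inner_add_left)
  have invQ: "A x \<in> Q" if x: "x \<in> Q" for x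
  proof -
    have "A x \<bullet> y = 0" if y: "y \<in> V" for y
    proof -
      obtain \<mu> where "A y = \<mu> *\<^sub>R y" "y \<in> S" using y by (auto simp: V_def)
      then show ?thesis using sym[of x y] x y by (simp add: Q_def)
    qed
    then show ?thesis using x inv by (simp add: Q_def)
  qed
  have "Q = {0}"
  proof (rule ccontr)
    assume ne: "Q \<noteq> {0}"
    obtain x \<mu> where x: "x \<in> Q" "x \<noteq> 0" "A x = \<mu> *\<^sub>R x"
      by (rule symmetric_eigenvector[OF lin subQ ne invQ]) (use sym in \<open>auto simp: Q_def\<close>)
    then have "x \<in> V" by (auto simp: V_def Q_def)
    then have "x \<bullet> x = 0" using x(1) by (simp add: Q_def)
    then show False using x(2) by simp
  qed
  obtain y z where yz: "y \<in> span V" "\<And>u. u \<in> span V \<Longrightarrow> orthogonal z u" "v = y + z"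
    using orthogonal_subspace_decomp_exists[of V v] by metis
  have "span V \<subseteq> S" using S by (intro span_minimal) (auto simp: V_def)
  then have "z \<in> S" using yz(1,3) v subspace_diff[OF S, of v y] by auto
  then have "z \<in> Q" using yz(2) span_base[of _ V] by (auto simp: Q_def orthogonal_def)
  then show ?thesis using \<open>Q = {0}\<close> yz by (simp add: V_def)
qed

section \<open>Ordering and reflecting angles\<close>

lemma four_elements_sorted:
  fixes S :: "real set"
  assumes "card S = 4"
  obtains p q r s where "S = {p, q, r, s}" "p < q" "q < r" "r < s"
proof -
  have fin: "finite S" using assms by (metis card.infinite zero_neq_numeral)
  define xs where "xs = sorted_list_of_set S"
  have xs: "length xs = 4" "set xs = S" "sorted_wrt (<) xs"
    using assms fin by (auto simp: xs_def)
  obtain p q r s where "xs = [p, q, r, s]"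
    using xs(1) by (auto simp: numeral_eq_Suc length_Suc_conv)
  then show thesis using that[of p q r s] xs(2,3) by auto
qed

lemma cot_reflection:
  assumes "0 < \<phi>" "\<phi> < pi" "0 < \<psi>" "\<psi> < pi" "cos \<phi> / sin \<phi> = - (cos \<psi> / sin \<psi>)"
  shows "\<phi> + \<psi> = pi"
proof -
  have s: "sin \<phi> > 0" "sin \<psi> > 0" using assms sin_gt_zero by auto
  have "sin (\<phi> + \<psi>) = 0" using assms(5) s by (simp add: sin_add field_simps)
  then have "sin (\<phi> + \<psi> - pi) = 0" by (simp add: sin_diff)
  moreover have "\<bar>\<phi> + \<psi> - pi\<bar> < pi" using assms by auto
  ultimately have "\<phi> + \<psi> - pi = 0"
    using sin_gt_zero[of "\<phi> + \<psi> - pi"] sin_gt_zero[of "- (\<phi> + \<psi> - pi)"]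
    by (metis abs_less_iff linorder_neqE_linordered_idom neg_0_less_iff_less order_less_irrefl sin_minus neg_equal_0_iff_equal)
  then show ?thesis by simp
qed

text \<open>The branch of the inverse cotangent with values between \<open>0\<close> and
  \<open>pi\<close>.\<close>

definition cot_angle :: "real \<Rightarrow> real" where "cot_angle \<kappa> = pi / 2 - arctan \<kappa>"

lemma cot_angle:
  "0 < cot_angle \<kappa>" "cot_angle \<kappa> < pi" "sin (cot_angle \<kappa>) > 0" "cos (cot_angle \<kappa>) = \<kappa> * sin (cot_angle \<kappa>)"
  "cot_angle (- \<kappa>) = pi - cot_angle \<kappa>"
proof -
  show 1: "0 < cot_angle \<kappa>" "cot_angle \<kappa> < pi"
    using arctan_bounded[of \<kappa>] by (auto simp: cot_angle_def)
  then show "sin (cot_angle \<kappa>) > 0" by (rule sin_gt_zero)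
  have "cos (arctan \<kappa>) \<noteq> 0" by simp
  then have "sin (arctan \<kappa>) = \<kappa> * cos (arctan \<kappa>)" using tan_arctan[of \<kappa>] by (simp add: tan_def field_simps)
  then show "cos (cot_angle \<kappa>) = \<kappa> * sin (cot_angle \<kappa>)"
    by (simp add: cot_angle_def cos_diff sin_diff)
  show "cot_angle (- \<kappa>) = pi - cot_angle \<kappa>" by (simp add: cot_angle_def arctan_minus)
qed

lemma inj_cot_angle: "inj cot_angle"
  by (rule injI) (simp add: cot_angle_def arctan_eq_iff)

section \<open>Symmetry of the angles at one end\<close>

context isoparam
begin

text \<open>An eigenvector for \<open>lam \<kappa>\<close> at the point with the opposite normal is
  one for \<open>- lam \<kappa>\<close> of the original shape operator. If no
  \<open>lam \<kappa>'\<close> had this value, it would be orthogonal to the eigenvectors in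
  \<open>Et p\<close>, which span the tangent space.\<close>

lemma lam_symmetric:
  assumes \<kappa>: "\<kappa> \<in> K" "\<alpha> \<kappa> \<noteq> 0"
  obtains \<kappa>' where "\<kappa>' \<in> K" "\<alpha> \<kappa>' \<noteq> 0" "lam \<kappa>' = - lam \<kappa>"
proof (rule ccontr)
  assume neg: "\<not> thesis"
  have nl: "lam \<kappa>' \<noteq> - lam \<kappa>" if "\<kappa>' \<in> K" "\<alpha> \<kappa>' \<noteq> 0" for \<kappa>' using neg assms that \<open>\<And>\<kappa>'. \<kappa>' \<in> K \<Longrightarrow> \<alpha> \<kappa>' \<noteq> 0 \<Longrightarrow> lam \<kappa>' = - lam \<kappa> \<Longrightarrow> thesis\<close> by blast
  obtain p where p: "p \<in> M" using M_ne by (auto simp: M_def)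
  obtain p' where p': "p' \<in> M" "foc p' = foc p" "nu p' = - nu p" using opposite_normal[OF p] .
  obtain X where X: "X \<in> E p' \<kappa>" "X \<noteq> 0" using E_nontrivial[OF p'(1) \<kappa>(1)] .
  let ?A = "shape (foc p) (nu p)"
  have XT: "X \<in> Tan (foc p)" using Et_Tan[OF p'(1), of X] X \<kappa> p'(2) by auto
  have "shape (foc p) (- nu p) X = lam \<kappa> *\<^sub>R X" using shape_E[OF p'(1) X(1) \<kappa>] p'(2,3) by simp
  then have AX: "?A X = - lam \<kappa> *\<^sub>R X" using shape_uminus[OF foc_\<Sigma>[OF p], of "nu p" X] by (simp add: minus_equation_iff[of "?A X"])
  have "X \<bullet> Y = 0" if Y: "Y \<in> Et p" for Y
  proof -
    obtain \<kappa>' where \<kappa>': "\<kappa>' \<in> K" "\<alpha> \<kappa>' \<noteq> 0" "Y \<in> E p \<kappa>'" using Y by blast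
    have "?A Y = lam \<kappa>' *\<^sub>R Y" by (rule shape_E[OF p \<kappa>'(3,1,2)])
    then have "- lam \<kappa> * (X \<bullet> Y) = lam \<kappa>' * (X \<bullet> Y)" using shape_sym[OF p, of X Y] AX by simp
    moreover have "lam \<kappa>' \<noteq> - lam \<kappa>" by (rule nl[OF \<kappa>'(1,2)])
    ultimately show ?thesis by (simp only: mult_cancel_right) auto
  qed
  then have "X = 0" by (rule span_orthogonal_eq_0[OF Tan_span[OF p XT]])
  then show False using X(2) by simp
qed

lemma angle_ge: assumes "\<kappa> \<in> K" shows "d \<le> cot_angle \<kappa>"
  using no_focal_before[OF assms, of "cot_angle \<kappa>"] cot_angle[of \<kappa>] by force

lemma angle_trig:
  "\<alpha> \<kappa> * sin (cot_angle \<kappa>) = sin (cot_angle \<kappa> - d)"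
  "(sin d + \<kappa> * cos d) * sin (cot_angle \<kappa>) = cos (cot_angle \<kappa> - d)"
  by (simp_all add: \<alpha>_def sin_diff cos_diff cot_angle(4) algebra_simps)

lemma focal_angle: assumes "\<kappa> \<in> K" shows "\<alpha> \<kappa> = 0 \<longleftrightarrow> cot_angle \<kappa> = d"
proof
  assume "\<alpha> \<kappa> = 0"
  then have "sin (cot_angle \<kappa> - d) = 0" using angle_trig(1)[of \<kappa>] by simp
  moreover have "cot_angle \<kappa> - d < pi" using cot_angle(2)[of \<kappa>] d_pos by simp
  ultimately show "cot_angle \<kappa> = d" using angle_ge[OF assms] sin_gt_zero[of "cot_angle \<kappa> - d"] by force
next
  assume "cot_angle \<kappa> = d"
  then show "\<alpha> \<kappa> = 0" using angle_trig(1)[of \<kappa>] cot_angle(3)[of \<kappa>] by simp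
qed

lemma lam_angle: "lam \<kappa> = cos (cot_angle \<kappa> - d) / sin (cot_angle \<kappa> - d)"
  unfolding lam_def angle_trig[symmetric] using cot_angle(3)[of \<kappa>] by simp

lemma angle_symmetric:
  assumes "\<kappa> \<in> K" "cot_angle \<kappa> \<noteq> d"
  obtains \<kappa>' where "\<kappa>' \<in> K" "cot_angle \<kappa>' \<noteq> d" "(cot_angle \<kappa> - d) + (cot_angle \<kappa>' - d) = pi"
proof -
  obtain \<kappa>' where \<kappa>': "\<kappa>' \<in> K" "\<alpha> \<kappa>' \<noteq> 0" "lam \<kappa>' = - lam \<kappa>"
    using lam_symmetric[OF assms(1)] focal_angle[OF assms(1)] assms(2) by blast
  have "(cot_angle \<kappa> - d) + (cot_angle \<kappa>' - d) = pi"
    by (rule cot_reflection)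
      (use angle_ge[OF assms(1)] angle_ge[OF \<kappa>'(1)] assms focal_angle[OF \<kappa>'(1)] \<kappa>' cot_angle(2)[of \<kappa>] cot_angle(2)[of \<kappa>'] d_pos
        in \<open>auto simp: lam_angle\<close>)
  then show thesis using that \<kappa>' focal_angle by blast
qed

end

text \<open>The reflection at \<open>pi / 2\<close> reverses the order in each triple, so it fixes
  the middle elements \<open>r\<close> and \<open>s - q\<close> and exchanges \<open>q\<close> and
  \<open>s\<close>; this determines all three.\<close>

lemma spacing:
  fixes q r s :: real
  assumes "0 < q" "q < r" "r < s"
    and "\<And>x. x \<in> {q, r, s} \<Longrightarrow> pi - x \<in> {q, r, s}"
    and "\<And>x. x \<in> {s - r, s - q, s} \<Longrightarrow> pi - x \<in> {s - r, s - q, s}"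
  shows "q = pi / 4" "r = pi / 2" "s = 3 * pi / 4"
proof -
  have "r = pi / 2" "q + s = pi" using assms(1-3) assms(4)[of q] assms(4)[of r] assms(4)[of s] by auto
  moreover have "s - q = pi / 2" using assms(1-3) assms(5)[of "s - r"] assms(5)[of "s - q"] assms(5)[of s] by auto
  ultimately show "q = pi / 4" "r = pi / 2" "s = 3 * pi / 4" by (auto simp: field_simps)
qed

section \<open>Both ends are focal\<close>

context transnormal
begin

lemma neg_w: "x \<noteq> 0 \<Longrightarrow> transnormal.w (\<lambda>x. - F x) (\<lambda>t. b (- t)) x = - w x"
  unfolding transnormal.w_def[OF neg_transnormal] w_def by (simp add: neg_grd)

lemma neg_W:
  assumes "x \<in> regular"
  shows "transnormal.W (\<lambda>x. - F x) (\<lambda>t. b (- t)) x v = - W x v"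
proof -
  have "((\<lambda>x. - w x) has_derivative (\<lambda>v. - W x v)) (at x)" by (rule has_derivative_minus[OF dw[OF assms]])
  then have "(transnormal.w (\<lambda>x. - F x) (\<lambda>t. b (- t)) has_derivative (\<lambda>v. - W x v)) (at x)"
    by (rule has_derivative_transform_within_open[OF _ open_regular assms]) (simp add: neg_w regular_def)
  from fun_cong[OF frechet_derivative_at[OF this], of v] show ?thesis
    unfolding transnormal.W_def[OF neg_transnormal] by simp
qed

lemma neg_geo:
  assumes "p \<noteq> 0"
  shows "transnormal.geo (\<lambda>x. - F x) (\<lambda>t. b (- t)) p s = geo p (- s)"
    and "transnormal.geo' (\<lambda>x. - F x) (\<lambda>t. b (- t)) p s = - geo' p (- s)"
  unfolding transnormal.geo_def[OF neg_transnormal] transnormal.geo'_def[OF neg_transnormal] geo_def geo'_def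
  by (simp_all add: neg_w[OF assms])

end

text \<open>Passing to \<open>- F\<close> reverses \<open>w\<close>, hence the signs of the
  principal curvatures, and exchanges the two ends.\<close>

lemma (in isoparam) neg_isoparam:
  assumes "b tm = 0"
  shows "isoparam (\<lambda>x. - F x) (\<lambda>t. b (- t)) (- tp) (- t0) (- tm) (uminus ` K)"
proof -
  interpret n: transnormal "\<lambda>x. - F x" "\<lambda>t. b (- t)" by (rule neg_transnormal)
  have reg: "p \<in> regular" "p \<noteq> 0" if "norm p = 1" "F p = t0" for p
    using that M_regular[of p] \<Omega>_ne0[OF M_\<Omega>, of p] by (auto simp: M_def)
  have E: "{X. X \<bullet> p = 0 \<and> X \<bullet> n.w p = 0 \<and> n.W p X = - (- \<kappa>) *\<^sub>R X} = {X. X \<bullet> p = 0 \<and> X \<bullet> w p = 0 \<and> W p X = - \<kappa> *\<^sub>R X}"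
    if "norm p = 1" "F p = t0" for p \<kappa>
    using neg_w[OF reg(2)[OF that]] neg_W[OF reg(1)[OF that]] by (auto simp: minus_equation_iff)
  show ?thesis
  proof unfold_locales
    fix p X assume p: "norm p = 1" "- F p = - t0" and X: "X \<bullet> p = 0" "X \<bullet> n.w p = 0"
    have p': "F p = t0" using p by simp
    have "X \<bullet> w p = 0" using X(2) neg_w[OF reg(2)[OF p(1) p']] by simp
    have "(\<Union>\<kappa>\<in>uminus ` K. {X. X \<bullet> p = 0 \<and> X \<bullet> n.w p = 0 \<and> n.W p X = - \<kappa> *\<^sub>R X}) =
        (\<Union>\<kappa>\<in>K. {X. X \<bullet> p = 0 \<and> X \<bullet> w p = 0 \<and> W p X = - \<kappa> *\<^sub>R X})"
      unfolding image_image[symmetric] using E[OF p(1) p'] by simp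
    then show "X \<in> span (\<Union>\<kappa>\<in>uminus ` K. {X. X \<bullet> p = 0 \<and> X \<bullet> n.w p = 0 \<and> n.W p X = - \<kappa> *\<^sub>R X})"
      using E_span[OF p(1) p' X(1) \<open>X \<bullet> w p = 0\<close>] by simp
  next
    fix p \<kappa> assume p: "norm p = 1" "- F p = - t0" and "\<kappa> \<in> uminus ` K"
    then obtain \<kappa>' where \<kappa>': "\<kappa>' \<in> K" "\<kappa> = - \<kappa>'" by blast
    show "{X. X \<bullet> p = 0 \<and> X \<bullet> n.w p = 0 \<and> n.W p X = - \<kappa> *\<^sub>R X} \<noteq> {0}"
      unfolding \<kappa>'(2) using E[OF p(1), of \<kappa>'] E_ne[OF p(1) _ \<kappa>'(1)] p(2) by simp
  qed (use dim3 t_order b_pos M_ne M_conn assms in auto)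
qed

text \<open>The other end \<open>tm\<close> becomes the end \<open>tp\<close> of \<open>- F\<close>.\<close>

locale two_ended = isoparam F b tm t0 tp K for F :: "'a::euclidean_space \<Rightarrow> real" and b tm t0 tp K +
  assumes b_tm: "b tm = 0" and card_K: "card K = 4"
begin

sublocale N: isoparam "\<lambda>x. - F x" "\<lambda>t. b (- t)" "- tp" "- t0" "- tm" "uminus ` K"
  by (rule neg_isoparam[OF b_tm])

lemma N_M: "N.M = M" by (simp add: N.M_def M_def)

lemma N_\<Omega>: "N.\<Omega> = \<Omega>" by (auto simp: N.\<Omega>_def \<Omega>_def)

lemma N_L: assumes "tm < t" "t < tp" shows "N.L (- t) = - L t"
proof -
  define y where "y s = N.L (- (t0 + s)) + L (t0 + s)" for s
  have "y (t - t0) = 0"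
  proof (rule gronwall_zero[where y = y and T = "t - t0" and y' = "\<lambda>s. 0" and K = 0])
    fix s assume "s \<in> closed_segment 0 (t - t0)"
    then have s: "tm < t0 + s" "t0 + s < tp" using assms t_order by (auto simp: closed_segment_eq_real_ivl split: if_splits)
    have 1: "((\<lambda>s. N.L (- (t0 + s))) has_real_derivative 1 / sqrt (b (- (- (t0 + s)))) * - (0 + 1)) (at s)"
      by (rule DERIV_chain2[OF N.dL]) (use s in \<open>auto intro!: derivative_eq_intros\<close>)
    have 2: "((\<lambda>s. L (t0 + s)) has_real_derivative 1 / sqrt (b (t0 + s)) * (0 + 1)) (at s)"
      by (rule DERIV_chain2[OF dL]) (use s in \<open>auto intro!: derivative_eq_intros\<close>)
    have "(y has_real_derivative 0) (at s)"
      unfolding y_def using DERIV_add[OF 1 2] by (simp add: add.commute)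
    then show "(y has_vector_derivative 0) (at s)" by (simp add: has_real_derivative_iff_has_vector_derivative)
  qed (auto simp: y_def L_t0 N.L_t0)
  then show ?thesis by (simp add: y_def)
qed

lemma M_geo_full:
  assumes p: "p \<in> M" and s: "- N.d < s" "s < d"
  shows "geo p s \<in> \<Omega>" "L (F (geo p s)) = s" "w (geo p s) = geo' p s"
proof -
  have p0: "p \<noteq> 0" using M_norm[OF p] by auto
  have "geo p s \<in> \<Omega> \<and> L (F (geo p s)) = s \<and> w (geo p s) = geo' p s"
  proof (cases "0 \<le> s")
    case True
    then show ?thesis using M_geo[OF p _ s(2)] by simp
  next
    case False
    note n = N.M_geo[of p "- s", unfolded N_M N_\<Omega> neg_geo[OF p0], OF p]
    have O: "geo p s \<in> \<Omega>" using n(1) False s by simp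
    have "N.w (geo p s) = - w (geo p s)" by (rule neg_w[OF \<Omega>_ne0[OF O]])
    moreover have "N.L (- F (geo p s)) = - L (F (geo p s))" by (rule N_L[OF \<Omega>_F[OF O]])
    ultimately show ?thesis using n(2,3) O False s by simp
  qed
  then show "geo p s \<in> \<Omega>" "L (F (geo p s)) = s" "w (geo p s) = geo' p s" by auto
qed

lemma F_geo_neg: "p \<in> M \<Longrightarrow> F (geo p (- N.d)) = tm"
  using N.F_geo_d[of p] neg_geo(1)[OF \<Omega>_ne0[OF M_\<Omega>], of p N.d] by (simp add: N_M)

lemma \<Omega>_L: assumes "x \<in> \<Omega>" shows "- N.d < L (F x)" "L (F x) < d"
  using L_less_d[OF \<Omega>_F[OF assms]] N.L_less_d[of "- F x"] N_L[OF \<Omega>_F[OF assms]] \<Omega>_F[OF assms] by auto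

text \<open>
  If the end \<open>tp\<close> were not focal, \<open>\<Sigma>\<close> would be a hypersurface whose unit normals at a point,
  pointing to the same connected \<open>M\<close>, could be exchanged: a one-sided hypersurface of the sphere.
\<close>

lemma focal_exists: "\<exists>\<kappa>\<in>K. \<alpha> \<kappa> = 0"
proof (rule ccontr)
  assume "\<not> ?thesis"
  then have nf: "\<alpha> \<kappa> \<noteq> 0" if "\<kappa> \<in> K" for \<kappa> using that by blast
  \<comment> \<open>Without a focal direction the eigenspace of the Hessian for \<open>- c\<close>
    at a focal point is only the line of \<open>nu p\<close>, so two unit normals there agree up to
    sign.\<close>
  have line: "v = nu p \<or> v = - nu p" if p: "p \<in> M" and v: "H (foc p) v = - c *\<^sub>R v" "norm v = 1" for p v
  proof -
    note q = foc_\<Sigma>[OF p] and o = M_orthonormal[OF p p, of d]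
    note lin = linH[OF \<Sigma>_ne0[OF q]]
    have "c * (v \<bullet> foc p) = 0" using H_inner_q(1)[OF q, of v] v(1) by simp
    then have vq: "v \<bullet> foc p = 0" using c_pos by simp
    define v' where "v' = v - (v \<bullet> nu p) *\<^sub>R nu p"
    have "v' \<bullet> foc p = 0" "v' \<bullet> nu p = 0"
      using vq o by (simp_all add: v'_def inner_diff_left inner_commute[of "nu p" "foc p"])
    then have sp: "v' \<in> span (\<Union>\<kappa>\<in>K. E p \<kappa>)" by (rule perp_span[OF p])
    have "H (foc p) v' = 0"
      by (rule linear_eq_0_on_span[OF lin _ sp]) (use H_E[OF p] nf in auto)
    moreover have "H (foc p) v' = - c *\<^sub>R v'"
      using v(1) H_nu[OF p] by (simp add: v'_def linear_diff[OF lin] linear_cmul[OF lin] algebra_simps)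
    ultimately have "v' = 0" using c_pos by simp
    then have e: "v = (v \<bullet> nu p) *\<^sub>R nu p" by (simp add: v'_def)
    then have "norm v = \<bar>v \<bullet> nu p\<bar> * norm (nu p)" by (metis norm_scaleR)
    then have "\<bar>v \<bullet> nu p\<bar> = 1" using v(2) o(5) by simp
    then have "v \<bullet> nu p = 1 \<or> v \<bullet> nu p = - 1" by linarith
    then show ?thesis using e by (metis scaleR_minus1_left scaleR_one)
  qed
  \<comment> \<open>\<open>\<tau>\<close> is zero for \<open>s \<le> 0\<close> and grows to
    \<open>pi / 2\<close> at \<open>s = d\<close>. So \<open>\<omega>\<close> is constant near the
    other end, where a fibre of \<open>g\<close> may be large, and carries the normal
    \<open>nu\<close> at \<open>s = d\<close>, where only the sign is ambiguous.\<close>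
  define \<tau> where "\<tau> s = pi / 2 * max 0 (s / d)" for s
  define \<omega> where "\<omega> z = (cos (\<tau> (snd z)), sin (\<tau> (snd z)) *\<^sub>R geo' (fst z) (snd z))" for z :: "'a \<times> real"
  define g where "g z = geo (fst z) (snd z)" for z :: "'a \<times> real"
  define Z where "Z = M \<times> {- N.d..d}"
  obtain p where p: "p \<in> M" using M_ne by (auto simp: M_def)
  have dd: "d > 0" "N.d > 0" using d_pos N.d_pos by auto
  have contw: "continuous_on Z (\<lambda>z. w (fst z))"
    by (rule continuous_on_compose2[OF contw continuous_on_fst[OF continuous_on_id]]) (use M_regular in \<open>auto simp: Z_def\<close>)
  have cont\<tau>: "continuous_on Z (\<lambda>z. \<tau> (snd z))"
    unfolding \<tau>_def using dd by (intro continuous_intros) auto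
  have contg: "continuous_on Z g" unfolding g_def geo_def by (intro continuous_intros contw)
  have cont\<omega>: "continuous_on Z \<omega>" unfolding \<omega>_def geo'_def by (intro continuous_intros contw cont\<tau>)
  have \<tau>d: "\<tau> d = pi / 2" and \<tau>e: "\<tau> (- N.d) = 0" using dd by (auto simp: \<tau>_def max_def field_simps)
  have FZ: "(s = d \<longleftrightarrow> F (geo p s) = tp) \<and> (s = - N.d \<longleftrightarrow> F (geo p s) = tm)"
    if "p \<in> M" "s \<in> {- N.d..d}" for p s
  proof (cases "s = d \<or> s = - N.d")
    case True
    then show ?thesis using F_geo_d[OF that(1)] F_geo_neg[OF that(1)] t_order dd by auto
  next
    case False
    then have "geo p s \<in> \<Omega>" using M_geo_full(1)[OF that(1)] that(2) by auto
    then show ?thesis using \<Omega>_F False by force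
  qed
  have sign: "\<omega> z' = \<omega> z" if zz: "z \<in> Z" "z' \<in> Z" "g z = g z'" for z z'
  proof (rule no_sign_change[OF dim3 _ _ contg _ cont\<omega> _ _ zz])
    show "compact Z" unfolding Z_def by (intro compact_Times compact_M compact_Icc)
    show "connected Z" unfolding Z_def using M_conn by (intro connected_Times) (auto simp: M_def)
    show "g ` Z = sphere 0 1"
    proof (intro equalityI subsetI)
      show "x \<in> sphere 0 1" if "x \<in> g ` Z" for x
        using that M_orthonormal(4) by (auto simp: g_def Z_def)
      fix x :: 'a assume "x \<in> sphere 0 1"
      then have x1: "norm x = 1" by simp
      have le: "F x \<le> tp" "tm \<le> F x" using F_le_tp[OF x1] N.F_le_tp[OF x1] by auto
      have "F x = tp \<or> F x = tm \<or> x \<in> \<Omega>" using le x1 unfolding \<Omega>_def by force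
      then consider "F x = tp" | "F x = tm" | "x \<in> \<Omega>" by blast
      then show "x \<in> g ` Z"
      proof cases
        case 1
        then obtain p where "p \<in> M" "foc p = x" using foc_surj[of x] x1 by (auto simp: \<Sigma>_def)
        then show ?thesis using dd by (intro image_eqI[of _ _ "(p, d)"]) (auto simp: g_def Z_def)
      next
        case 2
        then obtain p where p: "p \<in> M" "N.geo p N.d = x" using N.foc_surj[of x] x1 by (auto simp: N.\<Sigma>_def N_M)
        moreover have "p \<noteq> 0" using M_norm[OF p(1)] by auto
        ultimately show ?thesis using dd neg_geo(1) by (intro image_eqI[of _ _ "(p, - N.d)"]) (auto simp: g_def Z_def)
      next
        case 3
        then show ?thesis using geo_backwards(1,3)[OF 3] \<Omega>_L[OF 3]
          by (intro image_eqI[of _ _ "(geo x (- L (F x)), L (F x))"]) (auto simp: g_def Z_def)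
      qed
    qed
    show "norm (\<omega> z) = 1" if "z \<in> Z" for z
    proof -
      have "geo' (fst z) (snd z) \<bullet> geo' (fst z) (snd z) = 1" using M_orthonormal(2) that by (auto simp: Z_def)
      then have "\<omega> z \<bullet> \<omega> z = (cos (\<tau> (snd z)))\<^sup>2 + (sin (\<tau> (snd z)))\<^sup>2"
        by (simp add: \<omega>_def inner_prod_def power2_eq_square)
      then show ?thesis by (simp add: norm_eq_1)
    qed
    fix z z' assume z: "z \<in> Z" "z' \<in> Z" "g z = g z'"
    obtain p s p' s' where ps: "z = (p, s)" "z' = (p', s')" "p \<in> M" "p' \<in> M" "s \<in> {- N.d..d}" "s' \<in> {- N.d..d}"
      using z(1,2) by (auto simp: Z_def)
    have geq: "geo p s = geo p' s'" using z(3) ps by (simp add: g_def)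
    consider "s = d" | "s = - N.d" | "- N.d < s" "s < d" using ps(5) by force
    then show "\<omega> z' = \<omega> z \<or> \<omega> z' = - \<omega> z"
    proof cases
      case 1
      then have s': "s' = d" using FZ[OF ps(3,5)] FZ[OF ps(4,6)] geq by metis
      have "nu p' = nu p \<or> nu p' = - nu p"
        using line[OF ps(3), of "nu p'"] H_nu[OF ps(4)] M_orthonormal(5)[OF ps(4) ps(4)] geq 1 s' by simp
      then show ?thesis using 1 s' by (auto simp: \<omega>_def ps \<tau>d)
    next
      case 2
      then have "s' = - N.d" using FZ[OF ps(3,5)] FZ[OF ps(4,6)] geq by metis
      then show ?thesis using 2 by (simp add: \<omega>_def ps \<tau>e zero_prod_def)
    next
      case 3
      then have "s' \<noteq> d" "s' \<noteq> - N.d" using FZ[OF ps(3,5)] FZ[OF ps(4,6)] geq by force+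
      then have s'b: "- N.d < s'" "s' < d" using ps(6) by auto
      have "s' = s" using M_geo_full(2)[OF ps(3) 3] M_geo_full(2)[OF ps(4) s'b] geq by simp
      moreover have "geo' p' s' = geo' p s" using M_geo_full(3)[OF ps(3) 3] M_geo_full(3)[OF ps(4) s'b] geq by simp
      ultimately show ?thesis by (simp add: \<omega>_def ps)
    qed
  qed
  obtain p' where p': "p' \<in> M" "foc p' = foc p" "nu p' = - nu p" using opposite_normal[OF p] .
  have "\<omega> (p', d) = \<omega> (p, d)"
    by (rule sign) (use p p' dd in \<open>auto simp: Z_def g_def\<close>)
  then have "nu p' = nu p" by (simp add: \<omega>_def \<tau>d)
  then have "nu p + nu p = 0" using p'(3) by (metis add.right_inverse)
  then have "nu p = 0" by (simp add: scaleR_2[symmetric])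
  then show False using M_orthonormal(5)[OF p p, of d] by simp
qed

end

lemma (in two_ended) neg_two_ended:
  "two_ended (\<lambda>x. - F x) (\<lambda>t. b (- t)) (- tp) (- t0) (- tm) (uminus ` K)"
proof (intro two_ended.intro two_ended_axioms.intro)
  show "isoparam (\<lambda>x. - F x) (\<lambda>t. b (- t)) (- tp) (- t0) (- tm) (uminus ` K)" by unfold_locales
  show "b (- (- tp)) = 0" using b_tp by simp
  show "card (uminus ` K) = 4" using card_K by (simp add: card_image)
qed

lemma cot_values:
  fixes x :: real
  assumes "x = pi / 4 \<or> x = pi / 2 \<or> x = 3 * pi / 4"
  shows "cos x / sin x = 1 \<or> cos x / sin x = 0 \<or> cos x / sin x = - 1"
  using assms
proof (elim disjE)
  assume x: "x = pi / 4"
  show ?thesis unfolding x by (simp add: cos_45 sin_45)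
next
  assume x: "x = pi / 2"
  show ?thesis unfolding x by simp
next
  assume "x = 3 * pi / 4"
  then have x: "x = pi - pi / 4" by simp
  show ?thesis unfolding x cos_pi_minus sin_pi_minus by (simp add: cos_45 sin_45)
qed

theorem (in two_ended) A_manifold_\<Sigma>: "A_manifold \<Sigma>"
proof (rule \<Sigma>_A_manifold)
  fix \<kappa> assume \<kappa>: "\<kappa> \<in> K" "\<alpha> \<kappa> \<noteq> 0"
  obtain \<kappa>0 where "\<kappa>0 \<in> K" "\<alpha> \<kappa>0 = 0" using focal_exists by blast
  then have \<kappa>0: "\<kappa>0 \<in> K" "cot_angle \<kappa>0 = d" using focal_angle by auto
  obtain \<kappa>1' where "\<kappa>1' \<in> uminus ` K" "N.\<alpha> \<kappa>1' = 0" using two_ended.focal_exists[OF neg_two_ended] by blast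
  then obtain \<kappa>1 where "\<kappa>1 \<in> K" "N.\<alpha> (- \<kappa>1) = 0" by blast
  then have \<kappa>1: "\<kappa>1 \<in> K" "pi - cot_angle \<kappa>1 = N.d" using N.focal_angle[of "- \<kappa>1"] cot_angle(5) by auto
  define \<Theta> where "\<Theta> = cot_angle ` K"
  have "card \<Theta> = 4" unfolding \<Theta>_def using card_K card_image[OF inj_on_subset[OF inj_cot_angle]] by simp
  then obtain a1 a2 a3 a4 where a: "\<Theta> = {a1, a2, a3, a4}" "a1 < a2" "a2 < a3" "a3 < a4"
    by (rule four_elements_sorted)
  have ge: "d \<le> x" if "x \<in> \<Theta>" for x using that angle_ge by (auto simp: \<Theta>_def)
  have le: "x \<le> pi - N.d" if "x \<in> \<Theta>" for x
    using that N.angle_ge[of "- _"] cot_angle(5) by (force simp: \<Theta>_def)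
  have "d \<in> \<Theta>" unfolding \<Theta>_def \<kappa>0(2)[symmetric] using \<kappa>0(1) by (rule imageI)
  moreover have "pi - N.d \<in> \<Theta>" unfolding \<Theta>_def \<kappa>1(2)[symmetric] using imageI[OF \<kappa>1(1), of cot_angle] by simp
  ultimately have "d \<in> \<Theta>" "pi - N.d \<in> \<Theta>" by auto
  \<comment> \<open>By \<open>ge\<close> and \<open>le\<close> all angles lie between the focal
    angles of the two ends, which are themselves among the four.\<close>
  then have d1: "a1 = d" and d4: "a4 = pi - N.d"
    using ge[of a1] le[of a4] a by auto
  have s1: "\<exists>y\<in>\<Theta>. y \<noteq> d \<and> (x - d) + (y - d) = pi" if x: "x \<in> \<Theta>" "x \<noteq> d" for x
  proof -
    obtain k where "k \<in> K" "x = cot_angle k" using x by (auto simp: \<Theta>_def)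
    then show ?thesis using angle_symmetric[of k] x(2) by (metis \<Theta>_def imageI)
  qed
  have s2: "\<exists>y\<in>\<Theta>. y \<noteq> a4 \<and> (a4 - x) + (a4 - y) = pi" if x: "x \<in> \<Theta>" "x \<noteq> a4" for x
  proof -
    obtain k where k: "k \<in> K" "x = cot_angle k" using x by (auto simp: \<Theta>_def)
    have kN: "- k \<in> uminus ` K" "cot_angle (- k) \<noteq> N.d" using k x(2) d4 cot_angle(5)[of k] by auto
    from N.angle_symmetric[OF this] obtain k' where
      k': "k' \<in> uminus ` K" "cot_angle k' \<noteq> N.d" "(cot_angle (- k) - N.d) + (cot_angle k' - N.d) = pi" .
    then obtain j where j: "j \<in> K" "k' = - j" by blast
    have "(a4 - x) + (a4 - cot_angle j) = pi" "cot_angle j \<noteq> a4"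
      using k' k d4 cot_angle(5)[of k] cot_angle(5)[of j] j(2) by auto
    then show ?thesis using j by (auto simp: \<Theta>_def)
  qed
  have r1: "pi - x \<in> {a2 - d, a3 - d, a4 - d}" if "x \<in> {a2 - d, a3 - d, a4 - d}" for x
  proof -
    have "x + d \<in> \<Theta>" "x + d \<noteq> d" using that a d1 by auto
    from s1[OF this] obtain y where y: "y \<in> \<Theta>" "y \<noteq> d" "x + (y - d) = pi" by auto
    then have "pi - x = y - d" by simp
    then show ?thesis using y(1,2) a(1) d1 by auto
  qed
  have r2: "pi - x \<in> {a4 - a3, a4 - a2, a4 - d}" if "x \<in> {a4 - a3, a4 - a2, a4 - d}" for x
  proof -
    have "a4 - x \<in> \<Theta>" "a4 - x \<noteq> a4" using that a d1 by auto
    from s2[OF this] obtain y where y: "y \<in> \<Theta>" "y \<noteq> a4" "x + (a4 - y) = pi" by auto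
    then have "pi - x = a4 - y" by simp
    then show ?thesis using y(1,2) a(1) d1 by auto
  qed
  have sp: "a2 - d = pi / 4" "a3 - d = pi / 2" "a4 - d = 3 * pi / 4"
    by (rule spacing[of "a2 - d" "a3 - d" "a4 - d"]; use a d1 r1 r2 in \<open>simp add: algebra_simps\<close>)+
  have "cot_angle \<kappa> \<in> \<Theta>" "cot_angle \<kappa> \<noteq> d" using \<kappa> focal_angle by (auto simp: \<Theta>_def)
  then have "cot_angle \<kappa> - d = pi / 4 \<or> cot_angle \<kappa> - d = pi / 2 \<or> cot_angle \<kappa> - d = 3 * pi / 4"
    using a(1) d1 sp by auto
  then have "lam \<kappa> = 1 \<or> lam \<kappa> = 0 \<or> lam \<kappa> = - 1" unfolding lam_angle by (rule cot_values)
  then show "lam \<kappa> * lam \<kappa> * lam \<kappa> = lam \<kappa>" by auto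
qed

section \<open>Passing from functions on the sphere to radial extensions\<close>

lemma normalize_powr: "x \<noteq> 0 \<Longrightarrow> (1 / norm x) *\<^sub>R x = ((x \<bullet> x) powr (- 1 / 2)) *\<^sub>R (x :: 'a::real_inner)"
  by (simp add: powr_minus powr_half_sqrt norm_eq_sqrt_inner inverse_eq_divide)

lemma smooth_on_normalize: "smooth_on (- {0}) (\<lambda>x :: 'a::euclidean_space. (1 / norm x) *\<^sub>R x)"
proof -
  have o: "open (- {0 :: 'a})" by (simp add: open_Compl)
  have "smooth_on (- {0}) (\<lambda>x :: 'a. ((x \<bullet> x) powr (- 1 / 2)) *\<^sub>R x)"
    by (intro smooth_on_scaleR smooth_on_powr smooth_on_inner smooth_on_id o) auto
  moreover have "(1 / norm x) *\<^sub>R x = ((x \<bullet> x) powr (- 1 / 2)) *\<^sub>R x" if "x \<in> - {0}" for x :: 'a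
    by (rule normalize_powr) (use that in simp)
  ultimately show ?thesis using smooth_on_cong[OF o] by (metis (no_types, lifting))
qed

lemma radial_extension_sphere:
  assumes f: "smooth_map_on (sphere 0 1) f"
  shows "radial_extension (\<lambda>x :: 'a::euclidean_space. f ((1 / norm x) *\<^sub>R x))"
proof
  let ?n = "\<lambda>x :: 'a. (1 / norm x) *\<^sub>R x"
  have o: "open (- {0 :: 'a})" by (simp add: open_Compl)
  show "smooth_on (- {0}) (\<lambda>x. f (?n x))"
  proof (rule smooth_on_local)
    fix x :: 'a assume "x \<in> - {0}"
    then have x: "x \<noteq> 0" "?n x \<in> sphere 0 1" by auto
    obtain W H where W: "open W" "?n x \<in> W" "smooth_on W H" "\<And>y. y \<in> W \<inter> sphere 0 1 \<Longrightarrow> H y = f y"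
      using f[unfolded smooth_map_on_def, rule_format, OF x(2)] by metis
    define W' where "W' = (- {0}) \<inter> ?n -` W"
    have oW: "open W'"
      unfolding W'_def by (rule continuous_open_preimage[OF smooth_on_continuous[OF smooth_on_normalize] o W(1)])
    have "smooth_on W' (\<lambda>x. H (?n x))"
      by (rule smooth_on_compose[OF oW W(1,3) smooth_on_subset[OF smooth_on_normalize]]) (auto simp: W'_def)
    moreover have "H (?n y) = f (?n y)" if "y \<in> W'" for y
      using that W(4)[of "?n y"] by (auto simp: W'_def)
    ultimately have "smooth_on W' (\<lambda>x. f (?n x))" using smooth_on_cong[OF oW] by (metis (no_types, lifting))
    then show "\<exists>W. open W \<and> x \<in> W \<and> smooth_on W (\<lambda>x. f (?n x))"
      using oW x W(2) by (intro exI[of _ W']) (auto simp: W'_def)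
  qed
  show "f (?n (r *\<^sub>R x)) = f (?n x)" if "r > 0" "x \<noteq> 0" for r x using that by simp
qed

lemma sphere_level:
  fixes p :: "'a::euclidean_space"
  assumes "norm p = 1"
  obtains B U \<phi> where "slice_chart (sphere 0 1) B U \<phi>" "0 \<in> U" "\<phi> 0 = p"
    "span ((\<lambda>b. pd b \<phi> 0) ` B) = {v. v \<bullet> p = 0}"
    "\<And>v. velocity (sphere 0 1) p v \<longleftrightarrow> v \<bullet> p = 0" "\<And>v. v \<in> tangent_space (sphere 0 1) p \<longleftrightarrow> v \<bullet> p = 0"
proof -
  define h where "h x = ((x \<bullet> x - 1) / 2) *\<^sub>R p" for x :: 'a
  define \<pi> where "\<pi> v = (v \<bullet> p) *\<^sub>R p" for v
  have p: "p \<bullet> p = 1" "p \<noteq> 0" using assms by (auto simp: norm_eq_1)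
  have "(h has_derivative (\<lambda>v. (((p \<bullet> v + v \<bullet> p) - 0) / 2) *\<^sub>R p)) (at p)"
    unfolding h_def[abs_def]
    by (intro has_derivative_scaleR_left has_derivative_diff has_derivative_const
        has_derivative_divide' has_derivative_inner has_derivative_ident bounded_linear.has_derivative[OF bounded_linear_divide])
  then have fd: "frechet_derivative h (at p) v = (v \<bullet> p) *\<^sub>R p" for v
    using fun_cong[OF frechet_derivative_at, of h _ p v] by (simp add: inner_commute)
  have lev: "open UNIV" "p \<in> UNIV" "smooth_on UNIV h" "linear \<pi>" "\<And>v. \<pi> (\<pi> v) = \<pi> v"
    "\<And>x. x \<in> UNIV \<Longrightarrow> \<pi> (h x) = h x" "h p = 0" "\<And>v. \<pi> v = 0 \<Longrightarrow> frechet_derivative h (at p) v = 0"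
    "\<And>v. frechet_derivative h (at p) v = 0 \<Longrightarrow> \<pi> v = 0" "\<And>x. x \<in> UNIV \<Longrightarrow> x \<in> sphere 0 1 \<longleftrightarrow> h x = 0"
  proof -
    show "smooth_on UNIV h" unfolding h_def[abs_def] divide_inverse
      by (intro smooth_on_scaleR smooth_on_const smooth_on_diff open_UNIV smooth_on_mult smooth_on_inner smooth_on_id)
    show "linear \<pi>" unfolding \<pi>_def[abs_def] by (intro linearI) (auto simp: inner_add_left scaleR_add_left)
  qed (use p in \<open>auto simp: h_def \<pi>_def fd norm_eq_1\<close>)
  have \<pi>0: "\<pi> v = 0 \<longleftrightarrow> v \<bullet> p = 0" for v using p by (simp add: \<pi>_def)
  obtain B U \<phi> where "slice_chart (sphere 0 1) B U \<phi>" "0 \<in> U" "\<phi> 0 = p"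
    "span ((\<lambda>b. pd b \<phi> 0) ` B) = {v. \<pi> v = 0}"
    using level_chart[OF lev] by metis
  then show thesis using that tangent_space_level[OF lev] \<pi>0 by simp
qed

context radial_extension
begin

text \<open>\<open>J x\<close> is tangent to the sphere, so a nonzero gradient could be followed
  along a great circle.\<close>

lemma J_max:
  assumes x: "norm x = 1" and max: "\<And>y. norm y = 1 \<Longrightarrow> F y \<le> F x"
  shows "J x = 0"
proof (rule ccontr)
  assume J: "J x \<noteq> 0"
  have x0: "x \<noteq> 0" using x by auto
  define v where "v = (1 / norm (J x)) *\<^sub>R J x"
  define \<gamma> where "\<gamma> t = cos t *\<^sub>R x + sin t *\<^sub>R v" for t
  have v: "v \<bullet> v = 1" "v \<bullet> x = 0" using J J_radial[OF x0] by (simp_all add: v_def dot_square_norm power2_eq_square)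
  have n: "norm (\<gamma> t) = 1" for t
  proof -
    have "\<gamma> t \<bullet> \<gamma> t = (cos t)\<^sup>2 + (sin t)\<^sup>2"
      using v x by (simp add: \<gamma>_def inner_add_left inner_add_right inner_commute[of x v] norm_eq_1 power2_eq_square)
    then show ?thesis by (simp add: norm_eq_1)
  qed
  have "(\<gamma> has_derivative (\<lambda>t. t *\<^sub>R v)) (at 0)" unfolding \<gamma>_def by (auto intro!: derivative_eq_intros)
  moreover have "(F has_derivative (\<lambda>u. J x \<bullet> u)) (at (\<gamma> 0))"
    using dF[OF x0] by (simp add: \<gamma>_def)
  ultimately have "((\<lambda>t. F (\<gamma> t)) has_derivative (\<lambda>t. J x \<bullet> (t *\<^sub>R v))) (at 0)"
    by (rule has_derivative_compose)
  then have "((\<lambda>t. F (\<gamma> t)) has_real_derivative J x \<bullet> v) (at 0)"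
    unfolding has_field_derivative_def by (simp add: mult.commute[of _ "J x \<bullet> v"])
  then have "J x \<bullet> v = 0"
    by (rule DERIV_local_max[where d = 1]) (use max n in \<open>auto simp: \<gamma>_def\<close>)
  then show False using J by (simp add: v_def)
qed

end

lemma first_zero_right:
  fixes b :: "real \<Rightarrow> real"
  assumes b: "continuous_on UNIV b" and t: "b t0 > 0" "t0 < t1" "b t1 = 0"
  obtains tp where "t0 < tp" "b tp = 0" "\<And>t. t0 \<le> t \<Longrightarrow> t < tp \<Longrightarrow> b t > 0"
proof -
  define A where "A = {t0..t1} \<inter> b -` {0}"
  have "closed A" unfolding A_def
    by (rule continuous_closed_preimage[OF continuous_on_subset[OF b]]) auto
  moreover have "t1 \<in> A" using t by (simp add: A_def)
  moreover have bdd: "bdd_below A" by (rule bdd_belowI[of _ t0]) (simp add: A_def)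
  ultimately have inA: "Inf A \<in> A" by (intro closed_contains_Inf) auto
  then have "t0 < Inf A" using t(1) by (cases "Inf A = t0") (auto simp: A_def)
  moreover have "b (Inf A) = 0" using inA by (simp add: A_def)
  moreover have "b t > 0" if ts: "t0 \<le> t" "t < Inf A" for t
  proof (rule ccontr)
    assume "\<not> b t > 0"
    then obtain s where s: "t0 \<le> s" "s \<le> t" "b s = 0"
      using IVT2'[of b t 0 t0] t(1) ts(1) continuous_on_subset[OF b] by (metis less_imp_le not_less subset_UNIV)
    then have "s \<in> A" using ts inA by (auto simp: A_def)
    then show False using cInf_lower[OF _ bdd] s ts by fastforce
  qed
  ultimately show thesis using that by blast
qed

theorem theorem1p1:
  fixes M M1 M2 :: "'a::euclidean_space set"
    and f :: "'a \<Rightarrow> real"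
    and m :: "nat \<Rightarrow> nat"
  assumes "isoparametric_hypersurface M 4 m"
    and "focal_submanifolds M f M1 M2"
    and "(m 1, m 2) \<noteq> (7, 8)" and "(m 1, m 2) \<noteq> (8, 7)"
  shows "A_manifold M1 \<and> A_manifold M2"
proof -
  obtain \<xi> \<kappa> where M: "M \<subseteq> sphere 0 1" "M \<noteq> {}" "connected M"
    and \<xi>: "unit_normal_field M \<xi>"
    and \<kappa>_less: "\<And>i j. i \<in> {1..4::nat} \<Longrightarrow> j \<in> {1..4} \<Longrightarrow> i < j \<Longrightarrow> \<kappa> j < \<kappa> i"
    and curv: "\<And>p. p \<in> M \<Longrightarrow> {\<mu>. curvature_space M \<xi> p \<mu> \<noteq> {0}} = \<kappa> ` {1..4}"
    using assms(1) unfolding isoparametric_hypersurface_def by metis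
  have isof: "isoparametric_function f" and Mreg: "M \<in> regular_level_sets f"
    and sing: "M1 \<in> singular_level_sets f" "M2 \<in> singular_level_sets f" "M1 \<noteq> M2"
    using assms(2) by (auto simp: focal_submanifolds_def)
  define F where "F x = f ((1 / norm x) *\<^sub>R x)" for x
  have Ff: "F x = f x" if "norm x = 1" for x using that by (simp add: F_def)
  obtain b a where smf: "smooth_map_on (sphere 0 1) f" and smb: "smooth_on UNIV (b :: real \<Rightarrow> real)"
    and grad: "\<And>B U \<phi> u. slice_chart (sphere 0 1) B U \<phi> \<Longrightarrow> u \<in> U \<inter> span B \<Longrightarrow>
      grad_norm_sq B (induced_metric \<phi>) (f \<circ> \<phi>) u = b (f (\<phi> u))"
    using isof unfolding isoparametric_function_def by metis
  interpret R: radial_extension F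
    unfolding F_def[abs_def] by (rule radial_extension_sphere[OF smf])
  have ext: "open (- {0 :: 'a})" "smooth_on (- {0}) F" "\<And>x. x \<in> - {0} \<inter> sphere 0 1 \<Longrightarrow> F x = f x"
    using R.open_punctured R.smF Ff by auto
  interpret T: transnormal F b
  proof
    show "smooth_on UNIV b" by (rule smb)
    fix p :: 'a assume p: "norm p = 1"
    then have p0: "p \<noteq> 0" by auto
    obtain B U \<phi> where c: "slice_chart (sphere 0 1) B U \<phi>" "0 \<in> U" "\<phi> 0 = p"
      "span ((\<lambda>b. pd b \<phi> 0) ` B) = {v. v \<bullet> p = 0}" using sphere_level[OF p] by metis
    have "grad_norm_sq B (induced_metric \<phi>) (f \<circ> \<phi>) 0 = grd F p \<bullet> grd F p"
    proof (rule grad_norm_sq_chart[OF c(1) _ ext(1) _ ext(2,3)])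
      show "0 \<in> U \<inter> span B" using c(2) span_0 by blast
      show "grd F p \<in> span ((\<lambda>b. pd b \<phi> 0) ` B)" unfolding c(4) using R.J_radial[OF p0] by simp
      show "frechet_derivative F (at (\<phi> 0)) v = grd F p \<bullet> v" for v
        unfolding c(3) using grd_inner[OF smooth_on_differentiable[OF R.smF, of p]] p0 by simp
    qed (use c(3) p0 in auto)
    then show "grd F p \<bullet> grd F p = b (F p)" using grad[OF c(1), of 0] c(2,3) Ff[OF p] span_0 by auto
  qed
  have crit: "p \<in> critical_points f \<longleftrightarrow> grd F p = 0" if p: "norm p = 1" for p
  proof -
    have p0: "p \<noteq> 0" using p by auto
    obtain vel: "\<And>v. velocity (sphere 0 1) p v \<longleftrightarrow> v \<bullet> p = 0" "\<And>v. v \<in> tangent_space (sphere 0 1) p \<longleftrightarrow> v \<bullet> p = 0"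
      using sphere_level[OF p] by metis
    have dif: "differential (sphere 0 1) f p v = grd F p \<bullet> v" if "v \<bullet> p = 0" for v
    proof -
      have "velocity (sphere 0 1) p v" using vel(1) that by blast
      from differential_eq[OF this ext(1) _ ext(2,3)] p0
      show ?thesis using grd_inner[OF smooth_on_differentiable[OF R.smF, of p]] by auto
    qed
    have "p \<in> critical_points f \<longleftrightarrow> (\<forall>v. v \<bullet> p = 0 \<longrightarrow> grd F p \<bullet> v = 0)"
      using p vel(2) dif by (auto simp: critical_points_def)
    also have "\<dots> \<longleftrightarrow> grd F p = 0" using R.J_radial[OF p0] by (metis inner_eq_zero_iff inner_zero_left)
    finally show ?thesis .
  qed
  obtain t0 where t0: "M = level_set f t0" "M \<inter> critical_points f = {}"
    using Mreg by (auto simp: regular_level_sets_def)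
  have Meq: "M = {x. norm x = 1 \<and> F x = t0}" using Ff by (auto simp: t0(1) level_set_def)
  have pos: "b t0 > 0"
  proof -
    obtain p where p: "p \<in> M" using M(2) by blast
    then have "norm p = 1" "F p = t0" by (auto simp: Meq)
    moreover have "grd F p \<noteq> 0" using p t0(2) crit[of p] \<open>norm p = 1\<close> by blast
    ultimately show ?thesis using T.eikonal[of p] by (metis inner_gt_zero_iff)
  qed
  have reg: "p \<in> T.regular" "norm p = 1" "p \<noteq> 0" "F p = t0" if "p \<in> M" for p
    using that pos by (auto simp: Meq T.regular_def)
  have lev: "velocity M p v \<longleftrightarrow> v \<bullet> p = 0 \<and> v \<bullet> T.w p = 0"
    "v \<in> tangent_space M p \<longleftrightarrow> v \<bullet> p = 0 \<and> v \<bullet> T.w p = 0" if p: "p \<in> M" for p v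
  proof -
    have "M = {x. norm x = 1 \<and> F x = F p}" using reg(4)[OF p] by (simp add: Meq)
    then show "velocity M p v \<longleftrightarrow> v \<bullet> p = 0 \<and> v \<bullet> T.w p = 0"
      "v \<in> tangent_space M p \<longleftrightarrow> v \<bullet> p = 0 \<and> v \<bullet> T.w p = 0"
      using T.level_tangent[OF reg(1)[OF p] reg(2)[OF p], of v] by simp_all
  qed
  have \<xi>w: "\<xi> p = (\<xi> p \<bullet> T.w p) *\<^sub>R T.w p" "\<xi> p \<bullet> T.w p = 1 \<or> \<xi> p \<bullet> T.w p = - 1" if p: "p \<in> M" for p
  proof -
    have ww: "T.w p \<bullet> T.w p = 1" "T.w p \<bullet> p = 0" using T.w_unit T.w_radial reg[OF p] by auto
    have \<xi>p: "norm (\<xi> p) = 1" "\<xi> p \<bullet> p = 0" "\<And>v. v \<in> tangent_space M p \<Longrightarrow> \<xi> p \<bullet> v = 0"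
      using \<xi> p by (auto simp: unit_normal_field_def)
    define r where "r = \<xi> p - (\<xi> p \<bullet> T.w p) *\<^sub>R T.w p"
    have r: "r \<bullet> p = 0" "r \<bullet> T.w p = 0" using ww \<xi>p(2) by (simp_all add: r_def inner_diff_left)
    then have "r \<in> tangent_space M p" using lev(2)[OF p] by blast
    then have "\<xi> p \<bullet> r = 0" by (rule \<xi>p(3))
    then have "r \<bullet> r = 0" using r(2) by (simp add: r_def inner_diff_left inner_commute)
    then show e: "\<xi> p = (\<xi> p \<bullet> T.w p) *\<^sub>R T.w p" by (simp add: r_def)
    have "norm (T.w p) = 1" using ww by (simp add: norm_eq_1)
    then have "\<bar>\<xi> p \<bullet> T.w p\<bar> = 1" using arg_cong[OF e, of norm] \<xi>p(1) by simp
    then show "\<xi> p \<bullet> T.w p = 1 \<or> \<xi> p \<bullet> T.w p = - 1" by linarith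
  qed
  have cont\<xi>: "continuous_on M \<xi>"
    unfolding continuous_on_eq_continuous_within
  proof
    fix p assume p: "p \<in> M"
    obtain W H where W: "open W" "p \<in> W" "smooth_on W H" "\<And>x. x \<in> W \<inter> M \<Longrightarrow> H x = \<xi> x"
      using \<xi> p unfolding unit_normal_field_def smooth_map_on_def by blast
    have "isCont H p" using smooth_on_continuous[OF W(3)] W(1,2) continuous_on_eq_continuous_at by blast
    then have "(H \<longlongrightarrow> H p) (at p within M)" using tendsto_within_subset[of H _ p UNIV] by (simp add: isCont_def)
    moreover have "\<forall>\<^sub>F x in at p within M. H x = \<xi> x"
      using W(1,2,4) by (auto simp: eventually_at_topological)
    ultimately have "(\<xi> \<longlongrightarrow> H p) (at p within M)" by (rule Lim_transform_eventually)
    then show "continuous (at p within M) \<xi>" using W(2,4) p by (simp add: continuous_within)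
  qed
  have contw: "continuous_on M T.w"
    using continuous_on_subset[OF smooth_on_continuous[OF T.smw]] reg(1) by blast
  obtain p0 where p0: "p0 \<in> M" using M(2) by blast
  \<comment> \<open>The given normal \<open>\<xi>\<close> is \<open>w\<close> or \<open>- w\<close>,
    with one sign on the whole connected set \<open>M\<close>; the principal curvatures for
    \<open>w\<close> are therefore the numbers \<open>\<sigma> * \<kappa> i\<close>.\<close>
  define \<sigma> where "\<sigma> = \<xi> p0 \<bullet> T.w p0"
  have \<sigma>: "\<sigma> * \<sigma> = 1" using \<xi>w(2)[OF p0] by (auto simp: \<sigma>_def)
  have \<xi>\<sigma>: "\<xi> p = \<sigma> *\<^sub>R T.w p" if p: "p \<in> M" for p
  proof -
    have "(\<lambda>p. \<xi> p \<bullet> T.w p) p = (\<lambda>p. \<xi> p \<bullet> T.w p) p0"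
    proof (rule integer_valued_constant[OF M(3) continuous_on_inner[OF cont\<xi> contw] _ p p0])
      show "\<xi> x \<bullet> T.w x \<in> \<int>" if "x \<in> M" for x using \<xi>w(2)[OF that] by auto
    qed
    then show ?thesis using \<xi>w(1)[OF p] by (simp add: \<sigma>_def)
  qed
  have diff\<xi>: "differential M \<xi> p X = \<sigma> *\<^sub>R T.W p X" if p: "p \<in> M" and X: "X \<bullet> p = 0" "X \<bullet> T.w p = 0" for p X
  proof -
    have "velocity M p X" using lev(1)[OF p] X by blast
    moreover have "smooth_on T.regular (\<lambda>x. \<sigma> *\<^sub>R T.w x)"
      by (rule smooth_on_scaleR[OF T.open_regular smooth_on_const T.smw])
    ultimately have "differential M \<xi> p X = frechet_derivative (\<lambda>x. \<sigma> *\<^sub>R T.w x) (at p) X"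
      using \<xi>\<sigma> by (intro differential_eq[OF _ T.open_regular reg(1)[OF p]]) auto
    then show ?thesis
      using frechet_derivative_at[OF has_derivative_scaleR_right[OF T.dw[OF reg(1)[OF p]], of \<sigma>]] by metis
  qed
  have curv_eq: "curvature_space M \<xi> p \<mu> = {X. X \<bullet> p = 0 \<and> X \<bullet> T.w p = 0 \<and> T.W p X = - (\<sigma> * \<mu>) *\<^sub>R X}"
    if p: "p \<in> M" for p \<mu>
  proof -
    have "- (\<sigma> *\<^sub>R Y) = \<mu> *\<^sub>R X \<longleftrightarrow> Y = - (\<sigma> * \<mu>) *\<^sub>R X" for X Y :: 'a
    proof
      assume "- (\<sigma> *\<^sub>R Y) = \<mu> *\<^sub>R X"
      then have "- (\<sigma> *\<^sub>R (\<sigma> *\<^sub>R Y)) = \<sigma> *\<^sub>R (\<mu> *\<^sub>R X)" by (metis scaleR_minus_right)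
      then have "- Y = (\<sigma> * \<mu>) *\<^sub>R X" using \<sigma> by simp
      then show "Y = - (\<sigma> * \<mu>) *\<^sub>R X" by (metis minus_minus scaleR_minus_left)
    qed (use \<sigma> in \<open>simp flip: mult.assoc\<close>)
    then have "X \<in> curvature_space M \<xi> p \<mu> \<longleftrightarrow> X \<bullet> p = 0 \<and> X \<bullet> T.w p = 0 \<and> T.W p X = - (\<sigma> * \<mu>) *\<^sub>R X" for X
      using lev(2)[OF p, of X] diff\<xi>[OF p, of X] unfolding curvature_space_def mem_Collect_eq by metis
    then show ?thesis by blast
  qed
  define K where "K = (\<lambda>i. \<sigma> * \<kappa> i) ` {1..4::nat}"
  have "inj_on (\<lambda>i. \<sigma> * \<kappa> i) {1..4}"
  proof (rule inj_onI)
    fix i j assume ij: "i \<in> {1..4::nat}" "j \<in> {1..4}" "\<sigma> * \<kappa> i = \<sigma> * \<kappa> j"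
    have "\<sigma> \<noteq> 0" using \<sigma> by auto
    then have "\<kappa> i = \<kappa> j" using ij(3) by simp
    then show "i = j" using \<kappa>_less[OF ij(1,2)] \<kappa>_less[OF ij(2,1)] by (cases i j rule: linorder_cases) auto
  qed
  then have cardK: "card K = 4" by (simp add: K_def card_image)
  have E_ne: "{X. X \<bullet> p = 0 \<and> X \<bullet> T.w p = 0 \<and> T.W p X = - k *\<^sub>R X} \<noteq> {0}" if p: "p \<in> M" and k: "k \<in> K" for p k
  proof -
    obtain i where i: "i \<in> {1..4}" "k = \<sigma> * \<kappa> i" using k by (auto simp: K_def)
    have "curvature_space M \<xi> p (\<kappa> i) \<noteq> {0}" using curv[OF p] i(1) by blast
    then show ?thesis unfolding curv_eq[OF p] i(2) .
  qed
  \<comment> \<open>The list of principal curvatures is complete, so every eigenvector given by the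
    spectral theorem for \<open>W p\<close> belongs to an element of \<open>K\<close>.\<close>
  have E_mem: "k \<in> K" if p: "p \<in> M" and X: "X \<noteq> 0" "X \<bullet> p = 0" "X \<bullet> T.w p = 0" "T.W p X = - k *\<^sub>R X" for p X k
  proof -
    have "\<sigma> * (\<sigma> * k) = k" using \<sigma> by (simp flip: mult.assoc)
    then have "X \<in> curvature_space M \<xi> p (\<sigma> * k)" unfolding curv_eq[OF p] using X by simp
    then have "\<sigma> * k \<in> \<kappa> ` {1..4}" using curv[OF p] X(1) by blast
    then obtain i where "i \<in> {1..4}" "\<sigma> * k = \<kappa> i" by blast
    then show ?thesis using \<open>\<sigma> * (\<sigma> * k) = k\<close> unfolding K_def by (metis imageI)
  qed
  have E_span: "X \<in> span (\<Union>k\<in>K. {X. X \<bullet> p = 0 \<and> X \<bullet> T.w p = 0 \<and> T.W p X = - k *\<^sub>R X})"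
    if p: "p \<in> M" and X: "X \<bullet> p = 0" "X \<bullet> T.w p = 0" for p X
  proof -
    define S where "S = {X. X \<bullet> p = 0 \<and> X \<bullet> T.w p = 0}"
    note r = reg(1,2)[OF p]
    have "X \<in> span {x \<in> S. \<exists>\<mu>. T.W p x = \<mu> *\<^sub>R x}"
    proof (rule symmetric_spectral_span[OF T.linW[OF r(1)]])
      show "subspace S" by (auto simp: S_def subspace_def inner_add_left)
      show "T.W p x \<in> S" if "x \<in> S" for x
        using that T.W_sym[OF r(1), of x p] T.W_sym[OF r(1), of x "T.w p"] T.W_x[OF r(1)] T.W_w[OF r]
        by (simp add: S_def inner_commute)
      show "T.W p x \<bullet> y = x \<bullet> T.W p y" for x y using T.W_sym[OF r(1), of x y] by (simp add: inner_commute)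
      show "X \<in> S" using X by (simp add: S_def)
    qed
    also have "\<dots> \<subseteq> span (\<Union>k\<in>K. {X. X \<bullet> p = 0 \<and> X \<bullet> T.w p = 0 \<and> T.W p X = - k *\<^sub>R X})"
    proof (rule span_minimal[OF _ subspace_span], rule subsetI)
      fix x assume "x \<in> {x \<in> S. \<exists>\<mu>. T.W p x = \<mu> *\<^sub>R x}"
      then obtain \<mu> where x: "x \<bullet> p = 0" "x \<bullet> T.w p = 0" "T.W p x = - (- \<mu>) *\<^sub>R x" by (auto simp: S_def)
      show "x \<in> span (\<Union>k\<in>K. {X. X \<bullet> p = 0 \<and> X \<bullet> T.w p = 0 \<and> T.W p X = - k *\<^sub>R X})"
      proof (cases "x = 0")
        case False
        from E_mem[OF p this x] x show ?thesis by (intro span_base) blast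
      qed (simp add: span_0)
    qed
    finally show ?thesis .
  qed
  \<comment> \<open>A principal direction, the normal and the position vector at \<open>p0\<close>
    are orthogonal and nonzero. The bound makes the sphere connected and simply connected.\<close>
  have dim3: "3 \<le> DIM('a)"
  proof -
    note r = reg(1,2)[OF p0]
    have "\<sigma> * \<kappa> 1 \<in> K" by (auto simp: K_def)
    moreover have "0 \<in> {X. X \<bullet> p0 = 0 \<and> X \<bullet> T.w p0 = 0 \<and> T.W p0 X = - (\<sigma> * \<kappa> 1) *\<^sub>R X}"
      using linear_0[OF T.linW[OF r(1)]] by simp
    ultimately obtain X where X: "X \<noteq> 0" "X \<bullet> p0 = 0" "X \<bullet> T.w p0 = 0" using E_ne[OF p0] by blast
    have w: "T.w p0 \<noteq> 0" "T.w p0 \<bullet> p0 = 0" "p0 \<noteq> 0" using T.w_unit[OF r] T.w_radial[OF r(1)] r(2) by auto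
    then have ne: "X \<noteq> p0" "X \<noteq> T.w p0" "T.w p0 \<noteq> p0" using X by auto
    have "independent {X, T.w p0, p0}"
      by (rule pairwise_orthogonal_independent)
        (use X w in \<open>auto simp: pairwise_def orthogonal_def inner_commute\<close>)
    then have "card {X, T.w p0, p0} \<le> DIM('a)" using independent_bound by blast
    then show ?thesis using ne by simp
  qed
  have cS: "compact (sphere (0::'a) 1)" "sphere (0::'a) 1 \<noteq> {}" using reg(2)[OF p0] by auto
  have cF: "continuous_on (sphere 0 1) F" by (rule continuous_on_subset[OF T.contF]) auto
  \<comment> \<open>At the extrema of \<open>F\<close> on the sphere the gradient vanishes, which
    supplies zeros of \<open>b\<close> on both sides of \<open>t0\<close>; the nearest ones become
    the two ends.\<close>
  obtain x1 where x1: "norm x1 = 1" "\<And>y. norm y = 1 \<Longrightarrow> F y \<le> F x1"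
    using continuous_attains_sup[OF cS cF] by auto
  obtain x2 where x2: "norm x2 = 1" "\<And>y. norm y = 1 \<Longrightarrow> F x2 \<le> F y"
    using continuous_attains_inf[OF cS cF] by auto
  have b1: "b (F x1) = 0" using T.eikonal[OF x1(1)] R.J_max[OF x1] by simp
  interpret TN: transnormal "\<lambda>x. - F x" "\<lambda>t. b (- t)" by (rule T.neg_transnormal)
  have b2: "b (F x2) = 0" using TN.eikonal[OF x2(1)] TN.J_max[OF x2(1)] x2(2) by simp
  have l: "t0 < F x1" "F x2 < t0"
    using x1(2)[OF reg(2)[OF p0]] x2(2)[OF reg(2)[OF p0]] reg(4)[OF p0] b1 b2 pos by (auto simp: less_le)
  obtain tp where tp: "t0 < tp" "b tp = 0" "\<And>t. t0 \<le> t \<Longrightarrow> t < tp \<Longrightarrow> b t > 0"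
    using first_zero_right[of b t0 "F x1"] T.contb pos l(1) b1 by blast
  obtain tm' where tm': "- t0 < tm'" "b (- tm') = 0" "\<And>t. - t0 \<le> t \<Longrightarrow> t < tm' \<Longrightarrow> b (- t) > 0"
    using first_zero_right[of "\<lambda>t. b (- t)" "- t0" "- F x2"] TN.contb pos l(2) b2 by auto
  interpret D: two_ended F b "- tm'" t0 tp K
  proof
    show "b t > 0" if "- tm' < t" "t < tp" for t
      using tp(3)[of t] tm'(3)[of "- t"] that by (cases "t0 \<le> t") auto
  qed (use dim3 tp(1,2) tm'(1,2) M(2,3) E_span E_ne cardK in \<open>auto simp: Meq\<close>)
  have neg: "A_manifold D.N.\<Sigma>" using two_ended.A_manifold_\<Sigma>[OF D.neg_two_ended] .
  \<comment> \<open>On a singular level \<open>b\<close> vanishes, while the values of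
    \<open>F\<close> lie between the two ends and \<open>b\<close> is positive strictly between
    them.\<close>
  have ends: "N = D.\<Sigma> \<or> N = D.N.\<Sigma>" if "N \<in> singular_level_sets f" for N
  proof -
    obtain t where N: "N = level_set f t" and "N \<inter> critical_points f \<noteq> {}"
      using \<open>N \<in> singular_level_sets f\<close> unfolding singular_level_sets_def by blast
    then obtain q where q: "q \<in> N" "q \<in> critical_points f" by blast
    have q1: "norm q = 1" "F q = t" using q(1) Ff by (auto simp: N level_set_def)
    have "b t = 0" using T.eikonal[OF q1(1)] crit[OF q1(1)] q(2) q1(2) by simp
    moreover have "- tm' \<le> t" "t \<le> tp" using D.F_le_tp[OF q1(1)] D.N.F_le_tp[OF q1(1)] q1(2) by auto
    ultimately have "t = tp \<or> t = - tm'" using D.b_pos[of t] by fastforce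
    moreover have "D.\<Sigma> = level_set f tp" "D.N.\<Sigma> = level_set f (- tm')"
      unfolding D.\<Sigma>_def D.N.\<Sigma>_def level_set_def using Ff by auto
    ultimately show ?thesis using N by blast
  qed
  then show ?thesis using ends[OF sing(1)] ends[OF sing(2)] D.A_manifold_\<Sigma> neg by metis
qed

end
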